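(* Let $(\varphi_k)_k\subset W^{1,2}(\mathbb{R}^3)$ and $\varphi\in W^{1,2}(\mathbb{R}^3)$ be such that $\|\varphi_k-\varphi\|_{W^{1,2}}\to 0$ as $k\to\infty$. Let $\tilde\psi_k$, respectively $\psi$, be the local solution of the frictional Newton-Schrödinger equation $$i\frac{\partial\psi}{\partial t}=-\frac{\hbar}{2m}\Delta\psi+i\,4\pi\frac{Gm^2}{\hbar}\,g_1(\psi)-i\,4\pi\frac{Gm^2}{\hbar}\,g_2(\psi)$$ with initial datum $\varphi_k$, respectively $\varphi$. Then there is $T>0$ such that (for all large $k$ the solutions $\tilde\psi_k$ and $\psi$ exist on $(-T,T)$ and) $$\lim_{k\to\infty}\|\psi-\tilde\psi_k\|_{L^\infty((-T,T),W^{1,2})}=0.$$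
   Context: $W^{1,2}=W^{1,2}(\mathbb{R}^3)$ is the Sobolev space of complex-valued functions with $\|\psi\|_{W^{1,2}}^2=\int|\nabla\psi|^2\,dx+\int|\psi|^2\,dx$, and $W^{-1,2}$ is its dual. The constants $\hbar,m,G$ are positive. For $\psi\in W^{1,2}$, $$g_1(\psi)=\psi\int_{\mathbb{R}^3}\frac{|\psi(y)|^2}{|\cdot-y|}\,dy,\qquad g_2(\psi)=\psi\int_{\mathbb{R}^3}\int_{\mathbb{R}^3}\frac{|\psi(y)|^2|\psi(z)|^2}{|z-y|}\,dy\,dz,$$ both regarded as elements of $W^{-1,2}$. A (weak) solution with initial datum $\varphi$ on an interval $I\ni 0$ is a function $\psi\in L^\infty(I,W^{1,2})\cap W^{1,\infty}(I,W^{-1,2})$ that satisfies the equation in $W^{-1,2}$ for a.e. $t\in I$ and $\psi(0)=\varphi$. For every $\varphi\in W^{1,2}$ a weak solution exists on some interval $[-T,T]$, $T>0$, and weak solutions are unique; this is "the local solution". *)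

theory Defs
  imports "HOL-Analysis.Analysis" "HOL-Probability.Essential_Supremum"
begin

section \<open>Test functions\<close>

primrec continuously_differentiable ::
    "nat \<Rightarrow> ('a::real_normed_vector \<Rightarrow> 'b::real_normed_vector) \<Rightarrow> bool" where
  "continuously_differentiable 0 f = continuous_on UNIV f"
| "continuously_differentiable (Suc n) f =
     ((\<forall>x. f differentiable (at x)) \<and>
      (\<forall>v. continuously_differentiable n (\<lambda>x. frechet_derivative f (at x) v)))"

definition smooth :: "('a::real_normed_vector \<Rightarrow> 'b::real_normed_vector) \<Rightarrow> bool" where
  "smooth f \<longleftrightarrow> (\<forall>n. continuously_differentiable n f)"

text \<open>Real-valued test functions are enough: all conditions tested below are complex linear in
  the test function.\<close>

definition test_function :: "'a::euclidean_space set \<Rightarrow> ('a \<Rightarrow> real) \<Rightarrow> bool" where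
  "test_function \<Omega> \<phi> \<longleftrightarrow>
     smooth \<phi> \<and> compact (closure {x. \<phi> x \<noteq> 0}) \<and> closure {x. \<phi> x \<noteq> 0} \<subseteq> \<Omega>"

definition partial_deriv :: "3 \<Rightarrow> (real^3 \<Rightarrow> real) \<Rightarrow> real^3 \<Rightarrow> real" where
  "partial_deriv i \<phi> x = frechet_derivative \<phi> (at x) (axis i 1)"

lemma cd_SucD: "continuously_differentiable (Suc n) f \<Longrightarrow> continuously_differentiable n f"
proof (induction n arbitrary: f)
  case 0
  then show ?case
    by (auto intro!: differentiable_imp_continuous_on simp: differentiable_on_def)
next
  case (Suc n)
  have "continuously_differentiable n (\<lambda>x. frechet_derivative f (at x) v)" for v
    using Suc.prems by (intro Suc.IH) simp
  with Suc.prems show ?case by simp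
qed

lemma cd_const: "continuously_differentiable n (\<lambda>x. c)"
  by (induction n arbitrary: c) auto

lemma cd_add:
  "continuously_differentiable n f \<Longrightarrow> continuously_differentiable n g \<Longrightarrow>
   continuously_differentiable n (\<lambda>x. f x + g x)"
proof (induction n arbitrary: f g)
  case 0
  then show ?case by (auto intro: continuous_intros)
next
  case (Suc n)
  have "frechet_derivative (\<lambda>x. f x + g x) (at x) v =
      frechet_derivative f (at x) v + frechet_derivative g (at x) v" for x v
  proof -
    have "((\<lambda>x. f x + g x) has_derivative
        (\<lambda>v. frechet_derivative f (at x) v + frechet_derivative g (at x) v)) (at x)"
      using Suc.prems by (intro has_derivative_add) (auto simp: frechet_derivative_works)
    from frechet_derivative_at[OF this] show ?thesis by metis
  qed
  with Suc show ?case by simp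
qed

lemma cd_mult:
  fixes f g :: "'a::real_normed_vector \<Rightarrow> real"
  shows "continuously_differentiable n f \<Longrightarrow> continuously_differentiable n g \<Longrightarrow>
   continuously_differentiable n (\<lambda>x. f x * g x)"
proof (induction n arbitrary: f g)
  case 0
  then show ?case by (auto intro: continuous_intros)
next
  case (Suc n)
  have "frechet_derivative (\<lambda>x. f x * g x) (at x) v =
      f x * frechet_derivative g (at x) v + frechet_derivative f (at x) v * g x" for x v
  proof -
    have "((\<lambda>x. f x * g x) has_derivative
        (\<lambda>v. f x * frechet_derivative g (at x) v + frechet_derivative f (at x) v * g x)) (at x)"
      using Suc.prems by (intro has_derivative_mult) (auto simp: frechet_derivative_works)
    from frechet_derivative_at[OF this] show ?thesis by metis
  qed
  moreover have "continuously_differentiable n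
      (\<lambda>x. f x * frechet_derivative g (at x) v + frechet_derivative f (at x) v * g x)" for v
    using Suc.prems cd_SucD[OF Suc.prems(1)] cd_SucD[OF Suc.prems(2)]
    by (intro cd_add Suc.IH) simp_all
  ultimately show ?case using Suc.prems by simp
qed

lemma cd_prod:
  fixes f :: "'i \<Rightarrow> 'a::real_normed_vector \<Rightarrow> real"
  assumes "\<And>i. continuously_differentiable n (f i)"
  shows "continuously_differentiable n (\<lambda>x. \<Prod>i\<in>I. f i x)"
  using assms by (induction I rule: infinite_finite_induct) (auto intro: cd_const cd_mult)

lemma partial_eq_0:
  assumes "x \<notin> closure {x. \<phi> x \<noteq> 0}"
  shows "partial_deriv i \<phi> x = 0"
proof -
  have "(\<phi> has_derivative (\<lambda>_. 0)) (at x)"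
  proof (rule has_derivative_transform_within_open[of "\<lambda>_. 0"])
    show "open (- closure {x. \<phi> x \<noteq> 0})" by (intro open_Compl closed_closure)
    show "x \<in> - closure {x. \<phi> x \<noteq> 0}" using assms by simp
    show "0 = \<phi> y" if "y \<in> - closure {x. \<phi> x \<noteq> 0}" for y
      using that closure_subset[of "{x. \<phi> x \<noteq> 0}"] by auto
  qed simp
  from frechet_derivative_at[OF this] show ?thesis by (metis partial_deriv_def)
qed

lemma test_function_continuous: "test_function \<Omega> \<phi> \<Longrightarrow> continuous_on UNIV \<phi>"
  unfolding test_function_def smooth_def by (auto dest: spec[of _ 0])

lemma partial_continuous: "test_function \<Omega> \<phi> \<Longrightarrow> continuous_on UNIV (partial_deriv i \<phi>)"
  unfolding test_function_def smooth_def partial_deriv_def[abs_def] by (auto dest: spec[of _ "Suc 0"])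

section \<open>Square integrable functions\<close>

text \<open>Every Lebesgue measurable function agrees almost everywhere with a Borel measurable one, so
  it makes no difference that Borel representatives are used here.\<close>

definition L2 :: "(real^3 \<Rightarrow> complex) set" where
  "L2 = {f. f \<in> borel_measurable lborel \<and> integrable lborel (\<lambda>x. (cmod (f x))\<^sup>2)}"

lemma L2_measurable: "f \<in> L2 \<Longrightarrow> f \<in> borel_measurable borel"
  by (simp add: L2_def)

lemma L2_mult_integrable:
  assumes "f \<in> L2" "g \<in> L2"
  shows "integrable lborel (\<lambda>x. f x * g x)"
proof (rule Bochner_Integration.integrable_bound)
  show "integrable lborel (\<lambda>x. (cmod (f x))\<^sup>2 + (cmod (g x))\<^sup>2)"
    using assms by (auto simp: L2_def)
  show "(\<lambda>x. f x * g x) \<in> borel_measurable lborel"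
    using assms by (auto simp: L2_def)
  have "a * b \<le> a\<^sup>2 + b\<^sup>2" if "a \<ge> 0" "b \<ge> 0" for a b :: real
    using that sum_squares_bound[of a b] mult_nonneg_nonneg[OF that] by linarith
  then show "AE x in lborel. norm (f x * g x) \<le> norm ((cmod (f x))\<^sup>2 + (cmod (g x))\<^sup>2)"
    by (auto simp: norm_mult)
qed

lemma L2_zero: "(\<lambda>_. 0) \<in> L2" by (simp add: L2_def)

lemma L2_cmult: "f \<in> L2 \<Longrightarrow> (\<lambda>x. c * f x) \<in> L2"
  by (auto simp: L2_def norm_mult power_mult_distrib)

lemma L2_cnj:
  assumes "f \<in> L2"
  shows "(\<lambda>x. cnj (f x)) \<in> L2"
proof -
  have "(\<lambda>x. cnj (f x)) \<in> borel_measurable borel"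
    using borel_measurable_continuous_onI[OF continuous_on_cnj[OF continuous_on_id]]
      L2_measurable[OF assms] by (rule measurable_compose[rotated])
  with assms show ?thesis by (simp add: L2_def)
qed

lemma L2_add:
  assumes "f \<in> L2" "g \<in> L2"
  shows "(\<lambda>x. f x + g x) \<in> L2"
proof -
  have "integrable lborel (\<lambda>x. (cmod (f x + g x))\<^sup>2)"
  proof (rule Bochner_Integration.integrable_bound)
    show "integrable lborel (\<lambda>x. 2 * (cmod (f x))\<^sup>2 + 2 * (cmod (g x))\<^sup>2)"
      using assms by (auto simp: L2_def)
    show "(\<lambda>x. (cmod (f x + g x))\<^sup>2) \<in> borel_measurable lborel"
      using assms by (auto simp: L2_def)
    have "(cmod (a + b))\<^sup>2 \<le> 2 * (cmod a)\<^sup>2 + 2 * (cmod b)\<^sup>2" for a b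
    proof -
      have "(cmod (a + b))\<^sup>2 \<le> (cmod a + cmod b)\<^sup>2"
        by (intro power_mono norm_triangle_ineq) simp
      also have "\<dots> \<le> 2 * (cmod a)\<^sup>2 + 2 * (cmod b)\<^sup>2"
        using sum_squares_bound[of "cmod a" "cmod b"] by (simp add: power2_sum)
      finally show ?thesis .
    qed
    then show "AE x in lborel. norm ((cmod (f x + g x))\<^sup>2)
        \<le> norm (2 * (cmod (f x))\<^sup>2 + 2 * (cmod (g x))\<^sup>2)"
      by (auto simp: abs_of_nonneg)
  qed
  with assms show ?thesis by (auto simp: L2_def)
qed

lemma continuous_compact_support_L2:
  fixes \<phi> :: "real^3 \<Rightarrow> real"
  assumes "continuous_on UNIV \<phi>" "compact K" "\<And>x. x \<notin> K \<Longrightarrow> \<phi> x = 0"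
  shows "(\<lambda>x. complex_of_real (\<phi> x)) \<in> L2"
proof -
  have "integrable lborel (\<lambda>x. indicator K x *\<^sub>R (\<phi> x)\<^sup>2)"
    using assms by (intro borel_integrable_compact)
      (auto intro!: continuous_intros intro: continuous_on_subset)
  also have "(\<lambda>x. indicator K x *\<^sub>R (\<phi> x)\<^sup>2) = (\<lambda>x. (\<phi> x)\<^sup>2)"
    using assms(3) by (force simp: indicator_def)
  finally have "integrable lborel (\<lambda>x. (\<phi> x)\<^sup>2)" .
  moreover have "\<phi> \<in> borel_measurable borel"
    using assms(1) by (rule borel_measurable_continuous_onI)
  ultimately show ?thesis by (auto simp: L2_def)
qed

lemma test_function_L2: "test_function UNIV \<phi> \<Longrightarrow> (\<lambda>x. complex_of_real (\<phi> x)) \<in> L2"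
  using closure_subset[of "{x. \<phi> x \<noteq> 0}"] test_function_continuous[of UNIV \<phi>]
  by (intro continuous_compact_support_L2[of _ "closure {x. \<phi> x \<noteq> 0}"])
     (auto simp: test_function_def)

lemma partial_L2: "test_function UNIV \<phi> \<Longrightarrow> (\<lambda>x. complex_of_real (partial_deriv i \<phi> x)) \<in> L2"
  using partial_continuous[of UNIV \<phi> i] partial_eq_0[of _ \<phi> i]
  by (intro continuous_compact_support_L2[of _ "closure {x. \<phi> x \<noteq> 0}"])
     (auto simp: test_function_def)

section \<open>The fundamental lemma of the calculus of variations\<close>

definition flat_exp :: "real poly \<Rightarrow> real \<Rightarrow> real" where
  "flat_exp p t = (if t > 0 then poly p (1 / t) * exp (- (1 / t)) else 0)"

lemma poly_exp_tendsto_0: "((\<lambda>y::real. poly p y * exp (- y)) \<longlongrightarrow> 0) at_top"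
proof -
  have "((\<lambda>y::real. \<Sum>i\<le>degree p. coeff p i * (y ^ i / exp y)) \<longlongrightarrow> (\<Sum>i\<le>degree p. coeff p i * 0)) at_top"
    by (intro tendsto_intros tendsto_power_div_exp_0)
  then show ?thesis
    by (simp add: poly_altdef sum_distrib_right exp_minus divide_inverse mult.assoc)
qed

lemma flat_exp_at_right_0: "(flat_exp p \<longlongrightarrow> 0) (at_right 0)"
proof -
  have "((\<lambda>t. poly p (inverse t) * exp (- inverse t)) \<longlongrightarrow> 0) (at_right (0::real))"
    using filterlim_compose[OF poly_exp_tendsto_0 filterlim_inverse_at_top_right] by simp
  then show ?thesis
    by (rule Lim_transform_eventually)
       (auto simp: flat_exp_def inverse_eq_divide eventually_at_filter)
qed

lemma flat_exp_deriv:
  "(flat_exp p has_real_derivative flat_exp ((p - pderiv p) * [:0, 0, 1:]) t) (at t)"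
proof -
  consider "t > 0" | "t < 0" | "t = 0" by linarith
  then show ?thesis
  proof cases
    case 1
    have "((\<lambda>t. poly p (1 / t) * exp (- (1 / t))) has_real_derivative
        flat_exp ((p - pderiv p) * [:0, 0, 1:]) t) (at t)"
      using 1 by (auto intro!: derivative_eq_intros poly_DERIV[THEN DERIV_chain2]
          simp: flat_exp_def field_simps power2_eq_square)
    then show ?thesis
      by (rule has_field_derivative_transform_within_open[where S = "{0<..}"])
         (use 1 in \<open>auto simp: flat_exp_def\<close>)
  next
    case 2
    have "((\<lambda>t. 0) has_real_derivative 0) (at t)" by simp
    then have "(flat_exp p has_real_derivative 0) (at t)"
      by (rule has_field_derivative_transform_within_open[where S = "{..<0}"])
         (use 2 in \<open>auto simp: flat_exp_def\<close>)
    with 2 show ?thesis by (simp add: flat_exp_def)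
  next
    case 3
    have "((\<lambda>y. (flat_exp p y - flat_exp p 0) / (y - 0)) \<longlongrightarrow> 0) (at_right 0)"
      using flat_exp_at_right_0[of "p * [:0, 1:]"]
      by (rule Lim_transform_eventually) (auto simp: flat_exp_def eventually_at_filter)
    moreover have "((\<lambda>y. (flat_exp p y - flat_exp p 0) / (y - 0)) \<longlongrightarrow> 0) (at_left 0)"
      by (rule Lim_transform_eventually[OF tendsto_const[of 0]])
         (auto simp: flat_exp_def eventually_at_filter)
    ultimately have "(flat_exp p has_real_derivative 0) (at 0)"
      unfolding has_field_derivative_iff by (simp add: filterlim_split_at_real)
    with 3 show ?thesis by (simp add: flat_exp_def)
  qed
qed

lemma cd_flat_exp: "continuously_differentiable n (\<lambda>x::real^3. flat_exp p (c * x $ i + d))"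
proof (induction n arbitrary: p)
  case 0
  have "continuous_on UNIV (flat_exp p)"
    by (meson DERIV_isCont continuous_at_imp_continuous_on flat_exp_deriv)
  then show ?case
    by (auto intro!: continuous_intros continuous_on_compose2[of UNIV "flat_exp p"])
next
  case (Suc n)
  define q where "q = (p - pderiv p) * [:0, 0, 1:]"
  have *: "((\<lambda>x::real^3. flat_exp p (c * x $ i + d)) has_derivative
      (\<lambda>v. (c * v $ i) * flat_exp q (c * x $ i + d))) (at x)" for x
  proof -
    have "((\<lambda>x::real^3. c * x $ i + d) has_derivative (\<lambda>v. c * v $ i)) (at x)"
      by (auto intro!: derivative_eq_intros bounded_linear_imp_has_derivative
          bounded_linear_vec_nth)
    from DERIV_compose_FDERIV[OF flat_exp_deriv this] show ?thesis
      by (simp add: q_def)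
  qed
  have "frechet_derivative (\<lambda>x::real^3. flat_exp p (c * x $ i + d)) (at x) v =
      (c * v $ i) * flat_exp q (c * x $ i + d)" for x v
    using frechet_derivative_at[OF *] by metis
  moreover have "continuously_differentiable n (\<lambda>x. (c * v $ i) * flat_exp q (c * x $ i + d))" for v
    by (intro cd_mult cd_const Suc.IH)
  ultimately show ?case
    using * by (auto simp: differentiable_def intro!: exI)
qed

definition box_bump :: "real^3 \<Rightarrow> real^3 \<Rightarrow> nat \<Rightarrow> real^3 \<Rightarrow> real" where
  "box_bump a b n x = (\<Prod>i\<in>UNIV. flat_exp 1 (real n * x $ i + (- real n * a $ i)) *
     flat_exp 1 ((- real n) * x $ i + real n * b $ i))"

lemma flat_exp_1: "0 \<le> flat_exp 1 t" "flat_exp 1 t \<le> 1" "flat_exp 1 t \<noteq> 0 \<longleftrightarrow> t > 0"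
  by (auto simp: flat_exp_def)

lemma flat_exp_tendsto:
  assumes "s > 0"
  shows "(\<lambda>n. flat_exp 1 (real n * s)) \<longlonglongrightarrow> 1"
proof -
  have "(\<lambda>n. exp (- ((1 / real n) * (1 / s)))) \<longlonglongrightarrow> exp (- (0 * (1 / s)))"
    by (intro tendsto_intros lim_1_over_n)
  then have "(\<lambda>n. exp (- ((1 / real n) * (1 / s)))) \<longlonglongrightarrow> 1" by simp
  then show ?thesis
    by (rule Lim_transform_eventually)
       (use assms in \<open>auto simp: flat_exp_def intro!: eventually_sequentiallyI[of 1]\<close>)
qed

lemma box_bump_eq_0: "x \<notin> box a b \<Longrightarrow> box_bump a b n x = 0"
proof -
  assume "x \<notin> box a b"
  then obtain i where "x $ i \<le> a $ i \<or> b $ i \<le> x $ i"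
    by (auto simp: mem_box_cart not_less)
  then have "real n * x $ i \<le> real n * a $ i \<or> real n * b $ i \<le> real n * x $ i"
    by (metis mult_left_mono of_nat_0_le_iff)
  then have "flat_exp 1 (real n * x $ i + (- real n * a $ i)) = 0 \<or>
      flat_exp 1 ((- real n) * x $ i + real n * b $ i) = 0"
    unfolding flat_exp_def by (elim disj_forward) simp_all
  then have "\<exists>i\<in>UNIV. flat_exp 1 (real n * x $ i + (- real n * a $ i)) *
     flat_exp 1 ((- real n) * x $ i + real n * b $ i) = 0"
    by (intro bexI[of _ i]) (simp_all only: mult_eq_0_iff UNIV_I)
  then show ?thesis
    unfolding box_bump_def by (rule prod_zero[OF finite])
qed

lemma box_bump_bounds: "0 \<le> box_bump a b n x" "box_bump a b n x \<le> 1"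
  unfolding box_bump_def
  by (intro prod_nonneg prod_le_1 mult_nonneg_nonneg mult_le_one conjI ballI flat_exp_1)+

lemma box_bump_tendsto: "(\<lambda>n. box_bump a b n x) \<longlonglongrightarrow> indicator (box a b) x"
proof (cases "x \<in> box a b")
  case True
  have eq: "box_bump a b n x = (\<Prod>i\<in>UNIV. flat_exp 1 (real n * (x $ i - a $ i)) *
     flat_exp 1 (real n * (b $ i - x $ i)))" for n
    by (simp add: box_bump_def algebra_simps)
  have "(\<lambda>n. \<Prod>i\<in>UNIV. flat_exp 1 (real n * (x $ i - a $ i)) *
     flat_exp 1 (real n * (b $ i - x $ i))) \<longlonglongrightarrow> (\<Prod>i\<in>(UNIV::3 set). 1 * 1)"
    using True by (intro tendsto_prod tendsto_mult flat_exp_tendsto) (auto simp: mem_box_cart)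
  with True show ?thesis by (simp add: eq)
next
  case False
  then show ?thesis by (simp add: box_bump_eq_0)
qed

lemma box_bump_test: "test_function UNIV (box_bump a b n)"
proof -
  have "{x. box_bump a b n x \<noteq> 0} \<subseteq> cbox a b"
    using box_bump_eq_0 box_subset_cbox by blast
  then have "bounded {x. box_bump a b n x \<noteq> 0}"
    using bounded_cbox bounded_subset by blast
  moreover have "continuously_differentiable k (box_bump a b n)" for k
    unfolding box_bump_def[abs_def] by (intro cd_prod cd_mult cd_flat_exp)
  ultimately show ?thesis by (auto simp: test_function_def smooth_def)
qed

lemma indicator_L2: "(\<lambda>x. complex_of_real (indicator (box a b) x)) \<in> L2"
proof -
  have "(\<lambda>x::real^3. (cmod (complex_of_real (indicator (box a b) x)))\<^sup>2) = indicator (box a b)"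
    by (auto simp: indicator_def)
  moreover have "integrable lborel (indicator (box a b) :: real^3 \<Rightarrow> real)"
    by (intro integrable_real_indicator) (auto simp: emeasure_lborel_box_eq)
  ultimately show ?thesis by (auto simp: L2_def)
qed

lemma box_integral_zero:
  assumes f: "f \<in> L2"
    and z: "\<And>\<phi>. test_function UNIV \<phi> \<Longrightarrow> (\<integral>x. \<phi> x *\<^sub>R f x \<partial>lborel) = 0"
  shows "(\<integral>x. indicator (box a b) x *\<^sub>R f x \<partial>lborel) = 0"
proof -
  have [measurable]: "f \<in> borel_measurable borel" using f by (rule L2_measurable)
  have [measurable]: "box_bump a b n \<in> borel_measurable borel" for n
    using test_function_continuous[OF box_bump_test] by (rule borel_measurable_continuous_onI)
  have "(\<lambda>n. \<integral>x. box_bump a b n x *\<^sub>R f x \<partial>lborel) \<longlonglongrightarrow>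
      (\<integral>x. indicator (box a b) x *\<^sub>R f x \<partial>lborel)"
  proof (rule integral_dominated_convergence[where w = "\<lambda>x. cmod (indicator (box a b) x * f x)"])
    show "integrable lborel (\<lambda>x. cmod (indicator (box a b) x * f x))"
      using L2_mult_integrable[OF indicator_L2 f]
      by (intro integrable_norm) (simp add: of_real_indicator)
    show "AE x in lborel. (\<lambda>n. box_bump a b n x *\<^sub>R f x) \<longlonglongrightarrow> indicator (box a b) x *\<^sub>R f x"
      by (auto intro!: tendsto_intros box_bump_tendsto)
    have "cmod (box_bump a b n x *\<^sub>R f x) \<le> cmod (indicator (box a b) x * f x)" for n x
    proof (cases "x \<in> box a b")
      case True
      then show ?thesis
        using box_bump_bounds[of a b n x] by (simp add: mult_left_le_one_le)
    qed (simp add: box_bump_eq_0)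
    then show "AE x in lborel. cmod (box_bump a b n x *\<^sub>R f x) \<le>
        cmod (indicator (box a b) x * f x)" for n by simp
  qed auto
  then show ?thesis
    using z[OF box_bump_test] by (simp add: LIMSEQ_const_iff)
qed

lemma Int_stable_box: "Int_stable (range (\<lambda>(a, b). box a b :: (real^3) set))"
proof (rule Int_stableI_image)
  fix p q :: "(real^3) \<times> (real^3)"
  obtain c d where "box (fst p) (snd p) \<inter> box (fst q) (snd q) = box c d"
    by (rule that[OF box_Int_box])
  then show "\<exists>r\<in>UNIV. (case p of (a, b) \<Rightarrow> box a b) \<inter> (case q of (a, b) \<Rightarrow> box a b) =
      (case r of (a, b) \<Rightarrow> box a b)"
    by (intro bexI[of _ "(c, d)"]) (auto simp: case_prod_unfold)
qed

lemma AE_zero_real: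
  fixes f :: "real^3 \<Rightarrow> real"
  assumes [measurable]: "f \<in> borel_measurable borel"
    and int: "\<And>a b. integrable lborel (\<lambda>x. indicator (box a b) x * f x)"
    and z: "\<And>a b. (\<integral>x. indicator (box a b) x * f x \<partial>lborel) = 0"
  shows "AE x in lborel. f x = 0"
proof -
  define B where "B N = box (- (\<chi> i. real N)) (\<chi> i. real N :: real^3)" for N :: nat
  have [measurable]: "B N \<in> sets borel" for N by (simp add: B_def)
  have "AE x in lborel. indicator (B N) x * f x = 0" for N
  proof -
    define g where "g = (\<lambda>x. indicator (B N) x * f x)"
    have g: "integrable lborel g" using int by (simp add: g_def B_def)
    have gset: "set_integrable lborel A g" if "A \<in> sets borel" for A
      using that g unfolding set_integrable_def by (intro integrable_mult_indicator) auto
    have tot: "(\<integral>x. g x \<partial>lborel) = 0" using z by (simp add: g_def B_def)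
    have zero: "(\<integral>x\<in>A. g x \<partial>lborel) = 0" if "A \<in> sets borel" for A
    proof -
      have mem: "A \<in> sigma_sets UNIV (range (\<lambda>(a, b). box a b :: (real^3) set))"
        using that by (simp add: borel_eq_box)
      have sub: "range (\<lambda>(a, b). box a b :: (real^3) set) \<subseteq> Pow UNIV" by simp
      show ?thesis
        using Int_stable_box sub mem
      proof (induct rule: sigma_sets_induct_disjoint)
        case (basic A)
        then obtain a b where A: "A = box a b" by auto
        have "\<exists>c d. box a b \<inter> B N = box c d"
          unfolding B_def by (intro exI) (rule box_Int_box)
        then obtain c d where cd: "box a b \<inter> B N = box c d" by blast
        have "(\<integral>x\<in>A. g x \<partial>lborel) = (\<integral>x. indicator (box c d) x * f x \<partial>lborel)"
          unfolding set_lebesgue_integral_def A cd[symmetric] g_def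
          by (intro Bochner_Integration.integral_cong) (auto simp: indicator_def)
        then show ?case using z by simp
      next
        case empty
        show ?case by (simp add: set_lebesgue_integral_def)
      next
        case (compl A)
        have A: "A \<in> sets borel" using compl(1) by (simp add: borel_eq_box)
        have "(\<integral>x\<in>A \<union> (UNIV - A). g x \<partial>lborel) =
            (\<integral>x\<in>A. g x \<partial>lborel) + (\<integral>x\<in>UNIV - A. g x \<partial>lborel)"
          using A by (intro set_integral_Un gset) auto
        moreover have "A \<union> (UNIV - A) = UNIV" by blast
        ultimately show ?case
          using compl(2) tot by (simp add: set_lebesgue_integral_def)
      next
        case (union A)
        have A: "A i \<in> sets borel" for i using union(2) by (auto simp: borel_eq_box)
        have "(\<integral>x\<in>(\<Union>i. A i). g x \<partial>lborel) = (\<Sum>i. \<integral>x\<in>A i. g x \<partial>lborel)"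
        proof (rule lebesgue_integral_countable_add)
          show "\<And>i. A i \<in> sets lborel" using A by simp
          show "set_integrable lborel (\<Union>i. A i) g" using A by (intro gset) auto
          show "\<And>i j. i \<noteq> j \<Longrightarrow> A i \<inter> A j = {}"
            using union(1) by (simp add: disjoint_family_on_def)
        qed
        then show ?case using union(3) by simp
      qed
    qed
    have "AE x in lborel. g x = 0"
      using g by (intro density_unique_real[where f' = "\<lambda>_. 0"]) (auto simp: zero)
    then show ?thesis by (simp add: g_def)
  qed
  note AE_B = this
  have ex: "\<exists>N. x \<in> B N" for x
  proof -
    obtain N where N: "norm x < real N" using reals_Archimedean2 by blast
    have "\<bar>x $ i\<bar> < real N" for i using N component_le_norm_cart[of x i] by linarith
    then have "- real N < x $ i" "x $ i < real N" for i by (smt (verit))+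
    then have "x \<in> B N" by (simp add: B_def mem_box_cart)
    then show ?thesis ..
  qed
  from AE_B have "AE x in lborel. \<forall>N. indicator (B N) x * f x = 0"
    unfolding AE_all_countable by blast
  then show ?thesis
  proof eventually_elim
    case (elim x)
    from ex[of x] obtain N where "x \<in> B N" ..
    then show ?case using elim[rule_format, of N] by simp
  qed
qed

lemma fundamental_lemma:
  assumes f: "f \<in> L2"
    and z: "\<And>\<phi>. test_function UNIV \<phi> \<Longrightarrow> (\<integral>x. \<phi> x *\<^sub>R f x \<partial>lborel) = 0"
  shows "AE x in lborel. f x = 0"
proof -
  have [measurable]: "f \<in> borel_measurable borel" using f by (rule L2_measurable)
  have int: "integrable lborel (\<lambda>x. indicator (box a b) x *\<^sub>R f x)" for a b
    using L2_mult_integrable[OF indicator_L2 f] by (simp add: scaleR_conv_of_real)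
  note zero = box_integral_zero[OF f z]
  have "AE x in lborel. Re (f x) = 0"
  proof (rule AE_zero_real)
    show "integrable lborel (\<lambda>x. indicator (box a b) x * Re (f x))" for a b
      using integrable_Re[OF int[of a b]] by simp
    show "(\<integral>x. indicator (box a b) x * Re (f x) \<partial>lborel) = 0" for a b
      using integral_Re[OF int[of a b]] zero[of a b] by simp
  qed measurable
  moreover have "AE x in lborel. Im (f x) = 0"
  proof (rule AE_zero_real)
    show "integrable lborel (\<lambda>x. indicator (box a b) x * Im (f x))" for a b
      using integrable_Im[OF int[of a b]] by simp
    show "(\<integral>x. indicator (box a b) x * Im (f x) \<partial>lborel) = 0" for a b
      using integral_Im[OF int[of a b]] zero[of a b] by simp
  qed measurable
  ultimately show ?thesis by eventually_elim (simp add: complex_eq_iff)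
qed

section \<open>The Sobolev space\<close>

definition weak_partial :: "3 \<Rightarrow> (real^3 \<Rightarrow> complex) \<Rightarrow> (real^3 \<Rightarrow> complex) \<Rightarrow> bool" where
  "weak_partial i f g \<longleftrightarrow>
     (\<forall>\<phi>. test_function UNIV \<phi> \<longrightarrow>
        (\<integral>x. partial_deriv i \<phi> x *\<^sub>R f x \<partial>lborel) = - (\<integral>x. \<phi> x *\<^sub>R g x \<partial>lborel))"

definition sobolev_functions :: "(real^3 \<Rightarrow> complex) set" where
  "sobolev_functions = {f \<in> L2. \<forall>i. \<exists>g\<in>L2. weak_partial i f g}"

definition sobolev_eq :: "(real^3 \<Rightarrow> complex) \<Rightarrow> (real^3 \<Rightarrow> complex) \<Rightarrow> bool" where
  "sobolev_eq f g \<longleftrightarrow>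
     f \<in> sobolev_functions \<and> g \<in> sobolev_functions \<and> (AE x in lborel. f x = g x)"

lemma test_mult_integrable:
  fixes \<phi> :: "real^3 \<Rightarrow> real"
  assumes "test_function UNIV \<phi>" "f \<in> L2"
  shows "integrable lborel (\<lambda>x. \<phi> x *\<^sub>R f x)" "integrable lborel (\<lambda>x. partial_deriv i \<phi> x *\<^sub>R f x)"
  using L2_mult_integrable[OF test_function_L2[OF assms(1)] assms(2)]
    L2_mult_integrable[OF partial_L2[OF assms(1)] assms(2)] by (simp_all add: scaleR_conv_of_real)

lemma weak_partial_add:
  assumes "f \<in> L2" "f' \<in> L2" "g \<in> L2" "g' \<in> L2" "weak_partial i f f'" "weak_partial i g g'"
  shows "weak_partial i (\<lambda>x. f x + g x) (\<lambda>x. f' x + g' x)"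
  using assms by (auto simp: weak_partial_def scaleR_add_right test_mult_integrable)

lemma weak_partial_cmult:
  assumes "weak_partial i f g"
  shows "weak_partial i (\<lambda>x. c * f x) (\<lambda>x. c * g x)"
  using assms by (auto simp: weak_partial_def mult_scaleR_right[symmetric] simp del: mult_scaleR_right)

lemma weak_partial_cong:
  assumes "f \<in> L2" "g \<in> L2" "AE x in lborel. f x = g x" "weak_partial i f h"
  shows "weak_partial i g h"
  unfolding weak_partial_def
proof safe
  fix \<phi> :: "real^3 \<Rightarrow> real" assume \<phi>: "test_function UNIV \<phi>"
  have "(\<integral>x. partial_deriv i \<phi> x *\<^sub>R g x \<partial>lborel) = (\<integral>x. partial_deriv i \<phi> x *\<^sub>R f x \<partial>lborel)"
    using assms test_mult_integrable[OF \<phi>]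
    by (intro integral_cong_AE) (auto intro: borel_measurable_integrable)
  with assms(4) \<phi> show "(\<integral>x. partial_deriv i \<phi> x *\<^sub>R g x \<partial>lborel) = - (\<integral>x. \<phi> x *\<^sub>R h x \<partial>lborel)"
    by (simp add: weak_partial_def)
qed

lemma L2_diff: "f \<in> L2 \<Longrightarrow> g \<in> L2 \<Longrightarrow> (\<lambda>x. f x - g x) \<in> L2"
  using L2_add[OF _ L2_cmult[of g "-1"]] by simp

lemma weak_partial_unique:
  assumes "g \<in> L2" "h \<in> L2" "weak_partial i f g" "weak_partial i f h"
  shows "AE x in lborel. g x = h x"
proof -
  have "AE x in lborel. g x - h x = 0"
  proof (rule fundamental_lemma[OF L2_diff[OF assms(1,2)]])
    fix \<phi> :: "real^3 \<Rightarrow> real" assume \<phi>: "test_function UNIV \<phi>"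
    have "(\<integral>x. \<phi> x *\<^sub>R g x \<partial>lborel) = (\<integral>x. \<phi> x *\<^sub>R h x \<partial>lborel)"
      using assms(3,4) \<phi> by (simp add: weak_partial_def)
    then show "(\<integral>x. \<phi> x *\<^sub>R (g x - h x) \<partial>lborel) = 0"
      using \<phi> assms(1,2) by (simp add: scaleR_diff_right test_mult_integrable)
  qed
  then show ?thesis by simp
qed

lemma sobolev_zero: "(\<lambda>_. 0) \<in> sobolev_functions"
  unfolding sobolev_functions_def
  by (auto simp: L2_zero weak_partial_def intro!: bexI[of _ "\<lambda>_. 0"])

lemma sobolev_add:
  assumes "f \<in> sobolev_functions" "g \<in> sobolev_functions"
  shows "(\<lambda>x. f x + g x) \<in> sobolev_functions"
  unfolding sobolev_functions_def
proof safe
  show "(\<lambda>x. f x + g x) \<in> L2" using assms by (auto simp: sobolev_functions_def L2_add)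
  fix i
  from assms obtain f' g' where "f' \<in> L2" "g' \<in> L2" "weak_partial i f f'" "weak_partial i g g'"
    unfolding sobolev_functions_def by blast
  with assms show "\<exists>h\<in>L2. weak_partial i (\<lambda>x. f x + g x) h"
    by (intro bexI[of _ "\<lambda>x. f' x + g' x"] weak_partial_add L2_add)
       (auto simp: sobolev_functions_def)
qed

lemma sobolev_cmult:
  assumes "f \<in> sobolev_functions"
  shows "(\<lambda>x. c * f x) \<in> sobolev_functions"
  using assms weak_partial_cmult L2_cmult unfolding sobolev_functions_def by blast

quotient_type W12 = "real^3 \<Rightarrow> complex" / partial: sobolev_eq
proof (rule part_equivpI)
  show "\<exists>f. sobolev_eq f f" using sobolev_zero by (auto simp: sobolev_eq_def)
  show "symp sobolev_eq"
    unfolding sobolev_eq_def by (intro sympI) (simp add: eq_commute)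
  show "transp sobolev_eq"
  proof (rule transpI)
    fix f g h assume "sobolev_eq f g" "sobolev_eq g h"
    moreover from this have "AE x in lborel. f x = g x" "AE x in lborel. g x = h x"
      by (auto simp: sobolev_eq_def)
    then have "AE x in lborel. f x = h x" by eventually_elim simp
    ultimately show "sobolev_eq f h" by (simp add: sobolev_eq_def)
  qed
qed

text \<open>Pointwise expressions below use the chosen representative \<open>rep_W12 \<psi>\<close> of the class \<open>\<psi>\<close>;
  all of them are integrals or almost everywhere statements and do not depend on this choice.\<close>

definition weak_grad :: "W12 \<Rightarrow> 3 \<Rightarrow> real^3 \<Rightarrow> complex" where
  "weak_grad \<psi> i = (SOME g. g \<in> L2 \<and> weak_partial i (rep_W12 \<psi>) g)"

lift_definition scaleC_W12 :: "complex \<Rightarrow> W12 \<Rightarrow> W12" is "\<lambda>c f x. c * f x"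
  by (auto simp: sobolev_eq_def sobolev_cmult)

instantiation W12 :: real_vector
begin

lift_definition zero_W12 :: W12 is "\<lambda>_. 0"
  by (simp add: sobolev_eq_def sobolev_zero)

lift_definition plus_W12 :: "W12 \<Rightarrow> W12 \<Rightarrow> W12" is "\<lambda>f g x. f x + g x"
  by (auto simp: sobolev_eq_def sobolev_add)

definition "uminus_W12 \<psi> = scaleC_W12 (- 1) \<psi>"
definition "minus_W12 \<psi> \<zeta> = \<psi> + scaleC_W12 (- 1) (\<zeta>::W12)"
definition "scaleR_W12 r \<psi> = scaleC_W12 (complex_of_real r) \<psi>"

instance
proof
  fix a b c :: W12 and r s :: real
  show "a + b + c = a + (b + c)"
    by transfer (auto simp: sobolev_eq_def sobolev_add add.assoc)
  show "a + b = b + a"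
    by transfer (auto simp: sobolev_eq_def sobolev_add add.commute)
  show "0 + a = a"
    by transfer (auto simp: sobolev_eq_def)
  show "- a + a = 0"
    unfolding uminus_W12_def by transfer (auto simp: sobolev_eq_def sobolev_zero)
  show "a - b = a + - b"
    by (simp add: minus_W12_def uminus_W12_def)
  show "r *\<^sub>R (a + b) = r *\<^sub>R a + r *\<^sub>R b"
    unfolding scaleR_W12_def
    by transfer (auto simp: sobolev_eq_def sobolev_add sobolev_cmult distrib_left
        intro!: sobolev_add sobolev_cmult)
  show "(r + s) *\<^sub>R a = r *\<^sub>R a + s *\<^sub>R a"
    unfolding scaleR_W12_def
    by transfer (auto simp: sobolev_eq_def distrib_right intro!: sobolev_add sobolev_cmult)
  show "r *\<^sub>R s *\<^sub>R a = (r * s) *\<^sub>R a"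
    unfolding scaleR_W12_def
    by transfer (auto simp: sobolev_eq_def mult.assoc intro!: sobolev_cmult)
  show "1 *\<^sub>R a = a"
    unfolding scaleR_W12_def by transfer (auto simp: sobolev_eq_def)
qed

end

lemma rep_sobolev: "rep_W12 \<psi> \<in> sobolev_functions"
  using Quotient3_rep_reflp[OF Quotient3_W12, of \<psi>] by (simp add: sobolev_eq_def)

lemma rep_L2: "rep_W12 \<psi> \<in> L2"
  using rep_sobolev[of \<psi>] by (simp add: sobolev_functions_def)

lemma rep_abs: "f \<in> sobolev_functions \<Longrightarrow> AE x in lborel. rep_W12 (abs_W12 f) x = f x"
  using Quotient3_rep_abs[OF Quotient3_W12, of f] by (simp add: sobolev_eq_def)

lemma abs_rep: "abs_W12 (rep_W12 \<psi>) = \<psi>"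
  by (rule Quotient3_abs_rep[OF Quotient3_W12])

lemma W12_eqI: "AE x in lborel. rep_W12 \<psi> x = rep_W12 \<zeta> x \<Longrightarrow> \<psi> = \<zeta>"
  using Quotient3_rel_rep[OF Quotient3_W12, of \<psi> \<zeta>] by (simp add: sobolev_eq_def rep_sobolev)

lemma rep_plus: "AE x in lborel. rep_W12 (\<psi> + \<zeta>) x = rep_W12 \<psi> x + rep_W12 \<zeta> x"
proof -
  have "\<psi> + \<zeta> = abs_W12 (\<lambda>x. rep_W12 \<psi> x + rep_W12 \<zeta> x)"
    using plus_W12.abs_eq[of "rep_W12 \<psi>" "rep_W12 \<zeta>"]
    by (simp add: abs_rep sobolev_eq_def rep_sobolev)
  then show ?thesis using rep_abs[OF sobolev_add[OF rep_sobolev rep_sobolev]] by simp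
qed

lemma rep_scaleC: "AE x in lborel. rep_W12 (scaleC_W12 c \<psi>) x = c * rep_W12 \<psi> x"
proof -
  have "scaleC_W12 c \<psi> = abs_W12 (\<lambda>x. c * rep_W12 \<psi> x)"
    using scaleC_W12.abs_eq[of "rep_W12 \<psi>" c]
    by (simp add: abs_rep sobolev_eq_def rep_sobolev)
  then show ?thesis using rep_abs[OF sobolev_cmult[OF rep_sobolev]] by simp
qed

lemma rep_zero: "AE x in lborel. rep_W12 0 x = 0"
  using rep_abs[OF sobolev_zero] by (simp add: zero_W12_def)

lemma weak_grad: "weak_grad \<psi> i \<in> L2" "weak_partial i (rep_W12 \<psi>) (weak_grad \<psi> i)"
proof -
  have "\<exists>g. g \<in> L2 \<and> weak_partial i (rep_W12 \<psi>) g"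
    using rep_sobolev[of \<psi>] by (auto simp: sobolev_functions_def)
  from someI_ex[OF this] show "weak_grad \<psi> i \<in> L2" "weak_partial i (rep_W12 \<psi>) (weak_grad \<psi> i)"
    by (auto simp: weak_grad_def)
qed

lemma grad_plus: "AE x in lborel. weak_grad (\<psi> + \<zeta>) i x = weak_grad \<psi> i x + weak_grad \<zeta> i x"
proof (rule weak_partial_unique[OF weak_grad(1) _ weak_grad(2)])
  show "(\<lambda>x. weak_grad \<psi> i x + weak_grad \<zeta> i x) \<in> L2" by (intro L2_add weak_grad)
  have "weak_partial i (\<lambda>x. rep_W12 \<psi> x + rep_W12 \<zeta> x) (\<lambda>x. weak_grad \<psi> i x + weak_grad \<zeta> i x)"
    by (intro weak_partial_add rep_L2 weak_grad)
  then show "weak_partial i (rep_W12 (\<psi> + \<zeta>)) (\<lambda>x. weak_grad \<psi> i x + weak_grad \<zeta> i x)"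
    using rep_plus[of \<psi> \<zeta>] by (intro weak_partial_cong[OF L2_add[OF rep_L2 rep_L2] rep_L2]) auto
qed

lemma grad_scaleC: "AE x in lborel. weak_grad (scaleC_W12 c \<psi>) i x = c * weak_grad \<psi> i x"
proof (rule weak_partial_unique[OF weak_grad(1) _ weak_grad(2)])
  show "(\<lambda>x. c * weak_grad \<psi> i x) \<in> L2" by (intro L2_cmult weak_grad)
  have "weak_partial i (\<lambda>x. c * rep_W12 \<psi> x) (\<lambda>x. c * weak_grad \<psi> i x)"
    by (intro weak_partial_cmult weak_grad)
  then show "weak_partial i (rep_W12 (scaleC_W12 c \<psi>)) (\<lambda>x. c * weak_grad \<psi> i x)"
    using rep_scaleC[of c \<psi>] by (intro weak_partial_cong[OF L2_cmult[OF rep_L2] rep_L2]) auto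
qed

lemma L2_inner_integrable:
  assumes "f \<in> L2" "g \<in> L2"
  shows "integrable lborel (\<lambda>x. f x \<bullet> g x)"
proof -
  have "integrable lborel (\<lambda>x. Re (f x * cnj (g x)))"
    using L2_mult_integrable[OF assms(1) L2_cnj[OF assms(2)]] by (rule integrable_Re)
  then show ?thesis by (simp add: inner_complex_def)
qed

lemma rep_measurable [measurable]:
  "rep_W12 \<psi> \<in> borel_measurable borel" "weak_grad \<psi> i \<in> borel_measurable borel"
  using L2_measurable[OF rep_L2] L2_measurable[OF weak_grad(1)] by auto

instantiation W12 :: real_inner
begin

text \<open>On \<^typ>\<open>complex\<close>, \<open>z \<bullet> w = Re (z * cnj w)\<close>: this is the real part of the usual Hermitian
  product, and it induces the norm of the space, see \<open>norm_W12\<close> below.\<close>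

definition inner_W12 :: "W12 \<Rightarrow> W12 \<Rightarrow> real" where
  "inner_W12 \<psi> \<zeta> = (\<Sum>i\<in>UNIV. \<integral>x. weak_grad \<psi> i x \<bullet> weak_grad \<zeta> i x \<partial>lborel) +
     (\<integral>x. rep_W12 \<psi> x \<bullet> rep_W12 \<zeta> x \<partial>lborel)"

definition norm_W12 :: "W12 \<Rightarrow> real" where "norm_W12 \<psi> = sqrt (\<psi> \<bullet> \<psi>)"
definition sgn_W12 :: "W12 \<Rightarrow> W12" where "sgn_W12 \<psi> = \<psi> /\<^sub>R norm \<psi>"
definition dist_W12 :: "W12 \<Rightarrow> W12 \<Rightarrow> real" where "dist_W12 \<psi> \<zeta> = norm (\<psi> - \<zeta>)"
definition uniformity_W12 :: "(W12 \<times> W12) filter" where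
  "uniformity_W12 = (INF e\<in>{0 <..}. principal {(x, y). dist x y < e})"
definition open_W12 :: "W12 set \<Rightarrow> bool" where
  "open_W12 U \<longleftrightarrow> (\<forall>x\<in>U. eventually (\<lambda>(x', y). x' = x \<longrightarrow> y \<in> U) uniformity)"

instance
proof
  fix a b c :: W12 and r :: real and U :: "W12 set"
  show "a \<bullet> b = b \<bullet> a" by (simp add: inner_W12_def inner_commute)
  have "(\<integral>x. rep_W12 (a + b) x \<bullet> rep_W12 c x \<partial>lborel) =
      (\<integral>x. rep_W12 a x \<bullet> rep_W12 c x + rep_W12 b x \<bullet> rep_W12 c x \<partial>lborel)"
    using rep_plus[of a b] by (intro integral_cong_AE) (auto simp: inner_add_left)
  moreover have "(\<integral>x. weak_grad (a + b) i x \<bullet> weak_grad c i x \<partial>lborel) =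
      (\<integral>x. weak_grad a i x \<bullet> weak_grad c i x + weak_grad b i x \<bullet> weak_grad c i x \<partial>lborel)" for i
    using grad_plus[of a b i] by (intro integral_cong_AE) (auto simp: inner_add_left)
  ultimately show "(a + b) \<bullet> c = a \<bullet> c + b \<bullet> c"
    by (simp add: inner_W12_def L2_inner_integrable rep_L2 weak_grad sum.distrib)
  have "(\<integral>x. rep_W12 (r *\<^sub>R a) x \<bullet> rep_W12 b x \<partial>lborel) =
      (\<integral>x. r * (rep_W12 a x \<bullet> rep_W12 b x) \<partial>lborel)" for r and a b :: W12
    using rep_scaleC[of "complex_of_real r" a]
    by (intro integral_cong_AE) (auto simp: scaleR_W12_def scaleR_conv_of_real[symmetric])
  moreover have "(\<integral>x. weak_grad (r *\<^sub>R a) i x \<bullet> weak_grad b i x \<partial>lborel) =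
      (\<integral>x. r * (weak_grad a i x \<bullet> weak_grad b i x) \<partial>lborel)" for r i and a b :: W12
    using grad_scaleC[of "complex_of_real r" a i]
    by (intro integral_cong_AE) (auto simp: scaleR_W12_def scaleR_conv_of_real[symmetric])
  ultimately have scale: "r *\<^sub>R a \<bullet> b = r * (a \<bullet> b)" for r and a b :: W12
    by (simp add: inner_W12_def sum_distrib_left distrib_left)
  show "r *\<^sub>R a \<bullet> b = r * (a \<bullet> b)" by (rule scale)
  show "0 \<le> a \<bullet> a"
    by (auto simp: inner_W12_def intro!: add_nonneg_nonneg sum_nonneg integral_nonneg)
  show "a \<bullet> a = 0 \<longleftrightarrow> a = 0"
  proof
    assume "a \<bullet> a = 0"
    moreover have "0 \<le> (\<integral>x. rep_W12 a x \<bullet> rep_W12 a x \<partial>lborel)"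
      "0 \<le> (\<Sum>i\<in>UNIV. \<integral>x. weak_grad a i x \<bullet> weak_grad a i x \<partial>lborel)"
      by (auto intro!: sum_nonneg integral_nonneg)
    ultimately have "(\<integral>x. rep_W12 a x \<bullet> rep_W12 a x \<partial>lborel) = 0"
      unfolding inner_W12_def by linarith
    then have "AE x in lborel. rep_W12 a x \<bullet> rep_W12 a x = 0"
      by (subst (asm) integral_nonneg_eq_0_iff_AE) (auto intro: L2_inner_integrable rep_L2)
    with rep_zero show "a = 0" by (intro W12_eqI) auto
  next
    assume a: "a = 0"
    have "a = 0 *\<^sub>R a" by (simp add: a)
    then show "a \<bullet> a = 0" by (metis scale mult_zero_left)
  qed
  show "norm a = sqrt (a \<bullet> a)" "sgn a = a /\<^sub>R norm a" "dist a b = norm (a - b)"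
    by (simp_all add: norm_W12_def sgn_W12_def dist_W12_def)
  show "uniformity = (INF e\<in>{0 <..}. principal {(x, y). dist x (y::W12) < e})"
    by (fact uniformity_W12_def)
  show "open U \<longleftrightarrow> (\<forall>x\<in>U. eventually (\<lambda>(x', y). x' = x \<longrightarrow> y \<in> U) uniformity)"
    by (fact open_W12_def)
qed

end

lemma norm_W12:
  "(norm \<psi>)\<^sup>2 = (\<integral>x. (\<Sum>i\<in>UNIV. (cmod (weak_grad \<psi> i x))\<^sup>2) \<partial>lborel) +
     (\<integral>x. (cmod (rep_W12 \<psi> x))\<^sup>2 \<partial>lborel)"
proof -
  have "integrable lborel (\<lambda>x. (cmod (weak_grad \<psi> i x))\<^sup>2)" for i
    using weak_grad(1)[of \<psi> i] by (simp add: L2_def)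
  then show ?thesis
    by (simp add: power2_norm_eq_inner[of \<psi>] inner_W12_def power2_norm_eq_inner[symmetric])
qed

lemma bounded_linear_W12I:
  fixes L :: "W12 \<Rightarrow> complex"
  assumes add: "\<And>v w. L (v + w) = L v + L w"
    and scale: "\<And>r v. L (r *\<^sub>R v) = r *\<^sub>R L v"
    and bound: "\<And>v. norm (L v) \<le> A + (norm v)\<^sup>2"
  shows "bounded_linear L"
proof (rule bounded_linear_intro[OF add scale])
  fix v
  show "norm (L v) \<le> norm v * (A + 1)"
  proof (cases "v = 0")
    case True
    then show ?thesis using scale[of 0 0] by simp
  next
    case False
    define w where "w = v /\<^sub>R norm v"
    have "norm w = 1" using False by (simp add: w_def)
    have "v = norm v *\<^sub>R w" using False by (simp add: w_def)
    then have "norm (L v) = norm v * norm (L w)"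
      by (metis scale norm_scaleR abs_norm_cancel)
    also have "\<dots> \<le> norm v * (A + 1)"
      using bound[of w] \<open>norm w = 1\<close> by (intro mult_left_mono) simp_all
    finally show ?thesis .
  qed
qed

lemma L2_integral_bound:
  assumes "f \<in> L2" "g \<in> L2"
  shows "norm (\<integral>x. f x * g x \<partial>lborel) \<le>
    (\<integral>x. (cmod (f x))\<^sup>2 \<partial>lborel) + (\<integral>x. (cmod (g x))\<^sup>2 \<partial>lborel)"
proof -
  have "norm (\<integral>x. f x * g x \<partial>lborel) \<le> (\<integral>x. (cmod (f x))\<^sup>2 + (cmod (g x))\<^sup>2 \<partial>lborel)"
  proof (rule Bochner_Integration.integral_norm_bound_integral)
    show "integrable lborel (\<lambda>x. f x * g x)" using assms by (rule L2_mult_integrable)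
    show "integrable lborel (\<lambda>x. (cmod (f x))\<^sup>2 + (cmod (g x))\<^sup>2)"
      using assms by (simp add: L2_def)
    have "a * b \<le> a\<^sup>2 + b\<^sup>2" if "a \<ge> 0" "b \<ge> 0" for a b :: real
      using that sum_squares_bound[of a b] mult_nonneg_nonneg[OF that] by linarith
    then show "norm (f x * g x) \<le> (cmod (f x))\<^sup>2 + (cmod (g x))\<^sup>2" for x
      by (simp add: norm_mult)
  qed
  with assms show ?thesis by (simp add: L2_def)
qed

lemma norm_W12_bounds:
  "(\<integral>x. (cmod (rep_W12 v x))\<^sup>2 \<partial>lborel) \<le> (norm v)\<^sup>2"
  "(\<Sum>i\<in>UNIV. \<integral>x. (cmod (weak_grad v i x))\<^sup>2 \<partial>lborel) \<le> (norm v)\<^sup>2"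
  by (simp_all add: power2_norm_eq_inner[of v] inner_W12_def power2_norm_eq_inner[symmetric]
      sum_nonneg)

lemma integral_rep_plus:
  assumes "f \<in> L2"
  shows "(\<integral>x. f x * rep_W12 (v + w) x \<partial>lborel) =
    (\<integral>x. f x * rep_W12 v x \<partial>lborel) + (\<integral>x. f x * rep_W12 w x \<partial>lborel)"
proof -
  note [measurable] = L2_measurable[OF assms]
  have "(\<integral>x. f x * rep_W12 (v + w) x \<partial>lborel) =
      (\<integral>x. f x * rep_W12 v x + f x * rep_W12 w x \<partial>lborel)"
    using rep_plus[of v w] by (intro integral_cong_AE) (auto simp: distrib_left)
  with assms show ?thesis by (simp add: L2_mult_integrable rep_L2)
qed

lemma integral_rep_scaleC:
  assumes "f \<in> L2"
  shows "(\<integral>x. f x * rep_W12 (scaleC_W12 c v) x \<partial>lborel) = c * (\<integral>x. f x * rep_W12 v x \<partial>lborel)"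
proof -
  note [measurable] = L2_measurable[OF assms]
  have "(\<integral>x. f x * rep_W12 (scaleC_W12 c v) x \<partial>lborel) = (\<integral>x. c * (f x * rep_W12 v x) \<partial>lborel)"
    using rep_scaleC[of c v] by (intro integral_cong_AE) (auto simp: mult.left_commute)
  then show ?thesis by simp
qed

lemma integral_grad_plus:
  assumes "f \<in> L2"
  shows "(\<integral>x. f x * weak_grad (v + w) i x \<partial>lborel) =
    (\<integral>x. f x * weak_grad v i x \<partial>lborel) + (\<integral>x. f x * weak_grad w i x \<partial>lborel)"
proof -
  note [measurable] = L2_measurable[OF assms]
  have "(\<integral>x. f x * weak_grad (v + w) i x \<partial>lborel) =
      (\<integral>x. f x * weak_grad v i x + f x * weak_grad w i x \<partial>lborel)"
    using grad_plus[of v w i] by (intro integral_cong_AE) (auto simp: distrib_left)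
  with assms show ?thesis by (simp add: L2_mult_integrable weak_grad)
qed

lemma integral_grad_scaleC:
  assumes "f \<in> L2"
  shows "(\<integral>x. f x * weak_grad (scaleC_W12 c v) i x \<partial>lborel) = c * (\<integral>x. f x * weak_grad v i x \<partial>lborel)"
proof -
  note [measurable] = L2_measurable[OF assms]
  have "(\<integral>x. f x * weak_grad (scaleC_W12 c v) i x \<partial>lborel) =
      (\<integral>x. c * (f x * weak_grad v i x) \<partial>lborel)"
    using grad_scaleC[of c v i] by (intro integral_cong_AE) (auto simp: mult.left_commute)
  then show ?thesis by simp
qed

section \<open>The dual space\<close>

text \<open>The type \<^typ>\<open>W12 \<Rightarrow>\<^sub>L complex\<close> contains all real linear bounded maps; the dual space consists
  of the complex linear ones.  A function \<open>g\<close> is regarded as the functional \<open>v \<mapsto> \<integral> g v\<close>, without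
  complex conjugation, which is consistent with distributions.\<close>

definition W_dual :: "(W12 \<Rightarrow>\<^sub>L complex) set" where
  "W_dual = {F. \<forall>c v. blinfun_apply F (scaleC_W12 c v) = c * blinfun_apply F v}"

definition scaleC_dual :: "complex \<Rightarrow> (W12 \<Rightarrow>\<^sub>L complex) \<Rightarrow> W12 \<Rightarrow>\<^sub>L complex" where
  "scaleC_dual c F = blinfun_mult_right c o\<^sub>L F"

definition functional_of :: "(real^3 \<Rightarrow> complex) \<Rightarrow> W12 \<Rightarrow>\<^sub>L complex" where
  "functional_of g = Blinfun (\<lambda>v. \<integral>x. g x * rep_W12 v x \<partial>lborel)"

definition embed :: "W12 \<Rightarrow> W12 \<Rightarrow>\<^sub>L complex" where
  "embed \<psi> = functional_of (rep_W12 \<psi>)"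

definition laplacian :: "W12 \<Rightarrow> W12 \<Rightarrow>\<^sub>L complex" where
  "laplacian \<psi> = Blinfun (\<lambda>v. - (\<integral>x. (\<Sum>i\<in>UNIV. weak_grad \<psi> i x * weak_grad v i x) \<partial>lborel))"

lemma functional_of_apply:
  assumes "f \<in> L2"
  shows "blinfun_apply (functional_of f) v = (\<integral>x. f x * rep_W12 v x \<partial>lborel)"
proof -
  have "bounded_linear (\<lambda>v. \<integral>x. f x * rep_W12 v x \<partial>lborel)"
  proof (rule bounded_linear_W12I[OF integral_rep_plus[OF assms]])
    fix r v
    show "(\<integral>x. f x * rep_W12 (r *\<^sub>R v) x \<partial>lborel) = r *\<^sub>R (\<integral>x. f x * rep_W12 v x \<partial>lborel)"
      by (simp add: scaleR_W12_def integral_rep_scaleC[OF assms] scaleR_conv_of_real)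
    show "norm (\<integral>x. f x * rep_W12 v x \<partial>lborel) \<le> (\<integral>x. (cmod (f x))\<^sup>2 \<partial>lborel) + (norm v)\<^sup>2"
      using L2_integral_bound[OF assms rep_L2[of v]] norm_W12_bounds(1)[of v] by linarith
  qed
  then show ?thesis by (simp add: functional_of_def bounded_linear_Blinfun_apply)
qed

lemma embed_apply: "blinfun_apply (embed \<psi>) v = (\<integral>x. rep_W12 \<psi> x * rep_W12 v x \<partial>lborel)"
  by (simp add: embed_def functional_of_apply rep_L2)

lemma embed_dual: "embed \<psi> \<in> W_dual"
  by (simp add: W_dual_def embed_apply integral_rep_scaleC rep_L2)

lemma laplacian_apply:
  "blinfun_apply (laplacian \<psi>) v =
     - (\<integral>x. (\<Sum>i\<in>UNIV. weak_grad \<psi> i x * weak_grad v i x) \<partial>lborel)"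
proof -
  have sum: "(\<integral>x. (\<Sum>i\<in>UNIV. weak_grad \<psi> i x * weak_grad v i x) \<partial>lborel) =
      (\<Sum>i\<in>UNIV. \<integral>x. weak_grad \<psi> i x * weak_grad v i x \<partial>lborel)" for v
    by (intro Bochner_Integration.integral_sum L2_mult_integrable weak_grad)
  have "bounded_linear (\<lambda>v. - (\<integral>x. (\<Sum>i\<in>UNIV. weak_grad \<psi> i x * weak_grad v i x) \<partial>lborel))"
    unfolding sum
  proof (rule bounded_linear_W12I)
    fix r v w
    show "- (\<Sum>i\<in>UNIV. \<integral>x. weak_grad \<psi> i x * weak_grad (v + w) i x \<partial>lborel) =
        - (\<Sum>i\<in>UNIV. \<integral>x. weak_grad \<psi> i x * weak_grad v i x \<partial>lborel) +
        - (\<Sum>i\<in>UNIV. \<integral>x. weak_grad \<psi> i x * weak_grad w i x \<partial>lborel)"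
      by (simp add: integral_grad_plus weak_grad sum.distrib)
    show "- (\<Sum>i\<in>UNIV. \<integral>x. weak_grad \<psi> i x * weak_grad (r *\<^sub>R v) i x \<partial>lborel) =
        r *\<^sub>R - (\<Sum>i\<in>UNIV. \<integral>x. weak_grad \<psi> i x * weak_grad v i x \<partial>lborel)"
      by (simp add: scaleR_W12_def integral_grad_scaleC weak_grad scaleR_conv_of_real
          sum_distrib_left)
    have "norm (- (\<Sum>i\<in>UNIV. \<integral>x. weak_grad \<psi> i x * weak_grad v i x \<partial>lborel)) \<le>
        (\<Sum>i\<in>UNIV. norm (\<integral>x. weak_grad \<psi> i x * weak_grad v i x \<partial>lborel))"
      unfolding norm_minus_cancel by (rule norm_sum)
    also have "\<dots> \<le> (\<Sum>i\<in>UNIV. (\<integral>x. (cmod (weak_grad \<psi> i x))\<^sup>2 \<partial>lborel) +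
        (\<integral>x. (cmod (weak_grad v i x))\<^sup>2 \<partial>lborel))"
      by (intro sum_mono L2_integral_bound weak_grad)
    also have "\<dots> \<le> (\<Sum>i\<in>UNIV. \<integral>x. (cmod (weak_grad \<psi> i x))\<^sup>2 \<partial>lborel) + (norm v)\<^sup>2"
      using norm_W12_bounds(2)[of v] by (simp add: sum.distrib)
    finally show "norm (- (\<Sum>i\<in>UNIV. \<integral>x. weak_grad \<psi> i x * weak_grad v i x \<partial>lborel)) \<le>
        (\<Sum>i\<in>UNIV. \<integral>x. (cmod (weak_grad \<psi> i x))\<^sup>2 \<partial>lborel) + (norm v)\<^sup>2" .
  qed
  then show ?thesis by (simp add: laplacian_def bounded_linear_Blinfun_apply)
qed

lemma laplacian_dual: "laplacian \<psi> \<in> W_dual"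
proof -
  have "(\<integral>x. (\<Sum>i\<in>UNIV. weak_grad \<psi> i x * weak_grad v i x) \<partial>lborel) =
      (\<Sum>i\<in>UNIV. \<integral>x. weak_grad \<psi> i x * weak_grad v i x \<partial>lborel)" for v
    by (intro Bochner_Integration.integral_sum L2_mult_integrable weak_grad)
  then show ?thesis
    by (simp add: W_dual_def laplacian_apply integral_grad_scaleC weak_grad sum_distrib_left)
qed

text \<open>For \<open>\<psi>\<close> in the Sobolev space the potential \<open>\<integral> |\<psi>(y)|\<^sup>2 / |x - y| dy\<close> converges for every \<open>x\<close>
  and is bounded in \<open>x\<close> (Hardy's inequality), and the double integral is finite.  So \<open>g1 \<psi>\<close> and
  \<open>g2 \<psi>\<close> come from square integrable functions and are covered by \<open>functional_of_apply\<close>.\<close>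

definition g1 :: "W12 \<Rightarrow> W12 \<Rightarrow>\<^sub>L complex" where
  "g1 \<psi> = functional_of (\<lambda>x. rep_W12 \<psi> x *
     complex_of_real (\<integral>y. (cmod (rep_W12 \<psi> y))\<^sup>2 / norm (x - y) \<partial>lborel))"

definition g2 :: "W12 \<Rightarrow> W12 \<Rightarrow>\<^sub>L complex" where
  "g2 \<psi> = functional_of (\<lambda>x. rep_W12 \<psi> x *
     complex_of_real (\<integral>z. (\<integral>y. (cmod (rep_W12 \<psi> y))\<^sup>2 * (cmod (rep_W12 \<psi> z))\<^sup>2 / norm (z - y)
       \<partial>lborel) \<partial>lborel))"

section \<open>Functions of time with values in a normed space\<close>

text \<open>The library restricts Borel measurability and the Bochner integral to second countable
  spaces, which the type \<^typ>\<open>W12 \<Rightarrow>\<^sub>L complex\<close> is not known to be; the following are the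
  general notions, built on its simple functions.\<close>

definition strongly_measurable :: "'a measure \<Rightarrow> ('a \<Rightarrow> 'b::real_normed_vector) \<Rightarrow> bool" where
  "strongly_measurable M f \<longleftrightarrow>
     (\<exists>s. (\<forall>n. simple_function M (s n)) \<and> (AE t in M. (\<lambda>n. s n t) \<longlonglongrightarrow> f t))"

definition has_strong_integral ::
    "'a measure \<Rightarrow> ('a \<Rightarrow> 'b::real_normed_vector) \<Rightarrow> 'b \<Rightarrow> bool" where
  "has_strong_integral M f w \<longleftrightarrow> strongly_measurable M f \<and>
     (\<exists>s. (\<forall>n. Bochner_Integration.simple_bochner_integrable M (s n)) \<and>
          (\<lambda>n. \<integral>\<^sup>+ t. ennreal (norm (f t - s n t)) \<partial>M) \<longlonglongrightarrow> 0 \<and>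
          (\<lambda>n. Bochner_Integration.simple_bochner_integral M (s n)) \<longlonglongrightarrow> w)"

definition Linf :: "real set \<Rightarrow> 'b::real_normed_vector set \<Rightarrow> (real \<Rightarrow> 'b) set" where
  "Linf I X = {u. strongly_measurable (lebesgue_on I) u \<and> (AE t in lebesgue_on I. u t \<in> X) \<and>
     (\<exists>C. AE t in lebesgue_on I. norm (u t) \<le> C)}"

definition Linf_norm :: "real set \<Rightarrow> (real \<Rightarrow> 'b::real_normed_vector) \<Rightarrow> ereal" where
  "Linf_norm I u = esssup (lebesgue_on I) (\<lambda>t. ereal (norm (u t)))"

definition weak_time_derivative ::
    "real set \<Rightarrow> (real \<Rightarrow> 'b::real_normed_vector) \<Rightarrow> (real \<Rightarrow> 'b) \<Rightarrow> bool" where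
  "weak_time_derivative I u u' \<longleftrightarrow>
     (\<forall>\<eta>. test_function (interior I) \<eta> \<longrightarrow>
        (\<exists>w. has_strong_integral (lebesgue_on I) (\<lambda>t. deriv \<eta> t *\<^sub>R u t) w \<and>
             has_strong_integral (lebesgue_on I) (\<lambda>t. \<eta> t *\<^sub>R u' t) (- w)))"

section \<open>Weak solutions\<close>

text \<open>Membership in \<open>W\<^sup>1\<^sup>,\<^sup>\<infinity>\<close> with values in the dual space means that \<open>embed \<circ> \<psi>\<close> and its weak time
  derivative \<open>\<psi>'\<close> both are in \<open>L\<^sup>\<infinity>\<close>.  Such a \<open>\<psi>\<close> is only determined up to a null set of times; its
  value at time \<open>0\<close> is that of its continuous representative \<open>\<Psi>\<close> in the dual space.\<close>

definition frictional_NS_solution ::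
    "real \<Rightarrow> real \<Rightarrow> real \<Rightarrow> real set \<Rightarrow> W12 \<Rightarrow> (real \<Rightarrow> W12) \<Rightarrow> bool" where
  "frictional_NS_solution hbar m G I \<phi> \<psi> \<longleftrightarrow>
     is_interval I \<and> 0 \<in> I \<and>
     \<psi> \<in> Linf I UNIV \<and>
     (\<lambda>t. embed (\<psi> t)) \<in> Linf I W_dual \<and>
     (\<exists>\<psi>' \<in> Linf I W_dual.
        weak_time_derivative I (\<lambda>t. embed (\<psi> t)) \<psi>' \<and>
        (AE t in lebesgue_on I.
           scaleC_dual \<i> (\<psi>' t) =
             - ((hbar / (2 * m)) *\<^sub>R laplacian (\<psi> t))
             + scaleC_dual (\<i> * of_real (4 * pi * G * m\<^sup>2 / hbar)) (g1 (\<psi> t))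
             - scaleC_dual (\<i> * of_real (4 * pi * G * m\<^sup>2 / hbar)) (g2 (\<psi> t)))) \<and>
     (\<exists>\<Psi>. continuous_on I \<Psi> \<and> (AE t in lebesgue_on I. \<Psi> t = embed (\<psi> t)) \<and>
        \<Psi> 0 = embed \<phi>)"

end

theory Submission
  imports Defs
begin

text \<open>Let \<open>K\<close> represent the inner product of \<open>L\<^sup>2\<close> in the Hilbert space \<open>W\<^sup>1\<^sup>,\<^sup>2\<close>, so that
  \<open>K = (1 - \<Delta>)\<^sup>-\<^sup>1\<close>, and let \<open>J\<close> be multiplication by the imaginary unit.  Tested against elements of
  \<open>W\<^sup>1\<^sup>,\<^sup>2\<close>, the equation becomes \<open>(K \<psi>)' = c J (K \<psi> - \<psi>) + K F(\<psi>)\<close> with \<open>c = hbar / (2 m)\<close>, where by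
  Hardy's inequality \<open>F\<close> is a locally Lipschitz map of \<open>W\<^sup>1\<^sup>,\<^sup>2\<close> into itself.  The group \<open>U\<close> generated by
  \<open>c J (1 - K\<^sup>-\<^sup>1)\<close>, a limit of exponentials of bounded operators, is isometric, so Picard iteration for
  Duhamel's formula solves the equation on a time interval that depends only on a bound for the
  initial datum.  The lemma of du Bois-Reymond turns weak time derivatives into integral identities.
  Hence any two weak solutions satisfy Duhamel's formula, and a Gronwall argument bounds their
  difference by a multiple of the difference of the initial data.  This gives uniqueness and
  continuous dependence at once.\<close>

section \<open>Hilbert spaces\<close>

text \<open>A weak solution is differentiable in time only after pairing with test elements, and
  then only almost everywhere, so neither its norm nor \<open>U (- t) (\<psi> t)\<close> can be
  differentiated directly. Testing with \<open>K (K (K v))\<close> removes the obstacle: on such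
  elements \<open>U\<close> is smooth enough for a pairing with a merely Lipschitz functional of
  time to be computed from its increments, and they are dense. Only the bounded \<open>K\<close> is
  ever handled; the Laplacian enters as 1 minus the inverse of \<open>K\<close>.

  The Lipschitz constant of the nonlinearity depends on a bound for both solutions, but a weak
  solution brings an essential bound of its own, which need not be uniform along the sequence of
  data. Uniformity comes back through uniqueness: the Picard solution obeys a bound \<open>R\<close>
  that depends only on a ball containing the data, and a weak solution with the same datum agrees
  with it almost everywhere, whatever its own bound was. Hence all data near \<phi> share one
  \<open>T\<close>, one \<open>R\<close> and one Lipschitz constant.\<close>

lemma quadratic_nonneg_imp_linear_zero:
  fixes a b :: real
  assumes "\<And>r. 0 \<le> r * a + r\<^sup>2 * b"
  shows "a = 0"
proof (rule ccontr)
  assume a: "a \<noteq> 0"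
  \<comment> \<open>The sign of \<open>b\<close> is unknown. Replacing it by a positive
    \<open>c\<close> above it gives a quadratic with a minimum, at \<open>- a / (2 * c)\<close>, and
    the minimum is negative unless \<open>a\<close> vanishes.\<close>
  define c where "c = \<bar>b\<bar> + 1"
  have c: "c > 0" "b \<le> c" by (auto simp: c_def)
  define r where "r = - a / (2 * c)"
  have "r * a + r\<^sup>2 * b \<le> r * a + r\<^sup>2 * c"
    using c by (intro add_left_mono mult_left_mono) auto
  also have "\<dots> = - a\<^sup>2 / (4 * c)"
    using c by (simp add: r_def power2_eq_square field_simps)
  also have "\<dots> < 0" using a c by (simp add: field_simps)
  finally show False using assms[of r] by simp
qed

text \<open>A minimising sequence for the distance from \<open>w\<close> to \<open>S\<close> is
  Cauchy by the parallelogram law, since midpoints stay in \<open>S\<close>. As \<open>S\<close> may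
  fail to be closed, the limit is only placed in its closure; the first variation at the limit gives
  orthogonality.\<close>

lemma subspace_approx_orthogonal:
  fixes S :: "'h::{real_inner,banach} set"
  assumes S: "subspace S"
  obtains p where "p \<in> closure S" "\<And>s. s \<in> S \<Longrightarrow> (w - p) \<bullet> s = 0"
proof -
  define Q where "Q = (\<lambda>s. (norm (w - s))\<^sup>2) ` S"
  define d where "d = Inf Q"
  have Q: "Q \<noteq> {}" "bdd_below Q"
    using subspace_0[OF S] by (auto simp: Q_def intro!: bdd_belowI[of _ 0])
  have d_le: "d \<le> (norm (w - s))\<^sup>2" if "s \<in> S" for s
    unfolding d_def using that by (intro cInf_lower Q) (auto simp: Q_def)
  have "\<exists>s\<in>S. (norm (w - s))\<^sup>2 < d + 1 / real (Suc n)" for n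
    using cInf_lessD[OF Q(1), of "d + 1 / real (Suc n)"] by (auto simp: d_def Q_def)
  then obtain s where s: "\<And>n. s n \<in> S" "\<And>n. (norm (w - s n))\<^sup>2 < d + 1 / real (Suc n)"
    by metis
  have par: "(norm (s m - s n))\<^sup>2 \<le> 2 / real (Suc m) + 2 / real (Suc n)" for m n
  proof -
    have "(1/2) *\<^sub>R (s m + s n) \<in> S"
      by (intro subspace_scale[OF S] subspace_add[OF S] s)
    from d_le[OF this] have "d \<le> (norm (w - (1/2) *\<^sub>R (s m + s n)))\<^sup>2" .
    moreover have "(norm (s m - s n))\<^sup>2 =
        2 * (norm (w - s m))\<^sup>2 + 2 * (norm (w - s n))\<^sup>2 - 4 * (norm (w - (1/2) *\<^sub>R (s m + s n)))\<^sup>2"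
      unfolding power2_norm_eq_inner by (simp add: inner_simps inner_commute algebra_simps)
    moreover have "2 / real (Suc k) = 2 * (1 / real (Suc k))" for k by simp
    ultimately show ?thesis using s(2)[of m] s(2)[of n] by (smt (verit))
  qed
  have "Cauchy s"
  proof (rule CauchyI)
    fix e :: real assume e: "0 < e"
    obtain M where M: "4 / e\<^sup>2 < real M" using reals_Archimedean2 by blast
    have "norm (s m - s n) < e" if "M \<le> m" "M \<le> n" for m n
    proof -
      have "2 / real (Suc m) \<le> 2 / real (Suc M)" "2 / real (Suc n) \<le> 2 / real (Suc M)"
        using that by (auto intro!: divide_left_mono)
      then have "(norm (s m - s n))\<^sup>2 \<le> 4 / real (Suc M)" using par[of m n] by linarith
      also have "\<dots> < e\<^sup>2" using M e by (simp add: field_simps) (smt (verit) zero_less_power)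
      finally show ?thesis using e by (metis power_less_imp_less_base less_imp_le)
    qed
    then show "\<exists>M. \<forall>m\<ge>M. \<forall>n\<ge>M. norm (s m - s n) < e" by blast
  qed
  then obtain p where p: "s \<longlonglongrightarrow> p" using Cauchy_convergent_iff convergent_def by blast
  have lim: "(\<lambda>n. (norm (w - (s n + v)))\<^sup>2) \<longlonglongrightarrow> (norm (w - (p + v)))\<^sup>2" for v
    by (intro tendsto_intros p)
  have "(norm (w - p))\<^sup>2 \<le> d"
  proof (rule LIMSEQ_le[of "\<lambda>n. (norm (w - s n))\<^sup>2" _ "\<lambda>n. d + 1 / real (Suc n)"])
    show "(\<lambda>n. (norm (w - s n))\<^sup>2) \<longlonglongrightarrow> (norm (w - p))\<^sup>2" using lim[of 0] by simp
    show "(\<lambda>n. d + 1 / real (Suc n)) \<longlonglongrightarrow> d"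
      using tendsto_add[OF tendsto_const LIMSEQ_inverse_real_of_nat, of d]
      by (simp add: inverse_eq_divide)
  qed (use s(2) less_imp_le in blast)
  moreover have "d \<le> (norm (w - (p + v)))\<^sup>2" if "v \<in> S" for v
    by (rule LIMSEQ_le_const[OF lim]) (use d_le subspace_add[OF S s(1) that] in blast)
  ultimately have min: "(norm (w - p))\<^sup>2 \<le> (norm (w - (p + v)))\<^sup>2" if "v \<in> S" for v
    using that by (meson order_trans)
  have "(w - p) \<bullet> v = 0" if "v \<in> S" for v
  proof -
    have "0 \<le> r * (- 2 * ((w - p) \<bullet> v)) + r\<^sup>2 * (v \<bullet> v)" for r
    proof -
      have "(norm (w - p))\<^sup>2 \<le> (norm (w - (p + r *\<^sub>R v)))\<^sup>2"
        by (intro min subspace_scale[OF S] that)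
      then show ?thesis
        unfolding power2_norm_eq_inner
        by (simp add: inner_simps inner_commute algebra_simps power2_eq_square)
    qed
    then show ?thesis using quadratic_nonneg_imp_linear_zero by fastforce
  qed
  moreover have "p \<in> closure S"
    using p s(1) closure_sequential by blast
  ultimately show ?thesis using that by blast
qed

text \<open>What is left of \<open>w\<close> after projection is orthogonal to \<open>S\<close>,
  hence zero.\<close>

lemma subspace_dense:
  fixes S :: "'h::{real_inner,banach} set"
  assumes "subspace S" "\<And>x. (\<And>s. s \<in> S \<Longrightarrow> x \<bullet> s = 0) \<Longrightarrow> x = 0"
  shows "closure S = UNIV"
proof (intro equalityI subset_UNIV subsetI)
  fix w
  obtain p where "p \<in> closure S" "\<And>s. s \<in> S \<Longrightarrow> (w - p) \<bullet> s = 0"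
    using subspace_approx_orthogonal[OF assms(1), of w] by blast
  then show "w \<in> closure S" using assms(2)[of "w - p"] by simp
qed

text \<open>If \<open>F\<close> is nonzero, the component \<open>z\<close> of some \<open>w\<close>
  orthogonal to the kernel spans the orthogonal complement of the kernel, so \<open>F\<close> is a
  multiple of the product with \<open>z\<close>. The scalars are real because the inner product of
  the Sobolev space is the real part of the Hermitian one.\<close>

lemma riesz_representation:
  fixes F :: "'h::{real_inner,banach} \<Rightarrow> real"
  assumes "bounded_linear F"
  obtains x where "\<And>v. x \<bullet> v = F v"
proof (cases "\<forall>v. F v = 0")
  case True
  then show ?thesis using that[of 0] by simp
next
  case False
  then obtain w where w: "F w \<noteq> 0" by blast
  interpret F: bounded_linear F by fact
  define N where "N = {x. F x = 0}"
  have "subspace N" by (auto simp: N_def subspace_def F.zero F.add F.scaleR)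
  then obtain p where p: "p \<in> closure N" "\<And>s. s \<in> N \<Longrightarrow> (w - p) \<bullet> s = 0"
    using subspace_approx_orthogonal[of N w] by blast
  have "closed N" unfolding N_def
    by (intro closed_Collect_eq linear_continuous_on[OF assms] continuous_on_const)
  with p(1) have Fp: "F p = 0" by (simp add: N_def)
  define z where "z = w - p"
  have Fz: "F z \<noteq> 0" using w Fp by (simp add: z_def F.diff)
  then have zz: "z \<bullet> z \<noteq> 0" using F.zero by auto
  have "(F z / (z \<bullet> z)) *\<^sub>R z \<bullet> v = F v" for v
  proof -
    have "v - (F v / F z) *\<^sub>R z \<in> N" using Fz by (simp add: N_def F.diff F.scaleR)
    from p(2)[OF this] have "z \<bullet> v = (F v / F z) * (z \<bullet> z)"
      by (simp add: z_def inner_simps)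
    then show ?thesis using Fz zz by simp
  qed
  then show ?thesis by (rule that)
qed

section \<open>The Banach algebra of bounded operators\<close>

text \<open>A type of its own lets composition be the multiplication of a Banach algebra, so that
  the exponential series and its calculus apply to operators.\<close>

typedef (overloaded) 'a endo = "UNIV :: ('a::real_normed_vector \<Rightarrow>\<^sub>L 'a) set"
  morphisms blinfun_of Endo by simp

setup_lifting type_definition_endo

instantiation endo :: (real_normed_vector) real_vector
begin

lift_definition zero_endo :: "'a endo" is 0 .
lift_definition plus_endo :: "'a endo \<Rightarrow> 'a endo \<Rightarrow> 'a endo" is "(+)" .
lift_definition minus_endo :: "'a endo \<Rightarrow> 'a endo \<Rightarrow> 'a endo" is "(-)" .
lift_definition uminus_endo :: "'a endo \<Rightarrow> 'a endo" is uminus .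
lift_definition scaleR_endo :: "real \<Rightarrow> 'a endo \<Rightarrow> 'a endo" is "(*\<^sub>R)" .
instance
proof
  fix a b c :: "'a endo" and r s :: real
  show "a + b + c = a + (b + c)" by transfer (simp add: add.assoc)
  show "a + b = b + a" by transfer (simp add: add.commute)
  show "0 + a = a" by transfer simp
  show "- a + a = 0" by transfer simp
  show "a - b = a + - b" by transfer simp
  show "r *\<^sub>R (a + b) = r *\<^sub>R a + r *\<^sub>R b" by transfer (simp add: scaleR_add_right)
  show "(r + s) *\<^sub>R a = r *\<^sub>R a + s *\<^sub>R a" by transfer (simp add: scaleR_add_left)
  show "r *\<^sub>R s *\<^sub>R a = (r * s) *\<^sub>R a" by transfer simp
  show "1 *\<^sub>R a = a" by transfer simp
qed

end

instantiation endo :: (real_normed_vector) real_normed_vector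
begin

lift_definition norm_endo :: "'a endo \<Rightarrow> real" is norm .
definition "sgn_endo (x::'a endo) = x /\<^sub>R norm x"
definition "dist_endo (x::'a endo) y = norm (x - y)"
definition "uniformity_endo = (INF e\<in>{0 <..}. principal {(x, y). dist (x::'a endo) y < e})"
definition "open_endo (U::'a endo set) \<longleftrightarrow> (\<forall>x\<in>U. eventually (\<lambda>(x', y). x' = x \<longrightarrow> y \<in> U) uniformity)"

instance
proof
  fix a b :: "'a endo" and r :: real and U :: "'a endo set"
  show "sgn a = a /\<^sub>R norm a" by (fact sgn_endo_def)
  show "dist a b = norm (a - b)" by (fact dist_endo_def)
  show "uniformity = (INF e\<in>{0 <..}. principal {(x, y). dist x (y::'a endo) < e})"
    by (fact uniformity_endo_def)
  show "open U \<longleftrightarrow> (\<forall>x\<in>U. eventually (\<lambda>(x', y). x' = x \<longrightarrow> y \<in> U) uniformity)"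
    by (fact open_endo_def)
  show "norm a = 0 \<longleftrightarrow> a = 0" by transfer simp
  show "norm (a + b) \<le> norm a + norm b" by transfer (rule norm_triangle_ineq)
  show "norm (r *\<^sub>R a) = \<bar>r\<bar> * norm a" by transfer simp
qed

end

text \<open>On the zero space the identity would have norm 0. The class \<open>perfect_space\<close>
  excludes this case and so yields \<open>norm 1 = 1\<close> and
  \<open>0 \<noteq> 1\<close>.\<close>

instantiation endo :: ("{real_normed_vector,perfect_space}") real_normed_algebra_1
begin

lift_definition one_endo :: "'a endo" is id_blinfun .
lift_definition times_endo :: "'a endo \<Rightarrow> 'a endo \<Rightarrow> 'a endo" is "(o\<^sub>L)" .

instance
proof
  fix a b c :: "'a endo" and r :: real
  show "a * b * c = a * (b * c)" by transfer (rule blinfun_eqI, simp)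
  show "1 * a = a" "a * 1 = a" by (transfer, simp add: blinfun_eqI)+
  show "(a + b) * c = a * c + b * c" "a * (b + c) = a * b + a * c"
    by (transfer, rule blinfun_eqI, simp add: blinfun.bilinear_simps)+
  show "r *\<^sub>R a * b = r *\<^sub>R (a * b)" "a * r *\<^sub>R b = r *\<^sub>R (a * b)"
    by (transfer, rule blinfun_eqI, simp add: blinfun.bilinear_simps)+
  show "norm (a * b) \<le> norm a * norm b" by transfer (rule norm_blinfun_compose)
  show n1: "norm (1::'a endo) = 1" by transfer simp
  then show "(0::'a endo) \<noteq> 1" by (metis norm_zero zero_neq_one)
qed

end

instance endo :: (banach) banach
proof
  fix X :: "nat \<Rightarrow> 'a endo" assume X: "Cauchy X"
  have "Cauchy (\<lambda>n. blinfun_of (X n))"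
    using X unfolding Cauchy_def dist_norm by (simp add: norm_endo.rep_eq minus_endo.rep_eq)
  then obtain L where "(\<lambda>n. blinfun_of (X n)) \<longlonglongrightarrow> L"
    using Cauchy_convergent_iff convergent_def by blast
  then have "X \<longlonglongrightarrow> Endo L"
    unfolding lim_sequentially dist_norm
    by (simp add: norm_endo.rep_eq minus_endo.rep_eq Endo_inverse)
  then show "convergent X" by (auto simp: convergent_def)
qed

definition app :: "'a::real_normed_vector endo \<Rightarrow> 'a \<Rightarrow> 'a" where
  "app A x = blinfun_apply (blinfun_of A) x"

lemma app_simps [simp]:
  fixes A B :: "'a::{real_normed_vector,perfect_space} endo"
  shows "app (A * B) x = app A (app B x)" "app 1 x = x" "app (A + B) x = app A x + app B x"
    "app (A - B) x = app A x - app B x" "app (r *\<^sub>R A) x = r *\<^sub>R app A x"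
  by (simp_all add: app_def times_endo.rep_eq one_endo.rep_eq plus_endo.rep_eq minus_endo.rep_eq
      scaleR_endo.rep_eq blinfun.bilinear_simps)

lemma app_Endo: "bounded_linear f \<Longrightarrow> app (Endo (Blinfun f)) x = f x"
  by (simp add: app_def Endo_inverse bounded_linear_Blinfun_apply)

lemma bounded_linear_app_left: "bounded_linear (\<lambda>A. app A x)"
proof (rule bounded_linear_intro)
  show "app (A + B) x = app A x + app B x" for A B
    by (simp add: app_def plus_endo.rep_eq blinfun.bilinear_simps)
  show "app (r *\<^sub>R A) x = r *\<^sub>R app A x" for r A
    by (simp add: app_def scaleR_endo.rep_eq blinfun.bilinear_simps)
  show "norm (app A x) \<le> norm A * norm x" for A
    by (simp add: app_def norm_endo.rep_eq norm_blinfun)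
qed

lemma bounded_linear_app: "bounded_linear (app A)"
  unfolding app_def[abs_def] by (rule blinfun.bounded_linear_right)

lemma endo_eqI: "(\<And>x. app A x = app B x) \<Longrightarrow> A = B"
  unfolding app_def by (metis blinfun_eqI blinfun_of_inject)

lemma exp_commute:
  fixes A B :: "'a::{real_normed_algebra_1,banach}"
  assumes "A * B = B * A"
  shows "exp A * B = B * exp A"
proof -
  have "A ^ n * B = B * A ^ n" for n
    by (induction n) (simp_all add: mult.assoc assms, metis assms mult.assoc)
  then have "(\<Sum>n. (A ^ n /\<^sub>R fact n) * B) = (\<Sum>n. B * (A ^ n /\<^sub>R fact n))" by simp
  then show ?thesis
    unfolding exp_def
    by (simp only: suminf_mult[OF summable_exp_generic] suminf_mult2[OF summable_exp_generic])
qed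

text \<open>Lets commutation with \<open>K\<close>, with \<open>J\<close> and with other generators
  pass from a generator to the group it generates.\<close>

lemma app_exp_commute:
  fixes A :: "'a::{banach,perfect_space} endo"
  assumes B: "bounded_linear B" and c: "\<And>x. B (app A x) = app A (B x)"
  shows "B (app (exp (t *\<^sub>R A)) x) = app (exp (t *\<^sub>R A)) (B x)"
proof -
  have "t *\<^sub>R A * Endo (Blinfun B) = Endo (Blinfun B) * t *\<^sub>R A"
    by (rule endo_eqI) (simp add: app_Endo[OF B] c linear_simps[OF B])
  from exp_commute[OF this] have "app (exp (t *\<^sub>R A) * Endo (Blinfun B)) x = app (Endo (Blinfun B) * exp (t *\<^sub>R A)) x"
    by simp
  then show ?thesis by (simp add: app_Endo[OF B])
qed

lemma app_exp_derivative:
  fixes A :: "'a::{banach,perfect_space} endo"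
  shows "((\<lambda>t. app (exp (t *\<^sub>R A)) x) has_vector_derivative app A (app (exp (t *\<^sub>R A)) x)) (at t)"
  using bounded_linear.has_vector_derivative[OF bounded_linear_app_left exp_scaleR_has_vector_derivative_left]
  by (metis app_simps(1))

text \<open>The derivative of \<open>u t \<bullet> u t\<close> is twice
  \<open>app A (u t) \<bullet> u t\<close>, which vanishes by skewness.\<close>

lemma app_exp_isometry:
  fixes A :: "'a::{real_inner,banach,perfect_space} endo"
  assumes skew: "\<And>x. app A x \<bullet> x = 0"
  shows "norm (app (exp (t *\<^sub>R A)) x) = norm x"
proof -
  define u where "u = (\<lambda>t. app (exp (t *\<^sub>R A)) x)"
  have "((\<lambda>t. u t \<bullet> u t) has_real_derivative 0) (at t)" for t
  proof -
    have d: "(u has_derivative (\<lambda>h. h *\<^sub>R app A (u t))) (at t)"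
      using app_exp_derivative[of A x t] by (simp add: has_vector_derivative_def u_def)
    have "((\<lambda>t. u t \<bullet> u t) has_derivative (\<lambda>h. u t \<bullet> (h *\<^sub>R app A (u t)) + h *\<^sub>R app A (u t) \<bullet> u t)) (at t)"
      by (rule has_derivative_inner[OF d d])
    then show ?thesis
      by (simp add: has_field_derivative_def skew inner_commute[of "u t"] lambda_zero)
  qed
  then have "u t \<bullet> u t = u 0 \<bullet> u 0" using DERIV_isconst_all by blast
  then show ?thesis by (simp add: u_def norm_eq_sqrt_inner)
qed

section \<open>The unitary group\<close>

text \<open>Mean value inequality: the derivative of the orbit of \<open>x\<close> is the orbit of
  \<open>app A x\<close>, so its norm is constant in time.\<close>

lemma app_exp_diff_bound:
  fixes A :: "'a::{real_inner,banach,perfect_space} endo"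
  assumes skew: "\<And>x. app A x \<bullet> x = 0"
  shows "norm (app (exp (t *\<^sub>R A)) x - x) \<le> \<bar>t\<bar> * norm (app A x)"
proof -
  define u where "u = (\<lambda>t. app (exp (t *\<^sub>R A)) x)"
  have d: "(u has_derivative (\<lambda>h. h *\<^sub>R app A (u s))) (at s)" for s
    using app_exp_derivative[of A x s] by (simp add: has_vector_derivative_def u_def)
  have n: "norm (app A (u s)) = norm (app A x)" for s
    unfolding u_def
    by (subst app_exp_commute[OF bounded_linear_app]) (simp_all add: app_exp_isometry[OF skew])
  have "norm (u t - u 0) \<le> norm (app A x) * norm (t - 0)"
  proof (rule differentiable_bound[of UNIV])
    show "(u has_derivative (\<lambda>h. h *\<^sub>R app A (u s))) (at s within UNIV)" for s
      using d by simp
    show "onorm (\<lambda>h. h *\<^sub>R app A (u s)) \<le> norm (app A x)" for s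
      by (rule onorm_le) (simp add: n mult.commute)
  qed auto
  then show ?thesis by (simp add: u_def mult.commute)
qed

text \<open>\<open>K_bound\<close> says that the square of \<open>K\<close> lies below
  \<open>K\<close>, hence \<open>0 \<le> K \<le> 1\<close> in the order of symmetric operators; this
  encodes that minus the Laplacian is nonnegative. \<open>K_inj\<close> makes the inverse of
  \<open>K\<close> densely defined. \<open>J\<close> is an orthogonal complex structure that
  commutes with \<open>K\<close>, so the space can be treated as a real one throughout.\<close>

locale schroedinger_pair =
  fixes K J :: "'h::{real_inner,banach,perfect_space} \<Rightarrow> 'h" and c :: real
  assumes K: "bounded_linear K" and J: "bounded_linear J"
    and K_sym: "K x \<bullet> y = x \<bullet> K y"
    and K_bound: "K x \<bullet> K x \<le> K x \<bullet> x"
    and K_inj: "K x = 0 \<Longrightarrow> x = 0"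
    and J_J: "J (J x) = - x"
    and J_inner: "J x \<bullet> J y = x \<bullet> y"
    and K_J: "K (J x) = J (K x)"
begin

lemmas K_simps = linear_simps[OF K]
lemmas J_simps = linear_simps[OF J]

lemma J_skew: "J x \<bullet> y = - (x \<bullet> J y)"
  using J_inner[of "J x" y] by (simp add: J_J)

lemma J_self: "J x \<bullet> x = 0" "x \<bullet> J x = 0"
  using J_skew[of x x] by (simp_all add: inner_commute)

lemma norm_J: "norm (J x) = norm x"
  by (simp add: norm_eq_sqrt_inner J_inner)

lemma K_nonneg: "0 \<le> K x \<bullet> x"
  using K_bound[of x] inner_ge_zero[of "K x"] by linarith

lemma norm_one_minus_K: "norm (x - K x) \<le> norm x"
  unfolding norm_le using K_bound[of x] K_nonneg[of x]
  by (simp add: inner_simps inner_commute)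

lemma norm_K: "norm (K x) \<le> norm x"
proof -
  have "norm (K x) * norm (K x) \<le> norm (K x) * norm x"
    using K_bound[of x] norm_cauchy_schwarz[of "K x" x] by (simp add: norm_eq_square[symmetric] power2_norm_eq_inner[symmetric] power2_eq_square)
  then show ?thesis by (cases "K x = 0") auto
qed

text \<open>This is the fixed point equation of
  \<open>x \<mapsto> (y + (x - K x)) / (1 + e)\<close>, a contraction because \<open>1 - K\<close>
  has norm at most 1.\<close>

lemma ex1_resolvent:
  assumes e: "e > 0"
  shows "\<exists>!x. K x + e *\<^sub>R x = y"
proof -
  have "\<exists>!x. (1 / (1 + e)) *\<^sub>R (y + (x - K x)) = x"
  proof (rule banach_fix_type[of "1 / (1 + e)"])
    show "\<forall>x x'. dist ((1 / (1 + e)) *\<^sub>R (y + (x - K x))) ((1 / (1 + e)) *\<^sub>R (y + (x' - K x')))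
        \<le> 1 / (1 + e) * dist x x'"
    proof (intro allI)
      fix x x'
      have "(1 / (1 + e)) *\<^sub>R (y + (x - K x)) - (1 / (1 + e)) *\<^sub>R (y + (x' - K x')) =
          (1 / (1 + e)) *\<^sub>R ((x - x') - K (x - x'))"
        by (simp add: K_simps algebra_simps)
      then show "dist ((1 / (1 + e)) *\<^sub>R (y + (x - K x))) ((1 / (1 + e)) *\<^sub>R (y + (x' - K x')))
        \<le> 1 / (1 + e) * dist x x'"
        using e norm_one_minus_K[of "x - x'"] by (simp add: dist_norm divide_right_mono)
    qed
  qed (use e in auto)
  moreover have "(1 / (1 + e)) *\<^sub>R (y + (x - K x)) = x \<longleftrightarrow> K x + e *\<^sub>R x = y" for x
  proof -
    have "(1 / (1 + e)) *\<^sub>R (y + (x - K x)) = x \<longleftrightarrow> y + (x - K x) = (1 + e) *\<^sub>R x"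
    proof
      assume "(1 / (1 + e)) *\<^sub>R (y + (x - K x)) = x"
      then have "(1 + e) *\<^sub>R x = (1 + e) *\<^sub>R (1 / (1 + e)) *\<^sub>R (y + (x - K x))" by simp
      then show "y + (x - K x) = (1 + e) *\<^sub>R x" using e by (simp del: scaleR_add_left)
    next
      assume "y + (x - K x) = (1 + e) *\<^sub>R x"
      then show "(1 / (1 + e)) *\<^sub>R (y + (x - K x)) = x" using e by (simp del: scaleR_add_left)
    qed
    then show ?thesis by (auto simp: algebra_simps)
  qed
  ultimately show ?thesis by simp
qed

text \<open>\<open>K\<^sup>-\<^sup>1\<close> is unbounded; \<open>gen n\<close> replaces it by the bounded operator \<open>(K + 1 / (n + 1))\<^sup>-\<^sup>1\<close>.\<close>

definition res :: "real \<Rightarrow> 'h \<Rightarrow> 'h" where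
  "res e y = (THE x. K x + e *\<^sub>R x = y)"

lemma res: "e > 0 \<Longrightarrow> K (res e y) + e *\<^sub>R res e y = y"
  unfolding res_def by (rule theI'[OF ex1_resolvent])

lemma res_unique: "e > 0 \<Longrightarrow> K x + e *\<^sub>R x = y \<Longrightarrow> res e y = x"
  using ex1_resolvent res by blast

lemma res_K: "e > 0 \<Longrightarrow> res e (K y) = K (res e y)"
  using res[of e y] by (intro res_unique) (simp_all add: K_simps[symmetric])

lemma res_J: "e > 0 \<Longrightarrow> res e (J y) = J (res e y)"
  using res[of e y] by (intro res_unique) (simp_all add: K_J J_simps[symmetric])

text \<open>Since \<open>K u \<bullet> u\<close> is nonnegative, \<open>K u\<close> is no longer
  than \<open>K u + e u = y\<close>. The bound is uniform in \<open>e\<close>, whereas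
  \<open>res e\<close> alone is controlled only by \<open>1 / e\<close>.\<close>

lemma norm_res_K:
  assumes "e > 0"
  shows "norm (res e (K y)) \<le> norm y"
proof -
  define u where "u = res e y"
  have "y = K u + e *\<^sub>R u" using res[OF assms, of y] by (simp add: u_def)
  moreover have "0 \<le> e * (K u \<bullet> u)" using K_nonneg[of u] assms by simp
  ultimately have "norm (K u) \<le> norm y"
    unfolding norm_le using assms by (simp add: inner_simps inner_commute)
  then show ?thesis by (simp add: res_K[OF assms] u_def)
qed

lemma bounded_linear_res:
  assumes e: "e > 0"
  shows "bounded_linear (res e)"
proof (rule bounded_linear_intro)
  show "res e (x + y) = res e x + res e y" for x y
    using res[OF e, of x] res[OF e, of y]
    by (intro res_unique[OF e]) (simp add: K_simps algebra_simps)
  show "res e (r *\<^sub>R x) = r *\<^sub>R res e x" for r x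
    using arg_cong[OF res[OF e, of x], of "scaleR r"]
    by (intro res_unique[OF e]) (simp add: K_simps algebra_simps)
  show "norm (res e y) \<le> norm y * (1 / e)" for y
  proof -
    define u where "u = res e y"
    have "e * (norm u * norm u) \<le> (K u + e *\<^sub>R u) \<bullet> u"
      using K_nonneg[of u] by (simp add: inner_simps dot_square_norm power2_eq_square)
    also have "\<dots> \<le> norm y * norm u"
      using res[OF e, of y] norm_cauchy_schwarz[of y u] by (simp add: u_def)
    finally have "e * norm u \<le> norm y" by (cases "u = 0") (auto simp: mult.assoc[symmetric])
    then show ?thesis using e by (simp add: u_def field_simps)
  qed
qed

lemma res_sym: 
  assumes "e > 0"
  shows "res e x \<bullet> y = x \<bullet> res e y"
proof -
  have "res e x \<bullet> (K (res e y) + e *\<^sub>R res e y) = (K (res e x) + e *\<^sub>R res e x) \<bullet> res e y"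
    by (simp add: inner_simps K_sym)
  then show ?thesis by (simp add: res[OF assms])
qed

definition gen :: "nat \<Rightarrow> 'h \<Rightarrow> 'h" where
  "gen n x = c *\<^sub>R J (x - res (1 / real (Suc n)) x)"

lemma bounded_linear_gen: "bounded_linear (gen n)"
  unfolding gen_def[abs_def]
  by (intro bounded_linear_const_scaleR bounded_linear_compose[OF J] bounded_linear_sub
      bounded_linear_ident bounded_linear_res) simp

text \<open>The resolvent \<open>R\<close> is symmetric and commutes with the skew \<open>J\<close>,
  so \<open>J (R x) \<bullet> x\<close> equals its own negative.\<close>

lemma gen_skew: "gen n x \<bullet> x = 0"
proof -
  define R where "R = res (1 / real (Suc n))"
  have "J (R x) \<bullet> x = R (J x) \<bullet> x" by (simp add: R_def res_J)
  also have "\<dots> = J x \<bullet> R x" by (simp add: R_def res_sym)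
  also have "\<dots> = - (J (R x) \<bullet> x)" by (simp add: J_skew inner_commute)
  finally have "J (R x) \<bullet> x = 0" by simp
  then show ?thesis by (simp add: gen_def R_def J_simps inner_simps J_self)
qed

lemma gen_K: "gen n (K x) = K (gen n x)"
  by (simp add: gen_def res_K K_simps J_simps K_J)

lemma gen_J: "gen n (J x) = J (gen n x)"
  by (simp add: gen_def res_J J_simps)

lemma res_res:
  assumes "e > 0" "d > 0" shows "res e (res d x) = res d (res e x)"
proof (rule res_unique[OF assms(1)])
  interpret d: bounded_linear "res d" by (rule bounded_linear_res[OF assms(2)])
  show "K (res d (res e x)) + e *\<^sub>R res d (res e x) = res d x"
    using res[OF assms(1), of x] by (simp add: res_K[OF assms(2), symmetric] d.scaleR[symmetric] d.add[symmetric])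
qed

text \<open>Resolvents at different parameters commute. This is what makes the exponentials of two
  approximating generators comparable.\<close>

lemma gen_gen: "gen m (gen n x) = gen n (gen m x)"
proof -
  define e d where "e = 1 / real (Suc m)" and "d = 1 / real (Suc n)"
  have ed: "e > 0" "d > 0" by (simp_all add: e_def d_def)
  note l = linear_simps[OF bounded_linear_res[OF ed(1)]] linear_simps[OF bounded_linear_res[OF ed(2)]]
  show ?thesis
    unfolding gen_def e_def[symmetric] d_def[symmetric]
    by (simp add: l J_simps res_J ed res_res[OF ed] algebra_simps)
qed

text \<open>By \<open>res e (K z) = z - e *\<^sub>R res e z\<close> with \<open>z = K y\<close>, the
  error is exactly \<open>c * e\<close> times \<open>J (res e (K y))\<close>. One factor
  \<open>K\<close> cancels the inverse of \<open>K\<close> in the limit generator, the other keeps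
  the resolvent bounded as \<open>e\<close> tends to 0.\<close>

lemma gen_KK: "norm (gen n (K (K y)) - c *\<^sub>R J (K (K y) - K y)) \<le> \<bar>c\<bar> * norm y / real (Suc n)"
proof -
  define e where "e = 1 / real (Suc n)"
  have e: "e > 0" by (simp add: e_def)
  have eq: "res e (K (K y)) = K y - e *\<^sub>R res e (K y)"
    using res[OF e, of "K y"] by (simp add: res_K[OF e] algebra_simps)
  have "gen n (K (K y)) - c *\<^sub>R J (K (K y) - K y) = (c * e) *\<^sub>R J (res e (K y))"
    unfolding gen_def e_def[symmetric] eq by (simp add: J_simps algebra_simps)
  then have "norm (gen n (K (K y)) - c *\<^sub>R J (K (K y) - K y)) = \<bar>c\<bar> * e * norm (res e (K y))"
    using e by (simp add: norm_J abs_mult)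
  also have "\<dots> \<le> \<bar>c\<bar> * e * norm y"
    using e norm_res_K[OF e, of y] by (intro mult_left_mono) auto
  finally show ?thesis by (simp add: e_def)
qed

section \<open>Groups generated by the bounded approximants\<close>

definition G :: "nat \<Rightarrow> 'h endo" where "G n = Endo (Blinfun (gen n))"

lemma app_G: "app (G n) x = gen n x"
  unfolding G_def by (rule app_Endo[OF bounded_linear_gen])

definition V :: "nat \<Rightarrow> real \<Rightarrow> 'h \<Rightarrow> 'h" where "V n t x = app (exp (t *\<^sub>R G n)) x"

lemma norm_V: "norm (V n t x) = norm x"
  unfolding V_def by (rule app_exp_isometry) (simp add: app_G gen_skew)

lemma V_linear: "V n t (x + y) = V n t x + V n t y" "V n t (r *\<^sub>R x) = r *\<^sub>R V n t x"
  "V n t (x - y) = V n t x - V n t y"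
  unfolding V_def by (simp_all add: linear_simps[OF bounded_linear_app])

lemma V_K: "V n t (K x) = K (V n t x)"
  unfolding V_def by (rule app_exp_commute[OF K, symmetric]) (simp add: app_G gen_K)

lemma V_J: "V n t (J x) = J (V n t x)"
  unfolding V_def by (rule app_exp_commute[OF J, symmetric]) (simp add: app_G gen_J)

lemma V_gen: "V n t (gen m x) = gen m (V n t x)"
  unfolding V_def by (rule app_exp_commute[OF bounded_linear_gen, symmetric]) (simp add: app_G gen_gen)

lemma V_0: "V n 0 x = x" by (simp add: V_def)

lemma V_add: "V n (s + t) x = V n s (V n t x)"
  unfolding V_def by (simp add: scaleR_add_left exp_add_commuting)

lemma V_derivative: "((\<lambda>t. V n t x) has_vector_derivative V n t (gen n x)) (at t within S)"
  using app_exp_derivative[of "G n" x t] V_gen[of n t n x]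
  by (simp add: V_def app_G has_vector_derivative_at_within)

text \<open>The generators commute, so \<open>V m\<close> is \<open>V n\<close> composed with the
  exponential of \<open>G m - G n\<close>, which is again skew; the isometry \<open>V n\<close>
  drops out of the norm.\<close>

lemma norm_V_diff: "norm (V m t x - V n t x) \<le> \<bar>t\<bar> * norm (gen m x - gen n x)"
proof -
  have "G n * G m = G m * G n"
    by (rule endo_eqI) (simp add: app_G gen_gen)
  then have "exp (t *\<^sub>R G n + t *\<^sub>R (G m - G n)) = exp (t *\<^sub>R G n) * exp (t *\<^sub>R (G m - G n))"
    by (intro exp_add_commuting) (simp add: algebra_simps)
  moreover have "t *\<^sub>R G n + t *\<^sub>R (G m - G n) = t *\<^sub>R G m" by (simp add: algebra_simps)
  ultimately have "V m t x = V n t (app (exp (t *\<^sub>R (G m - G n))) x)"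
    by (simp add: V_def)
  then have "V m t x - V n t x = V n t (app (exp (t *\<^sub>R (G m - G n))) x - x)"
    by (simp add: V_linear)
  then have "norm (V m t x - V n t x) = norm (app (exp (t *\<^sub>R (G m - G n))) x - x)"
    by (simp add: norm_V)
  also have "\<dots> \<le> \<bar>t\<bar> * norm (app (G m - G n) x)"
    by (rule app_exp_diff_bound) (simp add: app_G gen_skew inner_simps)
  finally show ?thesis by (simp add: app_G)
qed

text \<open>A vector orthogonal to the range satisfies
  \<open>K x \<bullet> K x = x \<bullet> K (K x) = 0\<close>, and \<open>K\<close> is
  injective.\<close>

lemma dense_range_K: "closure (range K) = UNIV"
proof (rule subspace_dense)
  show "subspace (range K)"
    using linear_subspace_image[OF bounded_linear.linear[OF K] subspace_UNIV] .
  show "x = 0" if "\<And>s. s \<in> range K \<Longrightarrow> x \<bullet> s = 0" for x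
  proof (rule K_inj)
    have "K x \<bullet> K x = x \<bullet> K (K x)" by (simp only: K_sym)
    then show "K x = 0" using that[of "K (K x)"] by simp
  qed
qed

lemma dense_range_KK: "closure (range (\<lambda>x. K (K x))) = UNIV"
proof (rule subspace_dense)
  show "subspace (range (\<lambda>x. K (K x)))"
    using linear_subspace_image[OF bounded_linear.linear[OF bounded_linear_compose[OF K K]] subspace_UNIV] .
  show "x = 0" if "\<And>s. s \<in> range (\<lambda>x. K (K x)) \<Longrightarrow> x \<bullet> s = 0" for x
  proof (rule K_inj, rule K_inj)
    have "K (K x) \<bullet> K (K x) = x \<bullet> K (K (K (K x)))" by (simp only: K_sym)
    then show "K (K x) = 0" using that[of "K (K (K (K x)))"] by simp
  qed
qed

text \<open>On the range of the square of \<open>K\<close> the generators converge, and with them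
  the groups, uniformly on bounded time intervals. This range is dense, and the isometries
  \<open>V n\<close> do not enlarge the error made in approximating \<open>x\<close>.\<close>

lemma V_uniformly_Cauchy: "uniformly_Cauchy_on {- T..T} (\<lambda>n t. V n t x)"
proof (rule uniformly_Cauchy_onI)
  fix e :: real assume e: "0 < e"
  have "\<exists>v\<in>range (\<lambda>x. K (K x)). dist v x < e / 4"
    using e dense_range_KK closure_approachable[of x "range (\<lambda>x. K (K x))"]
    by (metis UNIV_I divide_pos_pos zero_less_numeral)
  then obtain y where y: "norm (x - K (K y)) < e / 4"
    by (auto simp: dist_norm norm_minus_commute)
  define B where "B = \<bar>T\<bar> * (\<bar>c\<bar> * norm y) + 1"
  have B: "B > 0" unfolding B_def by (simp add: add_nonneg_pos)
  obtain M where M: "4 * B / e < real M" using reals_Archimedean2 by blast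
  show "\<exists>M. \<forall>t\<in>{- T..T}. \<forall>m\<ge>M. \<forall>n\<ge>M. dist (V m t x) (V n t x) < e"
  proof (intro exI[of _ M] ballI allI impI)
    fix t m n assume t: "t \<in> {- T..T}" and mn: "M \<le> m" "M \<le> n"
    define z where "z = K (K y)"
    define g where "g = c *\<^sub>R J (K (K y) - K y)"
    have s: "\<bar>c\<bar> * norm y / real (Suc k) \<le> \<bar>c\<bar> * norm y / real (Suc M)" if "M \<le> k" for k
      using that by (intro divide_left_mono) auto
    have "norm (gen m z - gen n z) \<le> norm (gen m z - g) + norm (gen n z - g)"
      using norm_triangle_ineq4[of "gen m z - g" "gen n z - g"] by simp
    also have "\<dots> \<le> 2 * (\<bar>c\<bar> * norm y / real (Suc M))"
      using gen_KK[of m y] gen_KK[of n y] s[OF mn(1)] s[OF mn(2)] by (simp add: z_def g_def)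
    finally have "\<bar>t\<bar> * norm (gen m z - gen n z) \<le> \<bar>T\<bar> * (2 * (\<bar>c\<bar> * norm y / real (Suc M)))"
      using t by (intro mult_mono) auto
    also have "\<dots> = 2 * (\<bar>T\<bar> * (\<bar>c\<bar> * norm y)) / real (Suc M)" by simp
    also have "\<dots> \<le> 2 * B / real (Suc M)"
      by (intro divide_right_mono) (auto simp: B_def)
    also have "\<dots> < e / 2"
    proof -
      have "4 * B < real (Suc M) * e" using M e by (simp add: field_simps)
      then show ?thesis using e by (simp add: field_simps)
    qed
    finally have "norm (V m t z - V n t z) < e / 2"
      using norm_V_diff[of m t z n] by simp
    moreover have "norm (V m t x - V m t z) < e / 4" "norm (V n t x - V n t z) < e / 4"
      using y by (simp_all add: V_linear[symmetric] norm_V z_def)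
    moreover have "norm (V m t x - V n t x) \<le> norm (V m t x - V m t z) +
        norm (V m t z - V n t z) + norm (V n t x - V n t z)"
      using norm_triangle_ineq[of "V m t x - V m t z" "(V m t z - V n t z) - (V n t x - V n t z)"]
        norm_triangle_ineq4[of "V m t z - V n t z" "V n t x - V n t z"] by simp
    ultimately show "dist (V m t x) (V n t x) < e"
      unfolding dist_norm by linarith
  qed
qed

section \<open>The limit group and its generator\<close>

definition U :: "real \<Rightarrow> 'h \<Rightarrow> 'h" where "U t x = lim (\<lambda>n. V n t x)"

lemma V_uniform_limit: "uniform_limit {- T..T} (\<lambda>n t. V n t x) (\<lambda>t. U t x) sequentially"
  using Cauchy_uniformly_convergent[OF V_uniformly_Cauchy, of T x]
  unfolding U_def uniformly_convergent_uniform_limit_iff .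

lemma V_tendsto: "(\<lambda>n. V n t x) \<longlonglongrightarrow> U t x"
  by (rule tendsto_uniform_limitI[OF V_uniform_limit[where T = "\<bar>t\<bar>"]]) auto

lemma norm_U: "norm (U t x) = norm x"
  using tendsto_norm[OF V_tendsto[of t x]] by (simp add: norm_V LIMSEQ_const_iff)

lemma U_linear: "U t (x + y) = U t x + U t y" "U t (r *\<^sub>R x) = r *\<^sub>R U t x"
  "U t (x - y) = U t x - U t y"
proof -
  show "U t (x + y) = U t x + U t y"
    by (rule LIMSEQ_unique[OF V_tendsto]) (simp add: V_linear tendsto_add V_tendsto)
  show "U t (r *\<^sub>R x) = r *\<^sub>R U t x"
    by (rule LIMSEQ_unique[OF V_tendsto]) (simp add: V_linear tendsto_scaleR V_tendsto)
  show "U t (x - y) = U t x - U t y"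
    by (rule LIMSEQ_unique[OF V_tendsto]) (simp add: V_linear tendsto_diff V_tendsto)
qed

lemma bounded_linear_U: "bounded_linear (U t)"
proof (rule bounded_linear_intro)
  show "norm (U t x) \<le> norm x * 1" for x by (simp add: norm_U)
qed (simp_all add: U_linear)

lemma U_K: "U t (K x) = K (U t x)"
  by (rule LIMSEQ_unique[OF V_tendsto]) (simp add: V_K bounded_linear.tendsto[OF K] V_tendsto)

lemma U_J: "U t (J x) = J (U t x)"
  by (rule LIMSEQ_unique[OF V_tendsto]) (simp add: V_J bounded_linear.tendsto[OF J] V_tendsto)

lemma U_0: "U 0 x = x"
  by (rule LIMSEQ_unique[OF V_tendsto]) (simp add: V_0)

text \<open>In \<open>V n s (V n t x)\<close> the argument moves with \<open>n\<close>; isometry of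
  \<open>V n s\<close> reduces the limit to the fixed argument \<open>U t x\<close>.\<close>

lemma U_add: "U (s + t) x = U s (U t x)"
proof (rule LIMSEQ_unique[OF V_tendsto])
  have "(\<lambda>n. V n s (V n t x - U t x)) \<longlonglongrightarrow> 0"
    using tendsto_norm_zero[OF LIM_zero[OF V_tendsto[of t x]]]
    by (intro tendsto_norm_zero_cancel[of "\<lambda>n. V n s (V n t x - U t x)"]) (simp add: norm_V)
  from tendsto_add[OF this V_tendsto[of s "U t x"]]
  show "(\<lambda>n. V n (s + t) x) \<longlonglongrightarrow> U s (U t x)" by (simp add: V_linear V_add)
qed

lemma U_minus: "U (- t) (U t x) = x" "U t (U (- t) x) = x"
  using U_add[of "- t" t x] U_add[of t "- t" x] by (simp_all add: U_0)

lemma U_inner: "U t x \<bullet> U t y = x \<bullet> y"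
  by (simp add: dot_norm U_linear(1)[symmetric] norm_U)

lemma continuous_U: "continuous_on S (\<lambda>t. U t x)"
proof -
  have "continuous_on {- T..T} (\<lambda>t. U t x)" for T
  proof (rule uniform_limit_theorem[OF _ V_uniform_limit])
    have "continuous_on {- T..T} (\<lambda>t. V n t x)" for n
      using V_derivative
      by (intro continuous_on_vector_derivative) blast
    then show "\<forall>\<^sub>F n in sequentially. continuous_on {- T..T} (\<lambda>t. V n t x)" by simp
  qed simp
  then have "isCont (\<lambda>t. U t x) t" for t
    by (rule continuous_on_interior[of "{- (\<bar>t\<bar> + 1)..\<bar>t\<bar> + 1}"]) auto
  then show ?thesis by (simp add: continuous_at_imp_continuous_on)
qed

text \<open>Isometry controls a change of the argument uniformly in time, so strong continuity
  already gives joint continuity.\<close>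

lemma continuous_U2:
  assumes f: "continuous_on S f" and g: "continuous_on S g"
  shows "continuous_on S (\<lambda>s. U (f s) (g s))"
  unfolding continuous_on_def
proof
  fix s assume s: "s \<in> S"
  have "((\<lambda>s'. U (f s') (g s' - g s)) \<longlongrightarrow> 0) (at s within S)"
    using g s unfolding continuous_on_def
    by (intro tendsto_norm_zero_cancel[of "\<lambda>s'. U (f s') (g s' - g s)"])
       (simp add: norm_U tendsto_norm_zero LIM_zero)
  moreover have "((\<lambda>s'. U (f s') (g s)) \<longlongrightarrow> U (f s) (g s)) (at s within S)"
    using continuous_on_compose2[OF continuous_U[of UNIV] f, of "g s"] s
    by (simp add: continuous_on_def)
  ultimately show "((\<lambda>s. U (f s) (g s)) \<longlongrightarrow> U (f s) (g s)) (at s within S)"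
    using tendsto_add by (fastforce simp: U_linear)
qed

text \<open>The derivatives \<open>V n s (gen n (K (K y)))\<close> converge uniformly on bounded
  time intervals, by \<open>gen_KK\<close> and by the uniform convergence of \<open>V n\<close> on
  the single vector \<open>g\<close>. So differentiation passes to the limit.\<close>

lemma U_KK_derivative:
  "((\<lambda>t. U t (K (K y))) has_vector_derivative U t (c *\<^sub>R J (K (K y) - K y))) (at t)"
proof -
  define T where "T = \<bar>t\<bar> + 1"
  define g where "g = c *\<^sub>R J (K (K y) - K y)"
  have t: "t \<in> {-T..T}" "t \<in> interior {-T..T}" by (auto simp: T_def)
  have "\<exists>f. \<forall>s\<in>{-T..T}. (\<lambda>n. V n s (K (K y))) \<longlonglongrightarrow> f s \<and>
      (f has_derivative (\<lambda>h. h *\<^sub>R U s g)) (at s within {-T..T})"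
  proof (rule has_derivative_sequence)
    show "convex {-T..T}" by simp
    show "((\<lambda>s. V n s (K (K y))) has_derivative (\<lambda>h. h *\<^sub>R V n s (gen n (K (K y))))) (at s within {-T..T})"
      for n s using V_derivative[of n "K (K y)" s "{-T..T}"] by (simp add: has_vector_derivative_def)
    show "t \<in> {-T..T}" by (rule t)
    show "(\<lambda>n. V n t (K (K y))) \<longlonglongrightarrow> U t (K (K y))" by (rule V_tendsto)
    fix e :: real assume e: "0 < e"
    have 1: "\<forall>\<^sub>F n in sequentially. \<forall>s\<in>{-T..T}. dist (V n s g) (U s g) < e / 2"
      using e by (intro uniform_limitD[OF V_uniform_limit]) simp
    have "(\<lambda>n. \<bar>c\<bar> * norm y * (1 / real (Suc n))) \<longlonglongrightarrow> \<bar>c\<bar> * norm y * 0"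
      using LIMSEQ_inverse_real_of_nat by (intro tendsto_intros) (simp add: inverse_eq_divide)
    then have 2: "\<forall>\<^sub>F n in sequentially. \<bar>c\<bar> * norm y * (1 / real (Suc n)) < e / 2"
      using e by (intro order_tendstoD) auto
    from 1 2 show "\<forall>\<^sub>F n in sequentially. \<forall>s\<in>{-T..T}. \<forall>h.
        norm (h *\<^sub>R V n s (gen n (K (K y))) - h *\<^sub>R U s g) \<le> e * norm h"
    proof eventually_elim
      case (elim n)
      show ?case
      proof (intro ballI allI)
        fix s h assume s: "s \<in> {-T..T}"
        have "norm (V n s (gen n (K (K y))) - V n s g) \<le> e / 2"
          using gen_KK[of n y] elim(2) unfolding V_linear(3)[symmetric] norm_V g_def
          by (simp only: times_divide_eq_right mult_1_right)
        moreover have "norm (V n s g - U s g) \<le> e / 2"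
          using elim(1) s by (auto simp: dist_norm intro: less_imp_le)
        ultimately have "norm (V n s (gen n (K (K y))) - U s g) \<le> e"
          using norm_triangle_ineq[of "V n s (gen n (K (K y))) - V n s g" "V n s g - U s g"] by simp
        then show "norm (h *\<^sub>R V n s (gen n (K (K y))) - h *\<^sub>R U s g) \<le> e * norm h"
          by (metis mult.commute mult_right_mono norm_ge_zero norm_scaleR real_norm_def scaleR_diff_right)
      qed
    qed
  qed
  then obtain f where f: "\<And>s. s \<in> {-T..T} \<Longrightarrow> (\<lambda>n. V n s (K (K y))) \<longlonglongrightarrow> f s"
    "\<And>s. s \<in> {-T..T} \<Longrightarrow> (f has_derivative (\<lambda>h. h *\<^sub>R U s g)) (at s within {-T..T})"
    by blast
  have eq: "f s = U s (K (K y))" if "s \<in> {-T..T}" for s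
    using LIMSEQ_unique[OF f(1)[OF that] V_tendsto] .
  have "((\<lambda>t. U t (K (K y))) has_derivative (\<lambda>h. h *\<^sub>R U t g)) (at t within {-T..T})"
    by (rule has_derivative_transform[OF t(1) _ f(2)[OF t(1)]]) (simp add: eq)
  then show ?thesis
    using at_within_interior[OF t(2)] by (simp add: has_vector_derivative_def g_def)
qed

text \<open>The generator composed with \<open>K\<close> is the bounded map \<open>g\<close>. If
  \<open>x\<close> is approximated by elements of the range of \<open>K\<close>, the derivatives
  therefore converge uniformly in time, which extends the formula to the whole range of
  \<open>K\<close>.\<close>

lemma U_K_derivative:
  "((\<lambda>t. U t (K x)) has_vector_derivative U t (c *\<^sub>R J (K x - x))) (at t)"
proof -
  have "x \<in> closure (range K)" by (simp add: dense_range_K)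
  then obtain z where z: "\<And>n. z n \<in> range K" "z \<longlonglongrightarrow> x"
    unfolding closure_sequential by blast
  then have "\<forall>n. \<exists>y. z n = K y" by blast
  then obtain y where y: "\<And>n. z n = K (y n)" by metis
  define g where "g = (\<lambda>x. c *\<^sub>R J (K x - x))"
  have g: "bounded_linear g" unfolding g_def
    by (intro bounded_linear_const_scaleR bounded_linear_compose[OF J] bounded_linear_sub K bounded_linear_ident)
  have zlim: "(\<lambda>n. U s (K (z n))) \<longlonglongrightarrow> U s (K x)" for s
    by (intro bounded_linear.tendsto[OF bounded_linear_U] bounded_linear.tendsto[OF K] z)
  have "\<exists>f. \<forall>s\<in>UNIV. (\<lambda>n. U s (K (z n))) \<longlonglongrightarrow> f s \<and>
      (f has_derivative (\<lambda>h. h *\<^sub>R U s (g x))) (at s within UNIV)"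
  proof (rule has_derivative_sequence)
    show "((\<lambda>s. U s (K (z n))) has_derivative (\<lambda>h. h *\<^sub>R U s (g (z n)))) (at s within UNIV)" for n s
      using U_KK_derivative[of "y n" s] by (simp add: has_vector_derivative_def y g_def)
    show "(\<lambda>n. U 0 (K (z n))) \<longlonglongrightarrow> U 0 (K x)" by (rule zlim)
    fix e :: real assume e: "0 < e"
    have "(\<lambda>n. g (z n)) \<longlonglongrightarrow> g x" by (rule bounded_linear.tendsto[OF g z(2)])
    then have "\<forall>\<^sub>F n in sequentially. dist (g (z n)) (g x) < e" using e by (rule tendstoD)
    then show "\<forall>\<^sub>F n in sequentially. \<forall>s\<in>UNIV. \<forall>h.
        norm (h *\<^sub>R U s (g (z n)) - h *\<^sub>R U s (g x)) \<le> e * norm h"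
    proof eventually_elim
      case (elim n)
      then have "norm (U s (g (z n)) - U s (g x)) \<le> e" for s
        by (simp add: U_linear(3)[symmetric] norm_U dist_norm)
      then show ?case
        by (metis mult.commute mult_right_mono norm_ge_zero norm_scaleR real_norm_def scaleR_diff_right)
    qed
  qed auto
  then obtain f where f: "\<And>s. (\<lambda>n. U s (K (z n))) \<longlonglongrightarrow> f s"
    "\<And>s. (f has_derivative (\<lambda>h. h *\<^sub>R U s (g x))) (at s)"
    by auto
  have "f = (\<lambda>s. U s (K x))"
    using LIMSEQ_unique[OF f(1) zlim] by blast
  with f(2)[of t] show ?thesis by (simp add: has_vector_derivative_def g_def)
qed

end

section \<open>Picard iteration\<close>

lemma onorm_scaleR_right_le:
  fixes v :: "'a::real_normed_vector"
  assumes "norm v \<le> B"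
  shows "onorm (\<lambda>h::real. h *\<^sub>R v) \<le> B"
proof (rule onorm_le)
  show "norm (h *\<^sub>R v) \<le> B * norm h" for h :: real
    using mult_right_mono[OF assms, of "\<bar>h\<bar>"] by (simp add: mult.commute)
qed

text \<open>The oriented integral from 0 to \<open>t\<close> for \<open>t\<close> of either sign:
  the base point \<open>- T\<close> provides one formula and one derivative rule for both.\<close>

definition int_from_0 :: "real \<Rightarrow> (real \<Rightarrow> 'a::banach) \<Rightarrow> real \<Rightarrow> 'a" where
  "int_from_0 T f t = integral {- T..t} f - integral {- T..0} f"

lemma int_from_0_derivative:
  assumes "continuous_on {- T..T} f" "t \<in> {- T..T}"
  shows "(int_from_0 T f has_vector_derivative f t) (at t within {- T..T})"
  unfolding int_from_0_def[abs_def]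
  using has_vector_derivative_diff[OF integral_has_vector_derivative[OF assms] has_vector_derivative_const]
  by simp

lemma int_from_0_zero: "int_from_0 T f 0 = 0"
  by (simp add: int_from_0_def)

lemma int_from_0_continuous:
  "continuous_on {- T..T} f \<Longrightarrow> continuous_on {- T..T} (int_from_0 T f)"
  using int_from_0_derivative by (blast intro: continuous_on_vector_derivative)

lemma int_from_0_diff:
  assumes "continuous_on {- T..T} f" "continuous_on {- T..T} g" "t \<in> {- T..T}" "T > 0"
  shows "int_from_0 T f t - int_from_0 T g t = int_from_0 T (\<lambda>s. f s - g s) t"
proof -
  have i: "f integrable_on {- T..u}" "g integrable_on {- T..u}" if "u \<in> {- T..T}" for u
    using assms that by (auto intro!: integrable_continuous_interval intro: continuous_on_subset)
  show ?thesis
    unfolding int_from_0_def using i[of t] i[of 0] assms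
    by (simp add: Henstock_Kurzweil_Integration.integral_diff)
qed

lemma int_from_0_bound:
  fixes f :: "real \<Rightarrow> 'a::banach"
  assumes f: "continuous_on {- T..T} f" and B: "\<And>s. s \<in> {- T..T} \<Longrightarrow> norm (f s) \<le> B"
    and t: "t \<in> {- T..T}"
  shows "norm (int_from_0 T f t) \<le> B * T"
proof -
  have T: "0 \<in> {- T..T}" using t by auto
  have "norm (int_from_0 T f t - int_from_0 T f 0) \<le> B * norm (t - 0)"
  proof (rule differentiable_bound[of "{- T..T}"])
    show "(int_from_0 T f has_derivative (\<lambda>h. h *\<^sub>R f s)) (at s within {- T..T})" if "s \<in> {- T..T}" for s
      using int_from_0_derivative[OF f that] by (simp add: has_vector_derivative_def)
    show "onorm (\<lambda>h. h *\<^sub>R f s) \<le> B" if "s \<in> {- T..T}" for s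
      using B[OF that] by (rule onorm_scaleR_right_le)
  qed (use t T in auto)
  moreover have "B * norm (t - 0) \<le> B * T"
    using t order_trans[OF norm_ge_zero B[OF T]] by (intro mult_left_mono) auto
  ultimately show ?thesis by (simp add: int_from_0_zero)
qed

text \<open>On the closed ball of radius \<open>R\<close> in the bounded continuous functions the
  integral operator has Lipschitz constant \<open>L * T \<le> 1 / 2\<close>, and
  \<open>norm \<phi> + B * T \<le> R\<close> keeps the ball invariant.\<close>

lemma picard:
  fixes G :: "real \<Rightarrow> 'a::banach \<Rightarrow> 'a"
  assumes T: "T > 0" and R: "R \<ge> 0"
    and cont: "\<And>X. continuous_on {- T..T} X \<Longrightarrow> continuous_on {- T..T} (\<lambda>s. G s (X s))"
    and bound: "\<And>s x. norm x \<le> R \<Longrightarrow> norm (G s x) \<le> B"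
    and lip: "\<And>s x y. norm x \<le> R \<Longrightarrow> norm y \<le> R \<Longrightarrow> norm (G s x - G s y) \<le> L * norm (x - y)"
    and L: "L \<ge> 0" "L * T \<le> 1 / 2" and RB: "norm \<phi> + B * T \<le> R"
  obtains X where "continuous_on {- T..T} X" "\<And>t. norm (X t) \<le> R" "X 0 = \<phi>"
    "\<And>t. t \<in> {- T..T} \<Longrightarrow> (X has_vector_derivative G t (X t)) (at t within {- T..T})"
proof -
  \<comment> \<open>Clamping time to the interval turns functions on it into bounded continuous
    functions on the whole line. This is also why the bound by \<open>R\<close> comes out for every
    \<open>t\<close>.\<close>
  define cl where "cl = (\<lambda>t::real. max (- T) (min T t))"
  have cl: "cl t \<in> {- T..T}" for t using T by (auto simp: cl_def)
  have cl_id: "cl t = t" if "t \<in> {- T..T}" for t using that by (auto simp: cl_def)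
  have cl_cont: "continuous_on A cl" for A unfolding cl_def by (intro continuous_intros)
  define P where "P = (\<lambda>X t. \<phi> + int_from_0 T (\<lambda>s. G s (X s)) (cl t))"
  define S where "S = {X :: real \<Rightarrow>\<^sub>C 'a. \<forall>t. norm (apply_bcontfun X t) \<le> R}"
  have norm_P: "norm (P X t) \<le> R" if "continuous_on {- T..T} X" "\<And>t. norm (X t) \<le> R" for X t
  proof -
    have "norm (int_from_0 T (\<lambda>s. G s (X s)) (cl t)) \<le> B * T"
      by (rule int_from_0_bound[OF cont[OF that(1)] bound[OF that(2)] cl])
    then show ?thesis unfolding P_def using RB norm_triangle_ineq[of \<phi>] by (smt (verit))
  qed
  have P_cont: "continuous_on UNIV (P X)" if "continuous_on {- T..T} X" for X
    unfolding P_def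
    by (intro continuous_intros continuous_on_compose2[OF int_from_0_continuous[OF cont[OF that]] cl_cont])
       (use cl in auto)
  have P_bc: "P X \<in> bcontfun" if "continuous_on {- T..T} X" "\<And>t. norm (X t) \<le> R" for X
    using P_cont[OF that(1)] norm_P[OF that] by (rule bcontfun_normI)
  have S_eq: "S = PiC UNIV (\<lambda>_. cball 0 R)" by (auto simp: S_def mem_PiC_iff Pi_iff)
  have "\<exists>!X\<in>S. Bcontfun (P (apply_bcontfun X)) = X"
  proof (rule Banach_fix[where c = "1 / 2"])
    show "complete S" unfolding S_eq
      by (simp add: complete_eq_closed closed_PiC)
    have "const_bcontfun 0 \<in> S" using R by (simp add: S_def const_bcontfun.rep_eq)
    then show "S \<noteq> {}" by blast
    show "(\<lambda>X. Bcontfun (P (apply_bcontfun X))) ` S \<subseteq> S"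
      using norm_P P_bc by (auto simp: S_def Bcontfun_inverse)
    fix X Y assume XY: "X \<in> S" "Y \<in> S"
    define x y where "x = apply_bcontfun X" and "y = apply_bcontfun Y"
    have x: "continuous_on {- T..T} x" "\<And>t. norm (x t) \<le> R" and y: "continuous_on {- T..T} y" "\<And>t. norm (y t) \<le> R"
      using XY by (auto simp: x_def y_def S_def)
    have "dist (P x t) (P y t) \<le> 1 / 2 * dist X Y" for t
    proof -
      have "P x t - P y t = int_from_0 T (\<lambda>s. G s (x s) - G s (y s)) (cl t)"
        unfolding P_def using int_from_0_diff[OF cont[OF x(1)] cont[OF y(1)] cl T] by simp
      moreover have "norm (int_from_0 T (\<lambda>s. G s (x s) - G s (y s)) (cl t)) \<le> (L * dist X Y) * T"
      proof (rule int_from_0_bound[OF _ _ cl])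
        show "continuous_on {- T..T} (\<lambda>s. G s (x s) - G s (y s))"
          by (intro continuous_intros cont x y)
        fix s
        have "norm (G s (x s) - G s (y s)) \<le> L * norm (x s - y s)" by (rule lip[OF x(2) y(2)])
        also have "\<dots> \<le> L * dist X Y"
          using dist_bounded[of X s Y] L(1) by (intro mult_left_mono) (auto simp: x_def y_def dist_norm)
        finally show "norm (G s (x s) - G s (y s)) \<le> L * dist X Y" .
      qed
      moreover have "(L * dist X Y) * T \<le> 1 / 2 * dist X Y"
        using mult_right_mono[OF L(2), of "dist X Y"] by (simp add: mult_ac)
      ultimately show ?thesis by (simp add: dist_norm)
    qed
    then show "dist (Bcontfun (P (apply_bcontfun X))) (Bcontfun (P (apply_bcontfun Y))) \<le> 1 / 2 * dist X Y"
      by (intro dist_bound) (simp add: Bcontfun_inverse P_bc x y x_def[symmetric] y_def[symmetric])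
  qed auto
  then obtain X where X: "X \<in> S" "Bcontfun (P (apply_bcontfun X)) = X" by blast
  define x where "x = apply_bcontfun X"
  have x: "continuous_on {- T..T} x" "\<And>t. norm (x t) \<le> R" using X(1) by (auto simp: x_def S_def)
  have Px: "P x = x" using X(2) Bcontfun_inverse[OF P_bc[OF x]] by (simp add: x_def)
  show ?thesis
  proof (rule that[OF x])
    show "x 0 = \<phi>" using Px[THEN fun_cong, of 0] T by (simp add: P_def cl_id int_from_0_zero)
    fix t assume t: "t \<in> {- T..T}"
    have "((\<lambda>t. \<phi> + int_from_0 T (\<lambda>s. G s (x s)) t) has_vector_derivative G t (x t)) (at t within {- T..T})"
      using has_vector_derivative_add[OF has_vector_derivative_const int_from_0_derivative[OF cont[OF x(1)] t]]
      by simp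
    then show "(x has_vector_derivative G t (x t)) (at t within {- T..T})"
    proof (rule has_vector_derivative_transform[OF t, rotated])
      show "x s = \<phi> + int_from_0 T (\<lambda>s. G s (x s)) s" if "s \<in> {- T..T}" for s
        using Px[THEN fun_cong, of s] cl_id[OF that] by (simp add: P_def)
    qed
  qed
qed

section \<open>Local existence in the interaction picture\<close>

context schroedinger_pair
begin

text \<open>Splitting \<open>X t\<close> into \<open>X s\<close> and \<open>X t - X s\<close> avoids
  differentiating \<open>U\<close> on arbitrary vectors: \<open>K (X s)\<close> lies in the domain
  of the generator, and for the increment, already of first order, strong continuity of
  \<open>U\<close> is enough.\<close>

lemma U_K_product_derivative:
  assumes X: "(X has_vector_derivative x') (at s)"
  shows "((\<lambda>t. U t (K (X t))) has_vector_derivative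
    c *\<^sub>R J (K (U s (X s)) - U s (X s)) + K (U s x')) (at s)"
proof -
  have U0: "U t 0 = 0" for t using norm_U[of t 0] by simp
  have 1: "((\<lambda>t. U t (K (X s))) has_vector_derivative c *\<^sub>R J (K (U s (X s)) - U s (X s))) (at s)"
    using U_K_derivative[of "X s" s] by (simp add: U_linear U_J U_K)
  have 2: "((\<lambda>t. U t (K (X t - X s))) has_vector_derivative K (U s x')) (at s)"
    unfolding has_vector_derivative_def
  proof (rule has_derivativeI_sandwich[of 1])
    define H where "H = (\<lambda>t. norm ((X t - X s) - (t - s) *\<^sub>R x') / norm (t - s) + norm (U t (K x') - U s (K x')))"
    have "((\<lambda>t. norm ((X t - X s) - (t - s) *\<^sub>R x') / norm (t - s)) \<longlongrightarrow> 0) (at s)"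
      using X unfolding has_vector_derivative_def has_derivative_iff_norm by simp
    moreover have "((\<lambda>t. norm (U t (K x') - U s (K x'))) \<longlongrightarrow> 0) (at s)"
      using continuous_U[of UNIV "K x'"] by (intro tendsto_norm_zero LIM_zero) (simp add: continuous_on_def)
    ultimately show "(H \<longlongrightarrow> 0) (at s)" unfolding H_def by (rule tendsto_add_zero)
    fix t assume ts: "t \<noteq> s"
    have "U t (K (X t - X s)) - U s (K (X s - X s)) - (t - s) *\<^sub>R K (U s x') =
        U t (K ((X t - X s) - (t - s) *\<^sub>R x')) + (t - s) *\<^sub>R (U t (K x') - U s (K x'))"
      by (simp add: K_simps U_linear U_K U0 algebra_simps)
    also have "norm \<dots> \<le> norm (K ((X t - X s) - (t - s) *\<^sub>R x')) + norm (t - s) * norm (U t (K x') - U s (K x'))"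
      using norm_triangle_ineq[of "U t (K ((X t - X s) - (t - s) *\<^sub>R x'))"
          "(t - s) *\<^sub>R (U t (K x') - U s (K x'))"] by (simp add: norm_U)
    also have "\<dots> \<le> norm ((X t - X s) - (t - s) *\<^sub>R x') + norm (t - s) * norm (U t (K x') - U s (K x'))"
      by (simp add: norm_K)
    also have "\<dots> = H t * norm (t - s)" using ts by (simp add: H_def field_simps)
    finally show "norm (U t (K (X t - X s)) - U s (K (X s - X s)) - (t - s) *\<^sub>R K (U s x')) / norm (t - s) \<le> H t"
      using ts by (simp add: divide_le_eq)
  qed (auto intro: bounded_linear_scaleR_left)
  have "(\<lambda>t. U t (K (X t))) = (\<lambda>t. U t (K (X s)) + U t (K (X t - X s)))"
    by (simp add: K_simps U_linear)
  with has_vector_derivative_add[OF 1 2] show ?thesis by simp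
qed

lemma local_existence:
  assumes F: "\<And>R. \<exists>L. \<forall>x y. norm x \<le> R \<longrightarrow> norm y \<le> R \<longrightarrow> norm (F x - F y) \<le> L * norm (x - y)"
  obtains T R where "T > 0"
    "\<And>\<phi>. norm \<phi> \<le> M \<Longrightarrow> \<exists>\<psi>. continuous_on {- T..T} \<psi> \<and> (\<forall>t. norm (\<psi> t) \<le> R) \<and> \<psi> 0 = \<phi> \<and>
      (\<forall>t\<in>{- T<..<T}. ((\<lambda>t. K (\<psi> t)) has_vector_derivative
          c *\<^sub>R J (K (\<psi> t) - \<psi> t) + K (F (\<psi> t))) (at t))"
proof -
  \<comment> \<open>One more than the size of the data; the time chosen below is too short for a
    solution to leave this ball.\<close>
  define R where "R = \<bar>M\<bar> + 1"
  obtain L0 where L0: "\<And>x y. norm x \<le> R \<Longrightarrow> norm y \<le> R \<Longrightarrow> norm (F x - F y) \<le> L0 * norm (x - y)"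
    using F by blast
  define L where "L = \<bar>L0\<bar>"
  have L: "norm (F x - F y) \<le> L * norm (x - y)" if "norm x \<le> R" "norm y \<le> R" for x y
    using L0[OF that] mult_right_mono[OF abs_ge_self[of L0] norm_ge_zero[of "x - y"]]
    unfolding L_def by linarith
  define B where "B = L * R + norm (F 0)"
  have B: "norm (F x) \<le> B" if "norm x \<le> R" for x
  proof -
    have "norm (F x) \<le> norm (F x - F 0) + norm (F 0)"
      using norm_triangle_ineq[of "F x - F 0" "F 0"] by simp
    also have "norm (F x - F 0) \<le> L * norm (x - 0)" using that by (intro L) (auto simp: R_def)
    also have "\<dots> \<le> L * R" using that by (intro mult_left_mono) (auto simp: L_def)
    finally show ?thesis by (simp add: B_def)
  qed
  have B0: "B \<ge> 0" "L \<ge> 0" "R \<ge> 0" by (auto simp: B_def L_def R_def)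
  \<comment> \<open>The first entry gives \<open>B * T \<le> 1\<close>, the gap between the data and
    \<open>R\<close>; the second gives the contraction factor 1/2. The added 1 covers vanishing
    \<open>B\<close> and \<open>L\<close>.\<close>
  define T where "T = min (1 / (B + 1)) (1 / (2 * (L + 1)))"
  have T: "T > 0" using B0 by (simp add: T_def)
  have "B * T \<le> B * (1 / (B + 1))" using B0 by (intro mult_left_mono) (auto simp: T_def)
  also have "\<dots> \<le> 1" using B0 by simp
  finally have BT: "B * T \<le> 1" .
  have "L * T \<le> L * (1 / (2 * (L + 1)))" using B0 by (intro mult_left_mono) (auto simp: T_def)
  also have "\<dots> \<le> 1 / 2" using B0 by (simp add: field_simps)
  finally have LT: "L * T \<le> 1 / 2" .
  have F_cont: "continuous_on S (\<lambda>s. F (X s))" if X: "continuous_on S X" for S :: "real set" and X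
  proof -
    have "isCont F x" for x
    proof -
      obtain L1 where L1: "\<And>y z. norm y \<le> norm x + 1 \<Longrightarrow> norm z \<le> norm x + 1 \<Longrightarrow> norm (F y - F z) \<le> L1 * norm (y - z)"
        using F by blast
      have "((\<lambda>y. F y - F x) \<longlongrightarrow> 0) (at x)"
      proof (rule Lim_null_comparison)
        have "\<forall>\<^sub>F y in at x. dist y x < 1" by (simp add: eventually_at) (use zero_less_one in blast)
        then show "\<forall>\<^sub>F y in at x. norm (F y - F x) \<le> L1 * norm (y - x)"
        proof eventually_elim
          case (elim y)
          then have "norm y \<le> norm x + 1" using norm_triangle_sub[of y x] by (simp add: dist_norm)
          then show ?case by (intro L1) auto
        qed
        have "((\<lambda>y. L1 * norm (y - x)) \<longlongrightarrow> L1 * norm (x - x)) (at x)"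
          by (intro tendsto_intros)
        then show "((\<lambda>y. L1 * norm (y - x)) \<longlongrightarrow> 0) (at x)" by simp
      qed
      then show ?thesis by (simp add: isCont_def LIM_zero_iff)
    qed
    then show ?thesis
      using X continuous_on_compose2[of UNIV F S X] by (simp add: continuous_at_imp_continuous_on)
  qed
  have "\<exists>\<psi>. continuous_on {- T..T} \<psi> \<and> (\<forall>t. norm (\<psi> t) \<le> R) \<and> \<psi> 0 = \<phi> \<and>
      (\<forall>t\<in>{- T<..<T}. ((\<lambda>t. K (\<psi> t)) has_vector_derivative
          c *\<^sub>R J (K (\<psi> t) - \<psi> t) + K (F (\<psi> t))) (at t))" if \<phi>: "norm \<phi> \<le> M" for \<phi>
  proof -
    \<comment> \<open>For \<open>\<psi> t = U t (X t)\<close> the unbounded part of the equation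
      disappears: \<open>X\<close> solves an ordinary differential equation whose right-hand side is
      Lipschitz on balls, uniformly in time.\<close>
    define G where "G = (\<lambda>s x. U (- s) (F (U s x)))"
    obtain X where X: "continuous_on {- T..T} X" "\<And>t. norm (X t) \<le> R" "X 0 = \<phi>"
      "\<And>t. t \<in> {- T..T} \<Longrightarrow> (X has_vector_derivative G t (X t)) (at t within {- T..T})"
    proof (rule picard[of T R G B L \<phi>])
      show "continuous_on {- T..T} (\<lambda>s. G s (X s))" if "continuous_on {- T..T} X" for X
        unfolding G_def by (intro continuous_U2 F_cont continuous_intros that)
      show "norm (G s x) \<le> B" if "norm x \<le> R" for s x
        unfolding G_def norm_U by (intro B) (simp add: norm_U that)
      show "norm (G s x - G s y) \<le> L * norm (x - y)" if "norm x \<le> R" "norm y \<le> R" for s x y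
      proof -
        have "norm (G s x - G s y) = norm (F (U s x) - F (U s y))"
          by (simp add: G_def U_linear(3)[symmetric] norm_U)
        also have "\<dots> \<le> L * norm (U s x - U s y)" by (intro L) (simp_all add: norm_U that)
        finally show ?thesis by (simp add: U_linear(3)[symmetric] norm_U)
      qed
      show "norm \<phi> + B * T \<le> R" using \<phi> BT by (simp add: R_def)
    qed (use T LT B0 in auto)
    define \<psi> where "\<psi> = (\<lambda>t. U t (X t))"
    have "((\<lambda>t. K (\<psi> t)) has_vector_derivative c *\<^sub>R J (K (\<psi> t) - \<psi> t) + K (F (\<psi> t))) (at t)"
      if t: "t \<in> {- T<..<T}" for t
    proof -
      have "at t within {- T..T} = at t" using t by (intro at_within_interior) simp
      moreover have "(X has_vector_derivative G t (X t)) (at t within {- T..T})"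
        using t by (intro X(4)) simp
      ultimately have "(X has_vector_derivative G t (X t)) (at t)" by metis
      from U_K_product_derivative[OF this] show ?thesis
        by (simp add: \<psi>_def G_def U_minus U_K)
    qed
    moreover have "continuous_on {- T..T} \<psi>" unfolding \<psi>_def
      by (intro continuous_U2 continuous_intros X)
    ultimately show ?thesis
      by (intro exI[of _ \<psi>]) (simp add: \<psi>_def norm_U U_0 X)
  qed
  with T show ?thesis by (rule that)
qed

section \<open>Duhamel's formula for weak solutions\<close>

text \<open>Increments of second order force the derivative to vanish everywhere. This replaces a
  product rule for a pairing in which one factor is only Lipschitz in time.\<close>

lemma eq_if_diff_le_square:
  fixes E :: "real \<Rightarrow> real"
  assumes "a \<le> b" and E: "\<And>s t. a \<le> s \<Longrightarrow> s \<le> t \<Longrightarrow> t \<le> b \<Longrightarrow> \<bar>E t - E s\<bar> \<le> C * (t - s)\<^sup>2"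
  shows "E b = E a"
proof -
  have E': "\<bar>E t - E s\<bar> \<le> \<bar>C\<bar> * \<bar>t - s\<bar> * \<bar>t - s\<bar>" if "s \<in> {a..b}" "t \<in> {a..b}" for s t
  proof -
    have "C * (t - s)\<^sup>2 \<le> \<bar>C\<bar> * (t - s)\<^sup>2" by (intro mult_right_mono) auto
    moreover have "(t - s)\<^sup>2 = \<bar>t - s\<bar> * \<bar>t - s\<bar>" by (simp add: power2_eq_square)
    moreover have "\<bar>E t - E s\<bar> \<le> C * (t - s)\<^sup>2"
      using E[of s t] E[of t s] that
      by (cases "s \<le> t") (auto simp: abs_minus_commute power2_commute)
    ultimately show ?thesis by (simp add: mult.assoc)
  qed
  have "(E has_derivative (\<lambda>h. 0)) (at s within {a..b})" if s: "s \<in> {a..b}" for s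
  proof (rule has_derivativeI_sandwich[of 1])
    have "((\<lambda>t. \<bar>C\<bar> * \<bar>t - s\<bar>) \<longlongrightarrow> \<bar>C\<bar> * \<bar>s - s\<bar>) (at s within {a..b})"
      by (intro tendsto_intros)
    then show "((\<lambda>t. \<bar>C\<bar> * \<bar>t - s\<bar>) \<longlongrightarrow> 0) (at s within {a..b})" by simp
    show "norm (E t - E s - 0) / norm (t - s) \<le> \<bar>C\<bar> * \<bar>t - s\<bar>" if "t \<in> {a..b}" "t \<noteq> s" for t
      using E'[OF s that(1)] that(2) by (simp add: divide_le_eq)
  qed auto
  then have "\<exists>k. \<forall>x\<in>{a..b}. E x = k"
    by (intro has_derivative_zero_constant) auto
  then show ?thesis using assms(1) by auto
qed

text \<open>\<open>p t\<close> stands for the product with \<open>K (w t)\<close>, where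
  \<open>w\<close> is a difference of weak solutions. Its evolution is known only in integrated form
  and on elements \<open>K u\<close>, with the generator moved to the test side. Along the moving
  element \<open>U t (K (K v))\<close> the generator terms of the two factors cancel, and only the
  source \<open>f\<close> remains.\<close>

lemma duhamel:
  fixes p :: "real \<Rightarrow> 'h \<Rightarrow> real" and f :: "real \<Rightarrow> 'h"
  assumes ab: "a \<le> b"
    and lin: "\<And>t. t \<in> {a..b} \<Longrightarrow> bounded_linear (p t)"
    and bd: "\<And>t v. t \<in> {a..b} \<Longrightarrow> \<bar>p t v\<bar> \<le> C * norm v"
    and lip: "\<And>s t v. s \<in> {a..b} \<Longrightarrow> t \<in> {a..b} \<Longrightarrow> \<bar>p t v - p s v\<bar> \<le> C * norm v * \<bar>t - s\<bar>"
    and f_bd: "\<And>r. r \<in> {a..b} \<Longrightarrow> norm (f r) \<le> N"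
    and f_int: "\<And>y. continuous_on {a..b} y \<Longrightarrow> (\<lambda>r. f r \<bullet> y r) integrable_on {a..b}"
    and eq: "\<And>s t u. a \<le> s \<Longrightarrow> s \<le> t \<Longrightarrow> t \<le> b \<Longrightarrow>
      p t (K u) - p s (K u) = integral {s..t} (\<lambda>r. f r \<bullet> K (K u) - p r (c *\<^sub>R J (K u - u)))"
  shows "p b (U b (K (K v))) - p a (U a (K (K v))) =
    integral {a..b} (\<lambda>r. f r \<bullet> U r (K (K (K v))))"
proof -
  define D where "D = (\<lambda>x. c *\<^sub>R J (K x - x))"
  have D: "bounded_linear D" unfolding D_def
    by (intro bounded_linear_const_scaleR bounded_linear_compose[OF J] bounded_linear_sub K bounded_linear_ident)
  note D_simps = linear_simps[OF D]
  have DU: "D (U t x) = U t (D x)" for t x by (simp add: D_def U_linear U_J U_K)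
  define y where "y = (\<lambda>t. U t (K (K v)))"
  have yK: "y t = K (U t (K v))" for t by (simp add: y_def U_K)
  \<comment> \<open>The derivative of \<open>y\<close>. The second factor \<open>K\<close> in front
    of \<open>v\<close> makes \<open>d\<close> itself Lipschitz in time, as the second-order
    estimates require.\<close>
  define d where "d = (\<lambda>t. D (U t (K v)))"
  have dK: "D (K x) = K (D x)" for x by (simp add: D_def K_simps K_J)
  have d_alt: "d t = U t (K (D v))" for t by (simp add: d_def DU dK)
  have y_deriv: "(y has_vector_derivative d t) (at t within S)" for t S
    using U_K_derivative[of "K v" t] unfolding y_def d_def DU
    by (auto simp: D_def intro: has_vector_derivative_at_within)
  have d_deriv: "(d has_vector_derivative U t (D (D v))) (at t within S)" for t S
    using U_K_derivative[of "D v" t] unfolding d_alt[abs_def]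
    by (auto simp: D_def intro: has_vector_derivative_at_within)
  define A where "A = norm (d 0) + norm (D (D v)) + 1"
  have A: "A > 0" by (simp add: A_def add_nonneg_pos)
  have norm_d: "norm (d t) \<le> A" for t by (simp add: A_def d_alt norm_U)
  have y_lip: "norm (y t - y s) \<le> A * \<bar>t - s\<bar>" for s t
  proof -
    have "norm (y t - y s) \<le> A * norm (t - s)"
    proof (rule differentiable_bound[of UNIV])
      show "(y has_derivative (\<lambda>h. h *\<^sub>R d r)) (at r within UNIV)" for r
        using y_deriv[of r UNIV] by (simp add: has_vector_derivative_def)
      show "onorm (\<lambda>h. h *\<^sub>R d r) \<le> A" for r
        using norm_d by (rule onorm_scaleR_right_le)
    qed auto
    then show ?thesis by simp
  qed
  have d_lip: "norm (d t - d s) \<le> A * \<bar>t - s\<bar>" for s t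
  proof -
    have "norm (d t - d s) \<le> A * norm (t - s)"
    proof (rule differentiable_bound[of UNIV])
      show "(d has_derivative (\<lambda>h. h *\<^sub>R U r (D (D v)))) (at r within UNIV)" for r
        using d_deriv[of r UNIV] by (simp add: has_vector_derivative_def)
      have "norm (U r (D (D v))) \<le> A" for r by (simp add: norm_U A_def)
      then show "onorm (\<lambda>h. h *\<^sub>R U r (D (D v))) \<le> A" for r
        by (rule onorm_scaleR_right_le)
    qed auto
    then show ?thesis by simp
  qed
  have y_taylor: "norm (y t - y s - (t - s) *\<^sub>R d s) \<le> A * (t - s)\<^sup>2" if st: "s \<le> t" for s t
  proof -
    have "norm ((y t - t *\<^sub>R d s) - (y s - s *\<^sub>R d s)) \<le> (A * (t - s)) * norm (t - s)"
    proof (rule differentiable_bound[of "{s..t}"])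
      show "((\<lambda>r. y r - r *\<^sub>R d s) has_derivative (\<lambda>h. h *\<^sub>R (d r - d s))) (at r within {s..t})" for r
      proof -
        have "((\<lambda>r. y r - r *\<^sub>R d s) has_vector_derivative (d r - 1 *\<^sub>R d s)) (at r within {s..t})"
          by (intro has_vector_derivative_diff y_deriv
              has_vector_derivative_scaleR[where g = "\<lambda>_. d s" and g' = 0, simplified]) simp
        then show ?thesis by (simp add: has_vector_derivative_def)
      qed
      show "onorm (\<lambda>h. h *\<^sub>R (d r - d s)) \<le> A * (t - s)" if r: "r \<in> {s..t}" for r
      proof (rule onorm_scaleR_right_le)
        have "norm (d r - d s) \<le> A * \<bar>r - s\<bar>" by (rule d_lip)
        also have "\<dots> \<le> A * (t - s)" using r A by (intro mult_left_mono) auto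
        finally show "norm (d r - d s) \<le> A * (t - s)" .
      qed
    qed (use st in auto)
    then show ?thesis using st by (simp add: algebra_simps power2_eq_square)
  qed
  define g where "g = (\<lambda>r. f r \<bullet> U r (K (K (K v))))"
  have gK: "g r = f r \<bullet> K (y r)" for r by (simp add: g_def y_def U_K)
  have int_sub: "h integrable_on {s..t}" if "h integrable_on {a..b}" "a \<le> s" "t \<le> b"
    for h :: "real \<Rightarrow> real" and s t
    using that by (intro integrable_on_subinterval[OF that(1)]) auto
  have g_int: "g integrable_on {a..b}"
    unfolding g_def by (intro f_int continuous_U)
  have fc_int: "(\<lambda>r. f r \<bullet> z) integrable_on {a..b}" for z by (intro f_int continuous_intros)
  have p_cont: "continuous_on {a..b} (\<lambda>r. p r z)" for z
  proof (rule lipschitz_on_continuous_on)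
    show "(C * norm z + \<bar>C * norm z\<bar>)-lipschitz_on {a..b} (\<lambda>r. p r z)"
    proof (rule lipschitz_onI)
      fix s t assume "s \<in> {a..b}" "t \<in> {a..b}"
      from lip[OF this(2,1), of z] have "\<bar>p s z - p t z\<bar> \<le> C * norm z * \<bar>s - t\<bar>" .
      also have "\<dots> \<le> (C * norm z + \<bar>C * norm z\<bar>) * \<bar>s - t\<bar>" by (intro mult_right_mono) auto
      finally show "dist (p s z) (p t z) \<le> (C * norm z + \<bar>C * norm z\<bar>) * dist s t"
        by (simp add: dist_real_def)
    qed auto
  qed
  have p_int: "(\<lambda>r. p r z) integrable_on {a..b}" for z
    by (intro integrable_continuous_interval p_cont)
  \<comment> \<open>Duhamel's formula is the equality of \<open>E\<close> at the two
    endpoints.\<close>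
  define E where "E = (\<lambda>t. p t (y t) - integral {a..t} g)"
  have "E b = E a"
  proof (rule eq_if_diff_le_square[OF ab])
    fix s t assume st: "a \<le> s" "s \<le> t" "t \<le> b"
    then have s: "s \<in> {a..b}" and t: "t \<in> {a..b}" by auto
    interpret pt: bounded_linear "p t" by (rule lin[OF t])
    have "integral {a..t} g = integral {a..s} g + integral {s..t} g"
      using st by (intro Henstock_Kurzweil_Integration.integral_combine[symmetric] int_sub[OF g_int]) auto
    \<comment> \<open>The increment of \<open>p\<close> is taken with \<open>y\<close> frozen at
      \<open>s\<close>, that of \<open>y\<close> with \<open>p\<close> frozen at \<open>t\<close>.
      The former contains minus the integral of \<open>p r (d s)\<close>, the latter plus the
      integral of \<open>p t (d s)\<close>; their sum is of second order.\<close>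
    then have "E t - E s = (p t (y s) - p s (y s)) + (p t (y t) - p t (y s)) - integral {s..t} g"
      by (simp add: E_def)
    also have "p t (y s) - p s (y s) =
        integral {s..t} (\<lambda>r. f r \<bullet> K (y s)) - integral {s..t} (\<lambda>r. p r (d s))"
      unfolding yK eq[OF st] d_def D_def
      using st by (intro Henstock_Kurzweil_Integration.integral_diff int_sub[OF fc_int] int_sub[OF p_int]) auto
    also have "p t (y t) - p t (y s) = p t (y t - y s - (t - s) *\<^sub>R d s) + integral {s..t} (\<lambda>r. p t (d s))"
      using st by (simp add: pt.diff pt.scaleR)
    finally have "E t - E s = (integral {s..t} (\<lambda>r. f r \<bullet> K (y s)) - integral {s..t} g) +
        (integral {s..t} (\<lambda>r. p t (d s)) - integral {s..t} (\<lambda>r. p r (d s))) +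
        p t (y t - y s - (t - s) *\<^sub>R d s)" by simp
    also have "integral {s..t} (\<lambda>r. f r \<bullet> K (y s)) - integral {s..t} g =
        integral {s..t} (\<lambda>r. f r \<bullet> K (y s) - g r)"
      using st by (intro Henstock_Kurzweil_Integration.integral_diff[symmetric] int_sub[OF fc_int] int_sub[OF g_int]) auto
    also have "integral {s..t} (\<lambda>r. p t (d s)) - integral {s..t} (\<lambda>r. p r (d s)) =
        integral {s..t} (\<lambda>r. p t (d s) - p r (d s))"
      using st by (intro Henstock_Kurzweil_Integration.integral_diff[symmetric] int_sub[OF p_int]) auto
    finally have "\<bar>E t - E s\<bar> \<le> \<bar>integral {s..t} (\<lambda>r. f r \<bullet> K (y s) - g r)\<bar> +
        \<bar>integral {s..t} (\<lambda>r. p t (d s) - p r (d s))\<bar> + \<bar>p t (y t - y s - (t - s) *\<^sub>R d s)\<bar>"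
      by linarith
    moreover have "\<bar>integral {s..t} (\<lambda>r. f r \<bullet> K (y s) - g r)\<bar> \<le> \<bar>N\<bar> * (A * (t - s)) * (t - s)"
    proof -
      have "norm (integral {s..t} (\<lambda>r. f r \<bullet> K (y s) - g r)) \<le> integral {s..t} (\<lambda>r. \<bar>N\<bar> * (A * (t - s)))"
      proof (rule integral_norm_bound_integral)
        show "(\<lambda>r. f r \<bullet> K (y s) - g r) integrable_on {s..t}"
          using st by (intro integrable_diff int_sub[OF fc_int] int_sub[OF g_int]) auto
        fix r assume r: "r \<in> {s..t}"
        have "norm (f r \<bullet> K (y s) - g r) = \<bar>f r \<bullet> K (y s - y r)\<bar>"
          by (simp add: gK K_simps inner_simps)
        also have "\<dots> \<le> norm (f r) * norm (K (y s - y r))" by (rule Cauchy_Schwarz_ineq2)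
        also have "\<dots> \<le> \<bar>N\<bar> * (A * (t - s))"
        proof (intro mult_mono)
          show "norm (f r) \<le> \<bar>N\<bar>" using f_bd[of r] r st by auto
          have "norm (K (y s - y r)) \<le> A * \<bar>s - r\<bar>"
            using norm_K[of "y s - y r"] y_lip[of s r] by linarith
          also have "\<dots> \<le> A * (t - s)" using r A by (intro mult_left_mono) auto
          finally show "norm (K (y s - y r)) \<le> A * (t - s)" .
        qed auto
        finally show "norm (f r \<bullet> K (y s) - g r) \<le> \<bar>N\<bar> * (A * (t - s))" .
      qed auto
      then show ?thesis using st by (simp add: mult_ac)
    qed
    moreover have "\<bar>integral {s..t} (\<lambda>r. p t (d s) - p r (d s))\<bar> \<le> \<bar>C\<bar> * A * (t - s) * (t - s)"
    proof -
      have "norm (integral {s..t} (\<lambda>r. p t (d s) - p r (d s))) \<le> integral {s..t} (\<lambda>r. \<bar>C\<bar> * A * (t - s))"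
      proof (rule integral_norm_bound_integral)
        show "(\<lambda>r. p t (d s) - p r (d s)) integrable_on {s..t}"
          using st by (intro integrable_diff int_sub[OF p_int]) auto
        fix r assume r: "r \<in> {s..t}"
        have "norm (p t (d s) - p r (d s)) \<le> C * norm (d s) * \<bar>t - r\<bar>"
          using lip[of r t "d s"] r st by auto
        also have "\<dots> \<le> \<bar>C\<bar> * A * (t - s)"
          using r norm_d[of s] A by (intro mult_mono) auto
        finally show "norm (p t (d s) - p r (d s)) \<le> \<bar>C\<bar> * A * (t - s)" .
      qed auto
      then show ?thesis using st by (simp add: mult_ac)
    qed
    moreover have "\<bar>p t (y t - y s - (t - s) *\<^sub>R d s)\<bar> \<le> \<bar>C\<bar> * (A * (t - s)\<^sup>2)"
    proof -
      have "\<bar>p t (y t - y s - (t - s) *\<^sub>R d s)\<bar> \<le> C * norm (y t - y s - (t - s) *\<^sub>R d s)"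
        by (rule bd[OF t])
      also have "\<dots> \<le> \<bar>C\<bar> * (A * (t - s)\<^sup>2)"
        using y_taylor[OF st(2)] by (intro mult_mono) auto
      finally show ?thesis .
    qed
    ultimately show "\<bar>E t - E s\<bar> \<le> (\<bar>N\<bar> * A + \<bar>C\<bar> * A + \<bar>C\<bar> * A) * (t - s)\<^sup>2"
      by (simp add: power2_eq_square algebra_simps)
  qed
  then show ?thesis by (simp add: E_def y_def g_def)
qed

end

section \<open>Uniqueness and continuous dependence\<close>

text \<open>Lebesgue measure is complete, so a change on a null set preserves measurability.\<close>

lemma borel_measurable_lebesgue_on_AE_cong:
  fixes f g :: "'a::euclidean_space \<Rightarrow> 'b::euclidean_space"
  assumes S: "S \<in> sets lebesgue" and f: "f \<in> borel_measurable (lebesgue_on S)"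
    and ae: "AE x in lebesgue_on S. f x = g x"
  shows "g \<in> borel_measurable (lebesgue_on S)"
proof -
  have neg: "negligible {x \<in> S. f x \<noteq> g x}"
    using ae S by (simp add: AE_restrict_space_iff completion.AE_iff_null_sets negligible_iff_null_sets)
  have "f measurable_on S" using f S by (simp add: measurable_on_iff_borel_measurable)
  from this neg have "g measurable_on S" by (rule measurable_on_spike) auto
  then show ?thesis using S by (simp add: measurable_on_iff_borel_measurable)
qed

text \<open>It suffices to test with elements of \<open>S\<close> that tend to \<open>x\<close>
  itself.\<close>

lemma dense_inner_bound:
  fixes x :: "'a::real_inner"
  assumes S: "closure S = UNIV" and Q: "Q \<ge> 0" and b: "\<And>s. s \<in> S \<Longrightarrow> x \<bullet> s \<le> Q * norm s"
  shows "norm x \<le> Q"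
proof (cases "x = 0")
  case False
  have "x \<in> closure S" using S by simp
  then obtain s where s: "\<And>n. s n \<in> S" "s \<longlonglongrightarrow> x" unfolding closure_sequential by blast
  have "x \<bullet> x \<le> Q * norm x"
  proof (rule LIMSEQ_le)
    show "(\<lambda>n. x \<bullet> s n) \<longlonglongrightarrow> x \<bullet> x" by (intro tendsto_intros s)
    show "(\<lambda>n. Q * norm (s n)) \<longlonglongrightarrow> Q * norm x" by (intro tendsto_intros s)
    show "\<exists>N. \<forall>n\<ge>N. x \<bullet> s n \<le> Q * norm (s n)" using b[OF s(1)] by blast
  qed
  then have "norm x * norm x \<le> Q * norm x" by (simp add: dot_square_norm power2_eq_square)
  then show ?thesis using False by simp
qed (use Q in simp)

context schroedinger_pair
begin

lemma dense_range_KKK: "closure (range (\<lambda>x. K (K (K x)))) = UNIV"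
proof (rule subspace_dense)
  show "subspace (range (\<lambda>x. K (K (K x))))"
    using linear_subspace_image[OF bounded_linear.linear[OF bounded_linear_compose[OF K bounded_linear_compose[OF K K]]] subspace_UNIV] .
  show "x = 0" if "\<And>s. s \<in> range (\<lambda>x. K (K (K x))) \<Longrightarrow> x \<bullet> s = 0" for x
  proof (rule K_inj, rule K_inj)
    have "K (K x) \<bullet> K (K x) = x \<bullet> K (K (K (K x)))" by (simp only: K_sym)
    then show "K (K x) = 0" using that[of "K (K (K (K x)))"] by simp
  qed
qed

text \<open>One step of Gronwall's inequality in integral form. With the weight
  \<open>exp (2 * L * \<bar>t\<bar>)\<close>, the rate \<open>2 * L\<close> makes the integral of
  \<open>L * A * exp (2 * L * \<bar>r\<bar>)\<close> gain a factor 1/2. The norm of \<open>w\<close>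
  is accessible only almost everywhere and through pairings, so an essential bound is improved step
  by step.\<close>

lemma weak_estimate_step:
  fixes p :: "real \<Rightarrow> 'h \<Rightarrow> real" and w f :: "real \<Rightarrow> 'h" and T :: real
  defines "I \<equiv> {- T<..<T}"
  assumes T: "T > 0"
    and lin: "\<And>t. t \<in> I \<Longrightarrow> bounded_linear (p t)"
    and bd: "\<And>t v. t \<in> I \<Longrightarrow> \<bar>p t v\<bar> \<le> C * norm v"
    and lip: "\<And>s t v. s \<in> I \<Longrightarrow> t \<in> I \<Longrightarrow> \<bar>p t v - p s v\<bar> \<le> C * norm v * \<bar>t - s\<bar>"
    and pw: "AE t in lebesgue_on I. \<forall>v. p t v = K (w t) \<bullet> v"
    and p0: "\<And>v. p 0 v = K \<phi> \<bullet> v"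
    and f_meas: "\<And>y. continuous_on I y \<Longrightarrow> (\<lambda>r. f r \<bullet> y r) \<in> borel_measurable (lebesgue_on I)"
    and f_w: "AE t in lebesgue_on I. norm (f t) \<le> L * norm (w t)"
    and eq: "\<And>s t u. s \<in> I \<Longrightarrow> t \<in> I \<Longrightarrow> s \<le> t \<Longrightarrow>
      p t (K u) - p s (K u) = integral {s..t} (\<lambda>r. f r \<bullet> K (K u) - p r (c *\<^sub>R J (K u - u)))"
    and L: "L \<ge> 0" and A: "A \<ge> 0"
    and wA: "AE t in lebesgue_on I. norm (w t) \<le> A * exp (2 * L * \<bar>t\<bar>)"
  shows "AE t in lebesgue_on I. norm (w t) \<le> (norm \<phi> + A / 2) * exp (2 * L * \<bar>t\<bar>)"
proof -
  have I: "I \<in> sets lebesgue" by (simp add: I_def)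
  have 0: "0 \<in> I" using T by (simp add: I_def)
  define N where "N = (\<lambda>r. L * A * exp (2 * L * \<bar>r\<bar>))"
  \<comment> \<open>A version of \<open>f\<close> that obeys the bound at every time, as
    \<open>duhamel\<close> requires; it differs from \<open>f\<close> on a null set.\<close>
  define f' where "f' = (\<lambda>r. if norm (f r) \<le> N r then f r else 0)"
  have N0: "0 \<le> N r" for r using L A by (simp add: N_def)
  have f'N: "norm (f' r) \<le> N r" for r using N0 by (simp add: f'_def)
  have ae: "AE r in lebesgue_on I. f r = f' r"
    using f_w wA
  proof eventually_elim
    case (elim r)
    have "norm (f r) \<le> L * (A * exp (2 * L * \<bar>r\<bar>))"
      using elim mult_left_mono[OF elim(2) L] by linarith
    then show ?case by (simp add: f'_def N_def mult.assoc)
  qed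
  have neg: "negligible {r \<in> I. f r \<noteq> f' r}"
    using ae I by (simp add: AE_restrict_space_iff completion.AE_iff_null_sets negligible_iff_null_sets)
  have est: "p b (U b (K (K v))) \<le> (norm \<phi> + A / 2) * exp (2 * L * \<bar>b\<bar>) * norm (K (K (K v)))"
    if b: "b \<in> I" for b v
  proof -
    \<comment> \<open>Ordered endpoints treat times before and after 0 at once.\<close>
    define l u where "l = min 0 b" and "u = max 0 b"
    have lu: "l \<le> u" "l \<in> I" "u \<in> I" using b 0 by (auto simp: l_def u_def min_def max_def)
    have sub: "{l..u} \<subseteq> I" using lu by (auto simp: I_def)
    have N_cont: "continuous_on S N" for S unfolding N_def by (intro continuous_intros)
    have f'_int: "(\<lambda>r. f' r \<bullet> y r) integrable_on {l..u}" if y: "continuous_on {l..u} y" for y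
    proof -
      \<comment> \<open>Constant extension of \<open>y\<close> beyond \<open>{l..u}\<close>:
        measurability of the products with \<open>f\<close> is given for functions continuous on all
        of \<open>I\<close>.\<close>
      define y' where "y' = (\<lambda>r. y (max l (min u r)))"
      have y': "continuous_on I y'" unfolding y'_def
        by (rule continuous_on_compose2[OF y]) (use lu in \<open>auto intro!: continuous_intros\<close>)
      have "(\<lambda>r. f' r \<bullet> y' r) \<in> borel_measurable (lebesgue_on I)"
        by (rule borel_measurable_lebesgue_on_AE_cong[OF I f_meas[OF y']]) (use ae in \<open>eventually_elim, simp\<close>)
      then have m: "(\<lambda>r. f' r \<bullet> y' r) \<in> borel_measurable (lebesgue_on {l..u})"
        by (rule measurable_restrict_mono[OF _ sub])
      have "(\<lambda>r. f' r \<bullet> y' r) integrable_on {l..u}"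
      proof (rule measurable_bounded_by_integrable_imp_integrable[OF m])
        show "(\<lambda>r. N r * norm (y' r)) integrable_on {l..u}"
          by (intro integrable_continuous_interval continuous_intros N_cont continuous_on_subset[OF y' sub])
        show "norm (f' r \<bullet> y' r) \<le> N r * norm (y' r)" for r
          using Cauchy_Schwarz_ineq2[of "f' r" "y' r"] mult_right_mono[OF f'N[of r] norm_ge_zero[of "y' r"]] by simp
      qed simp
      then show ?thesis
        by (rule integrable_eq) (auto simp: y'_def)
    qed
    obtain B where B: "\<And>r. r \<in> {l..u} \<Longrightarrow> N r \<le> B"
      using continuous_attains_sup[OF compact_Icc _ N_cont, of l u] lu by fastforce
    have duh: "p u (U u (K (K v))) - p l (U l (K (K v))) = integral {l..u} (\<lambda>r. f' r \<bullet> U r (K (K (K v))))"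
    proof (rule duhamel[OF lu(1), where C = C and N = B])
      show "norm (f' r) \<le> B" if "r \<in> {l..u}" for r using f'N[of r] B[OF that] by linarith
      show "p t (K u') - p s (K u') = integral {s..t} (\<lambda>r. f' r \<bullet> K (K u') - p r (c *\<^sub>R J (K u' - u')))"
        if st: "l \<le> s" "s \<le> t" "t \<le> u" for s t u'
      proof -
        have "p t (K u') - p s (K u') = integral {s..t} (\<lambda>r. f r \<bullet> K (K u') - p r (c *\<^sub>R J (K u' - u')))"
          using st sub by (intro eq) auto
        also have "\<dots> = integral {s..t} (\<lambda>r. f' r \<bullet> K (K u') - p r (c *\<^sub>R J (K u' - u')))"
        proof (rule integral_spike[OF neg])
          have "{s..t} \<subseteq> I" using st sub by auto
          then show "f' r \<bullet> K (K u') - p r (c *\<^sub>R J (K u' - u')) = f r \<bullet> K (K u') - p r (c *\<^sub>R J (K u' - u'))"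
            if "r \<in> {s..t} - {r \<in> I. f r \<noteq> f' r}" for r
            using that by auto
        qed
        finally show ?thesis .
      qed
      show "\<bar>p t v - p s v\<bar> \<le> C * norm v * \<bar>t - s\<bar>" if "s \<in> {l..u}" "t \<in> {l..u}" for s t v
        using that sub by (intro lip) blast+
    qed (use sub lin bd f'_int in auto)
    have UKKK: "continuous_on S (\<lambda>r. U r (K (K (K v))))" for S by (rule continuous_U)
    have "\<bar>integral {l..u} (\<lambda>r. f' r \<bullet> U r (K (K (K v))))\<bar> \<le> integral {l..u} (\<lambda>r. N r * norm (K (K (K v))))"
    proof -
      have "norm (integral {l..u} (\<lambda>r. f' r \<bullet> U r (K (K (K v))))) \<le> integral {l..u} (\<lambda>r. N r * norm (K (K (K v))))"
      proof (rule integral_norm_bound_integral)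
        show "(\<lambda>r. f' r \<bullet> U r (K (K (K v)))) integrable_on {l..u}" by (rule f'_int[OF UKKK])
        show "(\<lambda>r. N r * norm (K (K (K v)))) integrable_on {l..u}"
          by (intro integrable_continuous_interval continuous_intros N_cont)
        show "norm (f' r \<bullet> U r (K (K (K v)))) \<le> N r * norm (K (K (K v)))" for r
          using Cauchy_Schwarz_ineq2[of "f' r" "U r (K (K (K v)))"]
            mult_right_mono[OF f'N[of r] norm_ge_zero[of "K (K (K v))"]] by (simp add: norm_U)
      qed
      then show ?thesis by simp
    qed
    also have "\<dots> = A / 2 * (exp (2 * L * \<bar>b\<bar>) - 1) * norm (K (K (K v)))"
    proof -
      have "integral {l..u} N = A / 2 * (exp (2 * L * \<bar>b\<bar>) - 1)"
      proof (rule integral_unique)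
        show "(N has_integral A / 2 * (exp (2 * L * \<bar>b\<bar>) - 1)) {l..u}"
        proof (cases "b \<ge> 0")
          case True
          have "((\<lambda>r. L * A * exp (2 * L * r)) has_integral (A / 2 * exp (2 * L * b) - A / 2 * exp (2 * L * 0))) {0..b}"
            using True by (intro fundamental_theorem_of_calculus)
              (auto intro!: derivative_eq_intros simp: has_real_derivative_iff_has_vector_derivative[symmetric])
          then have "(N has_integral (A / 2 * exp (2 * L * b) - A / 2 * exp (2 * L * 0))) {0..b}"
            by (rule has_integral_eq[rotated]) (simp add: N_def)
          then show ?thesis using True by (simp add: l_def u_def algebra_simps)
        next
          case False
          have "((\<lambda>r. L * A * exp (- 2 * L * r)) has_integral (- A / 2 * exp (- 2 * L * 0) - (- A / 2 * exp (- 2 * L * b)))) {b..0}"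
            using False by (intro fundamental_theorem_of_calculus)
              (auto intro!: derivative_eq_intros simp: has_real_derivative_iff_has_vector_derivative[symmetric])
          then have "(N has_integral (- A / 2 * exp (- 2 * L * 0) - (- A / 2 * exp (- 2 * L * b)))) {b..0}"
            by (rule has_integral_eq[rotated]) (simp add: N_def)
          then show ?thesis using False by (simp add: l_def u_def algebra_simps)
        qed
      qed
      then show ?thesis by (simp add: integral_mult_left)
    qed
    finally have int_le: "\<bar>p u (U u (K (K v))) - p l (U l (K (K v)))\<bar> \<le> A / 2 * (exp (2 * L * \<bar>b\<bar>) - 1) * norm (K (K (K v)))"
      by (simp add: duh)
    have "p b (U b (K (K v))) - p 0 (U 0 (K (K v))) \<le> \<bar>p u (U u (K (K v))) - p l (U l (K (K v)))\<bar>"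
      by (cases "b \<ge> 0") (auto simp: l_def u_def)
    moreover have "p 0 (U 0 (K (K v))) \<le> norm \<phi> * norm (K (K (K v)))"
      using norm_cauchy_schwarz[of \<phi> "K (K (K v))"] by (simp add: p0 U_0 K_sym)
    ultimately have "p b (U b (K (K v))) \<le> norm \<phi> * norm (K (K (K v))) + A / 2 * (exp (2 * L * \<bar>b\<bar>) - 1) * norm (K (K (K v)))"
      using int_le by linarith
    also have "\<dots> = (norm \<phi> + A / 2 * (exp (2 * L * \<bar>b\<bar>) - 1)) * norm (K (K (K v)))"
      by (simp add: algebra_simps)
    also have "\<dots> \<le> (norm \<phi> + A / 2) * exp (2 * L * \<bar>b\<bar>) * norm (K (K (K v)))"
    proof (rule mult_right_mono)
      have "norm \<phi> * 1 \<le> norm \<phi> * exp (2 * L * \<bar>b\<bar>)" using L by (intro mult_left_mono) auto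
      then show "norm \<phi> + A / 2 * (exp (2 * L * \<bar>b\<bar>) - 1) \<le> (norm \<phi> + A / 2) * exp (2 * L * \<bar>b\<bar>)"
        using A by (simp add: algebra_simps)
    qed simp
    finally show ?thesis .
  qed
  have "AE t in lebesgue_on I. t \<in> I" using I by (simp add: AE_restrict_space_iff)
  with pw show ?thesis
  proof eventually_elim
    case (elim b)
    \<comment> \<open>By isometry it is enough to bound \<open>U (- b) (w b)\<close>. Its product
      with \<open>K (K (K v))\<close> is \<open>p b (U b (K (K v)))\<close>, one \<open>K\<close>
      being absorbed into \<open>p\<close>, and these elements are dense.\<close>
    have "norm (U (- b) (w b)) \<le> (norm \<phi> + A / 2) * exp (2 * L * \<bar>b\<bar>)"
    proof (rule dense_inner_bound[OF dense_range_KKK])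
      fix s assume "s \<in> range (\<lambda>x. K (K (K x)))"
      then obtain v where s: "s = K (K (K v))" by blast
      have "U (- b) (w b) \<bullet> s = U b (U (- b) (w b)) \<bullet> U b (K (K (K v)))" by (simp only: U_inner s)
      also have "\<dots> = p b (U b (K (K v)))" using elim(1) by (simp add: U_minus U_K K_sym)
      also have "\<dots> \<le> (norm \<phi> + A / 2) * exp (2 * L * \<bar>b\<bar>) * norm s" unfolding s by (rule est[OF elim(2)])
      finally show "U (- b) (w b) \<bullet> s \<le> (norm \<phi> + A / 2) * exp (2 * L * \<bar>b\<bar>) * norm s" .
    qed (use A in auto)
    then show ?case by (simp add: norm_U)
  qed
qed

text \<open>The map \<open>A \<mapsto> norm \<phi> + A / 2\<close> of the single step has the fixed
  point \<open>2 * norm \<phi>\<close>, the origin of the constant; the excess over it halves each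
  time. The countably many exceptional null sets are discarded together.\<close>

lemma weak_estimate:
  fixes p :: "real \<Rightarrow> 'h \<Rightarrow> real" and w f :: "real \<Rightarrow> 'h" and T :: real
  defines "I \<equiv> {- T<..<T}"
  assumes T: "T > 0"
    and lin: "\<And>t. t \<in> I \<Longrightarrow> bounded_linear (p t)"
    and bd: "\<And>t v. t \<in> I \<Longrightarrow> \<bar>p t v\<bar> \<le> C * norm v"
    and lip: "\<And>s t v. s \<in> I \<Longrightarrow> t \<in> I \<Longrightarrow> \<bar>p t v - p s v\<bar> \<le> C * norm v * \<bar>t - s\<bar>"
    and pw: "AE t in lebesgue_on I. \<forall>v. p t v = K (w t) \<bullet> v"
    and p0: "\<And>v. p 0 v = K \<phi> \<bullet> v"
    and f_meas: "\<And>y. continuous_on I y \<Longrightarrow> (\<lambda>r. f r \<bullet> y r) \<in> borel_measurable (lebesgue_on I)"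
    and f_w: "AE t in lebesgue_on I. norm (f t) \<le> L * norm (w t)"
    and eq: "\<And>s t u. s \<in> I \<Longrightarrow> t \<in> I \<Longrightarrow> s \<le> t \<Longrightarrow>
      p t (K u) - p s (K u) = integral {s..t} (\<lambda>r. f r \<bullet> K (K u) - p r (c *\<^sub>R J (K u - u)))"
    and L: "L \<ge> 0" and w_bd: "AE t in lebesgue_on I. norm (w t) \<le> M"
  shows "AE t in lebesgue_on I. norm (w t) \<le> 2 * norm \<phi> * exp (2 * L * T)"
proof -
  define A where "A = (\<lambda>n::nat. 2 * norm \<phi> + \<bar>M\<bar> / 2 ^ n)"
  have "AE t in lebesgue_on I. norm (w t) \<le> A n * exp (2 * L * \<bar>t\<bar>)" for n
  proof (induction n)
    case 0
    show ?case using w_bd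
    proof eventually_elim
      case (elim t)
      have "A 0 = 2 * norm \<phi> + \<bar>M\<bar>" by (simp add: A_def)
      then have "norm (w t) \<le> A 0 * 1" using elim norm_ge_zero[of \<phi>] by linarith
      also have "\<dots> \<le> A 0 * exp (2 * L * \<bar>t\<bar>)" using L by (intro mult_left_mono) (auto simp: A_def)
      finally show ?case .
    qed
  next
    case (Suc n)
    have "AE t in lebesgue_on {- T<..<T}. norm (w t) \<le> (norm \<phi> + A n / 2) * exp (2 * L * \<bar>t\<bar>)"
    proof (rule weak_estimate_step[where p = p and C = C and f = f])
      show "0 \<le> A n" by (simp add: A_def)
    qed (fact T lin[unfolded I_def] bd[unfolded I_def] lip[unfolded I_def] pw[unfolded I_def] p0
        f_meas[unfolded I_def] f_w[unfolded I_def] eq[unfolded I_def] L Suc[unfolded I_def])+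
    moreover have "norm \<phi> + A n / 2 = A (Suc n)" by (simp add: A_def)
    ultimately show ?case by (simp only: I_def)
  qed
  then have "AE t in lebesgue_on I. \<forall>n. norm (w t) \<le> A n * exp (2 * L * \<bar>t\<bar>)"
    by (simp add: AE_all_countable)
  moreover have "AE t in lebesgue_on I. t \<in> I" by (simp add: AE_restrict_space_iff I_def)
  ultimately show ?thesis
  proof eventually_elim
    case (elim t)
    have "(\<lambda>n. 2 * norm \<phi> + \<bar>M\<bar> * (1 / 2) ^ n) \<longlonglongrightarrow> 2 * norm \<phi> + \<bar>M\<bar> * 0"
      by (intro tendsto_intros LIMSEQ_power_zero) auto
    moreover have "A = (\<lambda>n. 2 * norm \<phi> + \<bar>M\<bar> * (1 / 2) ^ n)"
      by (simp add: A_def fun_eq_iff power_divide)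
    ultimately have "A \<longlonglongrightarrow> 2 * norm \<phi>" by simp
    then have "norm (w t) \<le> 2 * norm \<phi> * exp (2 * L * \<bar>t\<bar>)"
      using elim(1) by (intro LIMSEQ_le_const[OF tendsto_mult_right]) auto
    also have "\<dots> \<le> 2 * norm \<phi> * exp (2 * L * T)"
      using elim(2) L by (intro mult_left_mono) (auto simp: I_def intro!: mult_left_mono)
    finally show ?case .
  qed
qed

end

section \<open>Square integrable functions, continued\<close>

text \<open>The discriminant of the nonnegative quadratic \<open>r \<mapsto> \<integral> (r *
  \<bar>F\<bar> + \<bar>G\<bar>)^2\<close>. If the leading coefficient \<open>A\<close> vanishes,
  the quadratic is an affine function of \<open>r\<close>, and nonnegativity forces
  \<open>C = 0\<close>.\<close>

lemma integral_Cauchy_Schwarz: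
  fixes F G :: "'a \<Rightarrow> real"
  assumes [measurable]: "F \<in> borel_measurable M" "G \<in> borel_measurable M"
    and F: "integrable M (\<lambda>x. (F x)\<^sup>2)" and G: "integrable M (\<lambda>x. (G x)\<^sup>2)"
  shows "integrable M (\<lambda>x. F x * G x)"
    and "(\<integral>x. \<bar>F x * G x\<bar> \<partial>M) \<le> sqrt (\<integral>x. (F x)\<^sup>2 \<partial>M) * sqrt (\<integral>x. (G x)\<^sup>2 \<partial>M)"
proof -
  show FG: "integrable M (\<lambda>x. F x * G x)"
  proof (rule Bochner_Integration.integrable_bound)
    show "integrable M (\<lambda>x. (F x)\<^sup>2 + (G x)\<^sup>2)" using F G by simp
    have "\<bar>a * b\<bar> \<le> a\<^sup>2 + b\<^sup>2" for a b :: real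
    proof -
      have "2 * (\<bar>a\<bar> * \<bar>b\<bar>) \<le> a\<^sup>2 + b\<^sup>2" using sum_squares_bound[of "\<bar>a\<bar>" "\<bar>b\<bar>"] by (simp add: mult.assoc)
      moreover have "0 \<le> \<bar>a\<bar> * \<bar>b\<bar>" by simp
      ultimately show ?thesis unfolding abs_mult by linarith
    qed
    then show "AE x in M. norm (F x * G x) \<le> norm ((F x)\<^sup>2 + (G x)\<^sup>2)" by simp
  qed measurable
  define A B C where "A = (\<integral>x. (F x)\<^sup>2 \<partial>M)" and "B = (\<integral>x. (G x)\<^sup>2 \<partial>M)" and "C = (\<integral>x. \<bar>F x * G x\<bar> \<partial>M)"
  have AB: "0 \<le> A" "0 \<le> B" "0 \<le> C" by (simp_all add: A_def B_def C_def)
  have quad: "0 \<le> r\<^sup>2 * A + 2 * r * C + B" for r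
  proof -
    have "0 \<le> (\<integral>x. (r * \<bar>F x\<bar> + \<bar>G x\<bar>)\<^sup>2 \<partial>M)" by simp
    also have "\<dots> = (\<integral>x. r\<^sup>2 * (F x)\<^sup>2 + (2 * r) * \<bar>F x * G x\<bar> + (G x)\<^sup>2 \<partial>M)"
      by (intro Bochner_Integration.integral_cong)
         (auto simp: power2_sum power_mult_distrib abs_mult)
    also have "\<dots> = r\<^sup>2 * A + 2 * r * C + B"
      using F G integrable_abs[OF FG] by (simp add: A_def B_def C_def)
    finally show ?thesis .
  qed
  have "C\<^sup>2 \<le> A * B"
  proof (cases "A = 0")
    case True
    have "C = 0"
    proof (rule ccontr)
      assume "C \<noteq> 0"
      then have "2 * (- (B + 1) / (2 * C)) * C + B = - 1" by (simp add: field_simps)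
      then show False using quad[of "- (B + 1) / (2 * C)"] True by simp
    qed
    then show ?thesis using AB by simp
  next
    case False
    then have "A > 0" using AB by simp
    have "(- C / A)\<^sup>2 * A + 2 * (- C / A) * C + B = B - C\<^sup>2 / A"
      using False by (simp add: power2_eq_square field_simps)
    then have "C\<^sup>2 / A \<le> B" using quad[of "- C / A"] by simp
    then show ?thesis using \<open>A > 0\<close> by (simp add: field_simps)
  qed
  then have "C \<le> sqrt (A * B)" by (rule real_le_rsqrt)
  then show "(\<integral>x. \<bar>F x * G x\<bar> \<partial>M) \<le> sqrt (\<integral>x. (F x)\<^sup>2 \<partial>M) * sqrt (\<integral>x. (G x)\<^sup>2 \<partial>M)"
    by (simp add: A_def B_def C_def real_sqrt_mult)
qed

text \<open>Summing \<open>2\<^sup>k d\<^sub>k\<close> rather than \<open>d\<^sub>k\<close> avoids Minkowski's inequality for infinite sums.\<close>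

lemma L2_Cauchy_limit:
  fixes f :: "nat \<Rightarrow> 'a \<Rightarrow> 'b::{banach,second_countable_topology}"
  assumes [measurable]: "\<And>n. f n \<in> borel_measurable M"
    and sq: "\<And>m n. integrable M (\<lambda>x. (norm (f m x - f n x))\<^sup>2)"
    and Cauchy: "\<And>e. e > 0 \<Longrightarrow> \<exists>N. \<forall>m\<ge>N. \<forall>n\<ge>N. (\<integral>x. (norm (f m x - f n x))\<^sup>2 \<partial>M) < e"
  obtains g where "g \<in> borel_measurable M"
    "\<And>n. integrable M (\<lambda>x. (norm (f n x - g x))\<^sup>2)"
    "(\<lambda>n. \<integral>x. (norm (f n x - g x))\<^sup>2 \<partial>M) \<longlonglongrightarrow> 0"
proof -
  have "\<forall>k. \<exists>N. \<forall>m\<ge>N. \<forall>n\<ge>N. (\<integral>x. (norm (f m x - f n x))\<^sup>2 \<partial>M) < (1/4) ^ k"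
    using Cauchy by simp
  then obtain N where N: "\<And>k m n. m \<ge> N k \<Longrightarrow> n \<ge> N k \<Longrightarrow> (\<integral>x. (norm (f m x - f n x))\<^sup>2 \<partial>M) < (1/4) ^ k"
    by metis
  \<comment> \<open>Partial sums, so that \<open>r j\<close> is at least every \<open>N k\<close>
    with \<open>k \<le> j\<close>, although \<open>N\<close> need not be monotone.\<close>
  define r where "r = (\<lambda>k. \<Sum>j\<le>k. N j)"
  have rN: "r j \<ge> N k" if "k \<le> j" for j k
    unfolding r_def using that by (intro member_le_sum) auto
  have nn: "(\<integral>\<^sup>+x. ennreal ((norm (f m x - f n x))\<^sup>2) \<partial>M) = ennreal (\<integral>x. (norm (f m x - f n x))\<^sup>2 \<partial>M)" for m n
    by (intro nn_integral_eq_integral sq) auto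
  define d where "d = (\<lambda>k x. (norm (f (r (Suc k)) x - f (r k) x))\<^sup>2)"
  have [measurable]: "d k \<in> borel_measurable M" for k by (simp add: d_def)
  have "(\<integral>\<^sup>+x. (\<Sum>k. ennreal (2 ^ k * d k x)) \<partial>M) = (\<Sum>k. \<integral>\<^sup>+x. ennreal (2 ^ k * d k x) \<partial>M)"
    by (rule nn_integral_suminf) auto
  also have "\<dots> \<le> (\<Sum>k. ennreal ((1/2) ^ k))"
  proof (intro suminf_le summableI)
    fix k
    have "(\<integral>\<^sup>+x. ennreal (2 ^ k * d k x) \<partial>M) = ennreal (2 ^ k) * (\<integral>\<^sup>+x. ennreal (d k x) \<partial>M)"
      by (simp add: ennreal_mult nn_integral_cmult d_def)
    also have "\<dots> = ennreal (2 ^ k * (\<integral>x. (norm (f (r (Suc k)) x - f (r k) x))\<^sup>2 \<partial>M))"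
      unfolding d_def nn by (simp add: ennreal_mult)
    also have "\<dots> \<le> ennreal (2 ^ k * (1/4) ^ k)"
      using N[OF rN[of k "Suc k"] rN[of k k]] by (intro ennreal_leI mult_left_mono) auto
    also have "2 ^ k * (1/4) ^ k = (1/2::real) ^ k" by (simp add: power_mult_distrib[symmetric])
    finally show "(\<integral>\<^sup>+x. ennreal (2 ^ k * d k x) \<partial>M) \<le> ennreal ((1/2) ^ k)" .
  qed
  also have "\<dots> = ennreal (\<Sum>k. (1/2) ^ k)" by (intro suminf_ennreal2) auto
  also have "\<dots> < \<infinity>" by simp
  finally have "AE x in M. (\<Sum>k. ennreal (2 ^ k * d k x)) \<noteq> \<infinity>"
    by (intro nn_integral_noteq_infinite) auto
  then have conv: "AE x in M. convergent (\<lambda>k. f (r k) x)"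
  proof eventually_elim
    case (elim x)
    have "summable (\<lambda>k. 2 ^ k * d k x)"
      using elim by (intro summable_suminf_not_top) (auto simp: d_def)
    then have "(\<lambda>k. 2 ^ k * d k x) \<longlonglongrightarrow> 0" by (rule summable_LIMSEQ_zero)
    then obtain C where C: "\<And>k. norm (2 ^ k * d k x) \<le> C"
      using convergent_imp_Bseq[of "\<lambda>k. 2 ^ k * d k x"] by (auto simp: convergent_def Bseq_def)
    \<comment> \<open>Boundedness of \<open>2 ^ k * d k x\<close> makes the increments decay
      geometrically with ratio \<open>1 / sqrt 2\<close>.\<close>
    have bound: "norm (f (r (Suc k)) x - f (r k) x) \<le> sqrt C * (1 / sqrt 2) ^ k" for k
    proof -
      have "d k x \<le> C / 2 ^ k" using C[of k] by (simp add: d_def field_simps)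
      then have "sqrt (d k x) \<le> sqrt (C / 2 ^ k)" by simp
      then show ?thesis by (simp add: d_def real_sqrt_divide real_sqrt_power power_one_over field_simps)
    qed
    have "summable (\<lambda>k. f (r (Suc k)) x - f (r k) x)"
      by (rule summable_comparison_test'[OF _ bound]) (intro summable_mult summable_geometric, simp)
    then have "convergent (\<lambda>n. \<Sum>k<n. f (r (Suc k)) x - f (r k) x)"
      by (simp add: summable_iff_convergent)
    then have "convergent (\<lambda>n. f (r n) x - f (r 0) x)" 
      using sum_lessThan_telescope[of "\<lambda>k. f (r k) x"] by simp
    then show ?case using convergent_add[OF _ convergent_const[of "f (r 0) x"]] by fastforce
  qed
  define g where "g = (\<lambda>x. lim (\<lambda>k. f (r k) x))"
  have [measurable]: "g \<in> borel_measurable M" unfolding g_def by (rule borel_measurable_lim_metric) simp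
  \<comment> \<open>Fatou's lemma along the subsequence carries the Cauchy estimate over to the
    distance from the limit, for every \<open>n\<close> beyond the threshold and not only along the
    subsequence.\<close>
  have fatou: "(\<integral>\<^sup>+x. ennreal ((norm (f n x - g x))\<^sup>2) \<partial>M) \<le> ennreal ((1/4) ^ k)" if "n \<ge> N k" for n k
  proof -
    have "(\<integral>\<^sup>+x. ennreal ((norm (f n x - g x))\<^sup>2) \<partial>M) =
        (\<integral>\<^sup>+x. liminf (\<lambda>j. ennreal ((norm (f n x - f (r j) x))\<^sup>2)) \<partial>M)"
    proof (rule nn_integral_cong_AE)
      show "AE x in M. ennreal ((norm (f n x - g x))\<^sup>2) = liminf (\<lambda>j. ennreal ((norm (f n x - f (r j) x))\<^sup>2))"
        using conv
      proof eventually_elim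
        case (elim x)
        then have "(\<lambda>j. f (r j) x) \<longlonglongrightarrow> g x" by (simp add: g_def convergent_LIMSEQ_iff)
        then have "(\<lambda>j. ennreal ((norm (f n x - f (r j) x))\<^sup>2)) \<longlonglongrightarrow> ennreal ((norm (f n x - g x))\<^sup>2)"
          by (intro tendsto_ennrealI tendsto_intros)
        then show ?case using lim_imp_Liminf[OF trivial_limit_sequentially] by metis
      qed
    qed
    also have "\<dots> \<le> liminf (\<lambda>j. \<integral>\<^sup>+x. ennreal ((norm (f n x - f (r j) x))\<^sup>2) \<partial>M)"
      by (rule nn_integral_liminf) simp
    also have "\<dots> \<le> ennreal ((1/4) ^ k)"
    proof (rule Liminf_le)
      show "\<forall>\<^sub>F j in sequentially. (\<integral>\<^sup>+x. ennreal ((norm (f n x - f (r j) x))\<^sup>2) \<partial>M) \<le> ennreal ((1/4) ^ k)"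
        unfolding nn using N[OF that rN] by (auto intro!: eventually_sequentiallyI[of k] ennreal_leI less_imp_le)
    qed simp
    finally show ?thesis .
  qed
  have int0: "integrable M (\<lambda>x. (norm (f (N 0) x - g x))\<^sup>2)"
    using fatou[of 0 "N 0"] by (intro integrableI_bounded) (auto intro: le_less_trans)
  have int: "integrable M (\<lambda>x. (norm (f n x - g x))\<^sup>2)" for n
  proof (rule Bochner_Integration.integrable_bound)
    show "integrable M (\<lambda>x. 2 * (norm (f n x - f (N 0) x))\<^sup>2 + 2 * (norm (f (N 0) x - g x))\<^sup>2)"
      using sq int0 by simp
    have "(norm (a - c))\<^sup>2 \<le> 2 * (norm (a - b))\<^sup>2 + 2 * (norm (b - c))\<^sup>2" for a b c :: 'b
    proof -
      have "(norm (a - c))\<^sup>2 \<le> (norm (a - b) + norm (b - c))\<^sup>2"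
        using norm_triangle_ineq[of "a - b" "b - c"] by (intro power_mono) auto
      also have "\<dots> \<le> 2 * (norm (a - b))\<^sup>2 + 2 * (norm (b - c))\<^sup>2"
        using sum_squares_bound[of "norm (a - b)" "norm (b - c)"] by (simp add: power2_sum)
      finally show ?thesis .
    qed
    then show "AE x in M. norm ((norm (f n x - g x))\<^sup>2)
        \<le> norm (2 * (norm (f n x - f (N 0) x))\<^sup>2 + 2 * (norm (f (N 0) x - g x))\<^sup>2)"
      by (auto simp: abs_of_nonneg)
  qed measurable
  have lim: "(\<integral>x. (norm (f n x - g x))\<^sup>2 \<partial>M) \<le> (1/4) ^ k" if "n \<ge> N k" for n k
    using fatou[OF that] nn_integral_eq_integral[OF int[of n]] by (simp add: ennreal_le_iff)
  have "(\<lambda>n. \<integral>x. (norm (f n x - g x))\<^sup>2 \<partial>M) \<longlonglongrightarrow> 0"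
  proof (rule LIMSEQ_I)
    fix e :: real assume "e > 0"
    then obtain k where "(1/4::real) ^ k < e" using real_arch_pow_inv[of e "1/4"] by auto
    then show "\<exists>no. \<forall>n\<ge>no. norm ((\<integral>x. (norm (f n x - g x))\<^sup>2 \<partial>M) - 0) < e"
      using lim by (intro exI[of _ "N k"]) (auto intro: le_less_trans)
  qed
  with int show ?thesis by (intro that[of g]) auto
qed

section \<open>Density of test functions\<close>

lemma test_function_add_scale:
  assumes "test_function UNIV \<phi>" "test_function UNIV \<eta>"
  shows "test_function UNIV (\<lambda>x. \<phi> x + r * \<eta> x)"
proof -
  have "{x. \<phi> x + r * \<eta> x \<noteq> 0} \<subseteq> {x. \<phi> x \<noteq> 0} \<union> {x. \<eta> x \<noteq> 0}" by auto
  moreover have "bounded {x. \<phi> x \<noteq> 0}" "bounded {x. \<eta> x \<noteq> 0}"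
    using assms by (auto simp: test_function_def)
  ultimately have "bounded {x. \<phi> x + r * \<eta> x \<noteq> 0}" using bounded_Un bounded_subset by metis
  then show ?thesis
    using assms by (auto simp: test_function_def smooth_def intro!: cd_add cd_mult cd_const)
qed

lemma test_function_zero: "test_function UNIV (\<lambda>x. 0)"
  by (auto simp: test_function_def smooth_def intro!: cd_const)

lemma test_function_square_integrable:
  fixes \<phi> :: "real^3 \<Rightarrow> real"
  assumes "test_function UNIV \<phi>"
  shows "\<phi> \<in> borel_measurable borel" "integrable lborel (\<lambda>x. (\<phi> x)\<^sup>2)"
  using test_function_L2[OF assms] borel_measurable_continuous_onI[OF test_function_continuous[OF assms]]
  by (auto simp: L2_def)

lemma square_integrable_diff:
  fixes f g :: "'a \<Rightarrow> real"
  assumes [measurable]: "f \<in> borel_measurable M" "g \<in> borel_measurable M"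
    and f: "integrable M (\<lambda>x. (f x)\<^sup>2)" and g: "integrable M (\<lambda>x. (g x)\<^sup>2)"
  shows "integrable M (\<lambda>x. (f x - g x)\<^sup>2)" "integrable M (\<lambda>x. (f x + g x)\<^sup>2)"
  using f g integral_Cauchy_Schwarz(1)[OF assms]
  by (simp_all add: power2_diff power2_sum mult.assoc)

text \<open>The argument for the orthogonal projection onto a subspace, followed by the fundamental lemma.\<close>

lemma test_functions_dense:
  fixes w :: "real^3 \<Rightarrow> real"
  assumes w_meas [measurable]: "w \<in> borel_measurable borel" and w: "integrable lborel (\<lambda>x. (w x)\<^sup>2)" and e: "e > 0"
  shows "\<exists>\<phi>. test_function UNIV \<phi> \<and> (\<integral>x. (w x - \<phi> x)\<^sup>2 \<partial>lborel) < e"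
proof -
  define q where "q = (\<lambda>\<phi>. \<integral>x. (w x - \<phi> x)\<^sup>2 \<partial>lborel)"
  define Q where "Q = q ` {\<phi>. test_function UNIV \<phi>}"
  define d where "d = Inf Q"
  note tf [measurable] = test_function_square_integrable(1)
  note tsq = test_function_square_integrable(2)
  have wt: "integrable lborel (\<lambda>x. (w x - \<phi> x)\<^sup>2)" if "test_function UNIV \<phi>" for \<phi>
    using tf[OF that] tsq[OF that] w by (intro square_integrable_diff) auto
  have Q: "Q \<noteq> {}" "bdd_below Q"
    using test_function_zero by (auto simp: Q_def q_def intro!: bdd_belowI[of _ 0])
  have d_le: "d \<le> q \<phi>" if "test_function UNIV \<phi>" for \<phi>
    unfolding d_def using that by (intro cInf_lower Q) (auto simp: Q_def)
  have "\<exists>\<phi>. test_function UNIV \<phi> \<and> q \<phi> < d + 1 / real (Suc n)" for n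
    using cInf_lessD[OF Q(1), of "d + 1 / real (Suc n)"] by (auto simp: d_def Q_def)
  then obtain s where s: "\<And>n. test_function UNIV (s n)" "\<And>n. q (s n) < d + 1 / real (Suc n)"
    by metis
  have [measurable]: "s n \<in> borel_measurable borel" for n by (rule tf[OF s(1)])
  have ssq: "integrable lborel (\<lambda>x. (s m x - s n x)\<^sup>2)" for m n
    using tsq[OF s(1)] by (intro square_integrable_diff) auto
  have par: "(\<integral>x. (s m x - s n x)\<^sup>2 \<partial>lborel) \<le> 2 / real (Suc m) + 2 / real (Suc n)" for m n
  proof -
    \<comment> \<open>The midpoint of \<open>s m\<close> and \<open>s n\<close>, spelled so that two
      instances of \<open>test_function_add_scale\<close> apply.\<close>
    have mid: "test_function UNIV (\<lambda>x. 0 + (1/2) * (s m x + 1 * s n x))"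
      by (intro test_function_add_scale test_function_zero s)
    from d_le[OF mid] have "d \<le> q (\<lambda>x. (1/2) * (s m x + s n x))" by simp
    moreover have "(\<integral>x. (s m x - s n x)\<^sup>2 \<partial>lborel) =
        (\<integral>x. 2 * (w x - s m x)\<^sup>2 + 2 * (w x - s n x)\<^sup>2 - 4 * (w x - (1/2) * (s m x + s n x))\<^sup>2 \<partial>lborel)"
      by (intro Bochner_Integration.integral_cong) (auto simp: power2_eq_square algebra_simps)
    then have "(\<integral>x. (s m x - s n x)\<^sup>2 \<partial>lborel) = 2 * q (s m) + 2 * q (s n) - 4 * q (\<lambda>x. (1/2) * (s m x + s n x))"
      unfolding q_def using wt[OF s(1)] wt[OF mid] by simp
    moreover have "2 / real (Suc k) = 2 * (1 / real (Suc k))" for k by simp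
    ultimately show ?thesis using s(2)[of m] s(2)[of n] by (smt (verit))
  qed
  have "\<exists>p. p \<in> borel_measurable lborel \<and> (\<forall>n. integrable lborel (\<lambda>x. (norm (s n x - p x))\<^sup>2)) \<and>
      (\<lambda>n. \<integral>x. (norm (s n x - p x))\<^sup>2 \<partial>lborel) \<longlonglongrightarrow> 0"
  proof (rule L2_Cauchy_limit[of s lborel])
    show "\<exists>N. \<forall>m\<ge>N. \<forall>n\<ge>N. (\<integral>x. (norm (s m x - s n x))\<^sup>2 \<partial>lborel) < e" if e: "e > 0" for e
    proof -
      obtain N where N: "4 / e < real N" using reals_Archimedean2 by blast
      have "(\<integral>x. (norm (s m x - s n x))\<^sup>2 \<partial>lborel) < e" if "N \<le> m" "N \<le> n" for m n
      proof -
        have "2 / real (Suc m) \<le> 2 / real (Suc N)" "2 / real (Suc n) \<le> 2 / real (Suc N)"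
          using that by (auto intro!: divide_left_mono)
        then have "(\<integral>x. (norm (s m x - s n x))\<^sup>2 \<partial>lborel) \<le> 4 / real (Suc N)" using par[of m n] by simp
        also have "\<dots> < e"
        proof -
          have "4 < e * real (Suc N)" using N e by (simp add: field_simps)
          then show ?thesis using e by (simp add: field_simps)
        qed
        finally show ?thesis .
      qed
      then show ?thesis by blast
    qed
  qed (use ssq in auto)
  then obtain p where [measurable]: "p \<in> borel_measurable borel"
    and sp: "\<And>n. integrable lborel (\<lambda>x. (s n x - p x)\<^sup>2)"
    and lim: "(\<lambda>n. \<integral>x. (s n x - p x)\<^sup>2 \<partial>lborel) \<longlonglongrightarrow> 0"
    by auto
  define v where "v = (\<lambda>x. w x - p x)"
  have [measurable]: "v \<in> borel_measurable borel" by (simp add: v_def)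
  have v: "integrable lborel (\<lambda>x. (v x)\<^sup>2)"
    using square_integrable_diff(2)[OF _ _ wt[OF s(1)[of 0]] sp[of 0]] by (simp add: v_def)
  \<comment> \<open>First variation: \<open>s n\<close> comes within \<open>1 / (n + 1)\<close> of
    the infimum, so comparison with \<open>s n + r \<phi>\<close> yields a quadratic inequality in
    \<open>r\<close> up to an error that vanishes in the limit.\<close>
  have orth: "(\<integral>x. v x * \<phi> x \<partial>lborel) = 0" if \<phi>: "test_function UNIV \<phi>" for \<phi>
  proof -
    define b where "b = (\<integral>x. (\<phi> x)\<^sup>2 \<partial>lborel)"
    note [measurable] = tf[OF \<phi>]
    have i: "integrable lborel (\<lambda>x. (w x - s n x) * \<phi> x)" "integrable lborel (\<lambda>x. v x * \<phi> x)"
      "integrable lborel (\<lambda>x. (s n x - p x) * \<phi> x)" for n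
      by (intro integral_Cauchy_Schwarz(1) wt[OF s(1)] tsq[OF \<phi>] v sp; simp)+
    have lim2: "(\<lambda>n. \<integral>x. (w x - s n x) * \<phi> x \<partial>lborel) \<longlonglongrightarrow> (\<integral>x. v x * \<phi> x \<partial>lborel)"
    proof (rule LIM_zero_cancel, rule Lim_null_comparison)
      show "\<forall>\<^sub>F n in sequentially. norm ((\<integral>x. (w x - s n x) * \<phi> x \<partial>lborel) - (\<integral>x. v x * \<phi> x \<partial>lborel))
          \<le> sqrt (\<integral>x. (s n x - p x)\<^sup>2 \<partial>lborel) * sqrt b"
      proof (intro always_eventually allI)
        fix n
        have "(\<integral>x. v x * \<phi> x \<partial>lborel) - (\<integral>x. (w x - s n x) * \<phi> x \<partial>lborel) = (\<integral>x. (s n x - p x) * \<phi> x \<partial>lborel)"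
          using i(1)[of n] i(2) i(3)[of n] by (subst Bochner_Integration.integral_diff[symmetric])
            (auto intro!: Bochner_Integration.integral_cong simp: v_def algebra_simps)
        moreover have "\<bar>\<integral>x. (s n x - p x) * \<phi> x \<partial>lborel\<bar> \<le> (\<integral>x. \<bar>(s n x - p x) * \<phi> x\<bar> \<partial>lborel)"
          by (rule integral_abs_bound)
        moreover have "\<dots> \<le> sqrt (\<integral>x. (s n x - p x)\<^sup>2 \<partial>lborel) * sqrt b"
          unfolding b_def by (intro integral_Cauchy_Schwarz(2) sp tsq[OF \<phi>]) auto
        ultimately show "norm ((\<integral>x. (w x - s n x) * \<phi> x \<partial>lborel) - (\<integral>x. v x * \<phi> x \<partial>lborel))
          \<le> sqrt (\<integral>x. (s n x - p x)\<^sup>2 \<partial>lborel) * sqrt b"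
          unfolding real_norm_def by linarith
      qed
      have "(\<lambda>n. sqrt (\<integral>x. (s n x - p x)\<^sup>2 \<partial>lborel) * sqrt b) \<longlonglongrightarrow> sqrt 0 * sqrt b"
        by (intro tendsto_intros lim)
      then show "(\<lambda>n. sqrt (\<integral>x. (s n x - p x)\<^sup>2 \<partial>lborel) * sqrt b) \<longlonglongrightarrow> 0" by simp
    qed
    have "0 \<le> r * (- 2 * (\<integral>x. v x * \<phi> x \<partial>lborel)) + r\<^sup>2 * b" for r
    proof (rule LIMSEQ_le_const)
      have "(\<lambda>n. 1 / real (Suc n) + (r * (- 2 * (\<integral>x. (w x - s n x) * \<phi> x \<partial>lborel)) + r\<^sup>2 * b)) \<longlonglongrightarrow>
          0 + (r * (- 2 * (\<integral>x. v x * \<phi> x \<partial>lborel)) + r\<^sup>2 * b)"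
        using LIMSEQ_inverse_real_of_nat by (intro tendsto_intros lim2) (simp add: inverse_eq_divide)
      then show "(\<lambda>n. 1 / real (Suc n) + (r * (- 2 * (\<integral>x. (w x - s n x) * \<phi> x \<partial>lborel)) + r\<^sup>2 * b)) \<longlonglongrightarrow>
          r * (- 2 * (\<integral>x. v x * \<phi> x \<partial>lborel)) + r\<^sup>2 * b" by simp
      have "0 \<le> 1 / real (Suc n) + (r * (- 2 * (\<integral>x. (w x - s n x) * \<phi> x \<partial>lborel)) + r\<^sup>2 * b)" for n
      proof -
        have "d \<le> q (\<lambda>x. s n x + r * \<phi> x)" by (intro d_le test_function_add_scale s \<phi>)
        also have "\<dots> = (\<integral>x. (w x - s n x)\<^sup>2 + (- 2 * r) * ((w x - s n x) * \<phi> x) + r\<^sup>2 * (\<phi> x)\<^sup>2 \<partial>lborel)"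
          unfolding q_def by (intro Bochner_Integration.integral_cong) (auto simp: power2_eq_square algebra_simps)
        also have "\<dots> = q (s n) + (- 2 * r) * (\<integral>x. (w x - s n x) * \<phi> x \<partial>lborel) + r\<^sup>2 * b"
          unfolding q_def b_def using wt[OF s(1)] i(1) tsq[OF \<phi>] by simp
        finally show ?thesis using s(2)[of n] by simp
      qed
      then show "\<exists>N. \<forall>n\<ge>N. 0 \<le> 1 / real (Suc n) + (r * (- 2 * (\<integral>x. (w x - s n x) * \<phi> x \<partial>lborel)) + r\<^sup>2 * b)"
        by blast
    qed
    then show ?thesis using quadratic_nonneg_imp_linear_zero by fastforce
  qed
  have "AE x in lborel. complex_of_real (v x) = 0"
  proof (rule fundamental_lemma)
    show "(\<lambda>x. complex_of_real (v x)) \<in> L2" using v by (simp add: L2_def)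
    show "(\<integral>x. \<phi> x *\<^sub>R complex_of_real (v x) \<partial>lborel) = 0" if "test_function UNIV \<phi>" for \<phi>
      using orth[OF that] by (simp add: scaleR_conv_of_real of_real_mult[symmetric] mult.commute del: of_real_mult)
  qed
  then have wp: "AE x in lborel. w x = p x" by eventually_elim (simp add: v_def)
  have "(\<integral>x. (s n x - p x)\<^sup>2 \<partial>lborel) = q (s n)" for n
    unfolding q_def using wp by (intro integral_cong_AE) (auto simp: power2_commute)
  then have "\<forall>\<^sub>F n in sequentially. q (s n) < e"
    using order_tendstoD(2)[OF lim e] by simp
  then obtain n where "q (s n) < e" by (auto simp: eventually_sequentially)
  then show ?thesis using s(1) by (auto simp: q_def)
qed

section \<open>Integration by parts in the Sobolev space\<close>

lemma lborel_translate:
  fixes f :: "'a::euclidean_space \<Rightarrow> 'b::{banach,second_countable_topology}"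
  assumes [measurable]: "f \<in> borel_measurable borel"
  shows "(\<integral>x. f (x + a) \<partial>lborel) = (\<integral>x. f x \<partial>lborel)"
    and "integrable lborel (\<lambda>x. f (x + a)) \<longleftrightarrow> integrable lborel f"
proof -
  have "(\<integral>x. f x \<partial>lborel) = (\<integral>x. f x \<partial>distr lborel borel ((+) a))" by (simp add: lborel_distr_plus)
  also have "\<dots> = (\<integral>x. f (x + a) \<partial>lborel)" by (subst integral_distr) (auto simp: add.commute)
  finally show "(\<integral>x. f (x + a) \<partial>lborel) = (\<integral>x. f x \<partial>lborel)" ..
  have "integrable lborel f \<longleftrightarrow> integrable (distr lborel borel ((+) a)) f" by (simp add: lborel_distr_plus)
  also have "\<dots> \<longleftrightarrow> integrable lborel (\<lambda>x. f (x + a))"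
    by (subst integrable_distr_eq) (auto simp: add.commute)
  finally show "integrable lborel (\<lambda>x. f (x + a)) \<longleftrightarrow> integrable lborel f" ..
qed

section \<open>The L2 norm and its duality with test functions\<close>

definition l2 :: "(real^3 \<Rightarrow> complex) \<Rightarrow> real" where
  "l2 f = sqrt (\<integral>x. (cmod (f x))\<^sup>2 \<partial>lborel)"

lemma l2_nonneg: "0 \<le> l2 f" by (simp add: l2_def)

lemma l2_square: "(l2 f)\<^sup>2 = (\<integral>x. (cmod (f x))\<^sup>2 \<partial>lborel)" by (simp add: l2_def)

lemma L2_integrable_square: "f \<in> L2 \<Longrightarrow> integrable lborel (\<lambda>x. (cmod (f x))\<^sup>2)"
  by (simp add: L2_def)

lemma l2_Cauchy_Schwarz:
  assumes "f \<in> L2" "g \<in> L2"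
  shows "integrable lborel (\<lambda>x. cmod (f x) * cmod (g x))"
    and "(\<integral>x. cmod (f x) * cmod (g x) \<partial>lborel) \<le> l2 f * l2 g"
    and "cmod (\<integral>x. f x * g x \<partial>lborel) \<le> l2 f * l2 g"
proof -
  have [measurable]: "f \<in> borel_measurable borel" "g \<in> borel_measurable borel"
    using assms by (auto intro: L2_measurable)
  note cs = integral_Cauchy_Schwarz[of "\<lambda>x. cmod (f x)" lborel "\<lambda>x. cmod (g x)"]
  show "integrable lborel (\<lambda>x. cmod (f x) * cmod (g x))"
    using assms by (intro cs(1)) (auto intro: L2_integrable_square)
  show 1: "(\<integral>x. cmod (f x) * cmod (g x) \<partial>lborel) \<le> l2 f * l2 g"
    using cs(2) assms by (simp add: l2_def L2_integrable_square)
  have "cmod (\<integral>x. f x * g x \<partial>lborel) \<le> (\<integral>x. cmod (f x * g x) \<partial>lborel)" by (rule integral_norm_bound)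
  with 1 show "cmod (\<integral>x. f x * g x \<partial>lborel) \<le> l2 f * l2 g" by (simp add: norm_mult)
qed

lemma l2_triangle:
  assumes f: "f \<in> L2" and g: "g \<in> L2"
  shows "l2 (\<lambda>x. f x + g x) \<le> l2 f + l2 g"
proof -
  have "(l2 (\<lambda>x. f x + g x))\<^sup>2 \<le>
      (\<integral>x. (cmod (f x))\<^sup>2 + 2 * (cmod (f x) * cmod (g x)) + (cmod (g x))\<^sup>2 \<partial>lborel)"
    unfolding l2_square
  proof (rule integral_mono)
    show "integrable lborel (\<lambda>x. (cmod (f x + g x))\<^sup>2)" by (intro L2_integrable_square L2_add f g)
    show "integrable lborel (\<lambda>x. (cmod (f x))\<^sup>2 + 2 * (cmod (f x) * cmod (g x)) + (cmod (g x))\<^sup>2)"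
      using l2_Cauchy_Schwarz(1)[OF f g] f g by (simp add: L2_integrable_square)
    show "(cmod (f x + g x))\<^sup>2 \<le> (cmod (f x))\<^sup>2 + 2 * (cmod (f x) * cmod (g x)) + (cmod (g x))\<^sup>2" for x
      using power_mono[OF norm_triangle_ineq[of "f x" "g x"], of 2] by (simp add: power2_sum mult.assoc)
  qed
  also have "\<dots> = (l2 f)\<^sup>2 + 2 * (\<integral>x. cmod (f x) * cmod (g x) \<partial>lborel) + (l2 g)\<^sup>2"
    using l2_Cauchy_Schwarz(1)[OF f g] f g by (simp add: L2_integrable_square l2_square)
  also have "\<dots> \<le> (l2 f + l2 g)\<^sup>2"
    using l2_Cauchy_Schwarz(2)[OF f g] by (simp add: power2_sum)
  finally show ?thesis by (rule power2_le_imp_le) (simp add: l2_nonneg)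
qed

lemma l2_cmult: "l2 (\<lambda>x. c * f x) = cmod c * l2 f"
  by (simp add: l2_def norm_mult power_mult_distrib real_sqrt_mult)

lemma L2_translate:
  assumes "f \<in> L2"
  shows "(\<lambda>x. f (x + a)) \<in> L2" "l2 (\<lambda>x. f (x + a)) = l2 f"
proof -
  have [measurable]: "f \<in> borel_measurable borel" using assms by (rule L2_measurable)
  show "(\<lambda>x. f (x + a)) \<in> L2"
    using assms lborel_translate(2)[of "\<lambda>x. (cmod (f x))\<^sup>2" a] by (simp add: L2_def)
  show "l2 (\<lambda>x. f (x + a)) = l2 f"
    using lborel_translate(1)[of "\<lambda>x. (cmod (f x))\<^sup>2" a] by (simp add: l2_def)
qed

lemma L2_bounded_mult:
  fixes X :: "real^3 \<Rightarrow> real"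
  assumes f: "f \<in> L2" and [measurable]: "X \<in> borel_measurable borel" and X: "\<And>x. \<bar>X x\<bar> \<le> C"
  shows "(\<lambda>x. of_real (X x) * f x) \<in> L2" "l2 (\<lambda>x. of_real (X x) * f x) \<le> C * l2 f"
proof -
  have [measurable]: "f \<in> borel_measurable borel" using f by (rule L2_measurable)
  have C: "0 \<le> C" using X[of 0] by linarith
  have le: "(cmod (of_real (X x) * f x))\<^sup>2 \<le> C\<^sup>2 * (cmod (f x))\<^sup>2" for x
    using power_mono[OF mult_right_mono[OF X[of x] norm_ge_zero[of "f x"]], of 2] by (simp add: norm_mult power_mult_distrib)
  have int: "integrable lborel (\<lambda>x. C\<^sup>2 * (cmod (f x))\<^sup>2)" using f by (simp add: L2_integrable_square)
  have int': "integrable lborel (\<lambda>x. (cmod (of_real (X x) * f x))\<^sup>2)"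
    by (rule Bochner_Integration.integrable_bound[OF int]) (use le in auto)
  then show "(\<lambda>x. of_real (X x) * f x) \<in> L2" by (simp add: L2_def)
  have "(l2 (\<lambda>x. of_real (X x) * f x))\<^sup>2 \<le> (C * l2 f)\<^sup>2"
    using integral_mono[OF int' int le] by (simp add: l2_square power_mult_distrib)
  then show "l2 (\<lambda>x. of_real (X x) * f x) \<le> C * l2 f"
    by (rule power2_le_imp_le) (simp add: C l2_nonneg)
qed

lemma L2_Re_Im:
  assumes "f \<in> L2"
  shows "(\<lambda>x. complex_of_real (Re (f x))) \<in> L2" "(\<lambda>x. complex_of_real (Im (f x))) \<in> L2"
proof -
  have [measurable]: "f \<in> borel_measurable borel" using assms by (rule L2_measurable)
  have le: "(Re z)\<^sup>2 \<le> (cmod z)\<^sup>2" "(Im z)\<^sup>2 \<le> (cmod z)\<^sup>2" for z by (simp_all add: cmod_power2)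
  show "(\<lambda>x. complex_of_real (Re (f x))) \<in> L2"
    unfolding L2_def using Bochner_Integration.integrable_bound[OF L2_integrable_square[OF assms], of "\<lambda>x. (Re (f x))\<^sup>2"] le
    by simp
  show "(\<lambda>x. complex_of_real (Im (f x))) \<in> L2"
    unfolding L2_def using Bochner_Integration.integrable_bound[OF L2_integrable_square[OF assms], of "\<lambda>x. (Im (f x))\<^sup>2"] le
    by simp
qed

lemma test_functions_dense_L2:
  assumes w: "w \<in> L2" and e: "e > 0"
  obtains \<phi> \<chi>' where "test_function UNIV \<phi>" "test_function UNIV \<chi>'"
    "l2 (\<lambda>x. w x - (of_real (\<phi> x) + \<i> * of_real (\<chi>' x))) < e"
proof -
  have [measurable]: "w \<in> borel_measurable borel" using w by (rule L2_measurable)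
  have e2: "e\<^sup>2 / 2 > 0" using e by simp
  have "integrable lborel (\<lambda>x. (Re (w x))\<^sup>2)" "integrable lborel (\<lambda>x. (Im (w x))\<^sup>2)"
    using L2_Re_Im[OF w] by (simp_all add: L2_def)
  then obtain \<phi> \<chi>' where t: "test_function UNIV \<phi>" "test_function UNIV \<chi>'"
    and c: "(\<integral>x. (Re (w x) - \<phi> x)\<^sup>2 \<partial>lborel) < e\<^sup>2 / 2" "(\<integral>x. (Im (w x) - \<chi>' x)\<^sup>2 \<partial>lborel) < e\<^sup>2 / 2"
    using test_functions_dense[OF _ _ e2, of "\<lambda>x. Re (w x)"] test_functions_dense[OF _ _ e2, of "\<lambda>x. Im (w x)"]
    by auto
  note [measurable] = test_function_square_integrable(1)[OF t(1)] test_function_square_integrable(1)[OF t(2)]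
  have i: "integrable lborel (\<lambda>x. (Re (w x) - \<phi> x)\<^sup>2)" "integrable lborel (\<lambda>x. (Im (w x) - \<chi>' x)\<^sup>2)"
    using L2_Re_Im[OF w] test_function_square_integrable(2)[OF t(1)] test_function_square_integrable(2)[OF t(2)]
    by (auto intro!: square_integrable_diff simp: L2_def)
  have "(l2 (\<lambda>x. w x - (of_real (\<phi> x) + \<i> * of_real (\<chi>' x))))\<^sup>2 = (\<integral>x. (Re (w x) - \<phi> x)\<^sup>2 + (Im (w x) - \<chi>' x)\<^sup>2 \<partial>lborel)"
    unfolding l2_square by (intro Bochner_Integration.integral_cong) (auto simp: cmod_power2)
  also have "\<dots> < e\<^sup>2" using c i by simp
  finally have "l2 (\<lambda>x. w x - (of_real (\<phi> x) + \<i> * of_real (\<chi>' x))) < e"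
    by (rule power2_less_imp_less) (use e in simp)
  with t show ?thesis by (rule that)
qed

text \<open>Approximate the conjugate of \<open>d\<close> by an \<open>s\<close> built from two real
  test functions; the square of \<open>l2 d\<close> is then the pairing of \<open>s\<close> with
  \<open>d\<close> up to a small error. The factor 2 arises because the real and the imaginary part
  of \<open>s\<close> are estimated separately.\<close>

lemma l2_le_if_dual_bound:
  assumes d: "d \<in> L2" and C: "C \<ge> 0"
    and b: "\<And>\<phi>. test_function UNIV \<phi> \<Longrightarrow> cmod (\<integral>x. of_real (\<phi> x) * d x \<partial>lborel) \<le> C * l2 (\<lambda>x. of_real (\<phi> x))"
  shows "l2 d \<le> 2 * C"
proof -
  define D where "D = l2 d"
  have D0: "0 \<le> D" by (simp add: D_def l2_nonneg)
  have cd: "(\<lambda>x. cnj (d x)) \<in> L2" by (rule L2_cnj[OF d])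
  have lcd: "l2 (\<lambda>x. cnj (d x)) = D" by (simp add: l2_def D_def)
  have step: "D\<^sup>2 \<le> e * D + 2 * C * (D + e)" if e: "e > 0" for e
  proof -
    obtain \<phi> \<eta> where t: "test_function UNIV \<phi>" "test_function UNIV \<eta>"
      and l: "l2 (\<lambda>x. cnj (d x) - (of_real (\<phi> x) + \<i> * of_real (\<eta> x))) < e"
      using test_functions_dense_L2[OF cd e] by blast
    define s where "s = (\<lambda>x. complex_of_real (\<phi> x) + \<i> * of_real (\<eta> x))"
    note tL = test_function_L2[OF t(1)] test_function_L2[OF t(2)]
    have sL: "s \<in> L2" unfolding s_def by (intro L2_add L2_cmult tL)
    have diffL: "(\<lambda>x. cnj (d x) - s x) \<in> L2" by (intro L2_diff cd sL)
    have ls: "l2 s \<le> D + e"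
    proof -
      have "l2 (\<lambda>x. cnj (d x) + (- 1) * (cnj (d x) - s x)) \<le> D + l2 (\<lambda>x. (- 1) * (cnj (d x) - s x))"
        using l2_triangle[OF cd L2_cmult[OF diffL, of "- 1"]] by (simp only: lcd)
      also have "l2 (\<lambda>x. (- 1) * (cnj (d x) - s x)) \<le> e" using l by (subst l2_cmult) (simp add: s_def)
      finally show ?thesis by simp
    qed
    have lp: "l2 (\<lambda>x. of_real (\<phi> x)) \<le> l2 s" "l2 (\<lambda>x. of_real (\<eta> x)) \<le> l2 s"
      unfolding l2_def real_sqrt_le_iff using sL tL
      by (intro integral_mono; auto simp: L2_def s_def cmod_power2)+
    have "cmod (\<integral>x. s x * d x \<partial>lborel) \<le> 2 * C * (D + e)"
    proof -
      have "(\<integral>x. s x * d x \<partial>lborel) = (\<integral>x. of_real (\<phi> x) * d x + \<i> * (of_real (\<eta> x) * d x) \<partial>lborel)"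
        by (intro Bochner_Integration.integral_cong) (auto simp: s_def algebra_simps)
      also have "\<dots> = (\<integral>x. of_real (\<phi> x) * d x \<partial>lborel) + \<i> * (\<integral>x. of_real (\<eta> x) * d x \<partial>lborel)"
        using L2_mult_integrable[OF tL(1) d] L2_mult_integrable[OF tL(2) d] by simp
      also have "cmod \<dots> \<le> cmod (\<integral>x. of_real (\<phi> x) * d x \<partial>lborel) + cmod (\<integral>x. of_real (\<eta> x) * d x \<partial>lborel)"
        by (rule order_trans[OF norm_triangle_ineq]) (simp add: norm_mult)
      also have "\<dots> \<le> C * l2 s + C * l2 s"
        using b[OF t(1)] b[OF t(2)] mult_left_mono[OF lp(1) C] mult_left_mono[OF lp(2) C] by linarith
      also have "\<dots> \<le> 2 * C * (D + e)" using mult_left_mono[OF ls C] by simp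
      finally show ?thesis .
    qed
    moreover have "cmod (\<integral>x. (cnj (d x) - s x) * d x \<partial>lborel) \<le> e * D"
    proof -
      have "cmod (\<integral>x. (cnj (d x) - s x) * d x \<partial>lborel) \<le> l2 (\<lambda>x. cnj (d x) - s x) * D"
        unfolding D_def by (rule l2_Cauchy_Schwarz(3)[OF diffL d])
      also have "\<dots> \<le> e * D" using l D0 by (intro mult_right_mono) (auto simp: s_def)
      finally show ?thesis .
    qed
    moreover have "complex_of_real (D\<^sup>2) = (\<integral>x. (cnj (d x) - s x) * d x \<partial>lborel) + (\<integral>x. s x * d x \<partial>lborel)"
    proof -
      have "complex_of_real (D\<^sup>2) = (\<integral>x. complex_of_real ((cmod (d x))\<^sup>2) \<partial>lborel)"
        unfolding D_def l2_square by (simp only: integral_complex_of_real)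
      also have "\<dots> = (\<integral>x. (cnj (d x) - s x) * d x + s x * d x \<partial>lborel)"
        by (intro Bochner_Integration.integral_cong) (auto simp: complex_norm_square algebra_simps simp del: of_real_power)
      also have "\<dots> = (\<integral>x. (cnj (d x) - s x) * d x \<partial>lborel) + (\<integral>x. s x * d x \<partial>lborel)"
        by (intro Bochner_Integration.integral_add L2_mult_integrable diffL sL d)
      finally show ?thesis .
    qed
    then have "cmod (complex_of_real (D\<^sup>2)) \<le> cmod (\<integral>x. (cnj (d x) - s x) * d x \<partial>lborel) + cmod (\<integral>x. s x * d x \<partial>lborel)"
      by (simp only: norm_triangle_ineq)
    moreover have "cmod (complex_of_real (D\<^sup>2)) = D\<^sup>2" by (simp only: norm_of_real) simp
    ultimately show ?thesis by linarith
  qed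
  have "D\<^sup>2 \<le> 2 * C * D"
  proof (rule field_le_epsilon)
    fix e :: real assume e: "e > 0"
    define r where "r = e / (D + 2 * C + 1)"
    have pos: "D + 2 * C + 1 > 0" using D0 C by simp
    have "r > 0" using e pos by (simp add: r_def)
    from step[OF this] have "D\<^sup>2 \<le> 2 * C * D + r * (D + 2 * C)" by (simp add: algebra_simps)
    also have "r * (D + 2 * C) \<le> r * (D + 2 * C + 1)" using \<open>r > 0\<close> by (intro mult_left_mono) auto
    also have "\<dots> = e" using pos by (simp add: r_def)
    finally show "D\<^sup>2 \<le> 2 * C * D + e" by simp
  qed
  then show ?thesis using C D0 unfolding D_def[symmetric] by (cases "D = 0") (auto simp: power2_eq_square)
qed

subsection \<open>Difference quotients\<close>

lemma test_function_translate:
  assumes "test_function UNIV \<phi>"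
  shows "test_function UNIV (\<lambda>x. \<phi> (x + a))"
    and "partial_deriv i (\<lambda>x. \<phi> (x + a)) x = partial_deriv i \<phi> (x + a)"
proof -
  have d: "((\<lambda>x. f (x + a)) has_derivative frechet_derivative f (at (x + a))) (at x)"
    if "\<And>x. f differentiable (at x)" for f :: "real^3 \<Rightarrow> real" and x
  proof -
    have "(f has_derivative frechet_derivative f (at (x + a))) (at (x + a))"
      using that frechet_derivative_works by blast
    moreover have "((\<lambda>x. x + a) has_derivative (\<lambda>x. x)) (at x)"
      by (auto intro!: derivative_eq_intros)
    ultimately show ?thesis
      using has_derivative_compose[of "\<lambda>x. x + a" "\<lambda>x. x" x UNIV f "frechet_derivative f (at (x + a))"] by simp
  qed
  have cd: "continuously_differentiable n f \<Longrightarrow> continuously_differentiable n (\<lambda>x. f (x + a))"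
    for n and f :: "real^3 \<Rightarrow> real"
  proof (induction n arbitrary: f)
    case 0
    then show ?case by (auto intro!: continuous_on_compose2[of UNIV f] continuous_intros)
  next
    case (Suc n)
    have "frechet_derivative (\<lambda>x. f (x + a)) (at x) v = frechet_derivative f (at (x + a)) v" for x v
      using frechet_derivative_at[OF d, of f x] Suc.prems by (metis continuously_differentiable.simps(2))
    moreover have "(\<lambda>x. f (x + a)) differentiable (at x)" for x
      using d[of f x] Suc.prems by (auto simp: differentiable_def)
    ultimately show ?case
      using Suc.IH[of "\<lambda>x. frechet_derivative f (at x) _"] Suc.prems by auto
  qed
  have diff: "\<phi> differentiable (at x)" for x
    using assms by (auto simp: test_function_def smooth_def dest: spec[of _ "Suc 0"])
  show "partial_deriv i (\<lambda>x. \<phi> (x + a)) x = partial_deriv i \<phi> (x + a)"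
    unfolding partial_deriv_def using frechet_derivative_at[OF d[OF diff], of x] by metis
  have "bounded {x. \<phi> x \<noteq> 0}" using assms by (simp add: test_function_def)
  moreover have "{x. \<phi> (x + a) \<noteq> 0} = (\<lambda>y. - a + y) ` {x. \<phi> x \<noteq> 0}"
    by (auto intro!: image_eqI[of _ _ "_ + a"])
  ultimately have "bounded {x. \<phi> (x + a) \<noteq> 0}" by (simp add: bounded_translation_minus)
  then show "test_function UNIV (\<lambda>x. \<phi> (x + a))"
    using assms cd by (auto simp: test_function_def smooth_def)
qed

lemma test_function_line_derivative:
  assumes "test_function UNIV \<phi>"
  shows "((\<lambda>h. \<phi> (x + h *\<^sub>R axis i 1)) has_real_derivative partial_deriv i \<phi> (x + s *\<^sub>R axis i 1)) (at s)"
proof -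
  have "\<phi> differentiable (at y)" for y
    using assms by (auto simp: test_function_def smooth_def dest: spec[of _ "Suc 0"])
  then have d: "(\<phi> has_derivative frechet_derivative \<phi> (at y)) (at y)" for y
    by (simp add: frechet_derivative_works)
  have "((\<lambda>h. x + h *\<^sub>R axis i 1) has_derivative (\<lambda>h. h *\<^sub>R axis i (1::real))) (at s)"
    by (auto intro!: derivative_eq_intros)
  from has_derivative_compose[OF this d]
  have "((\<lambda>h. \<phi> (x + h *\<^sub>R axis i 1)) has_derivative
      (\<lambda>h. frechet_derivative \<phi> (at (x + s *\<^sub>R axis i 1)) (h *\<^sub>R axis i 1))) (at s)" .
  moreover have "frechet_derivative \<phi> (at y) (h *\<^sub>R axis i 1) = partial_deriv i \<phi> y * h" for y h
    using linear_cmul[OF has_derivative_linear[OF d]] by (simp add: partial_deriv_def mult.commute)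
  ultimately show ?thesis by (simp add: has_field_derivative_def)
qed

lemma has_vector_derivative_iff_tendsto:
  "(F has_vector_derivative D) (at s) \<longleftrightarrow> ((\<lambda>y. (F y - F s) /\<^sub>R (y - s)) \<longlongrightarrow> D) (at s)"
proof -
  have "(F has_vector_derivative D) (at s) \<longleftrightarrow>
      ((\<lambda>y. norm (F y - F s - (y - s) *\<^sub>R D) / norm (y - s)) \<longlongrightarrow> 0) (at s)"
    unfolding has_vector_derivative_def has_derivative_iff_norm
    by (simp add: bounded_linear_scaleR_left)
  also have "\<dots> \<longleftrightarrow> ((\<lambda>y. norm ((F y - F s) /\<^sub>R (y - s) - D)) \<longlongrightarrow> 0) (at s)"
  proof (rule Lim_cong_within)
    fix y assume y: "y \<noteq> s"
    have "(F y - F s) /\<^sub>R (y - s) - D = (F y - F s - (y - s) *\<^sub>R D) /\<^sub>R (y - s)"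
      using y by (simp add: scaleR_diff_right)
    then show "norm (F y - F s - (y - s) *\<^sub>R D) / norm (y - s) = norm ((F y - F s) /\<^sub>R (y - s) - D)"
      by (simp add: divide_inverse mult.commute)
  qed auto
  also have "\<dots> \<longleftrightarrow> ((\<lambda>y. (F y - F s) /\<^sub>R (y - s)) \<longlongrightarrow> D) (at s)"
    by (simp add: tendsto_norm_zero_iff LIM_zero_iff)
  finally show ?thesis .
qed

text \<open>Differentiability along one axis only. The weights used below include kernels and their
  products with test functions, and integration by parts in direction \<open>i\<close> asks for no
  more.\<close>

definition line_derivative :: "3 \<Rightarrow> (real^3 \<Rightarrow> real) \<Rightarrow> (real^3 \<Rightarrow> real) \<Rightarrow> bool" where
  "line_derivative i X X' \<longleftrightarrow>
     (\<forall>x s. ((\<lambda>h. X (x + h *\<^sub>R axis i 1)) has_real_derivative X' (x + s *\<^sub>R axis i 1)) (at s))"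

lemma line_derivative_bound:
  assumes "line_derivative i X X'" "\<And>x. \<bar>X' x\<bar> \<le> C"
  shows "\<bar>X (x + h *\<^sub>R axis i 1) - X x\<bar> \<le> C * \<bar>h\<bar>"
proof -
  have "norm (X (x + h *\<^sub>R axis i 1) - X (x + 0 *\<^sub>R axis i 1)) \<le> C * norm (h - 0)"
    by (rule field_differentiable_bound[of UNIV]) (use assms in \<open>auto simp: line_derivative_def\<close>)
  then show ?thesis by simp
qed

lemma line_derivative_quotient:
  assumes "line_derivative i X X'" and y: "y \<longlonglongrightarrow> 0" "\<And>n. y n \<noteq> 0"
  shows "(\<lambda>n. (X (x + y n *\<^sub>R axis i 1) - X x) / y n) \<longlonglongrightarrow> X' x"
proof -
  have "((\<lambda>h. X (x + h *\<^sub>R axis i 1)) has_real_derivative X' (x + 0 *\<^sub>R axis i 1)) (at 0)"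
    using assms(1)[unfolded line_derivative_def, rule_format, of x 0] .
  then have "((\<lambda>h. (X (x + h *\<^sub>R axis i 1) - X x) / h) \<longlongrightarrow> X' x) (at 0)"
    by (simp add: has_field_derivative_iff)
  then show ?thesis
    using y unfolding tendsto_at_iff_sequentially by (auto simp: o_def)
qed

lemma indicator_cball_L2: "(\<lambda>x. complex_of_real (indicator (cball 0 r) x)) \<in> L2"
proof -
  have "(\<lambda>x::real^3. (cmod (complex_of_real (indicator (cball 0 r) x)))\<^sup>2) = indicator (cball 0 r)"
    by (auto simp: indicator_def)
  moreover have "integrable lborel (indicator (cball 0 r) :: real^3 \<Rightarrow> real)"
    using emeasure_bounded_finite[OF bounded_cball[of "0::real^3" r]]
    by (intro integrable_real_indicator) auto
  ultimately show ?thesis by (auto simp: L2_def)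
qed

lemma integrable_on_cball:
  assumes "f \<in> L2"
  shows "integrable lborel (\<lambda>x. C * (indicator (cball 0 r) x * cmod (f x)))"
  using l2_Cauchy_Schwarz(1)[OF indicator_cball_L2[of r] assms] by simp

text \<open>The difference quotients of a compactly supported \<open>X\<close> are supported in a fixed ball, which
  makes dominated convergence applicable.\<close>

lemma compact_line_quotient_tendsto:
  assumes f: "f \<in> L2" and X: "line_derivative i X X'" "\<And>x. \<bar>X' x\<bar> \<le> C"
    and [measurable]: "X \<in> borel_measurable borel" "X' \<in> borel_measurable borel"
    and supp: "\<And>x. norm x > r \<Longrightarrow> X x = 0" and y: "y \<longlonglongrightarrow> 0" "\<And>n. y n \<noteq> 0"
  shows "(\<lambda>n. \<integral>x. ((X (x + y n *\<^sub>R axis i 1) - X x) / y n) *\<^sub>R f x \<partial>lborel) \<longlonglongrightarrow> (\<integral>x. X' x *\<^sub>R f x \<partial>lborel)"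
proof -
  have [measurable]: "f \<in> borel_measurable borel" using f by (rule L2_measurable)
  obtain M where M: "\<And>n. \<bar>y n\<bar> \<le> M"
    using convergent_imp_Bseq[of y] y(1) by (auto simp: convergent_def Bseq_def)
  have C: "0 \<le> C" using X(2)[of 0] by linarith
  show ?thesis
  proof (rule integral_dominated_convergence[OF _ _ integrable_on_cball[OF f, of C "r + M"]])
    show "AE x in lborel. (\<lambda>n. ((X (x + y n *\<^sub>R axis i 1) - X x) / y n) *\<^sub>R f x) \<longlonglongrightarrow> X' x *\<^sub>R f x"
      by (intro AE_I2 tendsto_scaleR line_derivative_quotient[OF X(1) y] tendsto_const)
    fix n
    show "AE x in lborel. norm (((X (x + y n *\<^sub>R axis i 1) - X x) / y n) *\<^sub>R f x) \<le>
        C * (indicator (cball 0 (r + M)) x * cmod (f x))"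
    proof (rule AE_I2)
      fix x
      show "norm (((X (x + y n *\<^sub>R axis i 1) - X x) / y n) *\<^sub>R f x) \<le> C * (indicator (cball 0 (r + M)) x * cmod (f x))"
      proof (cases "norm x \<le> r + M")
        case True
        have "\<bar>(X (x + y n *\<^sub>R axis i 1) - X x) / y n\<bar> \<le> C"
          using line_derivative_bound[OF X, of x "y n"] y(2)[of n] by (simp add: abs_divide divide_le_eq)
        then have "\<bar>(X (x + y n *\<^sub>R axis i 1) - X x) / y n\<bar> * cmod (f x) \<le> C * cmod (f x)"
          by (rule mult_right_mono) simp
        then show ?thesis using True by simp
      next
        case False
        have "norm x \<le> norm (x + y n *\<^sub>R axis i 1) + \<bar>y n\<bar>"
          using norm_triangle_ineq4[of "x + y n *\<^sub>R axis i 1" "y n *\<^sub>R axis i 1"] by simp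
        then have "X (x + y n *\<^sub>R axis i 1) = 0" "X x = 0"
          using False M[of n] by (auto intro!: supp)
        then show ?thesis using C by (simp add: mult_nonneg_nonneg)
      qed
    qed
  qed measurable
qed

lemma test_function_facts:
  assumes "test_function UNIV \<phi>"
  shows "\<exists>C r. line_derivative i \<phi> (partial_deriv i \<phi>) \<and> (\<forall>x. \<bar>partial_deriv i \<phi> x\<bar> \<le> C) \<and>
    (\<forall>x. norm x > r \<longrightarrow> \<phi> x = 0) \<and> \<phi> \<in> borel_measurable borel \<and> partial_deriv i \<phi> \<in> borel_measurable borel"
proof -
  have cpt: "compact (closure {x. \<phi> x \<noteq> 0})" using assms by (simp add: test_function_def)
  then obtain r where r: "\<And>x. x \<in> closure {x. \<phi> x \<noteq> 0} \<Longrightarrow> norm x \<le> r"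
    using compact_imp_bounded bounded_iff by metis
  have supp: "\<phi> x = 0" if "norm x > r" for x
    using r[of x] closure_subset[of "{x. \<phi> x \<noteq> 0}"] that by fastforce
  have cont: "continuous_on UNIV (partial_deriv i \<phi>)" by (rule partial_continuous[OF assms])
  have "bounded (partial_deriv i \<phi> ` closure {x. \<phi> x \<noteq> 0})"
    by (intro compact_imp_bounded compact_continuous_image cpt continuous_on_subset[OF cont]) simp
  then obtain C where C: "\<And>x. x \<in> closure {x. \<phi> x \<noteq> 0} \<Longrightarrow> \<bar>partial_deriv i \<phi> x\<bar> \<le> C"
    by (auto simp: bounded_iff)
  have "\<bar>partial_deriv i \<phi> x\<bar> \<le> \<bar>C\<bar>" for x
    using C[of x] partial_eq_0[of x \<phi> i] by (cases "x \<in> closure {x. \<phi> x \<noteq> 0}") auto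
  moreover have "line_derivative i \<phi> (partial_deriv i \<phi>)"
    using test_function_line_derivative[OF assms] by (auto simp: line_derivative_def)
  ultimately show ?thesis
    using supp borel_measurable_continuous_onI[OF cont]
      borel_measurable_continuous_onI[OF test_function_continuous[OF assms]]
    by (intro exI[of _ "\<bar>C\<bar>"] exI[of _ r]) simp
qed

text \<open>The derivative falls on the translate of \<open>\<phi>\<close>, which is again a test
  function, so the weak derivative moves it to \<open>g\<close>.\<close>

lemma translate_pairing_derivative:
  assumes f: "f \<in> L2" and wp: "weak_partial i f g" and \<phi>: "test_function UNIV \<phi>"
  shows "((\<lambda>h. \<integral>x. \<phi> (x + h *\<^sub>R axis i 1) *\<^sub>R f x \<partial>lborel) has_vector_derivative
    - (\<integral>x. \<phi> (x + s *\<^sub>R axis i 1) *\<^sub>R g x \<partial>lborel)) (at s)"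
  unfolding has_vector_derivative_iff_tendsto tendsto_at_iff_sequentially
proof (intro allI impI)
  fix y :: "nat \<Rightarrow> real" assume y: "\<forall>n. y n \<in> UNIV - {s}" "y \<longlonglongrightarrow> s"
  define \<eta> where "\<eta> = (\<lambda>x. \<phi> (x + s *\<^sub>R axis i 1))"
  have \<eta>: "test_function UNIV \<eta>" unfolding \<eta>_def by (rule test_function_translate(1)[OF \<phi>])
  obtain C r where t: "line_derivative i \<eta> (partial_deriv i \<eta>)" "\<And>x. \<bar>partial_deriv i \<eta> x\<bar> \<le> C"
    "\<And>x. norm x > r \<Longrightarrow> \<eta> x = 0" "\<eta> \<in> borel_measurable borel" "partial_deriv i \<eta> \<in> borel_measurable borel"
    using test_function_facts[OF \<eta>, of i] by auto
  have "(\<lambda>n. y n - s) \<longlonglongrightarrow> 0" using y(2) by (simp add: LIM_zero)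
  from compact_line_quotient_tendsto[OF f t(1,2,4,5,3) this] y(1)
  have "(\<lambda>n. \<integral>x. ((\<eta> (x + (y n - s) *\<^sub>R axis i 1) - \<eta> x) / (y n - s)) *\<^sub>R f x \<partial>lborel) \<longlonglongrightarrow>
      (\<integral>x. partial_deriv i \<eta> x *\<^sub>R f x \<partial>lborel)" by simp
  moreover have "(\<integral>x. partial_deriv i \<eta> x *\<^sub>R f x \<partial>lborel) = - (\<integral>x. \<phi> (x + s *\<^sub>R axis i 1) *\<^sub>R g x \<partial>lborel)"
    using wp \<eta> by (simp add: weak_partial_def \<eta>_def)
  moreover have "(\<integral>x. ((\<eta> (x + (y n - s) *\<^sub>R axis i 1) - \<eta> x) / (y n - s)) *\<^sub>R f x \<partial>lborel) =
      ((\<integral>x. \<phi> (x + y n *\<^sub>R axis i 1) *\<^sub>R f x \<partial>lborel) - (\<integral>x. \<phi> (x + s *\<^sub>R axis i 1) *\<^sub>R f x \<partial>lborel)) /\<^sub>R (y n - s)" for n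
  proof -
    have "(\<integral>x. ((\<eta> (x + (y n - s) *\<^sub>R axis i 1) - \<eta> x) / (y n - s)) *\<^sub>R f x \<partial>lborel) =
        (\<integral>x. (\<phi> (x + y n *\<^sub>R axis i 1) *\<^sub>R f x - \<phi> (x + s *\<^sub>R axis i 1) *\<^sub>R f x) /\<^sub>R (y n - s) \<partial>lborel)"
      by (intro Bochner_Integration.integral_cong)
         (auto simp: \<eta>_def algebra_simps divide_inverse scaleR_diff_left scaleR_diff_right)
    also have "\<dots> = ((\<integral>x. \<phi> (x + y n *\<^sub>R axis i 1) *\<^sub>R f x \<partial>lborel) - (\<integral>x. \<phi> (x + s *\<^sub>R axis i 1) *\<^sub>R f x \<partial>lborel)) /\<^sub>R (y n - s)"
      using test_mult_integrable(1)[OF test_function_translate(1)[OF \<phi>] f] by simp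
    finally show ?thesis .
  qed
  ultimately show "((\<lambda>y. ((\<integral>x. \<phi> (x + y *\<^sub>R axis i 1) *\<^sub>R f x \<partial>lborel) - (\<integral>x. \<phi> (x + s *\<^sub>R axis i 1) *\<^sub>R f x \<partial>lborel)) /\<^sub>R (y - s)) \<circ> y)
      \<longlonglongrightarrow> - (\<integral>x. \<phi> (x + s *\<^sub>R axis i 1) *\<^sub>R g x \<partial>lborel)"
    by (simp add: o_def)
qed

lemma translate_pairing_shift:
  assumes f: "f \<in> L2" and \<phi>: "test_function UNIV \<phi>"
  shows "(\<integral>x. of_real (\<phi> x) * (f (x + a) - f x) \<partial>lborel) =
    (\<integral>x. \<phi> (x - a) *\<^sub>R f x \<partial>lborel) - (\<integral>x. \<phi> x *\<^sub>R f x \<partial>lborel)"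
proof -
  have [measurable]: "f \<in> borel_measurable borel" "\<phi> \<in> borel_measurable borel"
    using L2_measurable[OF f] test_function_square_integrable(1)[OF \<phi>] by auto
  have "(\<integral>x. of_real (\<phi> x) * (f (x + a) - f x) \<partial>lborel) = (\<integral>x. \<phi> x *\<^sub>R f (x + a) - \<phi> x *\<^sub>R f x \<partial>lborel)"
    by (intro Bochner_Integration.integral_cong) (auto simp: scaleR_conv_of_real algebra_simps)
  also have "\<dots> = (\<integral>x. \<phi> x *\<^sub>R f (x + a) \<partial>lborel) - (\<integral>x. \<phi> x *\<^sub>R f x \<partial>lborel)"
    by (intro Bochner_Integration.integral_diff test_mult_integrable(1)[OF \<phi>] L2_translate f)
  also have "(\<integral>x. \<phi> x *\<^sub>R f (x + a) \<partial>lborel) = (\<integral>x. \<phi> (x - a) *\<^sub>R f x \<partial>lborel)"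
    using lborel_translate(1)[of "\<lambda>x. \<phi> (x - a) *\<^sub>R f x" a] by simp
  finally show ?thesis .
qed

text \<open>Duality and the mean value inequality: translating \<open>f\<close> by \<open>h\<close>
  amounts to translating the test function by \<open>- h\<close>, and the derivative of that pairing
  is bounded by the L2 norms of \<open>\<phi>\<close> and \<open>g\<close>. The factor 2 is that of
  \<open>l2_le_if_dual_bound\<close>.\<close>

lemma l2_translate_diff:
  assumes f: "f \<in> L2" and g: "g \<in> L2" and wp: "weak_partial i f g"
  shows "l2 (\<lambda>x. f (x + h *\<^sub>R axis i 1) - f x) \<le> 2 * (\<bar>h\<bar> * l2 g)"
proof (rule l2_le_if_dual_bound)
  show "(\<lambda>x. f (x + h *\<^sub>R axis i 1) - f x) \<in> L2" by (intro L2_diff L2_translate f)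
  show "0 \<le> \<bar>h\<bar> * l2 g" by (simp add: l2_nonneg)
  fix \<phi> :: "real^3 \<Rightarrow> real" assume \<phi>: "test_function UNIV \<phi>"
  define F where "F = (\<lambda>h. \<integral>x. \<phi> (x + h *\<^sub>R axis i 1) *\<^sub>R f x \<partial>lborel)"
  define B where "B = l2 (\<lambda>x. of_real (\<phi> x)) * l2 g"
  have "norm (F (- h) - F 0) \<le> B * norm (- h - 0)"
  proof (rule differentiable_bound[of UNIV])
    fix s
    define D where "D = - (\<integral>x. \<phi> (x + s *\<^sub>R axis i 1) *\<^sub>R g x \<partial>lborel)"
    show "(F has_derivative (\<lambda>h. h *\<^sub>R D)) (at s within UNIV)"
      using translate_pairing_derivative[OF f wp \<phi>, of s] by (simp add: has_vector_derivative_def F_def D_def)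
    have "norm D = cmod (\<integral>x. of_real (\<phi> (x + s *\<^sub>R axis i 1)) * g x \<partial>lborel)"
      by (simp add: D_def scaleR_conv_of_real)
    also have "\<dots> \<le> l2 (\<lambda>x. of_real (\<phi> (x + s *\<^sub>R axis i 1))) * l2 g"
      by (intro l2_Cauchy_Schwarz(3) g test_function_L2 test_function_translate(1) \<phi>)
    also have "\<dots> = B" unfolding B_def using L2_translate(2)[OF test_function_L2[OF \<phi>]] by simp
    finally have D: "norm D \<le> B" .
    show "onorm (\<lambda>h. h *\<^sub>R D) \<le> B"
    proof (rule onorm_le)
      show "norm (h *\<^sub>R D) \<le> B * norm h" for h :: real
        using mult_right_mono[OF D, of "\<bar>h\<bar>"] by (simp add: mult.commute)
    qed
  qed auto
  moreover have "(\<integral>x. of_real (\<phi> x) * (f (x + h *\<^sub>R axis i 1) - f x) \<partial>lborel) = F (- h) - F 0"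
    using translate_pairing_shift[OF f \<phi>] by (simp add: F_def)
  ultimately show "cmod (\<integral>x. of_real (\<phi> x) * (f (x + h *\<^sub>R axis i 1) - f x) \<partial>lborel)
      \<le> \<bar>h\<bar> * l2 g * l2 (\<lambda>x. of_real (\<phi> x))"
    by (simp add: B_def mult_ac)
qed

definition diff_quotient :: "3 \<Rightarrow> (real^3 \<Rightarrow> complex) \<Rightarrow> nat \<Rightarrow> real^3 \<Rightarrow> complex" where
  "diff_quotient i f n x = of_real (real (Suc n)) * (f (x + (1 / real (Suc n)) *\<^sub>R axis i 1) - f x)"

lemma diff_quotient_L2:
  assumes f: "f \<in> L2" and g: "g \<in> L2" and wp: "weak_partial i f g"
  shows "diff_quotient i f n \<in> L2" "l2 (diff_quotient i f n) \<le> 2 * l2 g"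
proof -
  show "diff_quotient i f n \<in> L2"
    unfolding diff_quotient_def[abs_def] by (intro L2_cmult L2_diff L2_translate f)
  have "l2 (diff_quotient i f n) = real (Suc n) * l2 (\<lambda>x. f (x + (1 / real (Suc n)) *\<^sub>R axis i 1) - f x)"
    unfolding diff_quotient_def[abs_def] by (subst l2_cmult) (simp only: norm_of_real abs_of_nat)
  also have "\<dots> \<le> real (Suc n) * (2 * (\<bar>1 / real (Suc n)\<bar> * l2 g))"
    by (intro mult_left_mono l2_translate_diff f g wp) simp
  also have "\<dots> = 2 * l2 g" by simp
  finally show "l2 (diff_quotient i f n) \<le> 2 * l2 g" .
qed

text \<open>Shifting \<open>f\<close> forward is shifting the test function backward, hence the
  sequence \<open>- 1 / (n + 1)\<close> and the change of sign.\<close>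

lemma diff_quotient_test_tendsto:
  assumes f: "f \<in> L2" and wp: "weak_partial i f g" and \<phi>: "test_function UNIV \<phi>"
  shows "(\<lambda>n. \<integral>x. of_real (\<phi> x) * diff_quotient i f n x \<partial>lborel) \<longlonglongrightarrow> (\<integral>x. of_real (\<phi> x) * g x \<partial>lborel)"
proof -
  define F where "F = (\<lambda>h. \<integral>x. \<phi> (x + h *\<^sub>R axis i 1) *\<^sub>R f x \<partial>lborel)"
  have "((\<lambda>y. (F y - F 0) /\<^sub>R (y - 0)) \<longlongrightarrow> - (\<integral>x. \<phi> x *\<^sub>R g x \<partial>lborel)) (at 0)"
    using translate_pairing_derivative[OF f wp \<phi>, of 0]
    unfolding has_vector_derivative_iff_tendsto F_def by simp
  moreover have "(\<lambda>n. - (1 / real (Suc n))) \<longlonglongrightarrow> 0"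
    using tendsto_minus[OF LIMSEQ_inverse_real_of_nat] by (simp add: inverse_eq_divide)
  ultimately have "(\<lambda>n. (F (- (1 / real (Suc n))) - F 0) /\<^sub>R (- (1 / real (Suc n)))) \<longlonglongrightarrow> - (\<integral>x. \<phi> x *\<^sub>R g x \<partial>lborel)"
    unfolding tendsto_at_iff_sequentially o_def by (elim allE[of _ "\<lambda>n. - (1 / real (Suc n))"]) auto
  from tendsto_minus[OF this]
  have "(\<lambda>n. - ((F (- (1 / real (Suc n))) - F 0) /\<^sub>R (- (1 / real (Suc n))))) \<longlonglongrightarrow> (\<integral>x. \<phi> x *\<^sub>R g x \<partial>lborel)"
    by (simp only: minus_minus)
  moreover have "- (z /\<^sub>R (- (1 / real (Suc n)))) = real (Suc n) *\<^sub>R z" for z :: complex and n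
    by (simp del: of_nat_Suc)
  ultimately have "(\<lambda>n. real (Suc n) *\<^sub>R (F (- (1 / real (Suc n))) - F 0)) \<longlonglongrightarrow> (\<integral>x. \<phi> x *\<^sub>R g x \<partial>lborel)"
    by (simp only:)
  moreover have "(\<integral>x. of_real (\<phi> x) * diff_quotient i f n x \<partial>lborel) =
      real (Suc n) *\<^sub>R (F (- (1 / real (Suc n))) - F 0)" for n
  proof -
    have "(\<integral>x. of_real (\<phi> x) * diff_quotient i f n x \<partial>lborel) =
        (\<integral>x. of_real (real (Suc n)) * (of_real (\<phi> x) * (f (x + (1 / real (Suc n)) *\<^sub>R axis i 1) - f x)) \<partial>lborel)"
      by (intro Bochner_Integration.integral_cong) (auto simp: diff_quotient_def algebra_simps)
    also have "\<dots> = of_real (real (Suc n)) * (F (- (1 / real (Suc n))) - F 0)"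
      unfolding F_def using translate_pairing_shift[OF f \<phi>] by simp
    finally show ?thesis by (simp only: scaleR_conv_of_real)
  qed
  ultimately show ?thesis by (simp add: scaleR_conv_of_real)
qed

text \<open>Weak convergence: the quotients are bounded by \<open>2 * l2 g\<close> and converge when
  paired with test functions, which are dense.\<close>

lemma diff_quotient_tendsto:
  assumes f: "f \<in> L2" and g: "g \<in> L2" and wp: "weak_partial i f g" and w: "w \<in> L2"
  shows "(\<lambda>n. \<integral>x. w x * diff_quotient i f n x \<partial>lborel) \<longlonglongrightarrow> (\<integral>x. w x * g x \<partial>lborel)"
proof (rule LIMSEQ_I)
  fix e :: real assume e: "e > 0"
  \<comment> \<open>Twice \<open>l2 g\<close> for the quotient and once for its limit; the added 1
    keeps \<open>B\<close> positive.\<close>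
  define B where "B = 3 * l2 g + 1"
  define d where "d = e / (2 * B)"
  have pos: "B > 0" using l2_nonneg[of g] by (simp add: B_def)
  have d: "d > 0" using e pos by (simp add: d_def)
  obtain \<phi> \<eta> where t: "test_function UNIV \<phi>" "test_function UNIV \<eta>"
    and l: "l2 (\<lambda>x. w x - (of_real (\<phi> x) + \<i> * of_real (\<eta> x))) < d"
    using test_functions_dense_L2[OF w d] by blast
  define s where "s = (\<lambda>x. complex_of_real (\<phi> x) + \<i> * of_real (\<eta> x))"
  note tL = test_function_L2[OF t(1)] test_function_L2[OF t(2)]
  have sL: "s \<in> L2" unfolding s_def by (intro L2_add L2_cmult tL)
  have wsL: "(\<lambda>x. w x - s x) \<in> L2" by (intro L2_diff w sL)
  have split: "(\<integral>x. s x * q x \<partial>lborel) = (\<integral>x. of_real (\<phi> x) * q x \<partial>lborel) + \<i> * (\<integral>x. of_real (\<eta> x) * q x \<partial>lborel)"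
    if q: "q \<in> L2" for q
  proof -
    have "(\<integral>x. s x * q x \<partial>lborel) = (\<integral>x. of_real (\<phi> x) * q x + \<i> * (of_real (\<eta> x) * q x) \<partial>lborel)"
      by (intro Bochner_Integration.integral_cong) (auto simp: s_def algebra_simps)
    then show ?thesis using L2_mult_integrable[OF tL(1) q] L2_mult_integrable[OF tL(2) q] by simp
  qed
  note q = diff_quotient_L2[OF f g wp]
  have "(\<lambda>n. \<integral>x. s x * diff_quotient i f n x \<partial>lborel) \<longlonglongrightarrow> (\<integral>x. s x * g x \<partial>lborel)"
    unfolding split[OF q(1)] split[OF g]
    by (intro tendsto_intros diff_quotient_test_tendsto f wp t)
  then have "\<exists>N. \<forall>n\<ge>N. cmod ((\<integral>x. s x * diff_quotient i f n x \<partial>lborel) - (\<integral>x. s x * g x \<partial>lborel)) < e / 2"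
    by (rule LIMSEQ_D) (use e in simp)
  then obtain N where N: "\<And>n. n \<ge> N \<Longrightarrow> cmod ((\<integral>x. s x * diff_quotient i f n x \<partial>lborel) - (\<integral>x. s x * g x \<partial>lborel)) < e / 2"
    by blast
  have dec: "(\<integral>x. w x * q x \<partial>lborel) = (\<integral>x. (w x - s x) * q x \<partial>lborel) + (\<integral>x. s x * q x \<partial>lborel)" if q: "q \<in> L2" for q
  proof -
    have "(\<integral>x. w x * q x \<partial>lborel) = (\<integral>x. (w x - s x) * q x + s x * q x \<partial>lborel)"
      by (intro Bochner_Integration.integral_cong) (auto simp: algebra_simps)
    then show ?thesis using L2_mult_integrable[OF wsL q] L2_mult_integrable[OF sL q] by simp
  qed
  have small: "cmod (\<integral>x. (w x - s x) * q x \<partial>lborel) \<le> d * B" if "q \<in> L2" "l2 q \<le> B" for q B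
  proof -
    have "cmod (\<integral>x. (w x - s x) * q x \<partial>lborel) \<le> l2 (\<lambda>x. w x - s x) * l2 q"
      by (rule l2_Cauchy_Schwarz(3)[OF wsL that(1)])
    also have "\<dots> \<le> d * B" using l that d l2_nonneg by (intro mult_mono) (auto simp: s_def)
    finally show ?thesis .
  qed
  show "\<exists>no. \<forall>n\<ge>no. norm ((\<integral>x. w x * diff_quotient i f n x \<partial>lborel) - (\<integral>x. w x * g x \<partial>lborel)) < e"
  proof (intro exI[of _ N] allI impI)
    fix n assume n: "N \<le> n"
    define a b where "a = (\<integral>x. (w x - s x) * diff_quotient i f n x \<partial>lborel)" and "b = (\<integral>x. (w x - s x) * g x \<partial>lborel)"
    define c where "c = (\<integral>x. s x * diff_quotient i f n x \<partial>lborel) - (\<integral>x. s x * g x \<partial>lborel)"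
    have "(\<integral>x. w x * diff_quotient i f n x \<partial>lborel) - (\<integral>x. w x * g x \<partial>lborel) = (a - b) + c"
      unfolding dec[OF q(1)] dec[OF g] a_def b_def c_def by simp
    then have "cmod ((\<integral>x. w x * diff_quotient i f n x \<partial>lborel) - (\<integral>x. w x * g x \<partial>lborel)) \<le> cmod a + cmod b + cmod c"
      using norm_triangle_ineq[of "a - b" c] norm_triangle_ineq4[of a b] by simp
    also have "cmod a + cmod b \<le> d * (2 * l2 g) + d * l2 g"
      unfolding a_def b_def by (intro add_mono small q g order_refl)
    also have "\<dots> = d * (3 * l2 g)" by (simp add: algebra_simps)
    also have "\<dots> \<le> d * B" using d by (intro mult_left_mono) (auto simp: B_def)
    also have "\<dots> = e / 2" using pos by (simp add: d_def)
    finally show "norm ((\<integral>x. w x * diff_quotient i f n x \<partial>lborel) - (\<integral>x. w x * g x \<partial>lborel)) < e"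
      using N[OF n] by (simp add: c_def)
  qed
qed

text \<open>A weakly convergent bounded sequence is paired with a strongly convergent one.\<close>

lemma diff_quotient_tendsto_moving:
  assumes f: "f \<in> L2" and g: "g \<in> L2" and wp: "weak_partial i f g"
    and w: "w \<in> L2" "\<And>n. W n \<in> L2" "(\<lambda>n. l2 (\<lambda>x. W n x - w x)) \<longlonglongrightarrow> 0"
  shows "(\<lambda>n. \<integral>x. W n x * diff_quotient i f n x \<partial>lborel) \<longlonglongrightarrow> (\<integral>x. w x * g x \<partial>lborel)"
proof -
  note q = diff_quotient_L2[OF f g wp]
  have diffL: "(\<lambda>x. W n x - w x) \<in> L2" for n by (intro L2_diff w)
  have "(\<lambda>n. \<integral>x. (W n x - w x) * diff_quotient i f n x \<partial>lborel) \<longlonglongrightarrow> 0"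
  proof (rule Lim_null_comparison)
    show "\<forall>\<^sub>F n in sequentially. norm (\<integral>x. (W n x - w x) * diff_quotient i f n x \<partial>lborel) \<le> l2 (\<lambda>x. W n x - w x) * (2 * l2 g)"
    proof (intro always_eventually allI)
      fix n
      have "cmod (\<integral>x. (W n x - w x) * diff_quotient i f n x \<partial>lborel) \<le> l2 (\<lambda>x. W n x - w x) * l2 (diff_quotient i f n)"
        by (rule l2_Cauchy_Schwarz(3)[OF diffL q(1)])
      also have "\<dots> \<le> l2 (\<lambda>x. W n x - w x) * (2 * l2 g)"
        using q(2) by (intro mult_left_mono) (auto simp: l2_nonneg)
      finally show "norm (\<integral>x. (W n x - w x) * diff_quotient i f n x \<partial>lborel) \<le> l2 (\<lambda>x. W n x - w x) * (2 * l2 g)" .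
    qed
    show "(\<lambda>n. l2 (\<lambda>x. W n x - w x) * (2 * l2 g)) \<longlonglongrightarrow> 0"
      using tendsto_mult_right[OF w(3), of "2 * l2 g"] by simp
  qed
  from tendsto_add[OF this diff_quotient_tendsto[OF f g wp w(1)]]
  have "(\<lambda>n. (\<integral>x. (W n x - w x) * diff_quotient i f n x \<partial>lborel) + (\<integral>x. w x * diff_quotient i f n x \<partial>lborel)) \<longlonglongrightarrow> (\<integral>x. w x * g x \<partial>lborel)"
    by simp
  moreover have "(\<integral>x. W n x * diff_quotient i f n x \<partial>lborel) =
      (\<integral>x. (W n x - w x) * diff_quotient i f n x \<partial>lborel) + (\<integral>x. w x * diff_quotient i f n x \<partial>lborel)" for n
  proof -
    have "(\<integral>x. W n x * diff_quotient i f n x \<partial>lborel) = (\<integral>x. (W n x - w x) * diff_quotient i f n x + w x * diff_quotient i f n x \<partial>lborel)"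
      by (intro Bochner_Integration.integral_cong) (auto simp: algebra_simps)
    then show ?thesis using L2_mult_integrable[OF diffL q(1)] L2_mult_integrable[OF w(1) q(1)] by simp
  qed
  ultimately show ?thesis by simp
qed

text \<open>Enlarges the class of weights from test functions to compactly supported ones with a
  bounded derivative along the axis. Integration by parts is exact for difference quotients, by
  translation invariance, and both sides pass to the limit.\<close>

lemma weak_partial_test_compact:
  assumes u: "u \<in> L2" and u': "u' \<in> L2" and wp: "weak_partial i u u'"
    and X: "line_derivative i X X'" "\<And>x. \<bar>X' x\<bar> \<le> C" "\<And>x. norm x > r \<Longrightarrow> X x = 0"
    and cont: "continuous_on UNIV X" and meas: "X' \<in> borel_measurable borel"
  shows "(\<integral>x. X' x *\<^sub>R u x \<partial>lborel) = - (\<integral>x. X x *\<^sub>R u' x \<partial>lborel)"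
proof -
  have Xm: "X \<in> borel_measurable borel" using cont by (rule borel_measurable_continuous_onI)
  have [measurable]: "X \<in> borel_measurable borel" "u \<in> borel_measurable borel"
    using Xm L2_measurable[OF u] by auto
  have XL: "(\<lambda>x. complex_of_real (X x)) \<in> L2"
    by (rule continuous_compact_support_L2[OF cont compact_cball[of 0 r]]) (auto intro: X(3))
  define h where "h = (\<lambda>n. - (1 / real (Suc n)))"
  have "h \<longlonglongrightarrow> 0"
    using tendsto_minus[OF LIMSEQ_inverse_real_of_nat] by (simp add: h_def inverse_eq_divide)
  have lim1: "(\<lambda>n. \<integral>x. ((X (x + h n *\<^sub>R axis i 1) - X x) / h n) *\<^sub>R u x \<partial>lborel) \<longlonglongrightarrow> (\<integral>x. X' x *\<^sub>R u x \<partial>lborel)"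
    by (rule compact_line_quotient_tendsto[OF u X(1,2) Xm meas X(3) \<open>h \<longlonglongrightarrow> 0\<close>]) (auto simp: h_def)
  have "(\<integral>x. of_real (X x) * diff_quotient i u n x \<partial>lborel) =
      - (\<integral>x. ((X (x + h n *\<^sub>R axis i 1) - X x) / h n) *\<^sub>R u x \<partial>lborel)" for n
  proof -
    define m where "m = real (Suc n)"
    have m: "m > 0" by (simp add: m_def)
    have i1: "integrable lborel (\<lambda>x. of_real (X x) * u (x + (1 / m) *\<^sub>R axis i 1))"
      "integrable lborel (\<lambda>x. of_real (X x) * u x)"
      by (intro L2_mult_integrable XL L2_translate u)+
    have i2: "integrable lborel (\<lambda>x. of_real (X (x + h n *\<^sub>R axis i 1)) * u x)"
      by (intro L2_mult_integrable L2_translate(1)[OF XL] u)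
    have "(\<integral>x. of_real (X x) * diff_quotient i u n x \<partial>lborel) =
        (\<integral>x. of_real m * (of_real (X x) * u (x + (1 / m) *\<^sub>R axis i 1) - of_real (X x) * u x) \<partial>lborel)"
      by (intro Bochner_Integration.integral_cong) (auto simp: diff_quotient_def m_def algebra_simps)
    also have "\<dots> = of_real m * ((\<integral>x. of_real (X x) * u (x + (1 / m) *\<^sub>R axis i 1) \<partial>lborel) - (\<integral>x. of_real (X x) * u x \<partial>lborel))"
      using i1 by simp
    also have "(\<integral>x. of_real (X x) * u (x + (1 / m) *\<^sub>R axis i 1) \<partial>lborel) =
        (\<integral>x. of_real (X (x + h n *\<^sub>R axis i 1)) * u x \<partial>lborel)"
      using lborel_translate(1)[of "\<lambda>x. of_real (X (x + h n *\<^sub>R axis i 1)) * u x" "(1 / m) *\<^sub>R axis i 1"]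
      by (simp add: h_def m_def)
    also have "of_real m * ((\<integral>x. of_real (X (x + h n *\<^sub>R axis i 1)) * u x \<partial>lborel) - (\<integral>x. of_real (X x) * u x \<partial>lborel)) =
        (\<integral>x. of_real m * (of_real (X (x + h n *\<^sub>R axis i 1)) * u x - of_real (X x) * u x) \<partial>lborel)"
      using i1(2) i2 by simp
    also have "\<dots> = (\<integral>x. - (((X (x + h n *\<^sub>R axis i 1) - X x) / h n) *\<^sub>R u x) \<partial>lborel)"
      by (intro Bochner_Integration.integral_cong) (auto simp: h_def m_def scaleR_conv_of_real algebra_simps)
    finally show ?thesis by simp
  qed
  then have "(\<lambda>n. \<integral>x. of_real (X x) * diff_quotient i u n x \<partial>lborel) \<longlonglongrightarrow> - (\<integral>x. X' x *\<^sub>R u x \<partial>lborel)"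
    using tendsto_minus[OF lim1] by simp
  from LIMSEQ_unique[OF diff_quotient_tendsto[OF u u' wp XL] this] show ?thesis
    by (simp add: scaleR_conv_of_real minus_equation_iff)
qed

text \<open>Discrete Leibniz rule: the quotient of \<open>u v\<close> is the shifted
  \<open>v\<close> times the quotient of \<open>u\<close>, plus \<open>u\<close> times the quotient
  of \<open>v\<close>. The first term pairs a weakly convergent quotient with the strongly
  convergent \<open>W n\<close>. Integrability of \<open>u v\<close> provides the dominating
  function for a weight that is merely bounded with bounded derivative.\<close>

lemma weak_partial_product:
  assumes u: "u \<in> L2" "u' \<in> L2" "weak_partial i u u'" and v: "v \<in> L2" "v' \<in> L2" "weak_partial i v v'"
    and X: "line_derivative i X X'" "\<And>x. \<bar>X' x\<bar> \<le> C'" "\<And>x. \<bar>X x\<bar> \<le> C"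
    and Xm [measurable]: "X \<in> borel_measurable borel" "X' \<in> borel_measurable borel"
  shows "(\<integral>x. X' x *\<^sub>R (u x * v x) \<partial>lborel) = - (\<integral>x. X x *\<^sub>R (u' x * v x + u x * v' x) \<partial>lborel)"
proof -
  have [measurable]: "u \<in> borel_measurable borel" "v \<in> borel_measurable borel"
    using u(1) v(1) by (auto intro: L2_measurable)
  define h where "h = (\<lambda>n. - (1 / real (Suc n)))"
  have h: "h \<longlonglongrightarrow> 0" "\<And>n. h n \<noteq> 0"
    using tendsto_minus[OF LIMSEQ_inverse_real_of_nat] by (simp_all add: h_def inverse_eq_divide)
  have lim1: "(\<lambda>n. \<integral>x. ((X (x + h n *\<^sub>R axis i 1) - X x) / h n) *\<^sub>R (u x * v x) \<partial>lborel) \<longlonglongrightarrow>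
      (\<integral>x. X' x *\<^sub>R (u x * v x) \<partial>lborel)"
  proof (rule integral_dominated_convergence)
    show "integrable lborel (\<lambda>x. C' * (cmod (u x) * cmod (v x)))"
      using l2_Cauchy_Schwarz(1)[OF u(1) v(1)] by simp
    show "AE x in lborel. (\<lambda>n. ((X (x + h n *\<^sub>R axis i 1) - X x) / h n) *\<^sub>R (u x * v x)) \<longlonglongrightarrow> X' x *\<^sub>R (u x * v x)"
      by (intro AE_I2 tendsto_scaleR line_derivative_quotient[OF X(1) h] tendsto_const)
    fix n
    have "\<bar>(X (x + h n *\<^sub>R axis i 1) - X x) / h n\<bar> \<le> C'" for x
      using line_derivative_bound[OF X(1,2), of x "h n"] h(2)[of n] by (simp add: abs_divide divide_le_eq)
    then have "\<bar>(X (x + h n *\<^sub>R axis i 1) - X x) / h n\<bar> * cmod (u x * v x) \<le> C' * cmod (u x * v x)" for x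
      by (rule mult_right_mono) simp
    then show "AE x in lborel. norm (((X (x + h n *\<^sub>R axis i 1) - X x) / h n) *\<^sub>R (u x * v x)) \<le> C' * (cmod (u x) * cmod (v x))"
      by (simp add: norm_mult)
  qed measurable
  define W where "W = (\<lambda>n x. of_real (X x) * v (x + (1 / real (Suc n)) *\<^sub>R axis i 1))"
  have W: "W n \<in> L2" for n unfolding W_def by (intro L2_bounded_mult[OF _ _ X(3)] L2_translate v) simp
  have Xv: "(\<lambda>x. of_real (X x) * v x) \<in> L2" by (intro L2_bounded_mult[OF _ _ X(3)] v) simp
  have Xu: "(\<lambda>x. of_real (X x) * u x) \<in> L2" by (intro L2_bounded_mult[OF _ _ X(3)] u) simp
  have C: "0 \<le> C" using X(3)[of 0] by linarith
  have "(\<lambda>n. l2 (\<lambda>x. W n x - of_real (X x) * v x)) \<longlonglongrightarrow> 0"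
  proof (rule Lim_null_comparison)
    show "\<forall>\<^sub>F n in sequentially. norm (l2 (\<lambda>x. W n x - of_real (X x) * v x)) \<le> C * (2 * l2 v') * inverse (real (Suc n))"
    proof (intro always_eventually allI)
      fix n
      have "l2 (\<lambda>x. W n x - of_real (X x) * v x) = l2 (\<lambda>x. of_real (X x) * (v (x + (1 / real (Suc n)) *\<^sub>R axis i 1) - v x))"
        by (simp add: W_def algebra_simps)
      also have "\<dots> \<le> C * l2 (\<lambda>x. v (x + (1 / real (Suc n)) *\<^sub>R axis i 1) - v x)"
        by (intro L2_bounded_mult(2)[OF _ _ X(3)] L2_diff L2_translate v) simp
      also have "\<dots> \<le> C * (2 * (\<bar>1 / real (Suc n)\<bar> * l2 v'))"
        by (intro mult_left_mono l2_translate_diff v C)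
      also have "\<dots> = C * (2 * l2 v') * inverse (real (Suc n))" by (simp add: divide_inverse mult_ac)
      finally show "norm (l2 (\<lambda>x. W n x - of_real (X x) * v x)) \<le> C * (2 * l2 v') * inverse (real (Suc n))"
        by (simp add: l2_nonneg)
    qed
    show "(\<lambda>n. C * (2 * l2 v') * inverse (real (Suc n))) \<longlonglongrightarrow> 0"
      using tendsto_mult_left[OF LIMSEQ_inverse_real_of_nat, of "C * (2 * l2 v')"] by simp
  qed
  from tendsto_add[OF diff_quotient_tendsto_moving[OF u Xv W this] diff_quotient_tendsto[OF v Xu]]
  have lim2: "(\<lambda>n. (\<integral>x. W n x * diff_quotient i u n x \<partial>lborel) + (\<integral>x. of_real (X x) * u x * diff_quotient i v n x \<partial>lborel))
      \<longlonglongrightarrow> (\<integral>x. of_real (X x) * v x * u' x \<partial>lborel) + (\<integral>x. of_real (X x) * u x * v' x \<partial>lborel)" .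
  have id: "(\<integral>x. W n x * diff_quotient i u n x \<partial>lborel) + (\<integral>x. of_real (X x) * u x * diff_quotient i v n x \<partial>lborel) =
      - (\<integral>x. ((X (x + h n *\<^sub>R axis i 1) - X x) / h n) *\<^sub>R (u x * v x) \<partial>lborel)" for n
  proof -
    define m where "m = real (Suc n)"
    have m: "m > 0" by (simp add: m_def)
    define e where "e = (1 / m) *\<^sub>R (axis i 1 :: real^3)"
    have i1: "integrable lborel (\<lambda>x. of_real (X x) * u x * v x)"
      by (intro L2_mult_integrable Xu v)
    have i2: "integrable lborel (\<lambda>x. of_real (X x) * (u (x + e) * v (x + e)))"
      using L2_mult_integrable[OF L2_bounded_mult(1)[OF L2_translate(1)[OF u(1)] Xm(1) X(3)] L2_translate(1)[OF v(1)]]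
      by (simp add: mult.assoc)
    have i3: "integrable lborel (\<lambda>x. of_real (X (x - e)) * (u x * v x))"
      using lborel_translate(2)[of "\<lambda>x. of_real (X (x - e)) * (u x * v x)" e] i2 by simp
    have "(\<integral>x. W n x * diff_quotient i u n x \<partial>lborel) + (\<integral>x. of_real (X x) * u x * diff_quotient i v n x \<partial>lborel) =
        (\<integral>x. W n x * diff_quotient i u n x + of_real (X x) * u x * diff_quotient i v n x \<partial>lborel)"
      by (intro Bochner_Integration.integral_add[symmetric] L2_mult_integrable W Xu diff_quotient_L2(1)[OF u] diff_quotient_L2(1)[OF v])
    also have "\<dots> = (\<integral>x. of_real m * (of_real (X x) * (u (x + e) * v (x + e)) - of_real (X x) * u x * v x) \<partial>lborel)"
      by (intro Bochner_Integration.integral_cong) (auto simp: W_def diff_quotient_def m_def e_def algebra_simps)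
    also have "\<dots> = of_real m * ((\<integral>x. of_real (X x) * (u (x + e) * v (x + e)) \<partial>lborel) - (\<integral>x. of_real (X x) * u x * v x \<partial>lborel))"
      using i1 i2 by simp
    also have "(\<integral>x. of_real (X x) * (u (x + e) * v (x + e)) \<partial>lborel) = (\<integral>x. of_real (X (x - e)) * (u x * v x) \<partial>lborel)"
      using lborel_translate(1)[of "\<lambda>x. of_real (X (x - e)) * (u x * v x)" e] by simp
    also have "of_real m * ((\<integral>x. of_real (X (x - e)) * (u x * v x) \<partial>lborel) - (\<integral>x. of_real (X x) * u x * v x \<partial>lborel)) =
        (\<integral>x. of_real m * (of_real (X (x - e)) * (u x * v x) - of_real (X x) * u x * v x) \<partial>lborel)"
      using i1 i3 by simp
    also have "\<dots> = (\<integral>x. - (((X (x + h n *\<^sub>R axis i 1) - X x) / h n) *\<^sub>R (u x * v x)) \<partial>lborel)"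
      by (intro Bochner_Integration.integral_cong) (auto simp: h_def m_def e_def scaleR_conv_of_real algebra_simps)
    finally show ?thesis by simp
  qed
  have "(\<integral>x. of_real (X x) * v x * u' x \<partial>lborel) + (\<integral>x. of_real (X x) * u x * v' x \<partial>lborel) =
      - (\<integral>x. X' x *\<^sub>R (u x * v x) \<partial>lborel)"
    using LIMSEQ_unique[OF lim2[unfolded id] tendsto_minus[OF lim1]] .
  moreover have "(\<integral>x. of_real (X x) * v x * u' x \<partial>lborel) + (\<integral>x. of_real (X x) * u x * v' x \<partial>lborel) =
      (\<integral>x. of_real (X x) * v x * u' x + of_real (X x) * u x * v' x \<partial>lborel)"
    by (intro Bochner_Integration.integral_add[symmetric] L2_mult_integrable Xu Xv u v)
  moreover have "\<dots> = (\<integral>x. X x *\<^sub>R (u' x * v x + u x * v' x) \<partial>lborel)"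
    by (intro Bochner_Integration.integral_cong) (auto simp: scaleR_conv_of_real algebra_simps)
  ultimately show ?thesis by simp
qed

lemma weak_partial_cnj:
  assumes "weak_partial i f g"
  shows "weak_partial i (\<lambda>x. cnj (f x)) (\<lambda>x. cnj (g x))"
  unfolding weak_partial_def
proof (intro allI impI)
  fix \<phi> :: "real^3 \<Rightarrow> real" assume \<phi>: "test_function UNIV \<phi>"
  have c: "(\<integral>x. r x *\<^sub>R cnj (h x) \<partial>lborel) = cnj (\<integral>x. r x *\<^sub>R h x \<partial>lborel)"
    for r :: "real^3 \<Rightarrow> real" and h
    by (subst Bochner_Integration.integral_cnj[symmetric]) simp
  show "(\<integral>x. partial_deriv i \<phi> x *\<^sub>R cnj (f x) \<partial>lborel) = - (\<integral>x. \<phi> x *\<^sub>R cnj (g x) \<partial>lborel)"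
    using assms \<phi> by (simp add: c weak_partial_def)
qed

subsection \<open>Hardy's inequality\<close>

lemma line_inner:
  fixes x y :: "real^3"
  shows "(x + h *\<^sub>R axis i 1 - y) \<bullet> (x + h *\<^sub>R axis i 1 - y) = (x - y) \<bullet> (x - y) + 2 * h * (x - y) $ i + h\<^sup>2"
    and "(x + h *\<^sub>R axis i 1 - y) $ i = (x - y) $ i + h"
proof -
  have eq: "x + h *\<^sub>R axis i 1 - y = (x - y) + h *\<^sub>R axis i 1" by simp
  show "(x + h *\<^sub>R axis i 1 - y) \<bullet> (x + h *\<^sub>R axis i 1 - y) = (x - y) \<bullet> (x - y) + 2 * h * (x - y) $ i + h\<^sup>2"
    unfolding eq by (simp add: inner_add_left inner_add_right inner_axis inner_axis' power2_eq_square distrib_left)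
  show "(x + h *\<^sub>R axis i 1 - y) $ i = (x - y) $ i + h" unfolding eq by (simp add: axis_def)
qed

text \<open>A regularisation of the field \<open>z / |z|^2\<close>, whose divergence in three
  dimensions is \<open>1 / |z|^2\<close>.\<close>

definition hardy_field :: "real \<Rightarrow> 3 \<Rightarrow> real^3 \<Rightarrow> real" where
  "hardy_field e i z = z $ i / (z \<bullet> z + e\<^sup>2)"

definition hardy_field_deriv :: "real \<Rightarrow> 3 \<Rightarrow> real^3 \<Rightarrow> real" where
  "hardy_field_deriv e i z = 1 / (z \<bullet> z + e\<^sup>2) - 2 * (z $ i)\<^sup>2 / (z \<bullet> z + e\<^sup>2)\<^sup>2"

lemma denom_pos: "e > 0 \<Longrightarrow> (z::real^3) \<bullet> z + e\<^sup>2 > 0"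
  by (simp add: add_nonneg_pos)

lemma hardy_field_line_derivative:
  assumes e: "e > 0"
  shows "line_derivative i (\<lambda>x. hardy_field e i (x - y)) (\<lambda>x. hardy_field_deriv e i (x - y))"
  unfolding line_derivative_def
proof (intro allI)
  fix x s
  define b c where "b = (x - y) $ i" and "c = (x - y) \<bullet> (x - y) + e\<^sup>2"
  have pos: "c + 2 * s * b + s\<^sup>2 > 0"
    using denom_pos[OF e, of "x + s *\<^sub>R axis i 1 - y"] by (simp add: line_inner b_def c_def)
  have "((\<lambda>h. (b + h) / (c + 2 * h * b + h\<^sup>2)) has_real_derivative
      ((c + 2 * s * b + s\<^sup>2) - (b + s) * (2 * b + 2 * s)) / (c + 2 * s * b + s\<^sup>2)\<^sup>2) (at s)"
    using pos by (auto intro!: derivative_eq_intros simp: power2_eq_square)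
  moreover have "((c + 2 * s * b + s\<^sup>2) - (b + s) * (2 * b + 2 * s)) / (c + 2 * s * b + s\<^sup>2)\<^sup>2 =
      1 / (c + 2 * s * b + s\<^sup>2) - 2 * (b + s)\<^sup>2 / (c + 2 * s * b + s\<^sup>2)\<^sup>2"
  proof -
    define q where "q = c + 2 * s * b + s\<^sup>2"
    have "q \<noteq> 0" using pos by (simp add: q_def)
    moreover have "(b + s) * (2 * b + 2 * s) = 2 * (b + s)\<^sup>2" by (simp add: power2_eq_square algebra_simps)
    ultimately show ?thesis unfolding q_def[symmetric] by (simp add: diff_divide_distrib power2_eq_square)
  qed
  ultimately show "((\<lambda>h. hardy_field e i (x + h *\<^sub>R axis i 1 - y)) has_real_derivative
      hardy_field_deriv e i (x + s *\<^sub>R axis i 1 - y)) (at s)"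
    unfolding hardy_field_def hardy_field_deriv_def line_inner
    by (simp add: b_def c_def add.assoc add.commute add.left_commute)
qed

lemma component_square_le: "(z $ i)\<^sup>2 \<le> (z::real^3) \<bullet> z"
  using component_le_norm_cart[of z i] by (simp add: dot_square_norm abs_le_square_iff[symmetric])

lemma hardy_field_bounds:
  assumes e: "e > 0"
  shows "\<bar>hardy_field e i z\<bar> \<le> 1 / sqrt (z \<bullet> z + e\<^sup>2)" "\<bar>hardy_field e i z\<bar> \<le> 1 / e"
    "\<bar>hardy_field_deriv e i z\<bar> \<le> 3 / e\<^sup>2"
proof -
  define q where "q = z \<bullet> z + e\<^sup>2"
  have q: "q > 0" "q \<ge> e\<^sup>2" using denom_pos[OF e, of z] by (auto simp: q_def)
  have q3: "(z $ i)\<^sup>2 \<le> q"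
    using component_square_le[of z i] zero_le_power2[of e] unfolding q_def by linarith
  have sq: "sqrt q \<ge> e" using q(2) e by (simp add: real_le_rsqrt)
  have "\<bar>z $ i\<bar> \<le> sqrt q" using q3 by (simp add: real_le_rsqrt)
  then have "\<bar>z $ i\<bar> / q \<le> sqrt q / q" using q(1) by (simp add: divide_right_mono)
  also have "\<dots> = 1 / sqrt q" using q(1) by (simp add: real_div_sqrt field_simps)
  finally have 1: "\<bar>hardy_field e i z\<bar> \<le> 1 / sqrt q"
    using q(1) by (simp add: hardy_field_def q_def[symmetric] abs_divide)
  then show "\<bar>hardy_field e i z\<bar> \<le> 1 / sqrt (z \<bullet> z + e\<^sup>2)" by (simp add: q_def)
  have "1 / sqrt q \<le> 1 / e" using sq e q(1) by (intro divide_left_mono) auto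
  with 1 show "\<bar>hardy_field e i z\<bar> \<le> 1 / e" by linarith
  have iq: "1 / q \<le> 1 / e\<^sup>2" using q e by (intro divide_left_mono) auto
  have "(z $ i)\<^sup>2 / q\<^sup>2 \<le> q / q\<^sup>2" using q3 by (intro divide_right_mono) auto
  also have "\<dots> = 1 / q" using q by (simp add: power2_eq_square)
  finally have "(z $ i)\<^sup>2 / q\<^sup>2 \<le> 1 / q" .
  moreover have "0 \<le> (z $ i)\<^sup>2 / q\<^sup>2" by simp
  moreover have "hardy_field_deriv e i z = 1 / q - 2 * ((z $ i)\<^sup>2 / q\<^sup>2)" by (simp add: hardy_field_deriv_def q_def)
  moreover have "3 / e\<^sup>2 = 3 * (1 / e\<^sup>2)" by simp
  moreover have "0 < 1 / q" using q by simp
  ultimately show "\<bar>hardy_field_deriv e i z\<bar> \<le> 3 / e\<^sup>2" using iq by linarith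
qed

text \<open>With \<open>q\<close> the denominator, the divergence is
  \<open>3 / q - 2 * (z \<bullet> z) / q^2\<close>, and \<open>z \<bullet> z \<le> q\<close>. The 3
  is the dimension, which leaves \<open>1 / q\<close>.\<close>

lemma hardy_field_divergence:
  assumes e: "e > 0"
  shows "1 / (z \<bullet> z + e\<^sup>2) \<le> (\<Sum>i\<in>UNIV. hardy_field_deriv e i z)"
proof -
  define q where "q = z \<bullet> z + e\<^sup>2"
  have q: "q > 0" "z \<bullet> z \<le> q" using denom_pos[OF e, of z] by (auto simp: q_def)
  have zz: "(\<Sum>i\<in>UNIV. (z $ i)\<^sup>2) = z \<bullet> z" by (simp add: inner_vec_def power2_eq_square)
  have "(\<Sum>i\<in>UNIV. hardy_field_deriv e i z) = 3 / q - 2 * ((z \<bullet> z) / q\<^sup>2)"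
    by (simp add: hardy_field_deriv_def q_def[symmetric] sum_subtractf sum_divide_distrib[symmetric]
        sum_distrib_left[symmetric] zz)
  moreover have "(z \<bullet> z) / q\<^sup>2 \<le> q / q\<^sup>2" using q by (intro divide_right_mono) auto
  moreover have "q / q\<^sup>2 = 1 / q" using q by (simp add: power2_eq_square)
  moreover have "3 / q = 3 * (1 / q)" by simp
  ultimately show ?thesis unfolding q_def[symmetric] by linarith
qed

text \<open>Integrate \<open>(cmod u)^2\<close> against the divergence of the field and move the
  derivatives to \<open>u\<close>. Young's inequality with weight 1/6 in each of the three
  components puts half of the left-hand side on the right; absorbing it doubles 6 to 12. Absorption
  is legitimate because the integral is finite for \<open>e > 0\<close>.\<close>

lemma hardy_regularised:
  assumes u: "u \<in> L2" and g: "\<And>i. g i \<in> L2" "\<And>i. weak_partial i u (g i)" and e: "e > 0"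
  shows "integrable lborel (\<lambda>x. (cmod (u x))\<^sup>2 / ((x - y) \<bullet> (x - y) + e\<^sup>2))"
    and "(\<integral>x. (cmod (u x))\<^sup>2 / ((x - y) \<bullet> (x - y) + e\<^sup>2) \<partial>lborel) \<le> 12 * (\<Sum>i\<in>UNIV. (l2 (g i))\<^sup>2)"
proof -
  have [measurable]: "u \<in> borel_measurable borel" "g i \<in> borel_measurable borel" for i
    using u g(1) by (auto intro: L2_measurable)
  define k where "k = (\<lambda>x. (x - y) \<bullet> (x - y) + e\<^sup>2)"
  have k: "k x > 0" for x using denom_pos[OF e] by (simp add: k_def)
  have [measurable]: "k \<in> borel_measurable borel" by (simp add: k_def)
  have [measurable]: "hardy_field e i \<in> borel_measurable borel" "hardy_field_deriv e i \<in> borel_measurable borel" for i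
    by (simp_all add: hardy_field_def[abs_def] hardy_field_deriv_def[abs_def])
  have usq: "integrable lborel (\<lambda>x. (cmod (u x))\<^sup>2)" by (rule L2_integrable_square[OF u])
  have gsq: "integrable lborel (\<lambda>x. (cmod (g i x))\<^sup>2)" for i by (rule L2_integrable_square[OF g(1)])
  show int: "integrable lborel (\<lambda>x. (cmod (u x))\<^sup>2 / ((x - y) \<bullet> (x - y) + e\<^sup>2))"
  proof (rule Bochner_Integration.integrable_bound)
    show "integrable lborel (\<lambda>x. (1 / e\<^sup>2) * (cmod (u x))\<^sup>2)" using usq by simp
    have "(cmod (u x))\<^sup>2 / k x \<le> (cmod (u x))\<^sup>2 / e\<^sup>2" for x
      using e k[of x] by (intro divide_left_mono) (auto simp: k_def)
    then show "AE x in lborel. norm ((cmod (u x))\<^sup>2 / ((x - y) \<bullet> (x - y) + e\<^sup>2)) \<le> norm ((1 / e\<^sup>2) * (cmod (u x))\<^sup>2)"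
      using k by (simp add: k_def less_imp_le)
  qed measurable
  have int': "integrable lborel (\<lambda>x. hardy_field_deriv e i (x - y) * (cmod (u x))\<^sup>2)" for i
  proof (rule Bochner_Integration.integrable_bound)
    show "integrable lborel (\<lambda>x. (3 / e\<^sup>2) * (cmod (u x))\<^sup>2)" using usq by simp
    have "\<bar>hardy_field_deriv e i (x - y)\<bar> * (cmod (u x))\<^sup>2 \<le> (3 / e\<^sup>2) * (cmod (u x))\<^sup>2" for x
      by (intro mult_right_mono hardy_field_bounds e) simp
    then show "AE x in lborel. norm (hardy_field_deriv e i (x - y) * (cmod (u x))\<^sup>2) \<le> norm ((3 / e\<^sup>2) * (cmod (u x))\<^sup>2)"
      by (simp add: abs_mult)
  qed measurable
  have step: "(\<integral>x. hardy_field_deriv e i (x - y) * (cmod (u x))\<^sup>2 \<partial>lborel) \<le>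
      1 / 6 * (\<integral>x. (cmod (u x))\<^sup>2 / k x \<partial>lborel) + 6 * (l2 (g i))\<^sup>2" for i
  proof -
    have "complex_of_real (\<integral>x. hardy_field_deriv e i (x - y) * (cmod (u x))\<^sup>2 \<partial>lborel) =
        (\<integral>x. hardy_field_deriv e i (x - y) *\<^sub>R (u x * cnj (u x)) \<partial>lborel)"
      unfolding integral_complex_of_real[symmetric]
      by (intro Bochner_Integration.integral_cong)
         (auto simp: scaleR_conv_of_real complex_norm_square simp del: of_real_power)
    also have "\<dots> = - (\<integral>x. hardy_field e i (x - y) *\<^sub>R (g i x * cnj (u x) + u x * cnj (g i x)) \<partial>lborel)"
      by (rule weak_partial_product[OF u g(1) g(2) L2_cnj[OF u] L2_cnj[OF g(1)] weak_partial_cnj[OF g(2)]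
          hardy_field_line_derivative[OF e] hardy_field_bounds(3)[OF e] hardy_field_bounds(2)[OF e]]) measurable
    finally have eq: "complex_of_real (\<integral>x. hardy_field_deriv e i (x - y) * (cmod (u x))\<^sup>2 \<partial>lborel) =
        - (\<integral>x. hardy_field e i (x - y) *\<^sub>R (g i x * cnj (u x) + u x * cnj (g i x)) \<partial>lborel)" .
    have le: "norm (hardy_field e i (x - y) *\<^sub>R (g i x * cnj (u x) + u x * cnj (g i x))) \<le>
        1 / 6 * ((cmod (u x))\<^sup>2 / k x) + 6 * (cmod (g i x))\<^sup>2" for x
    proof -
      define a where "a = cmod (u x) / sqrt (k x)"
      have "norm (g i x * cnj (u x) + u x * cnj (g i x)) \<le> 2 * (cmod (u x) * cmod (g i x))"
        by (rule order_trans[OF norm_triangle_ineq]) (simp add: norm_mult)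
      then have "norm (hardy_field e i (x - y) *\<^sub>R (g i x * cnj (u x) + u x * cnj (g i x))) \<le>
          1 / sqrt (k x) * (2 * (cmod (u x) * cmod (g i x)))"
        unfolding norm_scaleR real_norm_def k_def
        by (intro mult_mono hardy_field_bounds(1) e) auto
      also have "\<dots> = 2 * a * cmod (g i x)" by (simp add: a_def)
      \<comment> \<open>The difference of the two sides is the square of
        \<open>a - 6 * cmod (g i x)\<close> divided by 6.\<close>
      also have "\<dots> \<le> 1 / 6 * a\<^sup>2 + 6 * (cmod (g i x))\<^sup>2"
        using zero_le_power2[of "a - 6 * cmod (g i x)"] by (simp add: power2_diff power_mult_distrib)
      also have "a\<^sup>2 = (cmod (u x))\<^sup>2 / k x" using k[of x] by (simp add: a_def power_divide less_imp_le)
      finally show ?thesis .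
    qed
    have int_U: "integrable lborel (\<lambda>x. (cmod (u x))\<^sup>2 / k x)" using int by (simp only: k_def)
    have int_a: "integrable lborel (\<lambda>x. 1 / 6 * ((cmod (u x))\<^sup>2 / k x))" "integrable lborel (\<lambda>x. 6 * (cmod (g i x))\<^sup>2)"
      by (intro integrable_mult_right int_U gsq)+
    have int_r: "integrable lborel (\<lambda>x. 1 / 6 * ((cmod (u x))\<^sup>2 / k x) + 6 * (cmod (g i x))\<^sup>2)"
      by (rule Bochner_Integration.integrable_add[OF int_a])
    have int_l: "integrable lborel (\<lambda>x. hardy_field e i (x - y) *\<^sub>R (g i x * cnj (u x) + u x * cnj (g i x)))"
    proof (rule Bochner_Integration.integrable_bound[OF int_r])
      have [measurable]: "(\<lambda>x. cnj (u x)) \<in> borel_measurable borel" "(\<lambda>x. cnj (g i x)) \<in> borel_measurable borel"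
        using L2_measurable[OF L2_cnj[OF u]] L2_measurable[OF L2_cnj[OF g(1)]] by auto
      show "(\<lambda>x. hardy_field e i (x - y) *\<^sub>R (g i x * cnj (u x) + u x * cnj (g i x))) \<in> borel_measurable lborel" by measurable
      show "AE x in lborel. norm (hardy_field e i (x - y) *\<^sub>R (g i x * cnj (u x) + u x * cnj (g i x))) \<le>
          norm (1 / 6 * ((cmod (u x))\<^sup>2 / k x) + 6 * (cmod (g i x))\<^sup>2)"
        by (intro AE_I2 order_trans[OF le]) (simp only: real_norm_def abs_ge_self)
    qed
    have "\<bar>\<integral>x. hardy_field_deriv e i (x - y) * (cmod (u x))\<^sup>2 \<partial>lborel\<bar> =
        cmod (\<integral>x. hardy_field e i (x - y) *\<^sub>R (g i x * cnj (u x) + u x * cnj (g i x)) \<partial>lborel)"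
      using arg_cong[OF eq, of cmod] by (simp only: norm_of_real norm_minus_cancel)
    also have "\<dots> \<le> (\<integral>x. 1 / 6 * ((cmod (u x))\<^sup>2 / k x) + 6 * (cmod (g i x))\<^sup>2 \<partial>lborel)"
      by (rule Bochner_Integration.integral_norm_bound_integral[OF int_l int_r le])
    also have "\<dots> = 1 / 6 * (\<integral>x. (cmod (u x))\<^sup>2 / k x \<partial>lborel) + 6 * (l2 (g i))\<^sup>2"
      unfolding Bochner_Integration.integral_add[OF int_a] integral_mult_right_zero l2_square ..
    finally show ?thesis by linarith
  qed
  have "(\<integral>x. (cmod (u x))\<^sup>2 / k x \<partial>lborel) \<le> (\<integral>x. (\<Sum>i\<in>UNIV. hardy_field_deriv e i (x - y) * (cmod (u x))\<^sup>2) \<partial>lborel)"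
  proof (rule integral_mono)
    show "integrable lborel (\<lambda>x. (cmod (u x))\<^sup>2 / k x)" using int by (simp add: k_def)
    show "integrable lborel (\<lambda>x. \<Sum>i\<in>UNIV. hardy_field_deriv e i (x - y) * (cmod (u x))\<^sup>2)" using int' by simp
    show "(cmod (u x))\<^sup>2 / k x \<le> (\<Sum>i\<in>UNIV. hardy_field_deriv e i (x - y) * (cmod (u x))\<^sup>2)" for x
      using mult_right_mono[OF hardy_field_divergence[OF e, of "x - y"], of "(cmod (u x))\<^sup>2"]
      by (simp add: k_def sum_distrib_right)
  qed
  also have "\<dots> = (\<Sum>i\<in>UNIV. \<integral>x. hardy_field_deriv e i (x - y) * (cmod (u x))\<^sup>2 \<partial>lborel)"
    by (rule Bochner_Integration.integral_sum[OF int'])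
  also have "\<dots> \<le> (\<Sum>i\<in>UNIV. 1 / 6 * (\<integral>x. (cmod (u x))\<^sup>2 / k x \<partial>lborel) + 6 * (l2 (g i))\<^sup>2)"
    by (intro sum_mono step)
  also have "\<dots> = 1 / 2 * (\<integral>x. (cmod (u x))\<^sup>2 / k x \<partial>lborel) + 6 * (\<Sum>i\<in>UNIV. (l2 (g i))\<^sup>2)"
    by (simp add: sum.distrib sum_distrib_left)
  finally show "(\<integral>x. (cmod (u x))\<^sup>2 / ((x - y) \<bullet> (x - y) + e\<^sup>2) \<partial>lborel) \<le> 12 * (\<Sum>i\<in>UNIV. (l2 (g i))\<^sup>2)"
    by (simp add: k_def)
qed

lemma inverse_Suc_tendsto: "(\<lambda>n. (1 / real (Suc n))\<^sup>2) \<longlonglongrightarrow> 0"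
  using tendsto_power[OF LIMSEQ_inverse_real_of_nat, of 2] by (simp add: inverse_eq_divide)

text \<open>Fatou's lemma as the regularisation \<open>1 / (n + 1)\<close> tends to 0. At
  \<open>x = y\<close> the integrand is 0 by the convention for division, so the pointwise
  inequality is trivial there.\<close>

lemma hardy:
  assumes u: "u \<in> L2" and g: "\<And>i. g i \<in> L2" "\<And>i. weak_partial i u (g i)"
  shows "integrable lborel (\<lambda>x. (cmod (u x) / norm (x - y))\<^sup>2)"
    and "(\<integral>x. (cmod (u x) / norm (x - y))\<^sup>2 \<partial>lborel) \<le> 12 * (\<Sum>i\<in>UNIV. (l2 (g i))\<^sup>2)"
proof -
  have [measurable]: "u \<in> borel_measurable borel" using u by (rule L2_measurable)
  define D where "D = 12 * (\<Sum>i\<in>UNIV. (l2 (g i))\<^sup>2)"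
  have D: "D \<ge> 0" by (auto simp: D_def intro!: sum_nonneg)
  define f where "f = (\<lambda>n x. (cmod (u x))\<^sup>2 / ((x - y) \<bullet> (x - y) + (1 / real (Suc n))\<^sup>2))"
  have f0: "0 \<le> f n x" for n x by (auto simp: f_def)
  have [measurable]: "f n \<in> borel_measurable borel" for n by (simp add: f_def)
  have fn: "(\<integral>\<^sup>+x. ennreal (f n x) \<partial>lborel) \<le> ennreal D" for n
  proof -
    have e: "1 / real (Suc n) > 0" by simp
    have "(\<integral>\<^sup>+x. ennreal (f n x) \<partial>lborel) = ennreal (\<integral>x. f n x \<partial>lborel)"
      using hardy_regularised(1)[OF u g e] f0[of n] by (intro nn_integral_eq_integral) (auto simp: f_def)
    also have "\<dots> \<le> ennreal D"
      using hardy_regularised(2)[OF u g e] by (intro ennreal_leI) (simp add: f_def D_def)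
    finally show ?thesis .
  qed
  have "(\<integral>\<^sup>+x. ennreal ((cmod (u x) / norm (x - y))\<^sup>2) \<partial>lborel) \<le> (\<integral>\<^sup>+x. liminf (\<lambda>n. ennreal (f n x)) \<partial>lborel)"
  proof (rule nn_integral_mono)
    fix x
    show "ennreal ((cmod (u x) / norm (x - y))\<^sup>2) \<le> liminf (\<lambda>n. ennreal (f n x))"
    proof (cases "x = y")
      case False
      then have pos: "(x - y) \<bullet> (x - y) > 0" by simp
      have "(\<lambda>n. f n x) \<longlonglongrightarrow> (cmod (u x))\<^sup>2 / ((x - y) \<bullet> (x - y) + 0)"
        unfolding f_def using pos by (intro tendsto_intros inverse_Suc_tendsto) auto
      then have "(\<lambda>n. ennreal (f n x)) \<longlonglongrightarrow> ennreal ((cmod (u x))\<^sup>2 / ((x - y) \<bullet> (x - y)))"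
        by (intro tendsto_ennrealI) simp
      from lim_imp_Liminf[OF trivial_limit_sequentially this]
      show ?thesis by (simp add: power_divide power2_norm_eq_inner)
    qed simp
  qed
  also have "\<dots> \<le> liminf (\<lambda>n. \<integral>\<^sup>+x. ennreal (f n x) \<partial>lborel)"
    by (rule nn_integral_liminf) simp
  also have "\<dots> \<le> ennreal D"
    by (rule Liminf_le) (use fn in auto)
  finally have nn: "(\<integral>\<^sup>+x. ennreal ((cmod (u x) / norm (x - y))\<^sup>2) \<partial>lborel) \<le> ennreal D" .
  then show int: "integrable lborel (\<lambda>x. (cmod (u x) / norm (x - y))\<^sup>2)"
    by (intro integrableI_bounded) (auto intro: le_less_trans)
  show "(\<integral>x. (cmod (u x) / norm (x - y))\<^sup>2 \<partial>lborel) \<le> 12 * (\<Sum>i\<in>UNIV. (l2 (g i))\<^sup>2)"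
    using nn nn_integral_eq_integral[OF int] D by (simp add: D_def ennreal_le_iff)
qed

subsection \<open>The Newtonian potential\<close>

text \<open>A regularisation of the Newtonian kernel, which recovers it as \<open>e\<close> tends to \<open>0\<close>.\<close>

definition ker :: "real \<Rightarrow> real^3 \<Rightarrow> real" where "ker e z = 1 / sqrt (z \<bullet> z + e\<^sup>2)"

definition ker_deriv :: "real \<Rightarrow> 3 \<Rightarrow> real^3 \<Rightarrow> real" where
  "ker_deriv e i z = - (z $ i) / (sqrt (z \<bullet> z + e\<^sup>2)) ^ 3"

lemma ker_line_derivative:
  assumes e: "e > 0"
  shows "line_derivative i (\<lambda>x. ker e (x - y)) (\<lambda>x. ker_deriv e i (x - y))"
  unfolding line_derivative_def
proof (intro allI)
  fix x s
  define b c where "b = (x - y) $ i" and "c = (x - y) \<bullet> (x - y) + e\<^sup>2"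
  define q where "q = c + 2 * s * b + s\<^sup>2"
  have pos: "q > 0"
    using denom_pos[OF e, of "x + s *\<^sub>R axis i 1 - y"] by (simp add: line_inner b_def c_def q_def)
  have "((\<lambda>h. c + 2 * h * b + h\<^sup>2) has_real_derivative 2 * b + 2 * s) (at s)"
    by (auto intro!: derivative_eq_intros)
  from DERIV_chain2[OF DERIV_real_sqrt this] pos
  have "((\<lambda>h. sqrt (c + 2 * h * b + h\<^sup>2)) has_real_derivative inverse (sqrt q) / 2 * (2 * b + 2 * s)) (at s)"
    by (simp add: q_def)
  from DERIV_inverse'[OF this] pos
  have "((\<lambda>h. inverse (sqrt (c + 2 * h * b + h\<^sup>2))) has_real_derivative
      - (inverse (sqrt q) * (inverse (sqrt q) / 2 * (2 * b + 2 * s)) * inverse (sqrt q))) (at s)"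
    by (simp add: q_def)
  moreover have "- (inverse (sqrt q) * (inverse (sqrt q) / 2 * (2 * b + 2 * s)) * inverse (sqrt q)) =
      - (b + s) / (sqrt q) ^ 3"
  proof -
    define t where "t = sqrt q"
    have "t \<noteq> 0" using pos by (simp add: t_def)
    then show ?thesis unfolding t_def[symmetric] by (simp add: field_simps power3_eq_cube)
  qed
  ultimately show "((\<lambda>h. ker e (x + h *\<^sub>R axis i 1 - y)) has_real_derivative
      ker_deriv e i (x + s *\<^sub>R axis i 1 - y)) (at s)"
    unfolding ker_def ker_deriv_def line_inner
    by (simp add: b_def c_def q_def add.assoc add.commute add.left_commute inverse_eq_divide)
qed

lemma ker_bounds:
  assumes e: "e > 0"
  shows "0 < ker e z" "ker e z \<le> 1 / e" "z \<noteq> 0 \<Longrightarrow> ker e z \<le> 1 / norm z" "\<bar>ker_deriv e i z\<bar> \<le> 1 / e\<^sup>2"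
proof -
  define q where "q = z \<bullet> z + e\<^sup>2"
  have q: "q > 0" "q \<ge> e\<^sup>2" "q \<ge> z \<bullet> z" using denom_pos[OF e, of z] by (auto simp: q_def)
  have sq: "sqrt q \<ge> e" "sqrt q > 0" using q e by (simp_all add: real_le_rsqrt)
  show "0 < ker e z" using q by (simp add: ker_def q_def)
  show le: "ker e z \<le> 1 / e" unfolding ker_def q_def[symmetric] using sq e by (intro divide_left_mono) auto
  show "ker e z \<le> 1 / norm z" if "z \<noteq> 0"
    unfolding ker_def q_def[symmetric] using sq that q(3)
    by (intro divide_left_mono) (auto simp: norm_eq_sqrt_inner)
  have "(z $ i)\<^sup>2 \<le> q" using component_square_le[of z i] q(3) by linarith
  then have "\<bar>z $ i\<bar> \<le> sqrt q" by (simp add: real_le_rsqrt)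
  then have "\<bar>z $ i\<bar> / (sqrt q) ^ 3 \<le> sqrt q / (sqrt q) ^ 3"
    using sq by (intro divide_right_mono) auto
  also have "\<dots> = 1 / q" using q by (simp add: power3_eq_cube)
  also have "\<dots> \<le> 1 / e\<^sup>2" using q e by (intro divide_left_mono) auto
  finally show "\<bar>ker_deriv e i z\<bar> \<le> 1 / e\<^sup>2"
    using sq by (simp add: ker_deriv_def q_def[symmetric] abs_divide)
qed

lemma ker_minus: "ker e (x - y) = ker e (y - x)" "ker_deriv e i (x - y) = - ker_deriv e i (y - x)"
proof -
  have "(x - y) \<bullet> (x - y) = (y - x) \<bullet> (y - x)" by (simp add: inner_diff algebra_simps inner_commute)
  then show "ker e (x - y) = ker e (y - x)" "ker_deriv e i (x - y) = - ker_deriv e i (y - x)"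
    by (simp_all add: ker_def ker_deriv_def minus_divide_left[symmetric] diff_divide_distrib)
qed

lemma ker_measurable [measurable]: "ker e \<in> borel_measurable borel" "ker_deriv e i \<in> borel_measurable borel"
  by (simp_all add: ker_def[abs_def] ker_deriv_def[abs_def])

lemma ker_tendsto:
  assumes "z \<noteq> 0"
  shows "(\<lambda>n. ker (1 / real (Suc n)) z) \<longlonglongrightarrow> 1 / norm z"
proof -
  have "(\<lambda>n. 1 / sqrt (z \<bullet> z + (1 / real (Suc n))\<^sup>2)) \<longlonglongrightarrow> 1 / sqrt (z \<bullet> z + 0)"
    using assms by (intro tendsto_intros inverse_Suc_tendsto) auto
  then show ?thesis by (simp add: ker_def norm_eq_sqrt_inner)
qed

text \<open>A bounded kernel times two integrable functions of separate variables is integrable on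
  the product.\<close>

lemma Fubini_kernel:
  fixes f :: "'a::euclidean_space \<Rightarrow> complex" and r :: "'a \<Rightarrow> real" and k :: "'a \<Rightarrow> 'a \<Rightarrow> real"
  assumes f: "integrable lborel f" and r: "integrable lborel r"
    and k [measurable]: "(\<lambda>(x, y). k x y) \<in> borel_measurable (lborel \<Otimes>\<^sub>M lborel)" and C: "\<And>x y. \<bar>k x y\<bar> \<le> C"
  shows "(\<integral>x. (\<integral>y. r y * k x y \<partial>lborel) *\<^sub>R f x \<partial>lborel) = (\<integral>y. r y *\<^sub>R (\<integral>x. k x y *\<^sub>R f x \<partial>lborel) \<partial>lborel)"
proof -
  have [measurable]: "f \<in> borel_measurable borel" "r \<in> borel_measurable borel"
    using borel_measurable_integrable[OF f] borel_measurable_integrable[OF r] by simp_all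
  have int: "integrable (lborel \<Otimes>\<^sub>M lborel) (\<lambda>(x, y). (r y * k x y) *\<^sub>R f x)"
  proof (rule lborel_pair.Fubini_integrable)
    show "(\<lambda>(x, y). (r y * k x y) *\<^sub>R f x) \<in> borel_measurable (lborel \<Otimes>\<^sub>M lborel)" by measurable
    have le: "norm ((r y * k x y) *\<^sub>R f x) \<le> (C * norm (f x)) * norm (r y)" for x y
    proof -
      have "norm ((r y * k x y) *\<^sub>R f x) = \<bar>k x y\<bar> * (norm (f x) * norm (r y))"
        by (simp add: abs_mult mult_ac)
      also have "\<dots> \<le> C * (norm (f x) * norm (r y))" by (intro mult_right_mono C) simp
      finally show ?thesis by (simp add: mult_ac)
    qed
    have i1: "integrable lborel (\<lambda>y. (C * norm (f x)) * norm (r y))" for x using r by simp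
    have i2: "integrable lborel (\<lambda>y. (r y * k x y) *\<^sub>R f x)" for x
    proof (rule Bochner_Integration.integrable_bound[OF i1])
      have "(\<lambda>y. k x y) \<in> borel_measurable lborel"
        using measurable_compose[OF measurable_Pair1'[of x lborel lborel] k] by simp
      then show "(\<lambda>y. (r y * k x y) *\<^sub>R f x) \<in> borel_measurable lborel" by simp
      show "AE y in lborel. norm ((r y * k x y) *\<^sub>R f x) \<le> norm ((C * norm (f x)) * norm (r y))"
        by (intro AE_I2 order_trans[OF le]) (simp only: real_norm_def abs_ge_self)
    qed
    then show "AE x in lborel. integrable lborel (\<lambda>y. case (x, y) of (x, y) \<Rightarrow> (r y * k x y) *\<^sub>R f x)" by simp
    show "integrable lborel (\<lambda>x. \<integral>y. norm (case (x, y) of (x, y) \<Rightarrow> (r y * k x y) *\<^sub>R f x) \<partial>lborel)"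
    proof (rule Bochner_Integration.integrable_bound)
      show "integrable lborel (\<lambda>x. (\<integral>y. norm (r y) \<partial>lborel) * C * norm (f x))" using f by simp
      show "(\<lambda>x. \<integral>y. norm (case (x, y) of (x, y) \<Rightarrow> (r y * k x y) *\<^sub>R f x) \<partial>lborel) \<in> borel_measurable lborel" by measurable
      have bd: "norm (\<integral>y. norm ((r y * k x y) *\<^sub>R f x) \<partial>lborel) \<le> (\<integral>y. norm (r y) \<partial>lborel) * C * norm (f x)" for x
      proof -
        have "(\<integral>y. norm ((r y * k x y) *\<^sub>R f x) \<partial>lborel) \<le> (\<integral>y. (C * norm (f x)) * norm (r y) \<partial>lborel)"
          by (rule integral_mono[OF integrable_norm[OF i2] i1 le])
        then show ?thesis by (simp add: mult_ac)
      qed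
      show "AE x in lborel. norm (\<integral>y. norm (case (x, y) of (x, y) \<Rightarrow> (r y * k x y) *\<^sub>R f x) \<partial>lborel) \<le>
          norm ((\<integral>y. norm (r y) \<partial>lborel) * C * norm (f x))"
        unfolding prod.case by (intro AE_I2 order_trans[OF bd]) (simp only: real_norm_def abs_ge_self)
    qed
  qed
  have rk: "integrable lborel (\<lambda>y. r y * k x y)" for x
  proof (rule Bochner_Integration.integrable_bound)
    show "integrable lborel (\<lambda>y. C * norm (r y))" using r by simp
    have "(\<lambda>y. k x y) \<in> borel_measurable lborel"
      using measurable_compose[OF measurable_Pair1'[of x lborel lborel] k] by simp
    then show "(\<lambda>y. r y * k x y) \<in> borel_measurable lborel" by simp
    have le: "norm (r y * k x y) \<le> C * norm (r y)" for y
      using mult_right_mono[OF C[of x y], of "norm (r y)"] by (simp add: abs_mult mult.commute)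
    show "AE y in lborel. norm (r y * k x y) \<le> norm (C * norm (r y))"
      by (intro AE_I2 order_trans[OF le]) (simp only: real_norm_def abs_ge_self)
  qed
  have "(\<integral>x. (\<integral>y. r y * k x y \<partial>lborel) *\<^sub>R f x \<partial>lborel) = (\<integral>x. (\<integral>y. (r y * k x y) *\<^sub>R f x \<partial>lborel) \<partial>lborel)"
    using rk by simp
  also have "\<dots> = (\<integral>y. (\<integral>x. (r y * k x y) *\<^sub>R f x \<partial>lborel) \<partial>lborel)"
    using lborel_pair.Fubini_integral[OF int] by simp
  also have "\<dots> = (\<integral>y. r y *\<^sub>R (\<integral>x. k x y *\<^sub>R f x \<partial>lborel) \<partial>lborel)"
    by (simp add: scaleR_scaleR[symmetric] del: scaleR_scaleR)
  finally show ?thesis .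
qed

definition pot :: "(real^3 \<Rightarrow> real) \<Rightarrow> real^3 \<Rightarrow> real" where
  "pot r x = (\<integral>y. r y / norm (x - y) \<partial>lborel)"

lemma pot_measurable [measurable (raw)]:
  assumes [measurable]: "r \<in> borel_measurable borel"
  shows "pot r \<in> borel_measurable borel"
proof -
  have "pot r \<in> borel_measurable lborel" unfolding pot_def[abs_def] by measurable
  then show ?thesis by simp
qed

text \<open>The square root of Hardy's bound: it controls the L2 norm of a function divided by the
  distance to a point, uniformly in the point, when \<open>g\<close> is the weak gradient of the
  function.\<close>

definition hardy_norm :: "(3 \<Rightarrow> real^3 \<Rightarrow> complex) \<Rightarrow> real" where
  "hardy_norm g = sqrt (12 * (\<Sum>i\<in>UNIV. (l2 (g i))\<^sup>2))"

text \<open>The singularity is put on the factor \<open>a\<close> that has a weak gradient;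
  \<open>b\<close> is merely square integrable, which allows it to be a weak derivative
  itself.\<close>

lemma hardy_product:
  assumes a: "a \<in> L2" "\<And>i. g i \<in> L2" "\<And>i. weak_partial i a (g i)" and b: "b \<in> L2"
  shows "integrable lborel (\<lambda>y. cmod (a y) * cmod (b y) / norm (x - y))"
    and "(\<integral>y. cmod (a y) * cmod (b y) / norm (x - y) \<partial>lborel) \<le> hardy_norm g * l2 b"
proof -
  have [measurable]: "a \<in> borel_measurable borel" "b \<in> borel_measurable borel"
    using a(1) b by (auto intro: L2_measurable)
  have h: "integrable lborel (\<lambda>y. (cmod (a y) / norm (y - x))\<^sup>2)"
    "(\<integral>y. (cmod (a y) / norm (y - x))\<^sup>2 \<partial>lborel) \<le> 12 * (\<Sum>i\<in>UNIV. (l2 (g i))\<^sup>2)"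
    using hardy[OF a] by auto
  have bs: "integrable lborel (\<lambda>y. (cmod (b y))\<^sup>2)" by (rule L2_integrable_square[OF b])
  have eq: "cmod (a y) * cmod (b y) / norm (x - y) = cmod (a y) / norm (y - x) * cmod (b y)" for y
    by (simp add: norm_minus_commute)
  note cs = integral_Cauchy_Schwarz[OF _ _ h(1) bs]
  show "integrable lborel (\<lambda>y. cmod (a y) * cmod (b y) / norm (x - y))"
    unfolding eq by (rule cs(1)) measurable
  have "(\<integral>y. \<bar>cmod (a y) / norm (y - x) * cmod (b y)\<bar> \<partial>lborel) \<le>
      sqrt (\<integral>y. (cmod (a y) / norm (y - x))\<^sup>2 \<partial>lborel) * sqrt (\<integral>y. (cmod (b y))\<^sup>2 \<partial>lborel)"
    by (rule cs(2)) measurable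
  also have "\<dots> \<le> hardy_norm g * l2 b"
    unfolding hardy_norm_def l2_def using h(2) by (intro mult_right_mono) (auto simp: l2_def)
  finally show "(\<integral>y. cmod (a y) * cmod (b y) / norm (x - y) \<partial>lborel) \<le> hardy_norm g * l2 b"
    by (simp add: eq)
qed

lemma AE_neq: "AE y in lborel. y \<noteq> (x :: real^3)"
  by (rule AE_lborel_singleton)

text \<open>The same bound serves the regularised potentials, since
  \<open>ker e z \<le> 1 / norm z\<close>. Its uniformity in \<open>e\<close> is what dominated
  convergence uses later.\<close>

lemma pot_bound:
  fixes D :: real
  assumes [measurable]: "r \<in> borel_measurable borel" and r: "\<And>y. \<bar>r y\<bar> \<le> R y"
    and R: "integrable lborel (\<lambda>y. R y / norm (x - y))" "(\<integral>y. R y / norm (x - y) \<partial>lborel) \<le> D"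
  shows "integrable lborel (\<lambda>y. r y / norm (x - y))" "\<bar>pot r x\<bar> \<le> D"
    and "e > 0 \<Longrightarrow> \<bar>\<integral>y. r y * ker e (x - y) \<partial>lborel\<bar> \<le> D"
proof -
  have le: "norm (r y / norm (x - y)) \<le> R y / norm (x - y)" for y
    using r[of y] by (simp add: abs_divide divide_right_mono)
  show int: "integrable lborel (\<lambda>y. r y / norm (x - y))"
    by (rule Bochner_Integration.integrable_bound[OF R(1)])
       (measurable, intro AE_I2 order_trans[OF le], simp only: real_norm_def abs_ge_self)
  have "norm (pot r x) \<le> (\<integral>y. R y / norm (x - y) \<partial>lborel)"
    unfolding pot_def by (rule Bochner_Integration.integral_norm_bound_integral[OF int R(1) le])
  then show "\<bar>pot r x\<bar> \<le> D" using R(2) by simp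
  show "\<bar>\<integral>y. r y * ker e (x - y) \<partial>lborel\<bar> \<le> D" if e: "e > 0"
  proof -
    have ker_le: "AE y in lborel. norm (r y * ker e (x - y)) \<le> R y / norm (x - y)"
      using AE_neq[of x]
    proof eventually_elim
      case (elim y)
      have "\<bar>r y\<bar> * ker e (x - y) \<le> R y * (1 / norm (x - y))"
        using ker_bounds(1,3)[OF e, of "x - y"] elim r[of y] by (intro mult_mono) auto
      then show ?case using ker_bounds(1)[OF e, of "x - y"] by (simp add: abs_mult)
    qed
    have int2: "integrable lborel (\<lambda>y. r y * ker e (x - y))"
    proof (rule Bochner_Integration.integrable_bound[OF R(1)])
      show "AE y in lborel. norm (r y * ker e (x - y)) \<le> norm (R y / norm (x - y))"
        using ker_le by eventually_elim (erule order_trans, simp only: real_norm_def abs_ge_self)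
    qed measurable
    have "norm (\<integral>y. r y * ker e (x - y) \<partial>lborel) \<le> (\<integral>y. norm (r y * ker e (x - y)) \<partial>lborel)"
      by (rule integral_norm_bound)
    also have "\<dots> \<le> (\<integral>y. R y / norm (x - y) \<partial>lborel)"
      by (rule integral_mono_AE[OF integrable_norm[OF int2] R(1) ker_le])
    finally show ?thesis using R(2) by simp
  qed
qed

lemma ker_pot_tendsto:
  assumes [measurable]: "r \<in> borel_measurable borel" and r: "integrable lborel (\<lambda>y. r y / norm (x - y))"
  shows "(\<lambda>n. \<integral>y. r y * ker (1 / real (Suc n)) (x - y) \<partial>lborel) \<longlonglongrightarrow> pot r x"
  unfolding pot_def
proof (rule integral_dominated_convergence)
  show "integrable lborel (\<lambda>y. norm (r y / norm (x - y)))" using r by (rule integrable_norm)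
  show "AE y in lborel. (\<lambda>n. r y * ker (1 / real (Suc n)) (x - y)) \<longlonglongrightarrow> r y / norm (x - y)"
    using AE_neq[of x]
  proof eventually_elim
    case (elim y)
    then show ?case using tendsto_mult_left[OF ker_tendsto[of "x - y"], of "r y"] by simp
  qed
  fix n
  show "AE y in lborel. norm (r y * ker (1 / real (Suc n)) (x - y)) \<le> norm (r y / norm (x - y))"
    using AE_neq[of x]
  proof eventually_elim
    case (elim y)
    have "\<bar>r y\<bar> * ker (1 / real (Suc n)) (x - y) \<le> \<bar>r y\<bar> * (1 / norm (x - y))"
      using ker_bounds(3)[of "1 / real (Suc n)" "x - y"] elim by (intro mult_left_mono) auto
    then show ?case using ker_bounds(1)[of "1 / real (Suc n)" "x - y"] by (simp add: abs_mult abs_divide)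
  qed
qed measurable

text \<open>The gradient of the potential is the potential of the gradient of the density:
  differentiating the Newtonian kernel would worsen its singularity, so the derivative is moved to
  \<open>r\<close>. With the bounded kernel \<open>ker e\<close> this takes an integration by parts
  in \<open>x\<close> for each fixed \<open>y\<close>, Fubini's theorem and an integration by parts
  in \<open>y\<close>; the regularisation is removed at the end.\<close>

lemma weak_partial_pot_mult:
  assumes a: "a \<in> L2" "\<And>i. ga i \<in> L2" "\<And>i. weak_partial i a (ga i)"
    and b: "b \<in> L2" "\<And>i. gb i \<in> L2" "\<And>i. weak_partial i b (gb i)"
    and u: "u \<in> L2" "u' \<in> L2" "weak_partial i u u'"
  defines "r \<equiv> \<lambda>y. Re (a y * cnj (b y))"
    and "r' \<equiv> \<lambda>y. Re (ga i y * cnj (b y) + a y * cnj (gb i y))"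
  shows "weak_partial i (\<lambda>x. of_real (pot r x) * u x) (\<lambda>x. of_real (pot r x) * u' x + of_real (pot r' x) * u x)"
  unfolding weak_partial_def
proof (intro allI impI)
  fix \<phi> :: "real^3 \<Rightarrow> real" assume \<phi>: "test_function UNIV \<phi>"
  have [measurable]: "a \<in> borel_measurable borel" "b \<in> borel_measurable borel" "u \<in> borel_measurable borel"
    "u' \<in> borel_measurable borel" "ga i \<in> borel_measurable borel" "gb i \<in> borel_measurable borel"
    "(\<lambda>y. cnj (b y)) \<in> borel_measurable borel" "(\<lambda>y. cnj (gb i y)) \<in> borel_measurable borel"
    using a b u L2_cnj[OF b(1)] L2_cnj[OF b(2)] by (auto intro: L2_measurable)
  obtain C\<phi> \<rho> where \<phi>d: "line_derivative i \<phi> (partial_deriv i \<phi>)" "\<And>x. \<bar>partial_deriv i \<phi> x\<bar> \<le> C\<phi>"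
    "\<And>x. norm x > \<rho> \<Longrightarrow> \<phi> x = 0" and [measurable]: "\<phi> \<in> borel_measurable borel" "partial_deriv i \<phi> \<in> borel_measurable borel"
    using test_function_facts[OF \<phi>, of i] by auto
  have cb: "(\<lambda>y. cnj (b y)) \<in> L2" "\<And>j. (\<lambda>y. cnj (gb j y)) \<in> L2" by (intro L2_cnj b)+
  have [measurable]: "r \<in> borel_measurable borel" "r' \<in> borel_measurable borel" by (simp_all add: r_def r'_def)
  have r_int: "integrable lborel r" unfolding r_def by (intro integrable_Re L2_mult_integrable a cb)
  have r'_int: "integrable lborel r'" unfolding r'_def
    by (intro integrable_Re Bochner_Integration.integrable_add L2_mult_integrable a cb)
  have r_le: "\<bar>r y\<bar> \<le> cmod (a y) * cmod (b y)" for y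
    unfolding r_def using abs_Re_le_cmod[of "a y * cnj (b y)"] by (simp add: norm_mult)
  have r'_le: "\<bar>r' y\<bar> \<le> cmod (b y) * cmod (ga i y) + cmod (a y) * cmod (gb i y)" for y
    unfolding r'_def using abs_Re_le_cmod[of "ga i y * cnj (b y) + a y * cnj (gb i y)"]
      norm_triangle_ineq[of "ga i y * cnj (b y)" "a y * cnj (gb i y)"] by (simp add: norm_mult mult.commute)
  \<comment> \<open>One bound for \<open>pot r\<close>, \<open>pot r'\<close> and their
    regularisations, independent of the point and of \<open>e\<close>.\<close>
  define D where "D = hardy_norm ga * l2 b + (hardy_norm gb * l2 (ga i) + hardy_norm ga * l2 (gb i))"
  have hn: "0 \<le> hardy_norm g" for g by (auto simp: hardy_norm_def intro!: sum_nonneg)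
  have D1: "hardy_norm ga * l2 b \<le> D" "hardy_norm gb * l2 (ga i) + hardy_norm ga * l2 (gb i) \<le> D"
    using hn l2_nonneg by (auto simp: D_def intro!: add_nonneg_nonneg mult_nonneg_nonneg)
  note hr = hardy_product[OF a b(1)]
  note h1 = hardy_product[OF b a(2)[of i]] and h2 = hardy_product[OF a b(2)[of i]]
  have hr': "integrable lborel (\<lambda>y. (cmod (b y) * cmod (ga i y) + cmod (a y) * cmod (gb i y)) / norm (x - y))"
    "(\<integral>y. (cmod (b y) * cmod (ga i y) + cmod (a y) * cmod (gb i y)) / norm (x - y) \<partial>lborel) \<le> D" for x
    unfolding add_divide_distrib using h1[of x] h2[of x] D1(2) by simp_all
  note pr = pot_bound[OF \<open>r \<in> borel_measurable borel\<close> r_le hr(1) order_trans[OF hr(2) D1(1)]]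
  note pr' = pot_bound[OF \<open>r' \<in> borel_measurable borel\<close> r'_le hr']
  define V V' where "V = (\<lambda>e x. \<integral>y. r y * ker e (x - y) \<partial>lborel)" and "V' = (\<lambda>e x. \<integral>y. r' y * ker e (x - y) \<partial>lborel)"
  have [measurable]: "V e \<in> borel_measurable borel" "V' e \<in> borel_measurable borel" for e
  proof -
    have "V e \<in> borel_measurable lborel" "V' e \<in> borel_measurable lborel" unfolding V_def V'_def by measurable
    then show "V e \<in> borel_measurable borel" "V' e \<in> borel_measurable borel" by simp_all
  qed
  have \<phi>u: "integrable lborel (\<lambda>x. \<phi> x *\<^sub>R u x)" "integrable lborel (\<lambda>x. partial_deriv i \<phi> x *\<^sub>R u x)"
    "integrable lborel (\<lambda>x. \<phi> x *\<^sub>R u' x)"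
    using test_mult_integrable[OF \<phi> u(1)] test_mult_integrable(1)[OF \<phi> u(2)] by auto
  have reg: "(\<integral>x. V e x *\<^sub>R (partial_deriv i \<phi> x *\<^sub>R u x) \<partial>lborel) =
      - ((\<integral>x. V e x *\<^sub>R (\<phi> x *\<^sub>R u' x) \<partial>lborel) + (\<integral>x. V' e x *\<^sub>R (\<phi> x *\<^sub>R u x) \<partial>lborel))" if e: "e > 0" for e
  proof -
    have kb: "\<bar>ker e z\<bar> \<le> 1 / e" for z using ker_bounds(1,2)[OF e, of z] by simp
    have km: "(\<lambda>(x, y). ker e (x - y)) \<in> borel_measurable (lborel \<Otimes>\<^sub>M (lborel :: (real^3) measure))"
      "(\<lambda>(x, y). ker_deriv e i (x - y)) \<in> borel_measurable (lborel \<Otimes>\<^sub>M (lborel :: (real^3) measure))" by measurable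
    have k_int: "integrable lborel (\<lambda>x. k (x - y) *\<^sub>R f x)"
      if "integrable lborel f" "k \<in> borel_measurable borel" "\<And>z. \<bar>k z\<bar> \<le> c" for k :: "real^3 \<Rightarrow> real" and f :: "real^3 \<Rightarrow> complex" and c y
    proof (rule Bochner_Integration.integrable_bound)
      note [measurable] = borel_measurable_integrable[OF that(1)] that(2)
      show "integrable lborel (\<lambda>x. c *\<^sub>R f x)" using that(1) by simp
      show "(\<lambda>x. k (x - y) *\<^sub>R f x) \<in> borel_measurable lborel" by measurable
      have "\<bar>k (x - y)\<bar> * norm (f x) \<le> \<bar>c\<bar> * norm (f x)" for x
        using that(3)[of "x - y"] by (intro mult_right_mono) auto
      then show "AE x in lborel. norm (k (x - y) *\<^sub>R f x) \<le> norm (c *\<^sub>R f x)" by simp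
    qed
    \<comment> \<open>For fixed \<open>y\<close>, the product of kernel and test function is an
      admissible weight for \<open>weak_partial_test_compact\<close>.\<close>
    have inner: "(\<integral>x. ker e (x - y) *\<^sub>R (partial_deriv i \<phi> x *\<^sub>R u x) \<partial>lborel) =
        - (\<integral>x. ker e (x - y) *\<^sub>R (\<phi> x *\<^sub>R u' x) \<partial>lborel) - (\<integral>x. ker_deriv e i (x - y) *\<^sub>R (\<phi> x *\<^sub>R u x) \<partial>lborel)" for y
    proof -
      have "bounded (\<phi> ` cball 0 \<rho>)"
        by (intro compact_imp_bounded compact_continuous_image compact_cball
            continuous_on_subset[OF test_function_continuous[OF \<phi>]]) simp
      then obtain B0 where "\<forall>v\<in>\<phi> ` cball 0 \<rho>. norm v \<le> B0" unfolding bounded_iff by blast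
      then have B0: "\<bar>\<phi> x\<bar> \<le> B0" if "x \<in> cball 0 \<rho>" for x using that by simp
      define B where "B = \<bar>B0\<bar>"
      have B: "\<bar>\<phi> x\<bar> \<le> B" for x
        using B0[of x] \<phi>d(3)[of x] by (cases "norm x \<le> \<rho>") (auto simp: B_def)
      have "(\<integral>x. (ker e (x - y) * partial_deriv i \<phi> x + ker_deriv e i (x - y) * \<phi> x) *\<^sub>R u x \<partial>lborel) =
          - (\<integral>x. (ker e (x - y) * \<phi> x) *\<^sub>R u' x \<partial>lborel)"
      proof (rule weak_partial_test_compact[OF u])
        show "line_derivative i (\<lambda>x. ker e (x - y) * \<phi> x) (\<lambda>x. ker e (x - y) * partial_deriv i \<phi> x + ker_deriv e i (x - y) * \<phi> x)"
          unfolding line_derivative_def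
        proof (intro allI)
          fix x s
          show "((\<lambda>h. ker e (x + h *\<^sub>R axis i 1 - y) * \<phi> (x + h *\<^sub>R axis i 1)) has_real_derivative
            ker e (x + s *\<^sub>R axis i 1 - y) * partial_deriv i \<phi> (x + s *\<^sub>R axis i 1) +
            ker_deriv e i (x + s *\<^sub>R axis i 1 - y) * \<phi> (x + s *\<^sub>R axis i 1)) (at s)"
            using DERIV_mult[OF ker_line_derivative[OF e, of i y, unfolded line_derivative_def, rule_format, of x s]
                \<phi>d(1)[unfolded line_derivative_def, rule_format, of x s]]
            by (simp add: mult.commute add.commute)
        qed
        show "\<bar>ker e (x - y) * partial_deriv i \<phi> x + ker_deriv e i (x - y) * \<phi> x\<bar> \<le> 1 / e * C\<phi> + 1 / e\<^sup>2 * B" for x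
        proof -
          have "\<bar>ker e (x - y) * partial_deriv i \<phi> x\<bar> \<le> 1 / e * C\<phi>"
            unfolding abs_mult using kb \<phi>d(2) e by (intro mult_mono) auto
          moreover have "\<bar>ker_deriv e i (x - y) * \<phi> x\<bar> \<le> 1 / e\<^sup>2 * B"
            unfolding abs_mult using ker_bounds(4)[OF e] B e by (intro mult_mono) auto
          ultimately show ?thesis by linarith
        qed
        show "ker e (x - y) * \<phi> x = 0" if "norm x > \<rho>" for x using \<phi>d(3)[OF that] by simp
        have "continuous_on UNIV (\<lambda>x. ker e (x - y))" unfolding ker_def
          using denom_pos[OF e] by (intro continuous_intros) (auto simp: less_imp_neq[symmetric] real_sqrt_eq_0_iff) 
        then show "continuous_on UNIV (\<lambda>x. ker e (x - y) * \<phi> x)"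
          by (intro continuous_intros test_function_continuous[OF \<phi>])
      qed measurable
      moreover have "(\<integral>x. (ker e (x - y) * partial_deriv i \<phi> x + ker_deriv e i (x - y) * \<phi> x) *\<^sub>R u x \<partial>lborel) =
          (\<integral>x. ker e (x - y) *\<^sub>R (partial_deriv i \<phi> x *\<^sub>R u x) \<partial>lborel) + (\<integral>x. ker_deriv e i (x - y) *\<^sub>R (\<phi> x *\<^sub>R u x) \<partial>lborel)"
        unfolding scaleR_add_left scaleR_scaleR[symmetric]
        by (intro Bochner_Integration.integral_add k_int[where c = "1 / e"] k_int[where c = "1 / e\<^sup>2"] \<phi>u kb ker_bounds(4)[OF e] ker_measurable)
      ultimately show ?thesis by (simp add: algebra_simps)
    qed
    \<comment> \<open>\<open>ker_deriv\<close> is odd, and the sign this produces cancels the sign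
      of the integration by parts in \<open>y\<close>.\<close>
    have Vd: "(\<integral>y. r y * ker_deriv e i (x - y) \<partial>lborel) = V' e x" for x
    proof -
      have "(\<integral>y. ker_deriv e i (y - x) *\<^sub>R (a y * cnj (b y)) \<partial>lborel) =
          - (\<integral>y. ker e (y - x) *\<^sub>R (ga i y * cnj (b y) + a y * cnj (gb i y)) \<partial>lborel)"
        by (rule weak_partial_product[OF a(1,2,3) cb weak_partial_cnj[OF b(3)] ker_line_derivative[OF e] ker_bounds(4)[OF e] kb]) measurable
      then have "Re (\<integral>y. ker_deriv e i (y - x) *\<^sub>R (a y * cnj (b y)) \<partial>lborel) =
          - Re (\<integral>y. ker e (y - x) *\<^sub>R (ga i y * cnj (b y) + a y * cnj (gb i y)) \<partial>lborel)" by simp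
      moreover have "Re (\<integral>y. ker_deriv e i (y - x) *\<^sub>R (a y * cnj (b y)) \<partial>lborel) = (\<integral>y. ker_deriv e i (y - x) * r y \<partial>lborel)"
        by (subst integral_Re[symmetric])
           (auto simp: r_def intro!: k_int[where c = "1 / e\<^sup>2"] L2_mult_integrable a cb ker_bounds(4)[OF e] ker_measurable)
      moreover have "Re (\<integral>y. ker e (y - x) *\<^sub>R (ga i y * cnj (b y) + a y * cnj (gb i y)) \<partial>lborel) = (\<integral>y. ker e (y - x) * r' y \<partial>lborel)"
        by (subst integral_Re[symmetric])
           (auto simp: r'_def intro!: k_int[where c = "1 / e"] Bochner_Integration.integrable_add L2_mult_integrable a cb kb ker_measurable)
      moreover have "(\<integral>y. r y * ker_deriv e i (x - y) \<partial>lborel) = - (\<integral>y. ker_deriv e i (y - x) * r y \<partial>lborel)"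
        by (subst ker_minus(2)) (simp add: mult.commute)
      moreover have "V' e x = (\<integral>y. ker e (y - x) * r' y \<partial>lborel)"
        unfolding V'_def by (subst ker_minus(1)) (simp add: mult.commute)
      ultimately show ?thesis by linarith
    qed
    have kb2: "\<bar>ker e (x - y)\<bar> \<le> 1 / e" for x y by (rule kb)
    have kbd: "\<bar>ker_deriv e i (x - y)\<bar> \<le> 1 / e\<^sup>2" for x y by (rule ker_bounds(4)[OF e])
    have I1: "(\<integral>x. V e x *\<^sub>R f x \<partial>lborel) = (\<integral>y. r y *\<^sub>R (\<integral>x. ker e (x - y) *\<^sub>R f x \<partial>lborel) \<partial>lborel)"
      if "integrable lborel f" for f :: "real^3 \<Rightarrow> complex"
      unfolding V_def by (rule Fubini_kernel[where k = "\<lambda>x y. ker e (x - y)" and C = "1 / e"]) (fact that r_int km(1) kb2)+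
    have I2: "(\<integral>x. V' e x *\<^sub>R f x \<partial>lborel) = (\<integral>y. r y *\<^sub>R (\<integral>x. ker_deriv e i (x - y) *\<^sub>R f x \<partial>lborel) \<partial>lborel)"
      if "integrable lborel f" for f :: "real^3 \<Rightarrow> complex"
      unfolding Vd[symmetric] by (rule Fubini_kernel[where k = "\<lambda>x y. ker_deriv e i (x - y)" and C = "1 / e\<^sup>2"]) (fact that r_int km(2) kbd)+
    have J: "integrable lborel (\<lambda>y. r y *\<^sub>R (\<integral>x. k (x - y) *\<^sub>R f x \<partial>lborel))"
      if f: "integrable lborel f" and [measurable]: "k \<in> borel_measurable borel" and k: "\<And>z. \<bar>k z\<bar> \<le> c"
      for k :: "real^3 \<Rightarrow> real" and f :: "real^3 \<Rightarrow> complex" and c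
    proof (rule Bochner_Integration.integrable_bound)
      note [measurable] = borel_measurable_integrable[OF f]
      show "integrable lborel (\<lambda>y. (c * (\<integral>x. norm (f x) \<partial>lborel)) * norm (r y))" using r_int by simp
      show "(\<lambda>y. r y *\<^sub>R (\<integral>x. k (x - y) *\<^sub>R f x \<partial>lborel)) \<in> borel_measurable lborel" by measurable
      have "norm (\<integral>x. k (x - y) *\<^sub>R f x \<partial>lborel) \<le> (\<integral>x. c * norm (f x) \<partial>lborel)" for y
      proof (rule Bochner_Integration.integral_norm_bound_integral[OF k_int[OF f _ k]])
        show "integrable lborel (\<lambda>x. c * norm (f x))" using f by simp
        show "norm (k (x - y) *\<^sub>R f x) \<le> c * norm (f x)" for x using k[of "x - y"] by (simp add: mult_right_mono)
      qed measurable
      then have "norm (\<integral>x. k (x - y) *\<^sub>R f x \<partial>lborel) * norm (r y) \<le> (\<integral>x. c * norm (f x) \<partial>lborel) * norm (r y)" for y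
        by (rule mult_right_mono) simp
      then have bd: "norm (r y *\<^sub>R (\<integral>x. k (x - y) *\<^sub>R f x \<partial>lborel)) \<le> (c * (\<integral>x. norm (f x) \<partial>lborel)) * norm (r y)" for y
        by (simp add: mult.commute)
      show "AE y in lborel. norm (r y *\<^sub>R (\<integral>x. k (x - y) *\<^sub>R f x \<partial>lborel)) \<le> norm ((c * (\<integral>x. norm (f x) \<partial>lborel)) * norm (r y))"
        by (intro AE_I2 order_trans[OF bd]) (simp only: real_norm_def abs_ge_self)
    qed
    have "(\<integral>x. V e x *\<^sub>R (partial_deriv i \<phi> x *\<^sub>R u x) \<partial>lborel) =
        (\<integral>y. - (r y *\<^sub>R (\<integral>x. ker e (x - y) *\<^sub>R (\<phi> x *\<^sub>R u' x) \<partial>lborel)) - r y *\<^sub>R (\<integral>x. ker_deriv e i (x - y) *\<^sub>R (\<phi> x *\<^sub>R u x) \<partial>lborel) \<partial>lborel)"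
      unfolding I1[OF \<phi>u(2)] inner by (simp add: scaleR_diff_right)
    also have "\<dots> = - (\<integral>x. V e x *\<^sub>R (\<phi> x *\<^sub>R u' x) \<partial>lborel) - (\<integral>x. V' e x *\<^sub>R (\<phi> x *\<^sub>R u x) \<partial>lborel)"
      unfolding I1[OF \<phi>u(3)] I2[OF \<phi>u(1)]
      using J[OF \<phi>u(3) ker_measurable(1) kb] J[OF \<phi>u(1) ker_measurable(2) ker_bounds(4)[OF e]] by simp
    finally show ?thesis by simp
  qed
  have lim: "(\<lambda>n. \<integral>x. V (1 / real (Suc n)) x *\<^sub>R f x \<partial>lborel) \<longlonglongrightarrow> (\<integral>x. pot r x *\<^sub>R f x \<partial>lborel)"
    "(\<lambda>n. \<integral>x. V' (1 / real (Suc n)) x *\<^sub>R f x \<partial>lborel) \<longlonglongrightarrow> (\<integral>x. pot r' x *\<^sub>R f x \<partial>lborel)"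
    if f: "integrable lborel f" for f :: "real^3 \<Rightarrow> complex"
  proof -
    note [measurable] = borel_measurable_integrable[OF f]
    have Df: "integrable lborel (\<lambda>x. D * norm (f x))" using f by simp
    show "(\<lambda>n. \<integral>x. V (1 / real (Suc n)) x *\<^sub>R f x \<partial>lborel) \<longlonglongrightarrow> (\<integral>x. pot r x *\<^sub>R f x \<partial>lborel)"
    proof (rule integral_dominated_convergence[OF _ _ Df])
      show "AE x in lborel. (\<lambda>n. V (1 / real (Suc n)) x *\<^sub>R f x) \<longlonglongrightarrow> pot r x *\<^sub>R f x"
        unfolding V_def by (intro AE_I2 tendsto_scaleR tendsto_const ker_pot_tendsto pr) measurable
      show "AE x in lborel. norm (V (1 / real (Suc n)) x *\<^sub>R f x) \<le> D * norm (f x)" for n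
        unfolding V_def norm_scaleR real_norm_def by (intro AE_I2 mult_right_mono pr(3)) auto
    qed measurable
    show "(\<lambda>n. \<integral>x. V' (1 / real (Suc n)) x *\<^sub>R f x \<partial>lborel) \<longlonglongrightarrow> (\<integral>x. pot r' x *\<^sub>R f x \<partial>lborel)"
    proof (rule integral_dominated_convergence[OF _ _ Df])
      show "AE x in lborel. (\<lambda>n. V' (1 / real (Suc n)) x *\<^sub>R f x) \<longlonglongrightarrow> pot r' x *\<^sub>R f x"
        unfolding V'_def by (intro AE_I2 tendsto_scaleR tendsto_const ker_pot_tendsto pr') measurable
      show "AE x in lborel. norm (V' (1 / real (Suc n)) x *\<^sub>R f x) \<le> D * norm (f x)" for n
        unfolding V'_def norm_scaleR real_norm_def by (intro AE_I2 mult_right_mono pr'(3)) auto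
    qed measurable
  qed
  have regn: "(\<integral>x. V (1 / real (Suc n)) x *\<^sub>R (partial_deriv i \<phi> x *\<^sub>R u x) \<partial>lborel) =
      - ((\<integral>x. V (1 / real (Suc n)) x *\<^sub>R (\<phi> x *\<^sub>R u' x) \<partial>lborel) + (\<integral>x. V' (1 / real (Suc n)) x *\<^sub>R (\<phi> x *\<^sub>R u x) \<partial>lborel))" for n
    by (rule reg) simp
  have "(\<lambda>n. \<integral>x. V (1 / real (Suc n)) x *\<^sub>R (partial_deriv i \<phi> x *\<^sub>R u x) \<partial>lborel) \<longlonglongrightarrow>
      - ((\<integral>x. pot r x *\<^sub>R (\<phi> x *\<^sub>R u' x) \<partial>lborel) + (\<integral>x. pot r' x *\<^sub>R (\<phi> x *\<^sub>R u x) \<partial>lborel))"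
    unfolding regn by (intro tendsto_minus tendsto_add lim \<phi>u)
  from LIMSEQ_unique[OF lim(1)[OF \<phi>u(2)] this]
  have "(\<integral>x. pot r x *\<^sub>R (partial_deriv i \<phi> x *\<^sub>R u x) \<partial>lborel) =
      - ((\<integral>x. pot r x *\<^sub>R (\<phi> x *\<^sub>R u' x) \<partial>lborel) + (\<integral>x. pot r' x *\<^sub>R (\<phi> x *\<^sub>R u x) \<partial>lborel))" .
  also have "(\<integral>x. pot r x *\<^sub>R (\<phi> x *\<^sub>R u' x) \<partial>lborel) + (\<integral>x. pot r' x *\<^sub>R (\<phi> x *\<^sub>R u x) \<partial>lborel) =
      (\<integral>x. pot r x *\<^sub>R (\<phi> x *\<^sub>R u' x) + pot r' x *\<^sub>R (\<phi> x *\<^sub>R u x) \<partial>lborel)"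
  proof (rule Bochner_Integration.integral_add[symmetric])
    have i: "integrable lborel (\<lambda>x. p x *\<^sub>R f x)"
      if f: "integrable lborel f" and [measurable]: "p \<in> borel_measurable borel" and p: "\<And>x. \<bar>p x\<bar> \<le> D" for p and f :: "real^3 \<Rightarrow> complex"
    proof (rule Bochner_Integration.integrable_bound)
      note [measurable] = borel_measurable_integrable[OF f]
      show "integrable lborel (\<lambda>x. D * norm (f x))" using f by simp
      show "(\<lambda>x. p x *\<^sub>R f x) \<in> borel_measurable lborel" by measurable
      have bd: "norm (p x *\<^sub>R f x) \<le> D * norm (f x)" for x using p[of x] by (simp add: mult_right_mono)
      show "AE x in lborel. norm (p x *\<^sub>R f x) \<le> norm (D * norm (f x))"
        by (intro AE_I2 order_trans[OF bd]) (simp only: real_norm_def abs_ge_self)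
    qed
    show "integrable lborel (\<lambda>x. pot r x *\<^sub>R (\<phi> x *\<^sub>R u' x))" by (intro i \<phi>u pr(2)) measurable
    show "integrable lborel (\<lambda>x. pot r' x *\<^sub>R (\<phi> x *\<^sub>R u x))" by (intro i \<phi>u pr'(2)) measurable
  qed
  also have "(\<integral>x. pot r x *\<^sub>R (partial_deriv i \<phi> x *\<^sub>R u x) \<partial>lborel) = (\<integral>x. partial_deriv i \<phi> x *\<^sub>R (of_real (pot r x) * u x) \<partial>lborel)"
    by (intro Bochner_Integration.integral_cong) (auto simp: scaleR_conv_of_real)
  also have "(\<integral>x. pot r x *\<^sub>R (\<phi> x *\<^sub>R u' x) + pot r' x *\<^sub>R (\<phi> x *\<^sub>R u x) \<partial>lborel) =
      (\<integral>x. \<phi> x *\<^sub>R (of_real (pot r x) * u' x + of_real (pot r' x) * u x) \<partial>lborel)"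
    by (intro Bochner_Integration.integral_cong) (auto simp: scaleR_conv_of_real algebra_simps)
  finally show "(\<integral>x. partial_deriv i \<phi> x *\<^sub>R (of_real (pot r x) * u x) \<partial>lborel) =
      - (\<integral>x. \<phi> x *\<^sub>R (of_real (pot r x) * u' x + of_real (pot r' x) * u x) \<partial>lborel)" .
qed

section \<open>The Sobolev space as a Hilbert space\<close>

lemma l2_cong_AE:
  assumes "f \<in> L2" "g \<in> L2" "AE x in lborel. f x = g x"
  shows "l2 f = l2 g"
proof -
  have [measurable]: "f \<in> borel_measurable borel" "g \<in> borel_measurable borel"
    using assms by (auto intro: L2_measurable)
  have "(\<integral>x. (cmod (f x))\<^sup>2 \<partial>lborel) = (\<integral>x. (cmod (g x))\<^sup>2 \<partial>lborel)"
    using assms(3) by (intro integral_cong_AE) auto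
  then show ?thesis by (simp add: l2_def)
qed

lemma norm_W12_l2: "(norm \<psi>)\<^sup>2 = (\<Sum>i\<in>UNIV. (l2 (weak_grad \<psi> i))\<^sup>2) + (l2 (rep_W12 \<psi>))\<^sup>2"
  by (simp add: power2_norm_eq_inner[of \<psi>] inner_W12_def power2_norm_eq_inner[symmetric] l2_square)

lemma l2_rep_le: "l2 (rep_W12 \<psi>) \<le> norm \<psi>"
proof (rule power2_le_imp_le)
  show "(l2 (rep_W12 \<psi>))\<^sup>2 \<le> (norm \<psi>)\<^sup>2" by (simp add: norm_W12_l2 sum_nonneg)
qed simp

lemma sum_l2_grad_le: "(\<Sum>i\<in>UNIV. (l2 (weak_grad \<psi> i))\<^sup>2) \<le> (norm \<psi>)\<^sup>2"
  by (simp add: norm_W12_l2)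

lemma l2_grad_le: "l2 (weak_grad \<psi> i) \<le> norm \<psi>"
proof (rule power2_le_imp_le)
  have "(l2 (weak_grad \<psi> i))\<^sup>2 \<le> (\<Sum>i\<in>UNIV. (l2 (weak_grad \<psi> i))\<^sup>2)"
    by (rule member_le_sum) auto
  then show "(l2 (weak_grad \<psi> i))\<^sup>2 \<le> (norm \<psi>)\<^sup>2" using sum_l2_grad_le[of \<psi>] by linarith
qed simp

text \<open>The 12 of Hardy's inequality is rounded up to 16, whose root is 4.\<close>

lemma hardy_norm_le: "hardy_norm (weak_grad \<psi>) \<le> 4 * norm \<psi>"
proof -
  have "sqrt (12 * (\<Sum>i\<in>UNIV. (l2 (weak_grad \<psi> i))\<^sup>2)) \<le> sqrt ((4 * norm \<psi>)\<^sup>2)"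
  proof (rule real_sqrt_le_mono)
    have "0 \<le> (norm \<psi>)\<^sup>2" "(4 * norm \<psi>)\<^sup>2 = 16 * (norm \<psi>)\<^sup>2" by (simp_all add: power_mult_distrib)
    then show "12 * (\<Sum>i\<in>UNIV. (l2 (weak_grad \<psi> i))\<^sup>2) \<le> (4 * norm \<psi>)\<^sup>2"
      using sum_l2_grad_le[of \<psi>] by linarith
  qed
  moreover have "sqrt ((4 * norm \<psi>)\<^sup>2) = 4 * norm \<psi>" by (rule real_sqrt_unique) simp_all
  ultimately show ?thesis unfolding hardy_norm_def by (simp only:)
qed

lemma abs_W12:
  assumes f: "f \<in> L2" and g: "\<And>i. g i \<in> L2" "\<And>i. weak_partial i f (g i)"
  shows "AE x in lborel. rep_W12 (abs_W12 f) x = f x" "AE x in lborel. weak_grad (abs_W12 f) i x = g i x"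
proof -
  have "f \<in> sobolev_functions" using assms by (auto simp: sobolev_functions_def)
  then show r: "AE x in lborel. rep_W12 (abs_W12 f) x = f x" by (rule rep_abs)
  have "weak_partial i f (weak_grad (abs_W12 f) i)"
    by (rule weak_partial_cong[OF rep_L2 f r weak_grad(2)])
  from weak_partial_unique[OF weak_grad(1) g(1) this g(2)]
  show "AE x in lborel. weak_grad (abs_W12 f) i x = g i x" .
qed

lemma rep_diff: "AE x in lborel. rep_W12 (\<psi> - \<zeta>) x = rep_W12 \<psi> x - rep_W12 \<zeta> x"
  using rep_plus[of \<psi> "scaleC_W12 (- 1) \<zeta>"] rep_scaleC[of "- 1" \<zeta>]
  unfolding minus_W12_def by eventually_elim simp

lemma grad_diff: "AE x in lborel. weak_grad (\<psi> - \<zeta>) i x = weak_grad \<psi> i x - weak_grad \<zeta> i x"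
  using grad_plus[of \<psi> "scaleC_W12 (- 1) \<zeta>" i] grad_scaleC[of "- 1" \<zeta> i]
  unfolding minus_W12_def by eventually_elim simp

lemma rep_scaleR: "AE x in lborel. rep_W12 (r *\<^sub>R \<psi>) x = of_real r * rep_W12 \<psi> x"
  unfolding scaleR_W12_def by (rule rep_scaleC)

lemma l2_diff_W12:
  "l2 (\<lambda>x. rep_W12 \<psi> x - rep_W12 \<zeta> x) = l2 (rep_W12 (\<psi> - \<zeta>))"
  "l2 (\<lambda>x. weak_grad \<psi> i x - weak_grad \<zeta> i x) = l2 (weak_grad (\<psi> - \<zeta>) i)"
  using rep_diff[of \<psi> \<zeta>] grad_diff[of \<psi> \<zeta> i]
  by (auto intro!: l2_cong_AE L2_diff rep_L2 weak_grad(1) elim: AE_mp)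

lemma L2_limit:
  assumes f: "\<And>n. f n \<in> L2" and C: "\<And>e. e > 0 \<Longrightarrow> \<exists>N. \<forall>m\<ge>N. \<forall>n\<ge>N. l2 (\<lambda>x. f m x - f n x) < e"
  shows "\<exists>g\<in>L2. (\<lambda>n. l2 (\<lambda>x. f n x - g x)) \<longlonglongrightarrow> 0"
proof -
  have [measurable]: "f n \<in> borel_measurable borel" for n using f by (rule L2_measurable)
  have "\<exists>g. g \<in> borel_measurable lborel \<and> (\<forall>n. integrable lborel (\<lambda>x. (cmod (f n x - g x))\<^sup>2)) \<and>
      (\<lambda>n. \<integral>x. (cmod (f n x - g x))\<^sup>2 \<partial>lborel) \<longlonglongrightarrow> 0"
  proof (rule L2_Cauchy_limit[of f lborel])
    show "integrable lborel (\<lambda>x. (cmod (f m x - f n x))\<^sup>2)" for m n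
      by (intro L2_integrable_square L2_diff f)
    show "\<exists>N. \<forall>m\<ge>N. \<forall>n\<ge>N. (\<integral>x. (cmod (f m x - f n x))\<^sup>2 \<partial>lborel) < e" if e: "e > 0" for e
    proof -
      obtain N where N: "\<And>m n. m \<ge> N \<Longrightarrow> n \<ge> N \<Longrightarrow> l2 (\<lambda>x. f m x - f n x) < sqrt e"
        using C[of "sqrt e"] e by auto
      have "(\<integral>x. (cmod (f m x - f n x))\<^sup>2 \<partial>lborel) < e" if "m \<ge> N" "n \<ge> N" for m n
        using N[OF that] by (simp add: l2_def)
      then show ?thesis by blast
    qed
  qed auto
  then obtain g where g: "g \<in> borel_measurable lborel" "\<And>n. integrable lborel (\<lambda>x. (cmod (f n x - g x))\<^sup>2)"
    "(\<lambda>n. \<integral>x. (cmod (f n x - g x))\<^sup>2 \<partial>lborel) \<longlonglongrightarrow> 0" by blast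
  have "(\<lambda>x. f 0 x - g x) \<in> L2" using g(1,2) by (simp add: L2_def)
  from L2_diff[OF f[of 0] this] have "g \<in> L2" by simp
  moreover have "(\<lambda>n. l2 (\<lambda>x. f n x - g x)) \<longlonglongrightarrow> 0"
    using tendsto_real_sqrt[OF g(3)] by (simp add: l2_def)
  ultimately show ?thesis by blast
qed

text \<open>Both sides of the defining identity are continuous under L2 convergence, so the weak
  derivative is a closed operator.\<close>

lemma weak_partial_limit:
  assumes f: "\<And>n. f n \<in> L2" "\<And>n. f' n \<in> L2" "\<And>n. weak_partial i (f n) (f' n)"
    and g: "g \<in> L2" "g' \<in> L2" "(\<lambda>n. l2 (\<lambda>x. f n x - g x)) \<longlonglongrightarrow> 0" "(\<lambda>n. l2 (\<lambda>x. f' n x - g' x)) \<longlonglongrightarrow> 0"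
  shows "weak_partial i g g'"
  unfolding weak_partial_def
proof (intro allI impI)
  fix \<phi> :: "real^3 \<Rightarrow> real" assume \<phi>: "test_function UNIV \<phi>"
  have lim: "(\<lambda>n. \<integral>x. w x * h n x \<partial>lborel) \<longlonglongrightarrow> (\<integral>x. w x * k x \<partial>lborel)"
    if w: "w \<in> L2" and h: "\<And>n. h n \<in> L2" "k \<in> L2" "(\<lambda>n. l2 (\<lambda>x. h n x - k x)) \<longlonglongrightarrow> 0" for w h k
  proof (rule LIM_zero_cancel, rule Lim_null_comparison)
    show "\<forall>\<^sub>F n in sequentially. norm ((\<integral>x. w x * h n x \<partial>lborel) - (\<integral>x. w x * k x \<partial>lborel)) \<le> l2 w * l2 (\<lambda>x. h n x - k x)"
    proof (intro always_eventually allI)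
      fix n
      have "(\<integral>x. w x * h n x \<partial>lborel) - (\<integral>x. w x * k x \<partial>lborel) = (\<integral>x. w x * h n x - w x * k x \<partial>lborel)"
        by (intro Bochner_Integration.integral_diff[symmetric] L2_mult_integrable w h)
      also have "\<dots> = (\<integral>x. w x * (h n x - k x) \<partial>lborel)" by (simp add: right_diff_distrib)
      finally show "norm ((\<integral>x. w x * h n x \<partial>lborel) - (\<integral>x. w x * k x \<partial>lborel)) \<le> l2 w * l2 (\<lambda>x. h n x - k x)"
        using l2_Cauchy_Schwarz(3)[OF w L2_diff[OF h(1)[of n] h(2)]] by simp
    qed
    show "(\<lambda>n. l2 w * l2 (\<lambda>x. h n x - k x)) \<longlonglongrightarrow> 0" using tendsto_mult_left[OF h(3), of "l2 w"] by simp
  qed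
  have eq: "(\<integral>x. of_real (partial_deriv i \<phi> x) * f n x \<partial>lborel) = - (\<integral>x. of_real (\<phi> x) * f' n x \<partial>lborel)" for n
    using f(3)[of n] \<phi> by (simp add: weak_partial_def scaleR_conv_of_real)
  have "(\<lambda>n. - (\<integral>x. of_real (\<phi> x) * f' n x \<partial>lborel)) \<longlonglongrightarrow> (\<integral>x. of_real (partial_deriv i \<phi> x) * g x \<partial>lborel)"
    using lim[OF partial_L2[OF \<phi>, where i = i] f(1) g(1,3)] unfolding eq .
  from LIMSEQ_unique[OF this tendsto_minus[OF lim[OF test_function_L2[OF \<phi>] f(2) g(2,4)]]]
  show "(\<integral>x. partial_deriv i \<phi> x *\<^sub>R g x \<partial>lborel) = - (\<integral>x. \<phi> x *\<^sub>R g' x \<partial>lborel)"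
    by (simp add: scaleR_conv_of_real)
qed

text \<open>Functions and weak gradients converge separately in L2, and closedness of the weak
  derivative identifies the limits of the gradients with the gradient of the limit.\<close>

instance W12 :: banach
proof
  fix X :: "nat \<Rightarrow> W12" assume X: "Cauchy X"
  have C: "\<exists>N. \<forall>m\<ge>N. \<forall>n\<ge>N. L (X m - X n) < e" if "\<And>v. L v \<le> norm v" "e > 0" for L :: "W12 \<Rightarrow> real" and e
    using X that unfolding Cauchy_iff by (meson le_less_trans)
  have "\<exists>g\<in>L2. (\<lambda>n. l2 (\<lambda>x. rep_W12 (X n) x - g x)) \<longlonglongrightarrow> 0"
    by (rule L2_limit[OF rep_L2]) (unfold l2_diff_W12, rule C[OF l2_rep_le])
  then obtain g where g: "g \<in> L2" "(\<lambda>n. l2 (\<lambda>x. rep_W12 (X n) x - g x)) \<longlonglongrightarrow> 0" by blast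
  have "\<exists>g\<in>L2. (\<lambda>n. l2 (\<lambda>x. weak_grad (X n) i x - g x)) \<longlonglongrightarrow> 0" for i
    by (rule L2_limit[OF weak_grad(1)]) (unfold l2_diff_W12, rule C[where L = "\<lambda>v. l2 (weak_grad v i)", OF l2_grad_le])
  then have "\<forall>i. \<exists>g. g \<in> L2 \<and> (\<lambda>n. l2 (\<lambda>x. weak_grad (X n) i x - g x)) \<longlonglongrightarrow> 0" by (simp add: Bex_def)
  from choice[OF this] obtain g' where g'': "\<forall>i. g' i \<in> L2 \<and> (\<lambda>n. l2 (\<lambda>x. weak_grad (X n) i x - g' i x)) \<longlonglongrightarrow> 0" ..
  have g': "\<And>i. g' i \<in> L2" "\<And>i. (\<lambda>n. l2 (\<lambda>x. weak_grad (X n) i x - g' i x)) \<longlonglongrightarrow> 0" using g'' by simp_all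
  have wp: "weak_partial i g (g' i)" for i
    by (rule weak_partial_limit[OF rep_L2 weak_grad g(1) g'(1) g(2) g'(2)])
  define \<psi> where "\<psi> = abs_W12 g"
  note ab = abs_W12[OF g(1) g'(1) wp, folded \<psi>_def]
  have e1: "l2 (rep_W12 (X n - \<psi>)) = l2 (\<lambda>x. rep_W12 (X n) x - g x)" for n
    unfolding l2_diff_W12(1)[symmetric] using ab(1) by (intro l2_cong_AE L2_diff rep_L2 g) auto
  have e2: "l2 (weak_grad (X n - \<psi>) i) = l2 (\<lambda>x. weak_grad (X n) i x - g' i x)" for n i
    unfolding l2_diff_W12(2)[symmetric] using ab(2)[of i] by (intro l2_cong_AE L2_diff weak_grad(1) g') auto
  have "(\<lambda>n. (norm (X n - \<psi>))\<^sup>2) \<longlonglongrightarrow> (\<Sum>i\<in>(UNIV::3 set). 0\<^sup>2) + 0\<^sup>2"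
    unfolding norm_W12_l2 e1 e2 by (intro tendsto_intros g g')
  then have "(\<lambda>n. sqrt ((norm (X n - \<psi>))\<^sup>2)) \<longlonglongrightarrow> sqrt 0" by (intro tendsto_real_sqrt) simp
  then have "(\<lambda>n. norm (X n - \<psi>)) \<longlonglongrightarrow> 0" by simp
  then have "X \<longlonglongrightarrow> \<psi>" by (rule LIM_zero_cancel[OF tendsto_norm_zero_cancel])
  then show "convergent X" by (auto simp: convergent_def)
qed

text \<open>The derivative of the product \<open>X\<close> of both test functions has integral 0,
  since each difference quotient of \<open>X\<close> has integral 0 by translation invariance. The
  product rule then gives the identity.\<close>

lemma test_function_weak_partial:
  assumes \<phi>: "test_function UNIV \<phi>"
  shows "weak_partial i (\<lambda>x. complex_of_real (\<phi> x)) (\<lambda>x. complex_of_real (partial_deriv i \<phi> x))"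
  unfolding weak_partial_def
proof (intro allI impI)
  fix \<eta> :: "real^3 \<Rightarrow> real" assume \<eta>: "test_function UNIV \<eta>"
  obtain C r where p: "line_derivative i \<phi> (partial_deriv i \<phi>)" "\<And>x. \<bar>partial_deriv i \<phi> x\<bar> \<le> C"
    "\<And>x. norm x > r \<Longrightarrow> \<phi> x = 0" and [measurable]: "\<phi> \<in> borel_measurable borel" "partial_deriv i \<phi> \<in> borel_measurable borel"
    using test_function_facts[OF \<phi>, of i] by auto
  obtain C' r' where q: "line_derivative i \<eta> (partial_deriv i \<eta>)" "\<And>x. \<bar>partial_deriv i \<eta> x\<bar> \<le> C'"
    "\<And>x. norm x > r' \<Longrightarrow> \<eta> x = 0" and [measurable]: "\<eta> \<in> borel_measurable borel" "partial_deriv i \<eta> \<in> borel_measurable borel"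
    using test_function_facts[OF \<eta>, of i] by auto
  define X where "X = (\<lambda>x. \<phi> x * \<eta> x)"
  define X' where "X' = (\<lambda>x. \<phi> x * partial_deriv i \<eta> x + partial_deriv i \<phi> x * \<eta> x)"
  have [measurable]: "X \<in> borel_measurable borel" "X' \<in> borel_measurable borel" by (simp_all add: X_def X'_def)
  have X: "line_derivative i X X'"
    unfolding line_derivative_def
  proof (intro allI)
    fix x s
    show "((\<lambda>h. X (x + h *\<^sub>R axis i 1)) has_real_derivative X' (x + s *\<^sub>R axis i 1)) (at s)"
      unfolding X_def X'_def
      using DERIV_mult[OF p(1)[unfolded line_derivative_def, rule_format, of x s] q(1)[unfolded line_derivative_def, rule_format, of x s]]
      by (simp add: mult.commute add.commute)
  qed
  have X'c: "continuous_on UNIV X'" unfolding X'_def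
    by (intro continuous_intros test_function_continuous[OF \<phi>] test_function_continuous[OF \<eta>]
        partial_continuous[OF \<phi>] partial_continuous[OF \<eta>])
  \<comment> \<open>The steps are at most 1, so the ball of this radius contains the supports of all
    translates. Its indicator is the square integrable factor that the limit of difference quotients
    is stated with.\<close>
  define \<rho> where "\<rho> = \<bar>r\<bar> + 1"
  have supp: "X x = 0" "X' x = 0" if "norm x > r" for x
  proof -
    have "open {x::real^3. r < norm x}" by (intro open_Collect_less continuous_intros)
    moreover have "{x. \<phi> x \<noteq> 0} \<inter> {x. r < norm x} = {}" using p(3) by auto
    ultimately have "closure {x. \<phi> x \<noteq> 0} \<inter> {x. r < norm x} = {}" by (simp add: open_Int_closure_eq_empty Int_commute)
    then have "x \<notin> closure {x. \<phi> x \<noteq> 0}" using that by blast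
    from partial_eq_0[OF this] show "X x = 0" "X' x = 0" using p(3)[OF that] by (simp_all add: X_def X'_def)
  qed
  have "bounded (X' ` cball 0 r)"
    by (intro compact_imp_bounded compact_continuous_image compact_cball continuous_on_subset[OF X'c]) simp
  then obtain B0 where B: "\<forall>v\<in>X' ` cball 0 r. norm v \<le> B0" unfolding bounded_iff by (elim exE)
  have B0: "\<bar>X' x\<bar> \<le> \<bar>B0\<bar>" for x
  proof (cases "norm x \<le> r")
    case True
    then have "\<bar>X' x\<bar> \<le> B0" using B by simp
    then show ?thesis by linarith
  qed (simp add: supp)
  define h where "h = (\<lambda>n. 1 / real (Suc n))"
  have h: "h \<longlonglongrightarrow> 0" "\<And>n. h n \<noteq> 0" "\<And>n. \<bar>h n\<bar> \<le> 1"
    using LIMSEQ_inverse_real_of_nat by (simp_all add: h_def inverse_eq_divide)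
  define I where "I = (\<lambda>x::real^3. complex_of_real (indicator (cball 0 \<rho>) x))"
  have lim: "(\<lambda>n. \<integral>x. ((X (x + h n *\<^sub>R axis i 1) - X x) / h n) *\<^sub>R I x \<partial>lborel) \<longlonglongrightarrow> (\<integral>x. X' x *\<^sub>R I x \<partial>lborel)"
    unfolding I_def by (rule compact_line_quotient_tendsto[OF indicator_cball_L2 X B0 _ _ supp(1) h(1,2)]) measurable
  have in1: "X y *\<^sub>R I x = of_real (X y)" if "norm (y - x) \<le> 1" for x y
  proof (cases "norm y \<le> r")
    case True
    then have "norm x \<le> \<rho>" using norm_triangle_ineq3[of x y] that by (simp add: \<rho>_def norm_minus_commute)
    then show ?thesis by (simp add: I_def scaleR_conv_of_real)
  qed (simp add: supp)
  have XI: "integrable lborel (\<lambda>x. complex_of_real (X x))"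
  proof -
    have "(\<lambda>x. complex_of_real (X x)) \<in> L2"
      by (rule continuous_compact_support_L2[of _ "cball 0 r"])
         (auto simp: X_def p(3) intro!: continuous_intros test_function_continuous[OF \<phi>] test_function_continuous[OF \<eta>])
    from L2_mult_integrable[OF this indicator_cball_L2[of \<rho>]]
    have "integrable lborel (\<lambda>x. complex_of_real (X x) * I x)" by (simp only: I_def)
    moreover have "complex_of_real (X x) * I x = complex_of_real (X x)" for x
      using in1[of x x] by (simp add: scaleR_conv_of_real)
    ultimately show ?thesis by (simp only:)
  qed
  have "(\<integral>x. ((X (x + h n *\<^sub>R axis i 1) - X x) / h n) *\<^sub>R I x \<partial>lborel) = 0" for n
  proof -
    have XIn: "integrable lborel (\<lambda>x. complex_of_real (X (x + h n *\<^sub>R axis i 1)))"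
      using lborel_translate(2)[of "\<lambda>x. complex_of_real (X x)"] XI by simp
    have e: "X (x + h n *\<^sub>R axis i 1) *\<^sub>R I x = of_real (X (x + h n *\<^sub>R axis i 1))" "X x *\<^sub>R I x = of_real (X x)" for x
      using h(3)[of n] by (auto intro!: in1)
    have "(\<integral>x. ((X (x + h n *\<^sub>R axis i 1) - X x) / h n) *\<^sub>R I x \<partial>lborel) =
        (\<integral>x. (of_real (X (x + h n *\<^sub>R axis i 1)) - of_real (X x)) /\<^sub>R h n \<partial>lborel)"
    proof (intro Bochner_Integration.integral_cong refl)
      fix x
      have "((X (x + h n *\<^sub>R axis i 1) - X x) / h n) *\<^sub>R I x =
          (X (x + h n *\<^sub>R axis i 1) *\<^sub>R I x - X x *\<^sub>R I x) /\<^sub>R h n"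
        by (simp add: divide_inverse scaleR_diff_left scaleR_diff_right right_diff_distrib mult.commute[of _ "inverse (h n)"])
      then show "((X (x + h n *\<^sub>R axis i 1) - X x) / h n) *\<^sub>R I x = (of_real (X (x + h n *\<^sub>R axis i 1)) - of_real (X x)) /\<^sub>R h n"
        by (simp only: e)
    qed
    also have "\<dots> = ((\<integral>x. complex_of_real (X (x + h n *\<^sub>R axis i 1)) \<partial>lborel) - (\<integral>x. complex_of_real (X x) \<partial>lborel)) /\<^sub>R h n"
      unfolding integral_scaleR_right Bochner_Integration.integral_diff[OF XIn XI] ..
    also have "(\<integral>x. complex_of_real (X (x + h n *\<^sub>R axis i 1)) \<partial>lborel) = (\<integral>x. complex_of_real (X x) \<partial>lborel)"
      by (rule lborel_translate(1)) simp
    finally show ?thesis by simp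
  qed
  with lim have zero: "(\<integral>x. X' x *\<^sub>R I x \<partial>lborel) = 0" by (simp add: LIMSEQ_const_iff)
  have "X' x *\<^sub>R I x = partial_deriv i \<eta> x *\<^sub>R complex_of_real (\<phi> x) + \<eta> x *\<^sub>R complex_of_real (partial_deriv i \<phi> x)" for x
  proof -
    have "X' x *\<^sub>R I x = of_real (X' x)" using supp(2)[of x] by (cases "norm x \<le> r") (auto simp: I_def \<rho>_def scaleR_conv_of_real)
    then show ?thesis by (simp add: X'_def scaleR_conv_of_real mult.commute)
  qed
  then have "(\<integral>x. partial_deriv i \<eta> x *\<^sub>R complex_of_real (\<phi> x) + \<eta> x *\<^sub>R complex_of_real (partial_deriv i \<phi> x) \<partial>lborel) = 0"
    using zero by simp
  then show "(\<integral>x. partial_deriv i \<eta> x *\<^sub>R complex_of_real (\<phi> x) \<partial>lborel) = - (\<integral>x. \<eta> x *\<^sub>R complex_of_real (partial_deriv i \<phi> x) \<partial>lborel)"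
    using test_mult_integrable[OF \<eta> test_function_L2[OF \<phi>]] test_mult_integrable(1)[OF \<eta> partial_L2[OF \<phi>]]
    by (simp add: eq_neg_iff_add_eq_0)
qed

text \<open>Leads to the class \<open>perfect_space\<close>, on which the operator algebra rests. A
  bump function is nonzero on an open set, hence not almost everywhere zero.\<close>

lemma W12_nontrivial: "\<exists>\<psi>::W12. \<psi> \<noteq> 0"
proof -
  define \<phi> where "\<phi> = box_bump (- 1) 1 1"
  have \<phi>: "test_function UNIV \<phi>" unfolding \<phi>_def by (rule box_bump_test)
  define \<psi> where "\<psi> = abs_W12 (\<lambda>x. complex_of_real (\<phi> x))"
  have r: "AE x in lborel. rep_W12 \<psi> x = complex_of_real (\<phi> x)"
    unfolding \<psi>_def by (rule abs_W12(1)[OF test_function_L2[OF \<phi>] partial_L2[OF \<phi>] test_function_weak_partial[OF \<phi>]])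
  have "\<psi> \<noteq> 0"
  proof
    assume "\<psi> = 0"
    then have r0: "AE x in lborel. rep_W12 \<psi> x = 0" using rep_zero by simp
    from r r0 have "AE x in lborel. \<phi> x = 0" by eventually_elim simp
    then have "{x. \<phi> x \<noteq> 0} \<in> null_sets lborel"
      using test_function_square_integrable(1)[OF \<phi>] by (subst AE_iff_null_sets) auto
    then have "negligible {x. \<phi> x \<noteq> 0}"
      by (simp add: negligible_iff_null_sets null_sets_completionI)
    moreover have "open {x. \<phi> x \<noteq> 0}"
      by (intro open_Collect_neq test_function_continuous[OF \<phi>] continuous_on_const)
    moreover have "\<phi> 0 \<noteq> 0" by (simp add: \<phi>_def box_bump_def flat_exp_def)
    ultimately show False using open_not_negligible by blast
  qed
  then show ?thesis by blast
qed

instance W12 :: perfect_space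
proof
  fix x :: W12
  show "\<not> open {x}"
  proof
    assume "open {x}"
    then obtain e where e: "e > 0" "\<And>y. dist y x < e \<Longrightarrow> y = x" by (auto simp: open_dist)
    obtain v :: W12 where v: "v \<noteq> 0" using W12_nontrivial by blast
    define y where "y = x + (e / (2 * norm v)) *\<^sub>R v"
    have "dist y x = e / 2" using v e by (simp add: y_def dist_norm)
    then have "y = x" using e by auto
    then show False using v e by (simp add: y_def)
  qed
qed

subsection \<open>Conjugation, multiplication by the imaginary unit, and the resolvent of the Laplacian\<close>

lemma inner_W12_AE:
  assumes "AE x in lborel. rep_W12 a x \<bullet> rep_W12 b x = rep_W12 c x \<bullet> rep_W12 d x"
    and "\<And>i. AE x in lborel. weak_grad a i x \<bullet> weak_grad b i x = weak_grad c i x \<bullet> weak_grad d i x"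
  shows "a \<bullet> b = c \<bullet> d"
proof -
  have "(\<integral>x. rep_W12 a x \<bullet> rep_W12 b x \<partial>lborel) = (\<integral>x. rep_W12 c x \<bullet> rep_W12 d x \<partial>lborel)"
    using assms(1) by (intro integral_cong_AE) auto
  moreover have "(\<integral>x. weak_grad a i x \<bullet> weak_grad b i x \<partial>lborel) = (\<integral>x. weak_grad c i x \<bullet> weak_grad d i x \<partial>lborel)" for i
    using assms(2)[of i] by (intro integral_cong_AE) auto
  ultimately show ?thesis by (simp add: inner_W12_def)
qed

abbreviation J :: "W12 \<Rightarrow> W12" where "J \<equiv> scaleC_W12 \<i>"

lemma rep_J: "AE x in lborel. rep_W12 (J a) x = \<i> * rep_W12 a x"
  by (rule rep_scaleC)

lemma grad_J: "AE x in lborel. weak_grad (J a) i x = \<i> * weak_grad a i x"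
  by (rule grad_scaleC)

lemma J_inner: "J a \<bullet> J b = a \<bullet> b"
proof (rule inner_W12_AE)
  show "AE x in lborel. rep_W12 (J a) x \<bullet> rep_W12 (J b) x = rep_W12 a x \<bullet> rep_W12 b x"
    using rep_J[of a] rep_J[of b] by eventually_elim (simp add: inner_complex_def)
  show "AE x in lborel. weak_grad (J a) i x \<bullet> weak_grad (J b) i x = weak_grad a i x \<bullet> weak_grad b i x" for i
    using grad_J[of a i] grad_J[of b i] by eventually_elim (simp add: inner_complex_def)
qed

lemma J_J: "J (J a) = - a"
proof (rule W12_eqI)
  show "AE x in lborel. rep_W12 (J (J a)) x = rep_W12 (- a) x"
    using rep_J[of "J a"] rep_J[of a] rep_scaleC[of "- 1" a] unfolding uminus_W12_def
    by eventually_elim simp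
qed

lemma bounded_linear_J: "bounded_linear J"
proof (rule bounded_linear_intro)
  fix a b :: W12 and r :: real
  show "J (a + b) = J a + J b"
    by (rule W12_eqI) (use rep_J[of "a + b"] rep_J[of a] rep_J[of b] rep_plus[of a b] rep_plus[of "J a" "J b"] in \<open>eventually_elim, simp add: distrib_left\<close>)
  show "J (r *\<^sub>R a) = r *\<^sub>R J a"
    by (rule W12_eqI) (use rep_J[of "r *\<^sub>R a"] rep_J[of a] rep_scaleR[of r a] rep_scaleR[of r "J a"] in \<open>eventually_elim, simp add: scaleR_conv_of_real\<close>)
  show "norm (J a) \<le> norm a * 1" by (simp add: norm_eq_sqrt_inner J_inner)
qed

text \<open>The dual pairing carries no conjugation while the inner product does; conjugating the
  test element translates one into the other.\<close>

definition conj_W12 :: "W12 \<Rightarrow> W12" where "conj_W12 a = abs_W12 (\<lambda>x. cnj (rep_W12 a x))"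

lemma conj_W12:
  "AE x in lborel. rep_W12 (conj_W12 a) x = cnj (rep_W12 a x)"
  "AE x in lborel. weak_grad (conj_W12 a) i x = cnj (weak_grad a i x)"
  unfolding conj_W12_def
  by (intro abs_W12[of _ "\<lambda>i x. cnj (weak_grad a i x)"] L2_cnj rep_L2 weak_grad(1) weak_partial_cnj weak_grad(2))+

lemma conj_conj: "conj_W12 (conj_W12 a) = a"
  by (rule W12_eqI) (use conj_W12(1)[of "conj_W12 a"] conj_W12(1)[of a]  in \<open>eventually_elim, simp\<close>)

lemma conj_J: "conj_W12 (J a) = - J (conj_W12 a)"
  by (rule W12_eqI) (use conj_W12(1)[of "J a"] conj_W12(1)[of a] rep_J[of a] rep_J[of "conj_W12 a"] rep_scaleC[of "- 1" "J (conj_W12 a)", folded uminus_W12_def] in \<open>eventually_elim, simp\<close>)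

lemma norm_conj: "norm (conj_W12 a) = norm a"
proof -
  have "conj_W12 a \<bullet> conj_W12 a = a \<bullet> a"
  proof (rule inner_W12_AE)
    show "AE x in lborel. rep_W12 (conj_W12 a) x \<bullet> rep_W12 (conj_W12 a) x = rep_W12 a x \<bullet> rep_W12 a x"
      using conj_W12(1)[of a] by eventually_elim (simp add: inner_complex_def)
    show "AE x in lborel. weak_grad (conj_W12 a) i x \<bullet> weak_grad (conj_W12 a) i x = weak_grad a i x \<bullet> weak_grad a i x" for i
      using conj_W12(2)[of a i] by eventually_elim (simp add: inner_complex_def)
  qed
  then show ?thesis by (simp add: norm_eq_sqrt_inner)
qed

lemma bounded_linear_conj: "bounded_linear conj_W12"
proof (rule bounded_linear_intro)
  fix a b :: W12 and r :: real
  show "conj_W12 (a + b) = conj_W12 a + conj_W12 b"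
    by (rule W12_eqI) (use conj_W12(1)[of "a + b"] conj_W12(1)[of a] conj_W12(1)[of b] rep_plus[of a b] rep_plus[of "conj_W12 a" "conj_W12 b"] in \<open>eventually_elim, simp\<close>)
  show "conj_W12 (r *\<^sub>R a) = r *\<^sub>R conj_W12 a"
    by (rule W12_eqI) (use conj_W12(1)[of "r *\<^sub>R a"] conj_W12(1)[of a] rep_scaleR[of r a] rep_scaleR[of r "conj_W12 a"] in \<open>eventually_elim, simp add: scaleR_conv_of_real\<close>)
  show "norm (conj_W12 a) \<le> norm a * 1" by (simp add: norm_conj)
qed

definition inner_L2 :: "W12 \<Rightarrow> W12 \<Rightarrow> real" where
  "inner_L2 a b = (\<integral>x. rep_W12 a x \<bullet> rep_W12 b x \<partial>lborel)"

lemma inner_L2_commute: "inner_L2 a b = inner_L2 b a"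
  by (simp add: inner_L2_def inner_commute)

lemma inner_L2_self: "inner_L2 a a = (l2 (rep_W12 a))\<^sup>2"
  by (simp add: inner_L2_def l2_square power2_norm_eq_inner)

lemma inner_L2_bound: "\<bar>inner_L2 a b\<bar> \<le> l2 (rep_W12 a) * l2 (rep_W12 b)"
proof -
  have "\<bar>inner_L2 a b\<bar> \<le> (\<integral>x. \<bar>rep_W12 a x \<bullet> rep_W12 b x\<bar> \<partial>lborel)"
    unfolding inner_L2_def by (rule integral_abs_bound)
  also have "\<dots> \<le> (\<integral>x. cmod (rep_W12 a x) * cmod (rep_W12 b x) \<partial>lborel)"
    by (intro integral_mono integrable_abs L2_inner_integrable rep_L2 l2_Cauchy_Schwarz(1) Cauchy_Schwarz_ineq2)
  also have "\<dots> \<le> l2 (rep_W12 a) * l2 (rep_W12 b)" by (intro l2_Cauchy_Schwarz(2) rep_L2)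
  finally show ?thesis .
qed

lemma inner_L2_add: "inner_L2 a (b + c) = inner_L2 a b + inner_L2 a c"
proof -
  have "inner_L2 a (b + c) = (\<integral>x. rep_W12 a x \<bullet> rep_W12 b x + rep_W12 a x \<bullet> rep_W12 c x \<partial>lborel)"
    unfolding inner_L2_def using rep_plus[of b c] by (intro integral_cong_AE) (auto simp: inner_add_right)
  then show ?thesis by (simp add: inner_L2_def L2_inner_integrable rep_L2)
qed

lemma inner_L2_scaleR: "inner_L2 a (r *\<^sub>R b) = r * inner_L2 a b"
proof -
  have "inner_L2 a (r *\<^sub>R b) = (\<integral>x. r * (rep_W12 a x \<bullet> rep_W12 b x) \<partial>lborel)"
    unfolding inner_L2_def using rep_scaleR[of r b]
    by (intro integral_cong_AE) (auto simp: scaleR_conv_of_real[symmetric])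
  then show ?thesis by (simp add: inner_L2_def)
qed

lemma bounded_linear_inner_L2: "bounded_linear (inner_L2 a)"
proof (rule bounded_linear_intro[OF inner_L2_add])
  show "inner_L2 a (r *\<^sub>R b) = r *\<^sub>R inner_L2 a b" for r b by (simp add: inner_L2_scaleR)
  show "norm (inner_L2 a b) \<le> norm b * l2 (rep_W12 a)" for b
    using inner_L2_bound[of a b] mult_left_mono[OF l2_rep_le[of b] l2_nonneg[of "rep_W12 a"]]
    by (simp add: mult.commute)
qed

lemma inner_L2_J: "inner_L2 (J a) b = - inner_L2 a (J b)"
proof -
  have "inner_L2 (J a) b = (\<integral>x. - (rep_W12 a x \<bullet> rep_W12 (J b) x) \<partial>lborel)"
    unfolding inner_L2_def using rep_J[of a] rep_J[of b]
    by (intro integral_cong_AE) (auto simp: inner_complex_def)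
  then show ?thesis by (simp add: inner_L2_def)
qed

definition K :: "W12 \<Rightarrow> W12" where "K a = (SOME b. \<forall>v. b \<bullet> v = inner_L2 a v)"

lemma K_inner: "K a \<bullet> v = inner_L2 a v"
proof -
  have "\<exists>b. \<forall>v. b \<bullet> v = inner_L2 a v"
    using riesz_representation[OF bounded_linear_inner_L2[of a]] by metis
  then have "\<forall>v. K a \<bullet> v = inner_L2 a v" unfolding K_def by (rule someI_ex)
  then show ?thesis by blast
qed

text \<open>The key bound is \<open>norm (K a) \<le> l2 (rep_W12 a)\<close>, from testing the
  definition of \<open>K a\<close> with \<open>K a\<close> itself. It gives \<open>K_bound\<close>,
  because \<open>K a \<bullet> a\<close> is the square of that L2 norm; the same identity gives
  injectivity.\<close>

lemma K_pair: "schroedinger_pair K J"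
proof (rule schroedinger_pair.intro)
  have eqI: "x = y" if "\<And>v. x \<bullet> v = y \<bullet> v" for x y :: W12
  proof -
    have "(x - y) \<bullet> (x - y) = 0" unfolding inner_diff_left[of x y] that by simp
    then show ?thesis by simp
  qed
  have bd: "K a \<bullet> K a \<le> K a \<bullet> a" "norm (K a) \<le> norm a" for a
  proof -
    have "norm (K a) * norm (K a) \<le> l2 (rep_W12 a) * norm (K a)"
    proof -
      have "norm (K a) * norm (K a) = inner_L2 a (K a)"
        by (simp add: K_inner[symmetric] dot_square_norm power2_eq_square)
      also have "\<dots> \<le> l2 (rep_W12 a) * l2 (rep_W12 (K a))" using inner_L2_bound[of a "K a"] by linarith
      also have "\<dots> \<le> l2 (rep_W12 a) * norm (K a)" by (intro mult_left_mono l2_rep_le l2_nonneg)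
      finally show ?thesis .
    qed
    then have le: "norm (K a) \<le> l2 (rep_W12 a)" by (cases "K a = 0") (auto simp: l2_nonneg)
    show "norm (K a) \<le> norm a" using le l2_rep_le[of a] by linarith
    show "K a \<bullet> K a \<le> K a \<bullet> a"
      using power_mono[OF le, of 2] by (simp add: K_inner[of a a] inner_L2_self dot_square_norm)
  qed
  show "bounded_linear K"
  proof (rule bounded_linear_intro)
    fix a b :: W12 and r :: real
    show "K (a + b) = K a + K b"
      by (rule eqI) (simp add: inner_add_left K_inner inner_L2_commute[of _ "_::W12"] inner_L2_add)
    show "K (r *\<^sub>R a) = r *\<^sub>R K a"
    proof (rule eqI)
      show "K (r *\<^sub>R a) \<bullet> v = (r *\<^sub>R K a) \<bullet> v" for v
        using inner_L2_scaleR[of v r a] by (simp add: K_inner inner_L2_commute[of v])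
    qed
    show "norm (K a) \<le> norm a * 1" by (simp add: bd)
  qed
  show "bounded_linear J" by (rule bounded_linear_J)
  fix x y :: W12
  show "K x \<bullet> y = x \<bullet> K y"
    by (simp add: K_inner inner_commute[of x] inner_L2_commute)
  show "K x \<bullet> K x \<le> K x \<bullet> x" by (rule bd)
  show "K x = 0 \<Longrightarrow> x = 0"
  proof -
    assume "K x = 0"
    then have "inner_L2 x x = 0" using K_inner[of x x] by simp
    then have "(\<integral>z. (cmod (rep_W12 x z))\<^sup>2 \<partial>lborel) = 0" by (simp add: inner_L2_self l2_square)
    then have "AE z in lborel. (cmod (rep_W12 x z))\<^sup>2 = 0"
      by (subst (asm) integral_nonneg_eq_0_iff_AE) (auto intro: L2_integrable_square rep_L2)
    with rep_zero show "x = 0" by (intro W12_eqI) auto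
  qed
  show "J (J x) = - x" by (rule J_J)
  show "J x \<bullet> J y = x \<bullet> y" by (rule J_inner)
  show "K (J x) = J (K x)"
  proof (rule eqI)
    fix v
    have "J (K x) \<bullet> v = - (K x \<bullet> J v)" using J_inner[of "K x" "J v"] J_inner[of "J (K x)" v] by (simp add: J_J)
    then show "K (J x) \<bullet> v = J (K x) \<bullet> v" by (simp add: K_inner inner_L2_J)
  qed
qed

subsection \<open>The dual pairing\<close>

lemma mult_pair_integrable:
  "integrable lborel (\<lambda>x. rep_W12 a x * rep_W12 b x)" "integrable lborel (\<lambda>x. weak_grad a i x * weak_grad b i x)"
  by (intro L2_mult_integrable rep_L2 weak_grad(1))+

lemma embed_pair: "Re (blinfun_apply (embed u) (conj_W12 v)) = K u \<bullet> v"
proof -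
  have "Re (blinfun_apply (embed u) (conj_W12 v)) = (\<integral>x. Re (rep_W12 u x * rep_W12 (conj_W12 v) x) \<partial>lborel)"
    unfolding embed_apply by (rule integral_Re[symmetric, OF mult_pair_integrable(1)])
  also have "\<dots> = inner_L2 u v"
    unfolding inner_L2_def using conj_W12(1)[of v] by (intro integral_cong_AE) (auto simp: inner_complex_def)
  finally show ?thesis by (simp add: K_inner)
qed

lemma laplacian_sum:
  "blinfun_apply (laplacian u) v = - (\<Sum>i\<in>UNIV. \<integral>x. weak_grad u i x * weak_grad v i x \<partial>lborel)"
  unfolding laplacian_apply by (simp add: Bochner_Integration.integral_sum mult_pair_integrable(2))

text \<open>The inner product is a gradient part plus an L2 part, so minus the gradient part is
  represented by \<open>K u - u\<close>. Through the Riesz map the Laplacian thus appears as 1 minus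
  the inverse of \<open>K\<close>, with \<open>K\<close> applied on the left.\<close>

lemma laplacian_pair: "Re (blinfun_apply (laplacian u) (conj_W12 v)) = (K u - u) \<bullet> v"
proof -
  have "Re (\<integral>x. weak_grad u i x * weak_grad (conj_W12 v) i x \<partial>lborel) = (\<integral>x. weak_grad u i x \<bullet> weak_grad v i x \<partial>lborel)" for i
  proof -
    have "Re (\<integral>x. weak_grad u i x * weak_grad (conj_W12 v) i x \<partial>lborel) = (\<integral>x. Re (weak_grad u i x * weak_grad (conj_W12 v) i x) \<partial>lborel)"
      by (rule integral_Re[symmetric, OF mult_pair_integrable(2)])
    also have "\<dots> = (\<integral>x. weak_grad u i x \<bullet> weak_grad v i x \<partial>lborel)"
      using conj_W12(2)[of v i] by (intro integral_cong_AE) (auto simp: inner_complex_def)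
    finally show ?thesis .
  qed
  then have "Re (blinfun_apply (laplacian u) (conj_W12 v)) = - (\<Sum>i\<in>UNIV. \<integral>x. weak_grad u i x \<bullet> weak_grad v i x \<partial>lborel)"
    by (simp add: laplacian_sum)
  moreover have "(K u - u) \<bullet> v = inner_L2 u v - u \<bullet> v" by (simp add: inner_diff_left K_inner)
  ultimately show ?thesis by (simp add: inner_L2_def inner_W12_def[of u v])
qed

lemma dual_scaleC: "F \<in> W_dual \<Longrightarrow> blinfun_apply F (scaleC_W12 c v) = c * blinfun_apply F v"
  by (simp add: W_dual_def)

text \<open>Conjugation is antilinear: the imaginary unit turns into \<open>- J\<close> when it is
  pulled through \<open>conj_W12\<close>.\<close>

lemma dual_i_pair:
  assumes "F \<in> W_dual"
  shows "Re (\<i> * blinfun_apply F (conj_W12 v)) = - Re (blinfun_apply F (conj_W12 (J v)))"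
  using dual_scaleC[OF assms, of \<i> "conj_W12 v"] by (simp add: conj_J blinfun.minus_right)

text \<open>A complex linear functional is determined by its real part, the imaginary part being
  read off at \<open>J v\<close>.\<close>

lemma dual_eqI:
  assumes F: "F \<in> W_dual" and G: "G \<in> W_dual"
    and eq: "\<And>v. Re (blinfun_apply F (conj_W12 v)) = Re (blinfun_apply G (conj_W12 v))"
  shows "F = G"
proof (rule blinfun_eqI)
  fix v
  have "Re (blinfun_apply F v) = Re (blinfun_apply G v)" for v using eq[of "conj_W12 v"] by (simp add: conj_conj)
  moreover from this[of "J v"] have "Im (blinfun_apply F v) = Im (blinfun_apply G v)"
    by (simp add: dual_scaleC[OF F] dual_scaleC[OF G])
  ultimately show "blinfun_apply F v = blinfun_apply G v" by (simp add: complex_eq_iff)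
qed

lemma scaleC_dual_apply: "blinfun_apply (scaleC_dual c F) v = blinfun_apply F v * c"
  by (simp add: scaleC_dual_def blinfun_mult_right.rep_eq mult.commute)

lemma W_dual_closed:
  "F \<in> W_dual \<Longrightarrow> G \<in> W_dual \<Longrightarrow> F + G \<in> W_dual"
  "F \<in> W_dual \<Longrightarrow> G \<in> W_dual \<Longrightarrow> F - G \<in> W_dual"
  "F \<in> W_dual \<Longrightarrow> r *\<^sub>R F \<in> W_dual"
  "F \<in> W_dual \<Longrightarrow> scaleC_dual c F \<in> W_dual"
  by (simp_all add: W_dual_def blinfun.bilinear_simps algebra_simps scaleC_dual_apply)

text \<open>The Riesz map from the space into its dual, written as \<open>1 - \<Delta>\<close>;
  \<open>dual_of_pair\<close> identifies it.\<close>

definition dual_of :: "W12 \<Rightarrow> W12 \<Rightarrow>\<^sub>L complex" where "dual_of h = embed h - laplacian h"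

lemma dual_of_dual: "dual_of h \<in> W_dual"
  unfolding dual_of_def by (intro W_dual_closed embed_dual laplacian_dual)

lemma dual_of_pair: "Re (blinfun_apply (dual_of h) (conj_W12 v)) = h \<bullet> v"
  by (simp add: dual_of_def blinfun.diff_left embed_pair laplacian_pair inner_diff_left)

lemma dual_of_K: "dual_of (K u) = embed u"
  by (rule dual_eqI[OF dual_of_dual embed_dual]) (simp add: dual_of_pair embed_pair)

text \<open>The factor 2 comes from estimating the real and the imaginary part of the value
  separately.\<close>

lemma norm_dual_le:
  assumes F: "F \<in> W_dual" and B: "\<And>v. \<bar>Re (blinfun_apply F (conj_W12 v))\<bar> \<le> B * norm v" and "B \<ge> 0"
  shows "norm F \<le> 2 * B"
proof (rule norm_blinfun_bound)
  fix v
  have Re: "\<bar>Re (blinfun_apply F v)\<bar> \<le> B * norm v" for v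
    using B[of "conj_W12 v"] by (simp add: conj_conj norm_conj)
  have "\<bar>Im (blinfun_apply F v)\<bar> \<le> B * norm v"
    using Re[of "J v"] by (simp add: dual_scaleC[OF F] norm_eq_sqrt_inner J_inner)
  then show "norm (blinfun_apply F v) \<le> 2 * B * norm v"
    using Re[of v] cmod_le[of "blinfun_apply F v"] by linarith
qed (use assms in simp)

lemma bounded_linear_dual_of: "bounded_linear dual_of"
proof (rule bounded_linear_intro)
  show "dual_of (x + y) = dual_of x + dual_of y" for x y
    by (rule dual_eqI[OF dual_of_dual W_dual_closed(1)[OF dual_of_dual dual_of_dual]])
       (simp add: blinfun.add_left dual_of_pair inner_add_left)
  show "dual_of (r *\<^sub>R x) = r *\<^sub>R dual_of x" for r x
    by (rule dual_eqI[OF dual_of_dual W_dual_closed(3)[OF dual_of_dual]])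
       (simp add: blinfun.scaleR_left dual_of_pair)
  show "norm (dual_of x) \<le> norm x * 2" for x
    using norm_dual_le[OF dual_of_dual, of x "norm x"] Cauchy_Schwarz_ineq2[of x]
    by (simp add: dual_of_pair mult.commute)
qed

section \<open>The nonlinearity\<close>

text \<open>The polarised density, with the squared modulus on the diagonal. Polarisation makes the
  Hartree term trilinear over the reals, so that differences can be telescoped.\<close>

definition dens :: "W12 \<Rightarrow> W12 \<Rightarrow> real^3 \<Rightarrow> real" where
  "dens a b y = Re (rep_W12 a y * cnj (rep_W12 b y))"

definition grad_dens :: "3 \<Rightarrow> W12 \<Rightarrow> W12 \<Rightarrow> real^3 \<Rightarrow> real" where
  "grad_dens i a b y = Re (weak_grad a i y * cnj (rep_W12 b y) + rep_W12 a y * cnj (weak_grad b i y))"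

lemma Re_cnj_inner: "Re (z * cnj w) = z \<bullet> w"
  by (simp add: inner_complex_def)

lemma dens_inner: "dens a b y = rep_W12 a y \<bullet> rep_W12 b y"
  by (simp only: dens_def Re_cnj_inner)

lemma dens_measurable [measurable]:
  "dens a b \<in> borel_measurable borel" "grad_dens i a b \<in> borel_measurable borel"
proof -
  have [measurable]: "weak_grad c i \<in> borel_measurable borel" "rep_W12 c \<in> borel_measurable borel" for c
    by (intro L2_measurable weak_grad(1) rep_L2)+
  show "dens a b \<in> borel_measurable borel" unfolding dens_def[abs_def] Re_cnj_inner by measurable
  show "grad_dens i a b \<in> borel_measurable borel"
    unfolding grad_dens_def[abs_def] plus_complex.sel Re_cnj_inner by measurable
qed

lemma hardy_bound:
  assumes "b \<in> L2"
  shows "integrable lborel (\<lambda>y. cmod (rep_W12 a y) * cmod (b y) / norm (x - y))"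
    and "(\<integral>y. cmod (rep_W12 a y) * cmod (b y) / norm (x - y) \<partial>lborel) \<le> 4 * norm a * l2 b"
proof -
  note h = hardy_product[OF rep_L2[of a] weak_grad(1)[of a] weak_grad(2)[of _ a] assms]
  show "integrable lborel (\<lambda>y. cmod (rep_W12 a y) * cmod (b y) / norm (x - y))" by (rule h(1))
  have "hardy_norm (weak_grad a) * l2 b \<le> 4 * norm a * l2 b"
    by (rule mult_right_mono[OF hardy_norm_le l2_nonneg])
  then show "(\<integral>y. cmod (rep_W12 a y) * cmod (b y) / norm (x - y) \<partial>lborel) \<le> 4 * norm a * l2 b"
    using h(2)[of x] by linarith
qed

lemma dens_potential:
  "integrable lborel (\<lambda>y. dens a b y / norm (x - y))" "\<bar>pot (dens a b) x\<bar> \<le> 4 * norm a * norm b"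
proof -
  have le: "\<bar>dens a b y\<bar> \<le> cmod (rep_W12 a y) * cmod (rep_W12 b y)" for y
    unfolding dens_def Re_cnj_inner by (rule Cauchy_Schwarz_ineq2)
  have "4 * norm a * l2 (rep_W12 b) \<le> 4 * norm a * norm b" by (intro mult_left_mono l2_rep_le) simp
  then have D: "(\<integral>y. cmod (rep_W12 a y) * cmod (rep_W12 b y) / norm (x - y) \<partial>lborel) \<le> 4 * norm a * norm b"
    using hardy_bound(2)[OF rep_L2[of b], of a x] by linarith
  show "integrable lborel (\<lambda>y. dens a b y / norm (x - y))" "\<bar>pot (dens a b) x\<bar> \<le> 4 * norm a * norm b"
    by (rule pot_bound[OF _ le hardy_bound(1)[OF rep_L2] D], measurable)+
qed

lemma grad_dens_potential: "\<bar>pot (grad_dens i a b) x\<bar> \<le> 8 * norm a * norm b"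
proof -
  have le: "\<bar>grad_dens i a b y\<bar> \<le> cmod (rep_W12 b y) * cmod (weak_grad a i y) + cmod (rep_W12 a y) * cmod (weak_grad b i y)" for y
    unfolding grad_dens_def plus_complex.sel Re_cnj_inner
    using Cauchy_Schwarz_ineq2[of "weak_grad a i y" "rep_W12 b y"] Cauchy_Schwarz_ineq2[of "rep_W12 a y" "weak_grad b i y"]
    by (simp add: mult.commute)
  have I: "integrable lborel (\<lambda>y. (cmod (rep_W12 b y) * cmod (weak_grad a i y) + cmod (rep_W12 a y) * cmod (weak_grad b i y)) / norm (x - y))"
    unfolding add_divide_distrib by (intro Bochner_Integration.integrable_add hardy_bound(1) weak_grad(1))
  have "(\<integral>y. (cmod (rep_W12 b y) * cmod (weak_grad a i y) + cmod (rep_W12 a y) * cmod (weak_grad b i y)) / norm (x - y) \<partial>lborel) =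
      (\<integral>y. cmod (rep_W12 b y) * cmod (weak_grad a i y) / norm (x - y) \<partial>lborel) +
      (\<integral>y. cmod (rep_W12 a y) * cmod (weak_grad b i y) / norm (x - y) \<partial>lborel)"
    unfolding add_divide_distrib
    by (intro Bochner_Integration.integral_add hardy_bound(1) weak_grad(1))
  also have "\<dots> \<le> 4 * norm b * l2 (weak_grad a i) + 4 * norm a * l2 (weak_grad b i)"
    by (intro add_mono hardy_bound(2) weak_grad(1))
  also have "\<dots> \<le> 4 * norm b * norm a + 4 * norm a * norm b"
    by (intro add_mono mult_left_mono l2_grad_le) simp_all
  also have "\<dots> = 8 * norm a * norm b" by (simp add: mult.commute)
  finally show ?thesis
    by (intro pot_bound(2)[OF _ le I]) (simp_all add: dens_measurable)
qed

definition hartree :: "W12 \<Rightarrow> W12 \<Rightarrow> W12 \<Rightarrow> W12" where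
  "hartree a b u = abs_W12 (\<lambda>x. of_real (pot (dens a b) x) * rep_W12 u x)"

lemma hartree_L2:
  "(\<lambda>x. of_real (pot (dens a b) x) * rep_W12 u x) \<in> L2"
  "l2 (\<lambda>x. of_real (pot (dens a b) x) * rep_W12 u x) \<le> 4 * norm a * norm b * l2 (rep_W12 u)"
  "(\<lambda>x. of_real (pot (dens a b) x) * weak_grad u i x + of_real (pot (grad_dens i a b) x) * rep_W12 u x) \<in> L2"
  "l2 (\<lambda>x. of_real (pot (dens a b) x) * weak_grad u i x + of_real (pot (grad_dens i a b) x) * rep_W12 u x)
    \<le> 4 * norm a * norm b * l2 (weak_grad u i) + 8 * norm a * norm b * l2 (rep_W12 u)"
proof -
  have p: "pot (dens a b) \<in> borel_measurable borel" "pot (grad_dens i a b) \<in> borel_measurable borel"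
    by measurable
  note A = L2_bounded_mult[OF rep_L2[of u] p(1) dens_potential(2)]
  note B = L2_bounded_mult[OF weak_grad(1)[of u i] p(1) dens_potential(2)]
  note C = L2_bounded_mult[OF rep_L2[of u] p(2) grad_dens_potential]
  show "(\<lambda>x. of_real (pot (dens a b) x) * rep_W12 u x) \<in> L2"
    "l2 (\<lambda>x. of_real (pot (dens a b) x) * rep_W12 u x) \<le> 4 * norm a * norm b * l2 (rep_W12 u)"
    by (rule A)+
  show "(\<lambda>x. of_real (pot (dens a b) x) * weak_grad u i x + of_real (pot (grad_dens i a b) x) * rep_W12 u x) \<in> L2"
    by (rule L2_add[OF B(1) C(1)])
  show "l2 (\<lambda>x. of_real (pot (dens a b) x) * weak_grad u i x + of_real (pot (grad_dens i a b) x) * rep_W12 u x)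
    \<le> 4 * norm a * norm b * l2 (weak_grad u i) + 8 * norm a * norm b * l2 (rep_W12 u)"
    using l2_triangle[OF B(1) C(1)] B(2) C(2) by linarith
qed

lemma rep_hartree: "AE x in lborel. rep_W12 (hartree a b u) x = of_real (pot (dens a b) x) * rep_W12 u x"
  and grad_hartree: "AE x in lborel. weak_grad (hartree a b u) i x =
    of_real (pot (dens a b) x) * weak_grad u i x + of_real (pot (grad_dens i a b) x) * rep_W12 u x"
proof -
  have w: "weak_partial i (\<lambda>x. of_real (pot (dens a b) x) * rep_W12 u x)
      (\<lambda>x. of_real (pot (dens a b) x) * weak_grad u i x + of_real (pot (grad_dens i a b) x) * rep_W12 u x)" for i
    unfolding dens_def[abs_def] grad_dens_def[abs_def]
    by (rule weak_partial_pot_mult[OF rep_L2 weak_grad(1) weak_grad(2) rep_L2 weak_grad(1) weak_grad(2) rep_L2 weak_grad(1) weak_grad(2)])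
  show "AE x in lborel. rep_W12 (hartree a b u) x = of_real (pot (dens a b) x) * rep_W12 u x"
    unfolding hartree_def by (rule abs_W12(1)[OF hartree_L2(1) hartree_L2(3) w])
  show "AE x in lborel. weak_grad (hartree a b u) i x =
    of_real (pot (dens a b) x) * weak_grad u i x + of_real (pot (grad_dens i a b) x) * rep_W12 u x"
    unfolding hartree_def by (rule abs_W12(2)[OF hartree_L2(1) hartree_L2(3) w])
qed

text \<open>The function contributes at most 4 and each component of its gradient at most 4 + 8 =
  12, from the potentials of the density and of its derivative. The sum
  \<open>3 * 12^2 + 4^2 = 448\<close> stays below \<open>22^2 = 484\<close>.\<close>

lemma norm_hartree_le: "norm (hartree a b u) \<le> 22 * (norm a * norm b * norm u)"
proof (rule power2_le_imp_le)
  define m where "m = norm a * norm b * norm u"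
  have m: "0 \<le> m" by (simp add: m_def)
  have "4 * norm a * norm b * l2 (rep_W12 u) \<le> 4 * norm a * norm b * norm u"
    by (intro mult_left_mono l2_rep_le) simp
  then have 1: "l2 (rep_W12 (hartree a b u)) \<le> 4 * m"
    unfolding l2_cong_AE[OF rep_L2 hartree_L2(1) rep_hartree] m_def using hartree_L2(2)[of a b u] by (simp add: mult.assoc)
  have 2: "l2 (weak_grad (hartree a b u) i) \<le> 12 * m" for i
  proof -
    have "4 * norm a * norm b * l2 (weak_grad u i) + 8 * norm a * norm b * l2 (rep_W12 u) \<le>
        4 * norm a * norm b * norm u + 8 * norm a * norm b * norm u"
      by (intro add_mono mult_left_mono l2_rep_le l2_grad_le) simp_all
    then show ?thesis
      unfolding l2_cong_AE[OF weak_grad(1) hartree_L2(3) grad_hartree] m_def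
      using hartree_L2(4)[of a b u i] by (simp add: mult.assoc)
  qed
  have "(norm (hartree a b u))\<^sup>2 \<le> (\<Sum>i\<in>(UNIV::3 set). (12 * m)\<^sup>2) + (4 * m)\<^sup>2"
    unfolding norm_W12_l2 by (intro add_mono sum_mono power_mono 1 2 l2_nonneg)
  also have "\<dots> = 448 * m\<^sup>2" by (simp add: power_mult_distrib)
  also have "\<dots> \<le> 484 * m\<^sup>2" by (intro mult_right_mono) simp_all
  also have "\<dots> = (22 * m)\<^sup>2" by (simp add: power_mult_distrib)
  finally show "(norm (hartree a b u))\<^sup>2 \<le> (22 * (norm a * norm b * norm u))\<^sup>2" unfolding m_def .
qed simp

lemma hartree_commute: "hartree a b u = hartree b a u"
proof -
  have "dens a b = dens b a" by (rule ext) (simp add: dens_def mult.commute)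
  then show ?thesis by (simp add: hartree_def)
qed

lemma pot_dens_diff: "pot (dens (a - b) c) x = pot (dens a c) x - pot (dens b c) x"
proof -
  have "pot (dens (a - b) c) x = (\<integral>y. dens a c y / norm (x - y) - dens b c y / norm (x - y) \<partial>lborel)"
    unfolding pot_def
  proof (rule integral_cong_AE)
    show "AE y in lborel. dens (a - b) c y / norm (x - y) = dens a c y / norm (x - y) - dens b c y / norm (x - y)"
      using rep_diff[of a b] by eventually_elim (simp add: dens_inner inner_diff_left diff_divide_distrib)
  qed measurable
  then show ?thesis by (simp add: pot_def dens_potential(1))
qed

lemma hartree_diff:
  "hartree (a - b) c u = hartree a c u - hartree b c u"
  "hartree c (a - b) u = hartree c a u - hartree c b u"
  "hartree a b (u - v) = hartree a b u - hartree a b v"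
proof -
  show 1: "hartree (a - b) c u = hartree a c u - hartree b c u" for a b c u
    by (rule W12_eqI) (use rep_hartree[of "a - b" c u] rep_hartree[of a c u] rep_hartree[of b c u]
      rep_diff[of "hartree a c u" "hartree b c u"] in \<open>eventually_elim, simp add: pot_dens_diff left_diff_distrib\<close>)
  show "hartree c (a - b) u = hartree c a u - hartree c b u"
    using 1[of a b c u] by (simp only: hartree_commute[of c])
  show "hartree a b (u - v) = hartree a b u - hartree a b v"
    by (rule W12_eqI) (use rep_hartree[of a b "u - v"] rep_hartree[of a b u] rep_hartree[of a b v] rep_diff[of u v]
      rep_diff[of "hartree a b u" "hartree a b v"] in \<open>eventually_elim, simp add: right_diff_distrib\<close>)
qed

lemma inner_L2_norm: "\<bar>inner_L2 a b\<bar> \<le> norm a * norm b"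
proof -
  have "l2 (rep_W12 a) * l2 (rep_W12 b) \<le> norm a * norm b" by (intro mult_mono l2_rep_le l2_nonneg norm_ge_zero)
  then show ?thesis using inner_L2_bound[of a b] by linarith
qed

text \<open>Dividing the equation by the imaginary unit turns both nonlinear terms into real
  multiples of Sobolev functions. The scalar in the second term is the double integral of
  \<open>g2\<close>, written as the L2 product of the Hartree term with
  \<open>\<psi>\<close>.\<close>

definition friction :: "real \<Rightarrow> W12 \<Rightarrow> W12" where
  "friction \<kappa> \<psi> = \<kappa> *\<^sub>R (hartree \<psi> \<psi> \<psi> - inner_L2 (hartree \<psi> \<psi> \<psi>) \<psi> *\<^sub>R \<psi>)"

text \<open>Telescoping. The cubic term changes in one of three slots, giving 66 = 3 * 22. The
  quintic term gives 110 = 66 + 22 + 22: the change of the Hartree term, of the second argument of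
  the L2 product and of the last factor.\<close>

lemma friction_lipschitz:
  obtains L where "0 \<le> L"
    "\<And>\<psi> \<zeta>. norm \<psi> \<le> R \<Longrightarrow> norm \<zeta> \<le> R \<Longrightarrow> norm (friction \<kappa> \<psi> - friction \<kappa> \<zeta>) \<le> L * norm (\<psi> - \<zeta>)"
proof (rule that[of "\<bar>\<kappa>\<bar> * (66 * R^2 + 110 * R^4)"])
  show "0 \<le> \<bar>\<kappa>\<bar> * (66 * R^2 + 110 * R^4)" by simp
  fix a b :: W12 assume a: "norm a \<le> R" and b: "norm b \<le> R"
  have R: "0 \<le> R" using a norm_ge_zero[of a] by linarith
  define d where "d = norm (a - b)"
  have d: "0 \<le> d" by (simp add: d_def)
  have tri: "norm (hartree x y z) \<le> 22 * (p * q * r)" if "norm x \<le> p" "norm y \<le> q" "norm z \<le> r" for x y z p q r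
  proof -
    have "norm x * norm y * norm z \<le> p * q * r"
      using that order_trans[OF norm_ge_zero that(1)] order_trans[OF norm_ge_zero that(2)] by (intro mult_mono) auto
    then show ?thesis using norm_hartree_le[of x y z] by linarith
  qed
  have N: "norm (hartree x x x) \<le> 22 * R^3" if "norm x \<le> R" for x
    using tri[OF that that that] by (simp add: power3_eq_cube)
  have "hartree a a a - hartree b b b = hartree (a - b) a a + hartree b (a - b) a + hartree b b (a - b)"
    by (simp add: hartree_diff)
  then have "norm (hartree a a a - hartree b b b) \<le> norm (hartree (a - b) a a) + norm (hartree b (a - b) a) + norm (hartree b b (a - b))"
    using norm_triangle_ineq[of "hartree (a - b) a a + hartree b (a - b) a" "hartree b b (a - b)"]
      norm_triangle_ineq[of "hartree (a - b) a a" "hartree b (a - b) a"] by simp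
  also have "\<dots> \<le> 22 * (d * R * R) + 22 * (R * d * R) + 22 * (R * R * d)"
    by (intro add_mono tri a b) (simp_all add: d_def)
  also have "\<dots> = 66 * R^2 * d" by (simp add: power2_eq_square)
  finally have ND: "norm (hartree a a a - hartree b b b) \<le> 66 * R^2 * d" .
  define q where "q = inner_L2 (hartree a a a - hartree b b b) a"
  have diff_left: "inner_L2 (x - y) z = inner_L2 x z - inner_L2 y z" for x y z
    using linear_simps(2)[OF bounded_linear_inner_L2, of z x y] by (simp only: inner_L2_commute)
  have diff_right: "inner_L2 z (x - y) = inner_L2 z x - inner_L2 z y" for x y z
    by (rule linear_simps(2)[OF bounded_linear_inner_L2])
  have e: "inner_L2 (hartree a a a) a *\<^sub>R a - inner_L2 (hartree b b b) b *\<^sub>R b =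
      q *\<^sub>R a + inner_L2 (hartree b b b) (a - b) *\<^sub>R a + inner_L2 (hartree b b b) b *\<^sub>R (a - b)"
    by (simp add: q_def diff_left diff_right algebra_simps)
  have q: "\<bar>q\<bar> \<le> 66 * R^2 * d * R"
    unfolding q_def using inner_L2_norm[of "hartree a a a - hartree b b b" a]
      mult_mono[OF ND a] R d by (simp add: mult_nonneg_nonneg)
  have q2: "\<bar>inner_L2 (hartree b b b) (a - b)\<bar> \<le> 22 * R^3 * d"
    using inner_L2_norm[of "hartree b b b" "a - b"] mult_right_mono[OF N[OF b] d] by (simp add: d_def)
  have q3: "\<bar>inner_L2 (hartree b b b) b\<bar> \<le> 22 * R^3 * R"
    using inner_L2_norm[of "hartree b b b" b] mult_mono[OF N[OF b] b] R by simp
  have "norm (q *\<^sub>R a + inner_L2 (hartree b b b) (a - b) *\<^sub>R a + inner_L2 (hartree b b b) b *\<^sub>R (a - b)) \<le>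
      \<bar>q\<bar> * norm a + \<bar>inner_L2 (hartree b b b) (a - b)\<bar> * norm a + \<bar>inner_L2 (hartree b b b) b\<bar> * d"
    using norm_triangle_ineq[of "q *\<^sub>R a + inner_L2 (hartree b b b) (a - b) *\<^sub>R a" "inner_L2 (hartree b b b) b *\<^sub>R (a - b)"]
      norm_triangle_ineq[of "q *\<^sub>R a" "inner_L2 (hartree b b b) (a - b) *\<^sub>R a"] by (simp add: d_def)
  also have "\<dots> \<le> (66 * R^2 * d * R) * R + (22 * R^3 * d) * R + (22 * R^3 * R) * d"
    using R d by (intro add_mono mult_mono q q2 q3 a) auto
  also have "\<dots> = 110 * R^4 * d" by (simp add: power4_eq_xxxx power3_eq_cube power2_eq_square)
  finally have QD: "norm (inner_L2 (hartree a a a) a *\<^sub>R a - inner_L2 (hartree b b b) b *\<^sub>R b) \<le> 110 * R^4 * d"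
    unfolding e .
  have "friction \<kappa> a - friction \<kappa> b = \<kappa> *\<^sub>R ((hartree a a a - hartree b b b) -
      (inner_L2 (hartree a a a) a *\<^sub>R a - inner_L2 (hartree b b b) b *\<^sub>R b))"
    by (simp add: friction_def algebra_simps)
  then have "norm (friction \<kappa> a - friction \<kappa> b) = \<bar>\<kappa>\<bar> * norm ((hartree a a a - hartree b b b) -
      (inner_L2 (hartree a a a) a *\<^sub>R a - inner_L2 (hartree b b b) b *\<^sub>R b))" by simp
  also have "\<dots> \<le> \<bar>\<kappa>\<bar> * (66 * R^2 * d + 110 * R^4 * d)"
    using norm_triangle_ineq4[of "hartree a a a - hartree b b b" "inner_L2 (hartree a a a) a *\<^sub>R a - inner_L2 (hartree b b b) b *\<^sub>R b"]
      ND QD by (intro mult_left_mono) auto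
  finally show "norm (friction \<kappa> a - friction \<kappa> b) \<le> \<bar>\<kappa>\<bar> * (66 * R^2 + 110 * R^4) * norm (a - b)"
    by (simp add: d_def algebra_simps)
qed

section \<open>The equation in the dual space, tested against Sobolev functions\<close>

lemma functional_of_eq_embed:
  assumes f: "f \<in> L2" and h: "AE x in lborel. rep_W12 h x = f x"
  shows "functional_of f = embed h"
proof (rule blinfun_eqI)
  fix v
  have [measurable]: "f \<in> borel_measurable borel" using f by (rule L2_measurable)
  show "blinfun_apply (functional_of f) v = blinfun_apply (embed h) v"
    unfolding functional_of_apply[OF f] embed_apply using h by (intro integral_cong_AE) auto
qed

lemma dens_self: "dens \<psi> \<psi> y = (cmod (rep_W12 \<psi> y))\<^sup>2"
  by (simp add: dens_inner power2_norm_eq_inner)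

lemma g1_eq: "g1 \<psi> = embed (hartree \<psi> \<psi> \<psi>)"
proof -
  have "g1 \<psi> = functional_of (\<lambda>x. of_real (pot (dens \<psi> \<psi>) x) * rep_W12 \<psi> x)"
    unfolding g1_def pot_def dens_self by (simp only: mult.commute)
  then show ?thesis by (simp only: functional_of_eq_embed[OF hartree_L2(1) rep_hartree])
qed

lemma g2_eq: "g2 \<psi> = embed (inner_L2 (hartree \<psi> \<psi> \<psi>) \<psi> *\<^sub>R \<psi>)"
proof -
  let ?q = "inner_L2 (hartree \<psi> \<psi> \<psi>) \<psi>"
  have [measurable]: "rep_W12 a \<in> borel_measurable borel" for a by (rule L2_measurable[OF rep_L2])
  have "(\<integral>y. (cmod (rep_W12 \<psi> y))\<^sup>2 * (cmod (rep_W12 \<psi> z))\<^sup>2 / norm (z - y) \<partial>lborel) =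
      pot (dens \<psi> \<psi>) z * (cmod (rep_W12 \<psi> z))\<^sup>2" for z
  proof -
    have "(\<integral>y. (cmod (rep_W12 \<psi> y))\<^sup>2 * (cmod (rep_W12 \<psi> z))\<^sup>2 / norm (z - y) \<partial>lborel) =
        (\<integral>y. ((cmod (rep_W12 \<psi> y))\<^sup>2 / norm (z - y)) * (cmod (rep_W12 \<psi> z))\<^sup>2 \<partial>lborel)" by simp
    also have "\<dots> = pot (dens \<psi> \<psi>) z * (cmod (rep_W12 \<psi> z))\<^sup>2"
      unfolding pot_def dens_self by (rule integral_mult_left_zero)
    finally show ?thesis .
  qed
  then have "(\<integral>z. (\<integral>y. (cmod (rep_W12 \<psi> y))\<^sup>2 * (cmod (rep_W12 \<psi> z))\<^sup>2 / norm (z - y) \<partial>lborel) \<partial>lborel) =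
      (\<integral>z. pot (dens \<psi> \<psi>) z * (cmod (rep_W12 \<psi> z))\<^sup>2 \<partial>lborel)" by (simp only:)
  also have "\<dots> = ?q"
    unfolding inner_L2_def
  proof (rule integral_cong_AE)
    show "AE z in lborel. pot (dens \<psi> \<psi>) z * (cmod (rep_W12 \<psi> z))\<^sup>2 = rep_W12 (hartree \<psi> \<psi> \<psi>) z \<bullet> rep_W12 \<psi> z"
      using rep_hartree[of \<psi> \<psi> \<psi>]
      by eventually_elim (simp add: scaleR_conv_of_real[symmetric] power2_norm_eq_inner)
  qed measurable
  finally have "g2 \<psi> = functional_of (\<lambda>x. of_real ?q * rep_W12 \<psi> x)"
    unfolding g2_def by (simp only: mult.commute)
  moreover have "AE x in lborel. rep_W12 (?q *\<^sub>R \<psi>) x = of_real ?q * rep_W12 \<psi> x"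
    using rep_scaleR[of ?q \<psi>] by (simp add: scaleR_conv_of_real)
  ultimately show ?thesis by (simp only: functional_of_eq_embed[OF L2_cmult[OF rep_L2]])
qed

text \<open>Tested with \<open>conj_W12 v\<close>, the factor \<i> on the derivative and on the
  nonlinear terms becomes minus a pairing with \<open>J v\<close>, and orthogonality of
  \<open>J\<close> brings the Laplacian term into the same form. Since \<open>J\<close> is onto,
  \<open>J v\<close> ranges over all test elements.\<close>

lemma equation_pairing:
  assumes D: "D \<in> W_dual"
  shows "scaleC_dual \<i> D = - (c *\<^sub>R laplacian \<psi>) + scaleC_dual (\<i> * of_real \<kappa>) (g1 \<psi>) - scaleC_dual (\<i> * of_real \<kappa>) (g2 \<psi>) \<longleftrightarrow>
    (\<forall>v. Re (blinfun_apply D (conj_W12 v)) = (c *\<^sub>R J (K \<psi> - \<psi>) + K (friction \<kappa> \<psi>)) \<bullet> v)"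
    (is "?L = ?R \<longleftrightarrow> _")
proof -
  interpret schroedinger_pair K J by (rule K_pair)
  have LW: "?L \<in> W_dual" by (rule W_dual_closed(4)[OF D])
  have RW: "?R \<in> W_dual"
    unfolding g1_eq g2_eq
    using W_dual_closed(3)[OF laplacian_dual, of "- c" \<psi>]
    by (intro W_dual_closed embed_dual) simp
  have L: "Re (blinfun_apply ?L (conj_W12 v)) = - Re (blinfun_apply D (conj_W12 (J v)))" for v
    using dual_i_pair[OF D, of v] by (simp only: scaleC_dual_apply mult.commute)
  have i: "Re (blinfun_apply (scaleC_dual (\<i> * of_real \<kappa>) (embed a)) (conj_W12 v)) = - (\<kappa> * (K a \<bullet> J v))" for a v
  proof -
    have "Re (blinfun_apply (scaleC_dual (\<i> * of_real \<kappa>) (embed a)) (conj_W12 v)) =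
        \<kappa> * Re (\<i> * blinfun_apply (embed a) (conj_W12 v))"
      by (simp add: scaleC_dual_apply)
    then show ?thesis by (simp only: dual_i_pair[OF embed_dual] embed_pair mult_minus_right)
  qed
  have R: "Re (blinfun_apply ?R (conj_W12 v)) = - ((c *\<^sub>R J (K \<psi> - \<psi>) + K (friction \<kappa> \<psi>)) \<bullet> J v)" for v
  proof -
    have "Re (blinfun_apply ?R (conj_W12 v)) = - (c * ((K \<psi> - \<psi>) \<bullet> v)) - \<kappa> * (K (hartree \<psi> \<psi> \<psi>) \<bullet> J v)
        + \<kappa> * (K (inner_L2 (hartree \<psi> \<psi> \<psi>) \<psi> *\<^sub>R \<psi>) \<bullet> J v)"
      unfolding g1_eq g2_eq blinfun.add_left blinfun.diff_left blinfun.minus_left blinfun.scaleR_left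
        plus_complex.sel minus_complex.sel uminus_complex.sel i scaleR_complex.sel laplacian_pair by simp
    also have "\<dots> = - ((c *\<^sub>R J (K \<psi> - \<psi>) + K (friction \<kappa> \<psi>)) \<bullet> J v)"
      by (simp only: friction_def K_simps inner_add_left inner_diff_left inner_scaleR_left J_inner) (simp add: algebra_simps)
    finally show ?thesis .
  qed
  have "?L = ?R \<longleftrightarrow> (\<forall>v. Re (blinfun_apply ?L (conj_W12 v)) = Re (blinfun_apply ?R (conj_W12 v)))"
    using dual_eqI[OF LW RW] by metis
  also have "\<dots> \<longleftrightarrow> (\<forall>v. Re (blinfun_apply D (conj_W12 (J v))) = (c *\<^sub>R J (K \<psi> - \<psi>) + K (friction \<kappa> \<psi>)) \<bullet> J v)"
    unfolding L R by simp
  also have "\<dots> \<longleftrightarrow> (\<forall>v. Re (blinfun_apply D (conj_W12 v)) = (c *\<^sub>R J (K \<psi> - \<psi>) + K (friction \<kappa> \<psi>)) \<bullet> v)"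
  proof
    assume *: "\<forall>v. Re (blinfun_apply D (conj_W12 (J v))) = (c *\<^sub>R J (K \<psi> - \<psi>) + K (friction \<kappa> \<psi>)) \<bullet> J v"
    show "\<forall>v. Re (blinfun_apply D (conj_W12 v)) = (c *\<^sub>R J (K \<psi> - \<psi>) + K (friction \<kappa> \<psi>)) \<bullet> v"
    proof
      fix v
      have "J (- J v) = v" by (simp add: J_simps J_J)
      with spec[OF *, of "- J v"] show "Re (blinfun_apply D (conj_W12 v)) = (c *\<^sub>R J (K \<psi> - \<psi>) + K (friction \<kappa> \<psi>)) \<bullet> v" by simp
    qed
  qed blast
  finally show ?thesis .
qed

section \<open>Strong measurability and strong integrals\<close>

lemma strongly_measurable_simple: "simple_function M s \<Longrightarrow> strongly_measurable M s"
  unfolding strongly_measurable_def by (rule exI[of _ "\<lambda>_. s"]) simp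

lemma strongly_measurable_compose2:
  assumes "strongly_measurable M f" "strongly_measurable M g"
    and h: "continuous_on UNIV (\<lambda>p. h (fst p) (snd p))"
  shows "strongly_measurable M (\<lambda>t. h (f t) (g t))"
proof -
  obtain s where s: "\<And>n. simple_function M (s n)" "AE t in M. (\<lambda>n. s n t) \<longlonglongrightarrow> f t"
    using assms(1) unfolding strongly_measurable_def by auto
  obtain s' where s': "\<And>n. simple_function M (s' n)" "AE t in M. (\<lambda>n. s' n t) \<longlonglongrightarrow> g t"
    using assms(2) unfolding strongly_measurable_def by auto
  show ?thesis
    unfolding strongly_measurable_def
  proof (intro exI[of _ "\<lambda>n t. h (s n t) (s' n t)"] conjI allI)
    show "simple_function M (\<lambda>t. h (s n t) (s' n t))" for n
      by (rule simple_function_compose2[OF s(1) s'(1)])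
    show "AE t in M. (\<lambda>n. h (s n t) (s' n t)) \<longlonglongrightarrow> h (f t) (g t)"
      using s(2) s'(2)
    proof eventually_elim
      case (elim t)
      show ?case
        using continuous_on_tendsto_compose[OF h tendsto_Pair[OF elim]] by simp
    qed
  qed
qed

lemma strongly_measurable_compose:
  assumes f: "strongly_measurable M f" and h: "continuous_on UNIV h"
  shows "strongly_measurable M (\<lambda>t. h (f t))"
  by (rule strongly_measurable_compose2[OF f f, of "\<lambda>x y. h x"])
     (rule continuous_on_compose2[OF h continuous_on_fst[OF continuous_on_id]], simp)

lemma AE_limit_measurable:
  fixes f :: "real \<Rightarrow> real"
  assumes I: "I \<in> sets lebesgue" and s: "\<And>n. s n \<in> borel_measurable (lebesgue_on I)"
    and lim: "AE t in lebesgue_on I. (\<lambda>n. s n t) \<longlonglongrightarrow> f t"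
  shows "f \<in> borel_measurable (lebesgue_on I)"
proof (rule borel_measurable_lebesgue_on_AE_cong[OF I])
  show "(\<lambda>t. lim (\<lambda>n. s n t)) \<in> borel_measurable (lebesgue_on I)"
    by (rule borel_measurable_lim_metric[OF s])
  show "AE t in lebesgue_on I. lim (\<lambda>n. s n t) = f t"
    using lim by eventually_elim (rule limI)
qed

lemma strongly_measurable_real:
  fixes f :: "real \<Rightarrow> real"
  assumes I: "I \<in> sets lebesgue" and f: "strongly_measurable (lebesgue_on I) f"
  shows "f \<in> borel_measurable (lebesgue_on I)"
proof -
  obtain s where s: "\<And>n. simple_function (lebesgue_on I) (s n)" "AE t in lebesgue_on I. (\<lambda>n. s n t) \<longlonglongrightarrow> f t"
    using f unfolding strongly_measurable_def by auto
  show ?thesis by (rule AE_limit_measurable[OF I borel_measurable_simple_function[OF s(1)] s(2)])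
qed

lemma strongly_measurable_inner:
  fixes f y :: "real \<Rightarrow> 'b::real_inner"
  assumes I: "I \<in> sets lebesgue" and f: "strongly_measurable (lebesgue_on I) f" and y: "continuous_on I y"
  shows "(\<lambda>t. f t \<bullet> y t) \<in> borel_measurable (lebesgue_on I)"
proof -
  let ?M = "lebesgue_on I"
  obtain s where s: "\<And>n. simple_function ?M (s n)" "AE t in ?M. (\<lambda>n. s n t) \<longlonglongrightarrow> f t"
    using f unfolding strongly_measurable_def by auto
  show ?thesis
  proof (rule AE_limit_measurable[OF I, of "\<lambda>n t. s n t \<bullet> y t"])
    fix n
    have [measurable]: "(\<lambda>t. x \<bullet> y t) \<in> borel_measurable ?M" for x
      by (rule continuous_imp_measurable_on_sets_lebesgue[OF _ I]) (intro continuous_intros y)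
    have [measurable]: "s n -` {x} \<inter> space ?M \<in> sets ?M" for x by (rule simple_functionD(2)[OF s(1)])
    \<comment> \<open>On each level set of the simple function the first factor is constant, so the
      product is a finite sum of indicators times continuous functions.\<close>
    have "(\<lambda>t. \<Sum>x\<in>s n ` space ?M. indicator (s n -` {x} \<inter> space ?M) t * (x \<bullet> y t)) \<in> borel_measurable ?M"
      by measurable
    also have "?this \<longleftrightarrow> (\<lambda>t. s n t \<bullet> y t) \<in> borel_measurable ?M"
    proof (rule measurable_cong)
      fix t assume t: "t \<in> space ?M"
      have "(\<Sum>x\<in>s n ` space ?M. indicator (s n -` {x} \<inter> space ?M) t * (x \<bullet> y t)) =
          (\<Sum>x\<in>s n ` space ?M. if x = s n t then s n t \<bullet> y t else 0)"
        using t by (intro sum.cong) (auto simp: indicator_def)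
      also have "\<dots> = s n t \<bullet> y t" using t simple_functionD(1)[OF s(1)] by (simp only: sum.delta) simp
      finally show "(\<Sum>x\<in>s n ` space ?M. indicator (s n -` {x} \<inter> space ?M) t * (x \<bullet> y t)) = s n t \<bullet> y t" .
    qed
    finally show "(\<lambda>t. s n t \<bullet> y t) \<in> borel_measurable ?M" .
    show "AE t in ?M. (\<lambda>n. s n t \<bullet> y t) \<longlonglongrightarrow> f t \<bullet> y t"
      using s(2) by eventually_elim (intro tendsto_intros)
  qed
qed

text \<open>Applying the functional to the approximating simple functions turns a strong integral
  into a Bochner integral of real functions. Identities between strong integrals can then be studied
  one real functional at a time.\<close>

lemma has_strong_integral_linear:
  fixes \<Lambda> :: "'b::real_normed_vector \<Rightarrow> real" and f :: "real \<Rightarrow> 'b"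
  assumes I: "I \<in> sets lebesgue" and w: "has_strong_integral (lebesgue_on I) f w" and \<Lambda>: "bounded_linear \<Lambda>"
  shows "has_bochner_integral (lebesgue_on I) (\<lambda>t. \<Lambda> (f t)) (\<Lambda> w)"
proof -
  let ?M = "lebesgue_on I"
  have f: "strongly_measurable ?M f" using w by (simp add: has_strong_integral_def)
  obtain s where s: "\<And>n. Bochner_Integration.simple_bochner_integrable ?M (s n)"
      "(\<lambda>n. \<integral>\<^sup>+ t. ennreal (norm (f t - s n t)) \<partial>?M) \<longlonglongrightarrow> 0"
      "(\<lambda>n. Bochner_Integration.simple_bochner_integral ?M (s n)) \<longlonglongrightarrow> w"
    using w unfolding has_strong_integral_def by auto
  have sf: "simple_function ?M (s n)" for n
    using s(1)[of n] by (simp add: Bochner_Integration.simple_bochner_integrable.simps)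
  obtain C where C: "\<And>x. \<bar>\<Lambda> x\<bar> \<le> norm x * C" "C > 0"
    using bounded_linear.pos_bounded[OF \<Lambda>] by auto
  show ?thesis
  proof (rule has_bochner_integral.intros)
    show "(\<lambda>t. \<Lambda> (f t)) \<in> borel_measurable ?M"
      by (intro strongly_measurable_real[OF I] strongly_measurable_compose[OF f] linear_continuous_on \<Lambda>)
    show "Bochner_Integration.simple_bochner_integrable ?M (\<lambda>t. \<Lambda> (s n t))" for n
      using Bochner_Integration.simple_bochner_integrable_compose2[of "\<lambda>x y. \<Lambda> x", OF _ s(1)[of n] s(1)[of n]]
      by (simp add: linear_simps[OF \<Lambda>])
    show "(\<lambda>n. Bochner_Integration.simple_bochner_integral ?M (\<lambda>t. \<Lambda> (s n t))) \<longlonglongrightarrow> \<Lambda> w"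
      unfolding Bochner_Integration.simple_bochner_integral_linear[OF bounded_linear.linear[OF \<Lambda>] s(1)]
      by (rule bounded_linear.tendsto[OF \<Lambda> s(3)])
    show "(\<lambda>n. \<integral>\<^sup>+ t. ennreal (norm (\<Lambda> (f t) - \<Lambda> (s n t))) \<partial>?M) \<longlonglongrightarrow> 0"
    proof (rule tendsto_sandwich[OF always_eventually always_eventually tendsto_const])
      show "\<forall>n. 0 \<le> (\<integral>\<^sup>+ t. ennreal (norm (\<Lambda> (f t) - \<Lambda> (s n t))) \<partial>?M)" by simp
      show "\<forall>n. (\<integral>\<^sup>+ t. ennreal (norm (\<Lambda> (f t) - \<Lambda> (s n t))) \<partial>?M) \<le> ennreal C * (\<integral>\<^sup>+ t. ennreal (norm (f t - s n t)) \<partial>?M)"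
      proof
        fix n
        have [measurable]: "(\<lambda>t. norm (f t - s n t)) \<in> borel_measurable ?M"
          by (intro strongly_measurable_real[OF I] strongly_measurable_compose2[OF f strongly_measurable_simple[OF sf]]
              continuous_intros)
        have "(\<integral>\<^sup>+ t. ennreal (norm (\<Lambda> (f t) - \<Lambda> (s n t))) \<partial>?M) \<le> (\<integral>\<^sup>+ t. ennreal C * ennreal (norm (f t - s n t)) \<partial>?M)"
        proof (rule nn_integral_mono)
          fix t
          have "norm (\<Lambda> (f t) - \<Lambda> (s n t)) \<le> C * norm (f t - s n t)"
            using C(1)[of "f t - s n t"] by (simp add: linear_simps[OF \<Lambda>] mult.commute)
          then show "ennreal (norm (\<Lambda> (f t) - \<Lambda> (s n t))) \<le> ennreal C * ennreal (norm (f t - s n t))"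
            using C(2) by (simp add: ennreal_mult[symmetric] ennreal_leI)
        qed
        also have "\<dots> = ennreal C * (\<integral>\<^sup>+ t. ennreal (norm (f t - s n t)) \<partial>?M)"
          by (rule nn_integral_cmult) measurable
        finally show "(\<integral>\<^sup>+ t. ennreal (norm (\<Lambda> (f t) - \<Lambda> (s n t))) \<partial>?M) \<le> ennreal C * (\<integral>\<^sup>+ t. ennreal (norm (f t - s n t)) \<partial>?M)" .
      qed
      show "(\<lambda>n. ennreal C * (\<integral>\<^sup>+ t. ennreal (norm (f t - s n t)) \<partial>?M)) \<longlonglongrightarrow> 0"
        using ennreal_tendsto_cmult[OF _ s(2), of "ennreal C"] by simp
    qed
  qed
qed

text \<open>Rounds down to the grid of width \<open>1 / (n + 1)\<close>; the maximum with
  \<open>- T\<close> keeps the value in the closed interval when the grid point falls to the left of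
  it.\<close>

definition step :: "real \<Rightarrow> nat \<Rightarrow> real \<Rightarrow> real" where
  "step T n t = max (- T) (real_of_int \<lfloor>real (Suc n) * t\<rfloor> / real (Suc n))"

lemma step_bounds:
  assumes "t \<in> {- T<..<T}"
  shows "step T n t \<in> {- T..T}" "\<bar>step T n t - t\<bar> \<le> 1 / real (Suc n)"
proof -
  have "real_of_int \<lfloor>real (Suc n) * t\<rfloor> / real (Suc n) \<le> t"
    using of_int_floor_le[of "real (Suc n) * t"] by (simp add: divide_le_eq mult.commute)
  moreover have "t \<le> real_of_int \<lfloor>real (Suc n) * t\<rfloor> / real (Suc n) + 1 / real (Suc n)"
  proof -
    have "t * real (Suc n) \<le> real_of_int \<lfloor>real (Suc n) * t\<rfloor> + 1"
      using real_of_int_floor_add_one_ge[of "real (Suc n) * t"] by (simp add: mult.commute)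
    then have "t \<le> (real_of_int \<lfloor>real (Suc n) * t\<rfloor> + 1) / real (Suc n)" by (subst pos_le_divide_eq) simp_all
    then show ?thesis by (simp only: add_divide_distrib)
  qed
  ultimately show "step T n t \<in> {- T..T}" "\<bar>step T n t - t\<bar> \<le> 1 / real (Suc n)"
    using assms by (auto simp: step_def max_def)
qed

lemma step_simple: "simple_function (lebesgue_on {- T<..<T}) (step T n)"
proof (rule simple_function_borel_measurable)
  have "step T n \<in> borel_measurable borel" unfolding step_def[abs_def] by measurable
  then show "step T n \<in> borel_measurable (lebesgue_on {- T<..<T})"
    by (intro measurable_restrict_space1 measurable_completion) simp
  have "step T n ` {- T<..<T} \<subseteq> (\<lambda>k. max (- T) (real_of_int k / real (Suc n))) ` {\<lfloor>- (real (Suc n) * T)\<rfloor>..\<lfloor>real (Suc n) * T\<rfloor>}"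
  proof
    fix x assume "x \<in> step T n ` {- T<..<T}"
    then obtain t where t: "- T < t" "t < T" "x = step T n t" by auto
    have "real (Suc n) * (- T) \<le> real (Suc n) * t" "real (Suc n) * t \<le> real (Suc n) * T"
      using t by (intro mult_left_mono; simp)+
    then have "\<lfloor>real (Suc n) * t\<rfloor> \<in> {\<lfloor>- (real (Suc n) * T)\<rfloor>..\<lfloor>real (Suc n) * T\<rfloor>}"
      by (simp add: floor_mono)
    then show "x \<in> (\<lambda>k. max (- T) (real_of_int k / real (Suc n))) ` {\<lfloor>- (real (Suc n) * T)\<rfloor>..\<lfloor>real (Suc n) * T\<rfloor>}"
      unfolding t(3) step_def by (rule imageI)
  qed
  from finite_subset[OF this] show "finite (step T n ` space (lebesgue_on {- T<..<T}))"
    by (simp add: space_restrict_space)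
qed

lemma step_approx:
  fixes f :: "real \<Rightarrow> 'b::real_normed_vector"
  assumes f: "continuous_on {- T..T} f" and e: "e > 0"
  shows "\<exists>N. \<forall>n\<ge>N. \<forall>t\<in>{- T<..<T}. norm (f t - f (step T n t)) \<le> e"
proof -
  have "uniformly_continuous_on {- T..T} f" by (rule compact_uniformly_continuous[OF f compact_Icc])
  then obtain d where d: "d > 0" "\<And>x y. x \<in> {- T..T} \<Longrightarrow> y \<in> {- T..T} \<Longrightarrow> dist y x < d \<Longrightarrow> dist (f y) (f x) < e"
    using uniformly_continuous_onE[OF _ e] by metis
  obtain N where N: "1 / real (Suc N) < d" using d(1) nat_approx_posE by blast
  show ?thesis
  proof (intro exI allI impI ballI)
    fix n t assume n: "N \<le> n" and t: "t \<in> {- T<..<T}"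
    have "1 / real (Suc n) \<le> 1 / real (Suc N)" using n by (intro divide_left_mono) auto
    then have "dist t (step T n t) < d"
      using step_bounds(2)[OF t, of n] N by (simp add: dist_real_def abs_minus_commute)
    then have "norm (f t - f (step T n t)) < e"
      using d(2)[OF step_bounds(1)[OF t, of n], of t] t by (simp add: dist_norm)
    then show "norm (f t - f (step T n t)) \<le> e" by simp
  qed
qed

lemma strongly_measurable_continuous:
  fixes f :: "real \<Rightarrow> 'b::real_normed_vector"
  assumes f: "continuous_on {- T..T} f"
  shows "strongly_measurable (lebesgue_on {- T<..<T}) f"
  unfolding strongly_measurable_def
proof (intro exI[of _ "\<lambda>n. f \<circ> step T n"] conjI allI)
  show "simple_function (lebesgue_on {- T<..<T}) (f \<circ> step T n)" for n
    by (rule simple_function_compose[OF step_simple])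
  show "AE t in lebesgue_on {- T<..<T}. (\<lambda>n. (f \<circ> step T n) t) \<longlonglongrightarrow> f t"
  proof (rule AE_I2)
    fix t assume "t \<in> space (lebesgue_on {- T<..<T})"
    then have t: "t \<in> {- T<..<T}" by (simp add: space_restrict_space)
    show "(\<lambda>n. (f \<circ> step T n) t) \<longlonglongrightarrow> f t"
    proof (rule LIMSEQ_I)
      fix r :: real assume r: "r > 0"
      then obtain N where "\<forall>n\<ge>N. \<forall>t\<in>{- T<..<T}. norm (f t - f (step T n t)) \<le> r / 2"
        using step_approx[OF f, of "r / 2"] by auto
      then have "\<forall>n\<ge>N. norm ((f \<circ> step T n) t - f t) < r" using t r by (force simp: norm_minus_commute)
      then show "\<exists>N. \<forall>n\<ge>N. norm ((f \<circ> step T n) t - f t) < r" ..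
    qed
  qed
qed

text \<open>The step approximants converge uniformly on an interval of finite measure, so their
  integrals form a Cauchy sequence.\<close>

lemma has_strong_integral_continuous:
  fixes f :: "real \<Rightarrow> 'b::banach"
  assumes T: "T > 0" and f: "continuous_on {- T..T} f"
  shows "\<exists>w. has_strong_integral (lebesgue_on {- T<..<T}) f w"
proof -
  let ?M = "lebesgue_on {- T<..<T}"
  let ?s = "\<lambda>n. f \<circ> step T n"
  let ?B = "\<lambda>n. Bochner_Integration.simple_bochner_integral ?M (?s n)"
  have sp: "space ?M = {- T<..<T}" by (simp add: space_restrict_space)
  have em: "emeasure ?M (space ?M) = ennreal (2 * T)"
    using T by (simp add: sp emeasure_restrict_space)
  have si: "Bochner_Integration.simple_bochner_integrable ?M (?s n)" for n
  proof (rule Bochner_Integration.simple_bochner_integrable.intros)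
    show "simple_function ?M (?s n)" by (rule simple_function_compose[OF step_simple])
    show "emeasure ?M {y \<in> space ?M. (?s n) y \<noteq> 0} \<noteq> \<infinity>"
      by (rule less_imp_neq[OF le_less_trans[OF emeasure_space]]) (simp only: em, simp)
  qed
  have le: "(\<integral>\<^sup>+ t. ennreal (norm (g t)) \<partial>?M) \<le> ennreal (e * (2 * T))"
    if "\<forall>t\<in>{- T<..<T}. norm (g t) \<le> e" "e \<ge> 0" for g :: "real \<Rightarrow> 'b" and e
  proof -
    have "(\<integral>\<^sup>+ t. ennreal (norm (g t)) \<partial>?M) \<le> (\<integral>\<^sup>+ t. ennreal e \<partial>?M)"
      using that(1) by (intro nn_integral_mono ennreal_leI) (simp add: sp)
    also have "\<dots> = ennreal (e * (2 * T))" using that(2) T by (simp only: nn_integral_const em ennreal_mult)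
    finally show ?thesis .
  qed
  have "Cauchy ?B"
  proof (rule CauchyI)
    fix r :: real assume r: "r > 0"
    \<comment> \<open>Two approximants then differ by at most \<open>2 * e\<close> on an interval of
      length \<open>2 * T\<close>, hence their integrals by at most \<open>r / 2\<close>.\<close>
    define e where "e = r / (8 * T)"
    have e: "e > 0" using r T by (simp add: e_def)
    obtain N where N: "\<forall>n\<ge>N. \<forall>t\<in>{- T<..<T}. norm (f t - ?s n t) \<le> e" using step_approx[OF f e] by auto
    show "\<exists>N. \<forall>m\<ge>N. \<forall>n\<ge>N. norm (?B m - ?B n) < r"
    proof (intro exI allI impI)
      fix m n assume mn: "N \<le> m" "N \<le> n"
      have d: "\<forall>t\<in>{- T<..<T}. norm (?s m t - ?s n t) \<le> 2 * e"
      proof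
        fix t assume t: "t \<in> {- T<..<T}"
        have "norm (f t - ?s m t) \<le> e" "norm (f t - ?s n t) \<le> e" using N mn t by simp_all
        moreover have "?s m t - ?s n t = (f t - ?s n t) - (f t - ?s m t)" by simp
        ultimately show "norm (?s m t - ?s n t) \<le> 2 * e"
          using norm_triangle_ineq4[of "f t - ?s n t" "f t - ?s m t"] by simp
      qed
      have sd: "Bochner_Integration.simple_bochner_integrable ?M (\<lambda>t. ?s m t - ?s n t)"
        by (rule Bochner_Integration.simple_bochner_integrable_compose2[OF _ si si]) simp
      have sn: "Bochner_Integration.simple_bochner_integrable ?M (\<lambda>t. norm (?s m t - ?s n t))"
        by (rule Bochner_Integration.simple_bochner_integrable_compose2[of "\<lambda>x y. norm x", OF _ sd sd]) simp
      let ?D = "Bochner_Integration.simple_bochner_integral ?M (\<lambda>t. norm (?s m t - ?s n t))"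
      have "ennreal ?D \<le> ennreal (2 * e * (2 * T))"
        unfolding Bochner_Integration.simple_bochner_integral_eq_nn_integral[OF sn norm_ge_zero]
        using d e by (intro le) auto
      then have D: "?D \<le> 2 * e * (2 * T)" using e T by (subst (asm) ennreal_le_iff) simp_all
      have "norm (?B m - ?B n) \<le> ?D"
        using Bochner_Integration.simple_bochner_integral_norm_bound[OF sd]
        by (simp only: Bochner_Integration.simple_bochner_integral_diff[OF si si])
      also have "\<dots> \<le> 2 * e * (2 * T)" by (rule D)
      also have "\<dots> < r" using r T by (simp add: e_def)
      finally show "norm (?B m - ?B n) < r" .
    qed
  qed
  then obtain w where w: "?B \<longlonglongrightarrow> w" using Cauchy_convergent convergent_def by blast
  have "(\<lambda>n. \<integral>\<^sup>+ t. ennreal (norm (f t - ?s n t)) \<partial>?M) \<longlonglongrightarrow> 0"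
  proof (rule order_tendstoI)
    fix a :: ennreal assume "0 < a"
    then obtain b where b: "0 < b" "b < a" using dense by blast
    then obtain r where r: "b = ennreal r" "r > 0" by (cases b) auto
    have e: "r / (2 * T) > 0" using r T by simp
    obtain N where N: "\<forall>n\<ge>N. \<forall>t\<in>{- T<..<T}. norm (f t - ?s n t) \<le> r / (2 * T)" using step_approx[OF f e] by auto
    have "(\<integral>\<^sup>+ t. ennreal (norm (f t - ?s n t)) \<partial>?M) < a" if "n \<ge> N" for n
    proof -
      have "(\<integral>\<^sup>+ t. ennreal (norm (f t - ?s n t)) \<partial>?M) \<le> ennreal (r / (2 * T) * (2 * T))"
        using N that e by (intro le) auto
      also have "\<dots> = b" using T r by simp
      finally show ?thesis using b(2) by (rule le_less_trans)
    qed
    then show "\<forall>\<^sub>F n in sequentially. (\<integral>\<^sup>+ t. ennreal (norm (f t - ?s n t)) \<partial>?M) < a"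
      by (rule eventually_sequentiallyI)
  qed simp
  then have "has_strong_integral ?M f w"
    unfolding has_strong_integral_def
    using strongly_measurable_continuous[OF f] w si by (intro conjI exI[of _ ?s]) auto
  then show ?thesis ..
qed

section \<open>The lemma of du Bois-Reymond on an interval\<close>

lemma cd_flat_exp_real: "continuously_differentiable n (\<lambda>x::real. flat_exp p (c * x + d))"
proof (induction n arbitrary: p)
  case 0
  have "continuous_on UNIV (flat_exp p)"
    by (intro continuous_at_imp_continuous_on ballI DERIV_isCont[OF flat_exp_deriv])
  then show ?case
    by (auto intro!: continuous_intros continuous_on_compose2[of UNIV "flat_exp p"])
next
  case (Suc n)
  define q where "q = (p - pderiv p) * [:0, 0, 1:]"
  have *: "((\<lambda>x. flat_exp p (c * x + d)) has_derivative (\<lambda>v. (c * v) * flat_exp q (c * x + d))) (at x)" for x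
  proof -
    have "((\<lambda>x. c * x + d) has_derivative (\<lambda>v. c * v)) (at x)"
      by (auto intro!: derivative_eq_intros)
    from DERIV_compose_FDERIV[OF flat_exp_deriv this] show ?thesis
      by (simp add: q_def)
  qed
  have "frechet_derivative (\<lambda>x. flat_exp p (c * x + d)) (at x) v = (c * v) * flat_exp q (c * x + d)" for x v
    by (rule fun_cong[OF frechet_derivative_at[OF *, symmetric]])
  moreover have "continuously_differentiable n (\<lambda>x. (c * v) * flat_exp q (c * x + d))" for v
    by (intro cd_mult cd_const Suc.IH)
  ultimately show ?case
    using * by (auto simp: differentiable_def intro!: exI)
qed

text \<open>For positive \<open>t\<close> this is \<open>exp (- 1 / t) / t^2\<close>. It is
  nonnegative with integral 1, because \<open>flat_exp 1\<close> climbs from 0 to 1, and so it is a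
  mollifier that lives on one side of 0.\<close>

definition flat_deriv :: "real \<Rightarrow> real" where "flat_deriv = flat_exp [:0, 0, 1:]"

lemma flat_deriv: "(flat_exp 1 has_real_derivative flat_deriv t) (at t)"
  using flat_exp_deriv[of 1 t] by (simp add: flat_deriv_def)

lemma flat_continuous: "continuous_on S (flat_exp 1)" "continuous_on S flat_deriv"
  unfolding flat_deriv_def
  by (intro continuous_at_imp_continuous_on ballI DERIV_isCont[OF flat_exp_deriv])+

lemma flat_measurable [measurable]: "flat_exp 1 \<in> borel_measurable borel" "flat_deriv \<in> borel_measurable borel"
  by (intro borel_measurable_continuous_onI flat_continuous)+

lemma flat_deriv_nonneg: "0 \<le> flat_deriv t" "t \<le> 0 \<Longrightarrow> flat_deriv t = 0"
  by (simp_all add: flat_deriv_def flat_exp_def)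

lemma flat_exp_at_top: "(flat_exp 1 \<longlongrightarrow> 1) at_top"
proof -
  have "((\<lambda>t::real. exp (- inverse t)) \<longlongrightarrow> exp (- 0)) at_top"
    by (intro tendsto_intros tendsto_inverse_0_at_top filterlim_ident)
  then have "((\<lambda>t::real. exp (- inverse t)) \<longlongrightarrow> 1) at_top" by simp
  moreover have "\<forall>\<^sub>F t in at_top. exp (- inverse t) = flat_exp 1 (t::real)"
    using eventually_gt_at_top[of 0] by eventually_elim (simp add: flat_exp_def inverse_eq_divide)
  ultimately show ?thesis by (rule Lim_transform_eventually)
qed

lemma flat_deriv_integral: "integrable lborel flat_deriv" "(\<integral>y. flat_deriv y \<partial>lborel) = 1"
proof -
  have "(\<integral>\<^sup>+ y. ennreal (flat_deriv y) \<partial>lborel) = (\<integral>\<^sup>+ y. ennreal (flat_deriv y) * indicator {0..} y \<partial>lborel)"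
    by (intro nn_integral_cong) (auto simp: indicator_def flat_deriv_nonneg)
  also have "\<dots> = ennreal (1 - flat_exp 1 0)"
    by (rule nn_integral_FTC_atLeast[OF _ flat_deriv flat_deriv_nonneg(1) flat_exp_at_top]) simp
  finally have "(\<integral>\<^sup>+ y. ennreal (flat_deriv y) \<partial>lborel) = ennreal 1" by (simp add: flat_exp_def)
  then have "integrable lborel flat_deriv \<and> (\<integral>y. flat_deriv y \<partial>lborel) = 1"
    by (subst (asm) nn_integral_eq_integrable) (auto simp: flat_deriv_nonneg)
  then show "integrable lborel flat_deriv" "(\<integral>y. flat_deriv y \<partial>lborel) = 1" by auto
qed

text \<open>Scaled copies of \<open>flat_deriv\<close> form an approximate identity supported on one side of a point; the
  derivatives of the test functions in \<open>test_function_flat\<close> consist of two such pieces.\<close>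

lemma flat_kernel_tendsto:
  fixes P :: "real \<Rightarrow> real"
  assumes P [measurable]: "P \<in> borel_measurable borel" and B: "\<And>x. \<bar>P x\<bar> \<le> B" and d: "d > 0"
    and lim: "\<And>y. y > 0 \<Longrightarrow> (\<lambda>n. P (a + \<sigma> * (y / real (Suc n)))) \<longlonglongrightarrow> l"
  shows "(\<lambda>n. \<integral>y. flat_deriv y * flat_exp 1 (real (Suc n) * d - y) * P (a + \<sigma> * (y / real (Suc n))) \<partial>lborel) \<longlonglongrightarrow> l"
proof -
  have "(\<lambda>n. \<integral>y. flat_deriv y * flat_exp 1 (real (Suc n) * d - y) * P (a + \<sigma> * (y / real (Suc n))) \<partial>lborel)
      \<longlonglongrightarrow> (\<integral>y. flat_deriv y * l \<partial>lborel)"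
  proof (rule integral_dominated_convergence[where w = "\<lambda>y. flat_deriv y * B"])
    show "AE y in lborel. (\<lambda>n. flat_deriv y * flat_exp 1 (real (Suc n) * d - y) * P (a + \<sigma> * (y / real (Suc n)))) \<longlonglongrightarrow> flat_deriv y * l"
    proof (rule AE_I2)
      fix y :: real
      show "(\<lambda>n. flat_deriv y * flat_exp 1 (real (Suc n) * d - y) * P (a + \<sigma> * (y / real (Suc n)))) \<longlonglongrightarrow> flat_deriv y * l"
      proof (cases "y > 0")
        case True
        have "filterlim (\<lambda>n. real (Suc n) * d - y) at_top sequentially"
          using d by real_asymp
        from filterlim_compose[OF flat_exp_at_top this]
        have "(\<lambda>n. flat_exp 1 (real (Suc n) * d - y)) \<longlonglongrightarrow> 1" .
        from tendsto_mult[OF tendsto_mult[OF tendsto_const[of "flat_deriv y"] this] lim[OF True]] show ?thesis by simp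
      qed (simp add: flat_deriv_nonneg)
    qed
    show "AE y in lborel. norm (flat_deriv y * flat_exp 1 (real (Suc n) * d - y) * P (a + \<sigma> * (y / real (Suc n)))) \<le> flat_deriv y * B" for n
    proof (rule AE_I2)
      fix y :: real
      have "\<bar>flat_exp 1 (real (Suc n) * d - y)\<bar> * \<bar>P (a + \<sigma> * (y / real (Suc n)))\<bar> \<le> 1 * B"
        using flat_exp_1 by (intro mult_mono B) auto
      from mult_left_mono[OF this flat_deriv_nonneg(1)[of y]]
      show "norm (flat_deriv y * flat_exp 1 (real (Suc n) * d - y) * P (a + \<sigma> * (y / real (Suc n)))) \<le> flat_deriv y * B"
        by (simp add: abs_mult flat_deriv_nonneg mult.assoc)
    qed
  qed (use flat_deriv_integral(1) in \<open>auto\<close>)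
  then show ?thesis by (simp add: flat_deriv_integral(2))
qed

text \<open>As \<open>N\<close> grows these functions tend to the indicator of the open interval
  from \<open>s\<close> to \<open>t\<close>, and their derivatives to a point mass at
  \<open>s\<close> minus one at \<open>t\<close>.\<close>

lemma test_function_flat:
  assumes N: "N > 0" and st: "s < t" "{s..t} \<subseteq> \<Omega>"
  defines "\<eta> \<equiv> \<lambda>x. flat_exp 1 (N * (x - s)) * flat_exp 1 (N * (t - x))"
  shows "test_function \<Omega> \<eta>"
    and "deriv \<eta> x = N * flat_deriv (N * (x - s)) * flat_exp 1 (N * (t - x)) -
      N * flat_deriv (N * (t - x)) * flat_exp 1 (N * (x - s))"
proof -
  have e: "\<eta> = (\<lambda>x. flat_exp 1 (N * x + (- N * s)) * flat_exp 1 ((- N) * x + N * t))"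
    by (simp add: \<eta>_def algebra_simps)
  have "smooth \<eta>" unfolding smooth_def e by (intro allI cd_mult cd_flat_exp_real)
  moreover have z: "closure {x. \<eta> x \<noteq> 0} \<subseteq> {s..t}"
    using N by (intro closure_minimal) (auto simp: \<eta>_def flat_exp_1(3) zero_less_mult_iff)
  moreover have "compact (closure {x. \<eta> x \<noteq> 0})"
    using closed_Int_compact[OF closed_closure compact_Icc, of "{x. \<eta> x \<noteq> 0}" s t] z by (simp add: Int_absorb2)
  ultimately show "test_function \<Omega> \<eta>" using st(2) by (auto simp: test_function_def)
  have "((\<lambda>x. N * (x - s)) has_real_derivative N) (at x)" "((\<lambda>x. N * (t - x)) has_real_derivative - N) (at x)"
    by (auto intro!: derivative_eq_intros)
  from DERIV_mult[OF DERIV_chain2[OF flat_deriv this(1)] DERIV_chain2[OF flat_deriv this(2)]]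
  have "(\<eta> has_real_derivative N * flat_deriv (N * (x - s)) * flat_exp 1 (N * (t - x)) -
      N * flat_deriv (N * (t - x)) * flat_exp 1 (N * (x - s))) (at x)"
    unfolding \<eta>_def by (simp add: algebra_simps)
  then show "deriv \<eta> x = N * flat_deriv (N * (x - s)) * flat_exp 1 (N * (t - x)) -
      N * flat_deriv (N * (t - x)) * flat_exp 1 (N * (x - s))" by (rule DERIV_imp_deriv)
qed

text \<open>Test with smooth cutoffs that tend to the indicator of the interval. The side with the
  derivative tends to \<open>p s - p t\<close> by continuity of \<open>p\<close>, the other side to
  the integral of \<open>q\<close> by dominated convergence.\<close>

lemma du_Bois_Reymond:
  fixes p q :: "real \<Rightarrow> real" and T :: real
  defines "I \<equiv> {- T<..<T}"
  assumes st: "s < t" "s \<in> I" "t \<in> I" and p: "continuous_on I p"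
    and q [measurable]: "q \<in> borel_measurable (lebesgue_on I)" and B: "AE r in lebesgue_on I. \<bar>q r\<bar> \<le> B"
    and weak: "\<And>\<eta>. test_function I \<eta> \<Longrightarrow> \<exists>w. has_bochner_integral (lebesgue_on I) (\<lambda>r. deriv \<eta> r * p r) w \<and>
      has_bochner_integral (lebesgue_on I) (\<lambda>r. \<eta> r * q r) (- w)"
  shows "p t - p s = integral {s..t} q"
proof -
  define N where "N = (\<lambda>n. real (Suc n))"
  have N: "N n > 0" for n by (simp add: N_def)
  define \<eta> where "\<eta> = (\<lambda>n x. flat_exp 1 (N n * (x - s)) * flat_exp 1 (N n * (t - x)))"
  have sub: "{s..t} \<subseteq> I" using st by (auto simp: I_def)
  have [measurable]: "I \<in> sets lebesgue" by (simp add: I_def)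
  have tf: "test_function I (\<eta> n)" "deriv (\<eta> n) x = N n * flat_deriv (N n * (x - s)) * flat_exp 1 (N n * (t - x)) -
      N n * flat_deriv (N n * (t - x)) * flat_exp 1 (N n * (x - s))" for n x
    unfolding \<eta>_def by (rule test_function_flat[OF N st(1) sub])+
  have pc: "continuous_on {s..t} p" by (rule continuous_on_subset[OF p sub])
  \<comment> \<open>Cutting \<open>p\<close> off outside \<open>{s..t}\<close> makes it bounded on
    the whole line and leaves the integrals unchanged, since \<open>deriv (\<eta> n)\<close>
    vanishes there.\<close>
  define P where "P = (\<lambda>x. indicator {s..t} x *\<^sub>R p x)"
  have Pm [measurable]: "P \<in> borel_measurable borel"
    unfolding P_def by (rule borel_measurable_continuous_on_indicator[OF _ pc]) simp
  obtain D where D: "\<forall>x\<in>p ` {s..t}. norm x \<le> D"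
    using compact_imp_bounded[OF compact_continuous_image[OF pc compact_Icc]] unfolding bounded_iff by (elim exE)
  have PD: "\<bar>P x\<bar> \<le> \<bar>D\<bar>" for x
  proof (cases "x \<in> {s..t}")
    case True
    then have "\<bar>p x\<bar> \<le> D" using D by simp
    then show ?thesis using True by (simp add: P_def)
  qed (simp add: P_def)
  have lim: "(\<lambda>n. P (a + \<sigma> * (y / real (Suc n)))) \<longlonglongrightarrow> p a"
    if y: "y > 0" and a: "(a = s \<and> \<sigma> = 1) \<or> (a = t \<and> \<sigma> = -1)" for y a \<sigma>
  proof -
    have l: "(\<lambda>n. a + \<sigma> * (y / real (Suc n))) \<longlonglongrightarrow> a"
    proof -
      have "(\<lambda>n. y / real (Suc n)) \<longlonglongrightarrow> 0" using LIMSEQ_Suc[OF lim_const_over_n[of y]] by simp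
      from tendsto_add[OF tendsto_const tendsto_mult[OF tendsto_const this]] show ?thesis by force
    qed
    have y0: "0 < y / real (Suc n)" for n using y by simp
    have "\<forall>\<^sub>F n in sequentially. a + \<sigma> * (y / real (Suc n)) \<in> {s..t}"
      using a
    proof
      assume a: "a = s \<and> \<sigma> = 1"
      then have "\<forall>\<^sub>F n in sequentially. a + \<sigma> * (y / real (Suc n)) < t"
        using l st(1) by (intro order_tendstoD(2)[OF l]) simp
      then show ?thesis by eventually_elim (use a y0 in \<open>auto intro: less_imp_le\<close>)
    next
      assume a: "a = t \<and> \<sigma> = -1"
      then have "\<forall>\<^sub>F n in sequentially. s < a + \<sigma> * (y / real (Suc n))"
        using l st(1) by (intro order_tendstoD(1)[OF l]) simp
      then show ?thesis by eventually_elim (use a y0 in \<open>auto intro: less_imp_le\<close>)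
    qed
    moreover have "a \<in> {s..t}" using a st by auto
    ultimately have "(\<lambda>n. p (a + \<sigma> * (y / real (Suc n)))) \<longlonglongrightarrow> p a"
      by (intro continuous_on_tendsto_compose[OF pc l])
    then show ?thesis
    proof (rule Lim_transform_eventually)
      show "\<forall>\<^sub>F n in sequentially. p (a + \<sigma> * (y / real (Suc n))) = P (a + \<sigma> * (y / real (Suc n)))"
        using \<open>\<forall>\<^sub>F n in sequentially. a + \<sigma> * (y / real (Suc n)) \<in> {s..t}\<close> by eventually_elim (simp add: P_def)
    qed
  qed
  have d: "t - s > 0" using st by simp
  \<comment> \<open>The substitution \<open>x = s + y / N n\<close> brings the part concentrated at
    \<open>s\<close> into the form of \<open>flat_kernel_tendsto\<close>.\<close>
  have A1: "(\<integral>x. N n * flat_deriv (N n * (x - s)) * flat_exp 1 (N n * (t - x)) * P x \<partial>lborel) =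
      (\<integral>y. flat_deriv y * flat_exp 1 (N n * (t - s) - y) * P (s + 1 * (y / N n)) \<partial>lborel)" for n
  proof -
    have "(\<integral>x. N n * flat_deriv (N n * (x - s)) * flat_exp 1 (N n * (t - x)) * P x \<partial>lborel) =
      \<bar>1 / N n\<bar> *\<^sub>R (\<integral>y. N n * flat_deriv (N n * (s + 1 / N n * y - s)) * flat_exp 1 (N n * (t - (s + 1 / N n * y))) * P (s + 1 / N n * y) \<partial>lborel)"
      using N[of n] by (intro lborel_integral_real_affine) simp
    also have "(\<lambda>y. N n * flat_deriv (N n * (s + 1 / N n * y - s)) * flat_exp 1 (N n * (t - (s + 1 / N n * y))) * P (s + 1 / N n * y)) =
        (\<lambda>y. N n * (flat_deriv y * flat_exp 1 (N n * (t - s) - y) * P (s + 1 * (y / N n))))"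
    proof
      fix y
      have "N n * (s + 1 / N n * y - s) = y" "N n * (t - (s + 1 / N n * y)) = N n * (t - s) - y" "s + 1 / N n * y = s + 1 * (y / N n)"
        using N[of n] by (simp_all add: field_simps)
      then show "N n * flat_deriv (N n * (s + 1 / N n * y - s)) * flat_exp 1 (N n * (t - (s + 1 / N n * y))) * P (s + 1 / N n * y) =
        N n * (flat_deriv y * flat_exp 1 (N n * (t - s) - y) * P (s + 1 * (y / N n)))" by (simp only: mult.assoc)
    qed
    finally show ?thesis using N[of n] by simp
  qed
  \<comment> \<open>The same at the right end, with the reflection
    \<open>x = t - y / N n\<close>.\<close>
  have A2: "(\<integral>x. N n * flat_deriv (N n * (t - x)) * flat_exp 1 (N n * (x - s)) * P x \<partial>lborel) =
      (\<integral>y. flat_deriv y * flat_exp 1 (N n * (t - s) - y) * P (t + - 1 * (y / N n)) \<partial>lborel)" for n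
  proof -
    have "(\<integral>x. N n * flat_deriv (N n * (t - x)) * flat_exp 1 (N n * (x - s)) * P x \<partial>lborel) =
      \<bar>- (1 / N n)\<bar> *\<^sub>R (\<integral>y. N n * flat_deriv (N n * (t - (t + - (1 / N n) * y))) * flat_exp 1 (N n * (t + - (1 / N n) * y - s)) * P (t + - (1 / N n) * y) \<partial>lborel)"
      using N[of n] by (intro lborel_integral_real_affine) simp
    also have "(\<lambda>y. N n * flat_deriv (N n * (t - (t + - (1 / N n) * y))) * flat_exp 1 (N n * (t + - (1 / N n) * y - s)) * P (t + - (1 / N n) * y)) =
        (\<lambda>y. N n * (flat_deriv y * flat_exp 1 (N n * (t - s) - y) * P (t + - 1 * (y / N n))))"
    proof
      fix y
      have "N n * (t - (t + - (1 / N n) * y)) = y" "N n * (t + - (1 / N n) * y - s) = N n * (t - s) - y" "t + - (1 / N n) * y = t + - 1 * (y / N n)"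
        using N[of n] by (simp_all add: field_simps)
      then show "N n * flat_deriv (N n * (t - (t + - (1 / N n) * y))) * flat_exp 1 (N n * (t + - (1 / N n) * y - s)) * P (t + - (1 / N n) * y) =
        N n * (flat_deriv y * flat_exp 1 (N n * (t - s) - y) * P (t + - 1 * (y / N n)))" by (simp only: mult.assoc)
    qed
    finally show ?thesis using N[of n] by simp
  qed
  let ?A = "\<lambda>n x. N n * flat_deriv (N n * (x - s)) * flat_exp 1 (N n * (t - x)) * P x"
  let ?B = "\<lambda>n x. N n * flat_deriv (N n * (t - x)) * flat_exp 1 (N n * (x - s)) * P x"
  have AB: "(\<lambda>n. (\<integral>x. ?A n x \<partial>lborel) - (\<integral>x. ?B n x \<partial>lborel)) \<longlonglongrightarrow> p s - p t"
    unfolding A1 A2 unfolding N_def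
    by (intro tendsto_diff flat_kernel_tendsto[OF Pm PD d] lim) auto
  have int: "integrable lborel (?A n)" "integrable lborel (?B n)" for n
  proof -
    have "integrable lborel (\<lambda>x. indicator {s..t} x *\<^sub>R (N n * flat_deriv (N n * (x - s)) * flat_exp 1 (N n * (t - x)) * p x))"
      "integrable lborel (\<lambda>x. indicator {s..t} x *\<^sub>R (N n * flat_deriv (N n * (t - x)) * flat_exp 1 (N n * (x - s)) * p x))"
      by (intro borel_integrable_compact compact_Icc continuous_intros pc
          continuous_on_compose2[OF flat_continuous(1)[of UNIV]] continuous_on_compose2[OF flat_continuous(2)[of UNIV]] subset_UNIV)+
    then show "integrable lborel (?A n)" "integrable lborel (?B n)" by (simp_all add: P_def mult_ac)
  qed
  have left: "(\<integral>r. deriv (\<eta> n) r * p r \<partial>lebesgue_on I) = (\<integral>x. ?A n x \<partial>lborel) - (\<integral>x. ?B n x \<partial>lborel)" for n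
  proof -
    have "(\<integral>r. deriv (\<eta> n) r * p r \<partial>lebesgue_on I) = (\<integral>r. indicator I r *\<^sub>R (deriv (\<eta> n) r * p r) \<partial>lebesgue)"
      by (rule integral_restrict_space) simp
    also have "(\<lambda>r. indicator I r *\<^sub>R (deriv (\<eta> n) r * p r)) = (\<lambda>x. ?A n x - ?B n x)"
    proof
      fix x
      show "indicator I x *\<^sub>R (deriv (\<eta> n) x * p x) = ?A n x - ?B n x"
      proof (cases "x \<in> {s..t}")
        case True
        then have "x \<in> I" using sub by blast
        with True show ?thesis by (simp add: tf(2) P_def left_diff_distrib)
      next
        case False
        then have "N n * (x - s) \<le> 0 \<or> N n * (t - x) \<le> 0" using N[of n] by (auto simp: mult_le_0_iff)
        then have "deriv (\<eta> n) x = 0" by (auto simp: tf(2) flat_deriv_nonneg flat_exp_def)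
        with False show ?thesis by (simp add: P_def)
      qed
    qed
    also have "(\<integral>x. ?A n x - ?B n x \<partial>lebesgue) = (\<integral>x. ?A n x - ?B n x \<partial>lborel)"
      by (rule integral_completion) measurable
    also have "\<dots> = (\<integral>x. ?A n x \<partial>lborel) - (\<integral>x. ?B n x \<partial>lborel)" by (rule Bochner_Integration.integral_diff[OF int])
    finally show ?thesis .
  qed
  have right: "(\<integral>r. \<eta> n r * q r \<partial>lebesgue_on I) = - (\<integral>r. deriv (\<eta> n) r * p r \<partial>lebesgue_on I)" for n
    using weak[OF tf(1)[of n]] by (auto simp: has_bochner_integral_iff)
  let ?g = "\<lambda>r. if r \<in> {s<..<t} then q r else 0"
  have \<eta>m [measurable]: "\<eta> n \<in> borel_measurable (lebesgue_on I)" for n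
  proof -
    have "\<eta> n \<in> borel_measurable borel" unfolding \<eta>_def by measurable
    then show ?thesis by (intro measurable_restrict_space1 measurable_completion) simp
  qed
  interpret finite_measure "lebesgue_on I"
    by (rule finite_measure_lebesgue_on) (simp add: I_def)
  have conv: "AE r in lebesgue_on I. (\<lambda>n. \<eta> n r * q r) \<longlonglongrightarrow> ?g r"
  proof (rule AE_I2)
    fix r
    show "(\<lambda>n. \<eta> n r * q r) \<longlonglongrightarrow> ?g r"
    proof (cases "r \<in> {s<..<t}")
      case True
      then have "(\<lambda>n. flat_exp 1 (N n * (r - s)) * flat_exp 1 (N n * (t - r)) * q r) \<longlonglongrightarrow> 1 * 1 * q r"
        unfolding N_def by (intro tendsto_mult tendsto_const LIMSEQ_Suc[OF flat_exp_tendsto]) simp_all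
      then show ?thesis using True by (simp add: \<eta>_def)
    next
      case False
      then have le: "N n * (r - s) \<le> 0 \<or> N n * (t - r) \<le> 0" for n using N[of n] by (auto simp: mult_le_0_iff)
      have "\<eta> n r = 0" for n using le[of n] by (auto simp: \<eta>_def flat_exp_def)
      moreover have "?g r = 0" using False by (rule if_not_P)
      ultimately show ?thesis by (simp only: mult_zero_left tendsto_const)
    qed
  qed
  have bound: "AE r in lebesgue_on I. norm (\<eta> n r * q r) \<le> \<bar>B\<bar>" for n
    using B
  proof eventually_elim
    case (elim r)
    have "\<bar>\<eta> n r\<bar> \<le> 1" unfolding \<eta>_def abs_mult using flat_exp_1 by (intro mult_le_one) auto
    from mult_mono[OF this elim] show ?case by (simp add: abs_mult)
  qed
  have gm: "?g \<in> borel_measurable (lebesgue_on I)"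
    by (rule AE_limit_measurable[OF _ _ conv]) measurable
  have "(\<lambda>n. \<integral>r. \<eta> n r * q r \<partial>lebesgue_on I) \<longlonglongrightarrow> (\<integral>r. ?g r \<partial>lebesgue_on I)"
    by (rule integral_dominated_convergence[OF gm _ integrable_const[of "\<bar>B\<bar>"] conv bound]) measurable
  moreover have "(\<lambda>n. \<integral>r. \<eta> n r * q r \<partial>lebesgue_on I) \<longlonglongrightarrow> - (p s - p t)"
    unfolding right left by (rule tendsto_minus[OF AB])
  ultimately have "(\<integral>r. ?g r \<partial>lebesgue_on I) = p t - p s" by (simp add: LIMSEQ_unique)
  moreover have "integrable (lebesgue_on I) ?g"
    by (rule integrable_dominated_convergence[OF gm _ integrable_const[of "\<bar>B\<bar>"] conv bound]) measurable
  then have "(\<integral>r. ?g r \<partial>lebesgue_on I) = integral I ?g" by (rule lebesgue_integral_eq_integral) simp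
  moreover have "integral I ?g = integral ({s<..<t} \<inter> I) q" by (rule Henstock_Kurzweil_Integration.integral_restrict_Int)
  moreover have "{s<..<t} \<inter> I = {s<..<t}" using sub by auto
  moreover have "integral {s<..<t} q = integral {s..t} q" by (rule integral_open_interval_real[symmetric])
  ultimately show ?thesis by simp
qed

section \<open>Weak solutions\<close>

lemma bounded_linear_Re_apply: "bounded_linear (\<lambda>F::W12 \<Rightarrow>\<^sub>L complex. Re (blinfun_apply F v))"
  "bounded_linear (\<lambda>F::W12 \<Rightarrow>\<^sub>L complex. Im (blinfun_apply F v))"
  by (rule bounded_linear_compose[OF bounded_linear_Re blinfun.bounded_linear_left]
      bounded_linear_compose[OF bounded_linear_Im blinfun.bounded_linear_left])+

lemma Re_apply_bound: "\<bar>Re (blinfun_apply F (conj_W12 v))\<bar> \<le> norm F * norm v"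
  using abs_Re_le_cmod[of "blinfun_apply F (conj_W12 v)"] norm_blinfun[of F "conj_W12 v"] by (simp add: norm_conj)

lemma AE_negligible:
  fixes I :: "real set"
  assumes "I \<in> sets lebesgue" "AE r in lebesgue_on I. f r = g r"
  shows "negligible {r \<in> I. f r \<noteq> g r}"
  using assms by (simp add: AE_restrict_space_iff completion.AE_iff_null_sets negligible_iff_null_sets)

lemma integral_AE_cong:
  fixes f g :: "real \<Rightarrow> real"
  assumes I: "I \<in> sets lebesgue" and ae: "AE r in lebesgue_on I. f r = g r" and sub: "{s..t} \<subseteq> I"
  shows "integral {s..t} f = integral {s..t} g"
  by (rule integral_spike[OF AE_negligible[OF I ae]]) (use sub in auto)

lemma Linf_real_integrable:
  fixes q :: "real \<Rightarrow> real"
  assumes q: "q \<in> borel_measurable (lebesgue_on I)" and B: "\<And>r. \<bar>q r\<bar> \<le> B" and sub: "{s..t} \<subseteq> I"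
  shows "q integrable_on {s..t}"
  by (rule measurable_bounded_by_integrable_imp_integrable[OF measurable_restrict_mono[OF q sub], of "\<lambda>_. B"])
     (use B in auto)

lemma integral_bound_const:
  fixes q :: "real \<Rightarrow> real"
  assumes q: "q integrable_on {s..t}" and B: "\<And>r. \<bar>q r\<bar> \<le> B" and st: "s \<le> t"
  shows "\<bar>integral {s..t} q\<bar> \<le> B * (t - s)"
proof -
  have "norm (integral {s..t} q) \<le> integral {s..t} (\<lambda>_. B)"
    by (rule Henstock_Kurzweil_Integration.integral_norm_bound_integral[OF q]) (use B in auto)
  then show ?thesis using st by (simp add: mult.commute)
qed

lemma friction_continuous: "continuous_on UNIV (friction \<kappa>)"
proof (intro continuous_at_imp_continuous_on ballI)
  fix \<psi> :: W12
  define R where "R = norm \<psi> + 1"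
  obtain L where L: "0 \<le> L"
    "\<And>a b. norm a \<le> R \<Longrightarrow> norm b \<le> R \<Longrightarrow> norm (friction \<kappa> a - friction \<kappa> b) \<le> L * norm (a - b)"
    using friction_lipschitz[of R \<kappa>] by auto
  have "((\<lambda>x. friction \<kappa> x - friction \<kappa> \<psi>) \<longlongrightarrow> 0) (at \<psi>)"
  proof (rule Lim_null_comparison)
    have "\<forall>\<^sub>F x in at \<psi>. dist x \<psi> < 1" by (rule eventually_at_ball'[of 1 \<psi> UNIV, THEN eventually_mono]) (auto simp: dist_commute)
    then show "\<forall>\<^sub>F x in at \<psi>. norm (friction \<kappa> x - friction \<kappa> \<psi>) \<le> L * norm (x - \<psi>)"
    proof eventually_elim
      case (elim x)
      then have "norm x \<le> R" using norm_triangle_ineq2[of x \<psi>] by (simp add: R_def dist_norm)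
      then show ?case by (intro L(2)) (simp_all add: R_def)
    qed
    have "((\<lambda>x. L * norm (x - \<psi>)) \<longlongrightarrow> L * norm (\<psi> - \<psi>)) (at \<psi>)" by (intro tendsto_intros)
    then show "((\<lambda>x. L * norm (x - \<psi>)) \<longlongrightarrow> 0) (at \<psi>)" by simp
  qed
  then show "isCont (friction \<kappa>) \<psi>" unfolding isCont_def by (rule LIM_zero_cancel)
qed

text \<open>The Riesz representative of the time derivative of \<open>embed \<psi>\<close>,
  equivalently the right-hand side of the equation for \<open>K \<psi>\<close>.\<close>

definition vfield :: "real \<Rightarrow> real \<Rightarrow> W12 \<Rightarrow> W12" where
  "vfield c \<kappa> \<psi> = c *\<^sub>R J (K \<psi> - \<psi>) + K (friction \<kappa> \<psi>)"

text \<open>Collects what later arguments use about a weak solution, in terms of real functions. The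
  weak derivative is replaced by a version bounded at all times, and the fundamental theorem of
  calculus is obtained for the continuous representative \<open>\<Psi>\<close>, for which values at
  single times are meaningful.\<close>

lemma solution_facts:
  fixes hbar m G T :: real
  defines "I \<equiv> {- T<..<T}" and "c \<equiv> hbar / (2 * m)" and "\<kappa> \<equiv> 4 * pi * G * m\<^sup>2 / hbar"
  assumes sol: "frictional_NS_solution hbar m G I \<phi> \<psi>"
  obtains \<Psi> \<psi>' C where "C \<ge> 0"
    "strongly_measurable (lebesgue_on I) \<psi>" "AE t in lebesgue_on I. norm (\<psi> t) \<le> C"
    "AE t in lebesgue_on I. \<Psi> t = embed (\<psi> t)" "\<Psi> 0 = embed \<phi>"
    "\<And>v. (\<lambda>t. Re (blinfun_apply (\<psi>' t) (conj_W12 v))) \<in> borel_measurable (lebesgue_on I)"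
    "\<And>t. norm (\<psi>' t) \<le> C"
    "AE t in lebesgue_on I. \<forall>v. Re (blinfun_apply (\<psi>' t) (conj_W12 v)) = vfield c \<kappa> (\<psi> t) \<bullet> v"
    "\<And>s t v. s \<in> I \<Longrightarrow> t \<in> I \<Longrightarrow> s \<le> t \<Longrightarrow>
      Re (blinfun_apply (\<Psi> t) (conj_W12 v)) - Re (blinfun_apply (\<Psi> s) (conj_W12 v)) =
      integral {s..t} (\<lambda>r. Re (blinfun_apply (\<psi>' r) (conj_W12 v)))"
proof -
  let ?M = "lebesgue_on I"
  have I: "I \<in> sets lebesgue" "interior I = I" by (simp_all add: I_def interior_open)
  have "\<psi> \<in> Linf I UNIV" using sol unfolding frictional_NS_solution_def by blast
  then obtain C1 where \<psi>: "strongly_measurable ?M \<psi>" "AE t in ?M. norm (\<psi> t) \<le> C1" unfolding Linf_def by blast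
  obtain \<psi>1 where \<psi>1: "\<psi>1 \<in> Linf I W_dual" "weak_time_derivative I (\<lambda>t. embed (\<psi> t)) \<psi>1"
    "AE t in ?M. scaleC_dual \<i> (\<psi>1 t) = - (c *\<^sub>R laplacian (\<psi> t)) + scaleC_dual (\<i> * of_real \<kappa>) (g1 (\<psi> t))
        - scaleC_dual (\<i> * of_real \<kappa>) (g2 (\<psi> t))"
    using sol unfolding frictional_NS_solution_def c_def \<kappa>_def by blast
  obtain \<Psi> where \<Psi>: "continuous_on I \<Psi>" "AE t in ?M. \<Psi> t = embed (\<psi> t)" "\<Psi> 0 = embed \<phi>"
    using sol unfolding frictional_NS_solution_def by blast
  obtain C2 where \<psi>1': "strongly_measurable ?M \<psi>1" "AE t in ?M. \<psi>1 t \<in> W_dual" "AE t in ?M. norm (\<psi>1 t) \<le> C2"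
    using \<psi>1(1) unfolding Linf_def by blast
  define C where "C = \<bar>C1\<bar> + \<bar>C2\<bar>"
  \<comment> \<open>The truncation changes \<open>\<psi>1\<close> only on a null set of
    times.\<close>
  define \<psi>' where "\<psi>' = (\<lambda>t. if norm (\<psi>1 t) \<le> C then \<psi>1 t else 0)"
  have C0: "0 \<le> C" by (simp add: C_def)
  have bd: "norm (\<psi>' t) \<le> C" for t using C0 by (simp add: \<psi>'_def)
  have ae: "AE t in ?M. \<psi>1 t = \<psi>' t" using \<psi>1'(3) by eventually_elim (auto simp: \<psi>'_def C_def)
  have meas: "(\<lambda>t. Re (blinfun_apply (\<psi>' t) (conj_W12 v))) \<in> borel_measurable ?M" for v
  proof (rule borel_measurable_lebesgue_on_AE_cong[OF I(1)])
    show "(\<lambda>t. Re (blinfun_apply (\<psi>1 t) (conj_W12 v))) \<in> borel_measurable ?M"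
      by (rule strongly_measurable_real[OF I(1) strongly_measurable_compose[OF \<psi>1'(1) linear_continuous_on[OF bounded_linear_Re_apply(1)]]])
    show "AE t in ?M. Re (blinfun_apply (\<psi>1 t) (conj_W12 v)) = Re (blinfun_apply (\<psi>' t) (conj_W12 v))"
      using ae by eventually_elim simp
  qed
  have eq: "AE t in ?M. \<forall>v. Re (blinfun_apply (\<psi>' t) (conj_W12 v)) = vfield c \<kappa> (\<psi> t) \<bullet> v"
    using ae \<psi>1(3) \<psi>1'(2)
  proof eventually_elim
    case (elim t)
    then show ?case using equation_pairing[OF elim(3), of c "\<psi> t" \<kappa>] by (simp add: vfield_def)
  qed
  have FTC: "Re (blinfun_apply (\<Psi> t) (conj_W12 v)) - Re (blinfun_apply (\<Psi> s) (conj_W12 v)) =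
      integral {s..t} (\<lambda>r. Re (blinfun_apply (\<psi>' r) (conj_W12 v)))"
    if st: "s \<in> I" "t \<in> I" "s \<le> t" for s t v
  proof (cases "s = t")
    case False
    let ?\<Lambda> = "\<lambda>F. Re (blinfun_apply F (conj_W12 v))"
    have \<Lambda>: "bounded_linear ?\<Lambda>" by (rule bounded_linear_Re_apply)
    show ?thesis
    proof (rule du_Bois_Reymond[of s t T "\<lambda>r. ?\<Lambda> (\<Psi> r)" "\<lambda>r. ?\<Lambda> (\<psi>' r)" "C * norm v", folded I_def])
      show "s < t" using st False by simp
      show "s \<in> I" "t \<in> I" by (rule st)+
      show p: "continuous_on I (\<lambda>r. ?\<Lambda> (\<Psi> r))"
        by (rule continuous_on_compose2[OF linear_continuous_on[OF \<Lambda>] \<Psi>(1), of UNIV]) simp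
      show "(\<lambda>r. ?\<Lambda> (\<psi>' r)) \<in> borel_measurable ?M" by (rule meas)
      show "AE r in ?M. \<bar>?\<Lambda> (\<psi>' r)\<bar> \<le> C * norm v"
      proof (rule AE_I2)
        fix r
        show "\<bar>?\<Lambda> (\<psi>' r)\<bar> \<le> C * norm v"
          using Re_apply_bound[of "\<psi>' r" v] mult_right_mono[OF bd[of r] norm_ge_zero[of v]] by linarith
      qed
      fix \<eta> :: "real \<Rightarrow> real" assume \<eta>: "test_function I \<eta>"
      then obtain w where w: "has_strong_integral ?M (\<lambda>t. deriv \<eta> t *\<^sub>R embed (\<psi> t)) w"
        "has_strong_integral ?M (\<lambda>t. \<eta> t *\<^sub>R \<psi>1 t) (- w)"
        using \<psi>1(2) unfolding weak_time_derivative_def I(2) by blast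
      note l1 = has_strong_integral_linear[OF I(1) w(1) \<Lambda>]
      note l2 = has_strong_integral_linear[OF I(1) w(2) \<Lambda>]
      have \<eta>c: "continuous_on UNIV \<eta>" by (rule test_function_continuous[OF \<eta>])
      have [measurable]: "(\<lambda>r. ?\<Lambda> (\<psi>' r)) \<in> borel_measurable ?M" by (rule meas)
      have [measurable]: "\<eta> \<in> borel_measurable ?M"
        by (rule continuous_imp_measurable_on_sets_lebesgue[OF continuous_on_subset[OF \<eta>c] I(1)]) simp
      \<comment> \<open>The weak derivative is that of \<open>embed (\<psi> t)\<close>; agreement
        almost everywhere transfers the identity to \<open>\<Psi>\<close>.\<close>
      have "has_bochner_integral ?M (\<lambda>r. deriv \<eta> r * ?\<Lambda> (\<Psi> r)) (?\<Lambda> w)"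
      proof (rule has_bochner_integralI_AE[OF l1])
        have "(\<lambda>t. ?\<Lambda> (deriv \<eta> t *\<^sub>R embed (\<psi> t))) \<in> borel_measurable ?M"
          using l1 by (simp add: has_bochner_integral_iff borel_measurable_integrable)
        moreover show ae: "AE t in ?M. ?\<Lambda> (deriv \<eta> t *\<^sub>R embed (\<psi> t)) = deriv \<eta> t * ?\<Lambda> (\<Psi> t)"
          using \<Psi>(2) by eventually_elim (simp add: blinfun.scaleR_left)
        ultimately show "(\<lambda>t. deriv \<eta> t * ?\<Lambda> (\<Psi> t)) \<in> borel_measurable ?M"
          by (rule borel_measurable_lebesgue_on_AE_cong[OF I(1)])
      qed
      moreover have "has_bochner_integral ?M (\<lambda>r. \<eta> r * ?\<Lambda> (\<psi>' r)) (- ?\<Lambda> w)"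
      proof -
        have "has_bochner_integral ?M (\<lambda>r. \<eta> r * ?\<Lambda> (\<psi>' r)) (?\<Lambda> (- w))"
        proof (rule has_bochner_integralI_AE[OF l2])
          show "AE t in ?M. ?\<Lambda> (\<eta> t *\<^sub>R \<psi>1 t) = \<eta> t * ?\<Lambda> (\<psi>' t)"
            using ae by eventually_elim (simp add: blinfun.scaleR_left)
        qed measurable
        then show ?thesis by (simp add: blinfun.minus_left)
      qed
      ultimately show "\<exists>w. has_bochner_integral ?M (\<lambda>r. deriv \<eta> r * ?\<Lambda> (\<Psi> r)) w \<and>
          has_bochner_integral ?M (\<lambda>r. \<eta> r * ?\<Lambda> (\<psi>' r)) (- w)" by blast
    qed
  qed simp
  have "AE t in ?M. norm (\<psi> t) \<le> C" using \<psi>(2) by eventually_elim (simp add: C_def)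
  from that[OF C0 \<psi>(1) this \<Psi>(2,3) meas bd eq FTC] show thesis .
qed

text \<open>The difference \<open>w\<close> of the solutions satisfies the hypotheses of
  \<open>weak_estimate\<close>. For \<open>p\<close> the pairing with the continuous representatives
  is taken, so that \<open>p 0\<close> is fixed by the initial data, while \<open>p t\<close> comes
  from \<open>K (w t)\<close> at almost every time.\<close>

lemma solution_difference:
  fixes hbar m G T :: real
  defines "I \<equiv> {- T<..<T}" and "\<kappa> \<equiv> 4 * pi * G * m\<^sup>2 / hbar"
  assumes T: "T > 0"
    and sol1: "frictional_NS_solution hbar m G I \<phi>1 \<psi>1" and sol2: "frictional_NS_solution hbar m G I \<phi>2 \<psi>2"
    and R1: "AE t in lebesgue_on I. norm (\<psi>1 t) \<le> R" and R2: "AE t in lebesgue_on I. norm (\<psi>2 t) \<le> R"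
    and L: "L \<ge> 0" "\<And>a b. norm a \<le> R \<Longrightarrow> norm b \<le> R \<Longrightarrow> norm (friction \<kappa> a - friction \<kappa> b) \<le> L * norm (a - b)"
  shows "AE t in lebesgue_on I. norm (\<psi>1 t - \<psi>2 t) \<le> 2 * norm (\<phi>1 - \<phi>2) * exp (2 * L * T)"
proof -
  define c where "c = hbar / (2 * m)"
  interpret schroedinger_pair K J c by (rule K_pair)
  let ?M = "lebesgue_on I"
  let ?\<Lambda> = "\<lambda>v F. Re (blinfun_apply F (conj_W12 v))"
  have I: "I \<in> sets lebesgue" by (simp add: I_def)
  obtain \<Psi>1 D1 C1 where 1: "C1 \<ge> 0"
    "strongly_measurable ?M \<psi>1" "AE t in ?M. norm (\<psi>1 t) \<le> C1"
    "AE t in ?M. \<Psi>1 t = embed (\<psi>1 t)" "\<Psi>1 0 = embed \<phi>1"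
    "\<And>v. (\<lambda>t. ?\<Lambda> v (D1 t)) \<in> borel_measurable ?M" "\<And>t. norm (D1 t) \<le> C1"
    "AE t in ?M. \<forall>v. ?\<Lambda> v (D1 t) = vfield c \<kappa> (\<psi>1 t) \<bullet> v"
    "\<And>s t v. s \<in> I \<Longrightarrow> t \<in> I \<Longrightarrow> s \<le> t \<Longrightarrow> ?\<Lambda> v (\<Psi>1 t) - ?\<Lambda> v (\<Psi>1 s) = integral {s..t} (\<lambda>r. ?\<Lambda> v (D1 r))"
    by (rule solution_facts[OF sol1[unfolded I_def], folded I_def c_def \<kappa>_def]) (rule that; assumption)
  obtain \<Psi>2 D2 C2 where 2: "C2 \<ge> 0"
    "strongly_measurable ?M \<psi>2" "AE t in ?M. norm (\<psi>2 t) \<le> C2"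
    "AE t in ?M. \<Psi>2 t = embed (\<psi>2 t)" "\<Psi>2 0 = embed \<phi>2"
    "\<And>v. (\<lambda>t. ?\<Lambda> v (D2 t)) \<in> borel_measurable ?M" "\<And>t. norm (D2 t) \<le> C2"
    "AE t in ?M. \<forall>v. ?\<Lambda> v (D2 t) = vfield c \<kappa> (\<psi>2 t) \<bullet> v"
    "\<And>s t v. s \<in> I \<Longrightarrow> t \<in> I \<Longrightarrow> s \<le> t \<Longrightarrow> ?\<Lambda> v (\<Psi>2 t) - ?\<Lambda> v (\<Psi>2 s) = integral {s..t} (\<lambda>r. ?\<Lambda> v (D2 r))"
    by (rule solution_facts[OF sol2[unfolded I_def], folded I_def c_def \<kappa>_def]) (rule that; assumption)
  define p where "p = (\<lambda>t v. ?\<Lambda> v (\<Psi>1 t - \<Psi>2 t))"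
  define q where "q = (\<lambda>v t. ?\<Lambda> v (D1 t - D2 t))"
  define C where "C = C1 + C2"
  have C: "C \<ge> 0" using 1(1) 2(1) by (simp add: C_def)
  have qB: "\<bar>q v t\<bar> \<le> C * norm v" for v t
  proof -
    have "norm (D1 t - D2 t) \<le> C" using norm_triangle_ineq4[of "D1 t" "D2 t"] 1(7)[of t] 2(7)[of t] by (simp add: C_def)
    from mult_right_mono[OF this norm_ge_zero[of v]] show ?thesis
      using Re_apply_bound[of "D1 t - D2 t" v] by (simp add: q_def)
  qed
  have qm: "q v \<in> borel_measurable ?M" for v
    unfolding q_def blinfun.diff_left minus_complex.sel by (intro borel_measurable_diff 1(6) 2(6))
  have sub: "{s..t} \<subseteq> I" if "s \<in> I" "t \<in> I" for s t using that by (auto simp: I_def)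
  have int: "q v integrable_on {s..t}" if "s \<in> I" "t \<in> I" for s t v
    by (rule Linf_real_integrable[OF qm qB sub[OF that]])
  have peq: "p t v - p s v = integral {s..t} (q v)" if st: "s \<in> I" "t \<in> I" "s \<le> t" for s t v
  proof -
    have iD: "(\<lambda>r. ?\<Lambda> v (D1 r)) integrable_on {s..t}" "(\<lambda>r. ?\<Lambda> v (D2 r)) integrable_on {s..t}"
    proof -
      have b: "\<bar>?\<Lambda> v (D1 r)\<bar> \<le> C1 * norm v" "\<bar>?\<Lambda> v (D2 r)\<bar> \<le> C2 * norm v" for r
        using Re_apply_bound[of "D1 r" v] mult_right_mono[OF 1(7)[of r] norm_ge_zero[of v]]
          Re_apply_bound[of "D2 r" v] mult_right_mono[OF 2(7)[of r] norm_ge_zero[of v]] by linarith+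
      show "(\<lambda>r. ?\<Lambda> v (D1 r)) integrable_on {s..t}" "(\<lambda>r. ?\<Lambda> v (D2 r)) integrable_on {s..t}"
        by (rule Linf_real_integrable[OF 1(6) b(1) sub[OF st(1,2)]], rule Linf_real_integrable[OF 2(6) b(2) sub[OF st(1,2)]])
    qed
    have "p t v - p s v = (?\<Lambda> v (\<Psi>1 t) - ?\<Lambda> v (\<Psi>1 s)) - (?\<Lambda> v (\<Psi>2 t) - ?\<Lambda> v (\<Psi>2 s))"
      by (simp add: p_def blinfun.diff_left)
    also have "\<dots> = integral {s..t} (\<lambda>r. ?\<Lambda> v (D1 r) - ?\<Lambda> v (D2 r))"
      unfolding 1(9)[OF st] 2(9)[OF st] by (rule Henstock_Kurzweil_Integration.integral_diff[OF iD, symmetric])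
    finally show ?thesis by (simp add: q_def blinfun.diff_left)
  qed
  have lip: "\<bar>p t v - p s v\<bar> \<le> C * norm v * \<bar>t - s\<bar>" if st: "s \<in> I" "t \<in> I" for s t v
  proof (cases "s \<le> t")
    case True
    show ?thesis unfolding peq[OF st True] using integral_bound_const[OF int[OF st] qB True] True by simp
  next
    case False
    then have ts: "t \<le> s" by simp
    have "\<bar>p s v - p t v\<bar> \<le> C * norm v * (s - t)"
      unfolding peq[OF st(2,1) ts] by (rule integral_bound_const[OF int[OF st(2,1)] qB ts])
    then show ?thesis using ts by (simp add: abs_minus_commute)
  qed
  have 0: "0 \<in> I" using T by (simp add: I_def)
  define w where "w = (\<lambda>t. \<psi>1 t - \<psi>2 t)"
  define f where "f = (\<lambda>t. friction \<kappa> (\<psi>1 t) - friction \<kappa> (\<psi>2 t))"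
  \<comment> \<open>One constant that bounds \<open>p t\<close> on the whole interval and is at
    least the Lipschitz constant \<open>C\<close>; the 1 added to \<open>T\<close> ensures the
    latter.\<close>
  define B where "B = norm (\<Psi>1 0 - \<Psi>2 0) + C * (T + 1)"
  have pw: "AE t in ?M. \<forall>v. p t v = K (w t) \<bullet> v"
    using 1(4) 2(4)
    by eventually_elim (simp add: p_def w_def blinfun.diff_left embed_pair K_simps inner_diff_left)
  have "AE t in ?M. norm (w t) \<le> 2 * norm (\<phi>1 - \<phi>2) * exp (2 * L * T)"
  proof (rule weak_estimate[where T = T and p = p and f = f and C = B and M = "2 * R", folded I_def])
    show "T > 0" by (rule T)
    show "bounded_linear (p t)" for t
      unfolding p_def
      by (rule bounded_linear_compose[OF bounded_linear_Re bounded_linear_compose[OF blinfun.bounded_linear_right bounded_linear_conj]])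
    show "\<bar>p t v\<bar> \<le> B * norm v" if t: "t \<in> I" for t v
    proof -
      have "\<bar>t - 0\<bar> \<le> T + 1" using t by (auto simp: I_def)
      then have "C * norm v * \<bar>t - 0\<bar> \<le> C * norm v * (T + 1)" using C by (intro mult_left_mono) simp_all
      moreover have "\<bar>p 0 v\<bar> \<le> norm (\<Psi>1 0 - \<Psi>2 0) * norm v" unfolding p_def by (rule Re_apply_bound)
      ultimately show ?thesis using lip[OF 0 t, of v] by (simp add: B_def algebra_simps)
    qed
    show "\<bar>p t v - p s v\<bar> \<le> B * norm v * \<bar>t - s\<bar>" if st: "s \<in> I" "t \<in> I" for s t v
    proof -
      have "C * 1 \<le> C * (T + 1)" using C T by (intro mult_left_mono) simp_all
      then have "C \<le> B" using norm_ge_zero[of "\<Psi>1 0 - \<Psi>2 0"] unfolding B_def by linarith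
      then have "C * (norm v * \<bar>t - s\<bar>) \<le> B * (norm v * \<bar>t - s\<bar>)" by (intro mult_right_mono) simp_all
      then show ?thesis using lip[OF st, of v] by (simp add: mult.assoc)
    qed
    show "AE t in ?M. \<forall>v. p t v = K (w t) \<bullet> v" by (rule pw)
    show "p 0 v = K (\<phi>1 - \<phi>2) \<bullet> v" for v
      by (simp add: p_def 1(5) 2(5) blinfun.diff_left embed_pair K_simps inner_diff_left)
    have fs: "strongly_measurable ?M f"
      unfolding f_def
      by (intro strongly_measurable_compose2[OF strongly_measurable_compose[OF 1(2) friction_continuous]
          strongly_measurable_compose[OF 2(2) friction_continuous]] continuous_intros)
    show "(\<lambda>r. f r \<bullet> y r) \<in> borel_measurable ?M" if "continuous_on I y" for y
      by (rule strongly_measurable_inner[OF I fs that])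
    show "AE t in ?M. norm (f t) \<le> L * norm (w t)"
      using R1 R2 by eventually_elim (simp add: f_def w_def L(2))
    show "L \<ge> 0" by (rule L)
    show "AE t in ?M. norm (w t) \<le> 2 * R"
      using R1 R2
    proof eventually_elim
      case (elim t)
      then show ?case using norm_triangle_ineq4[of "\<psi>1 t" "\<psi>2 t"] by (simp add: w_def)
    qed
    show "p t (K u) - p s (K u) = integral {s..t} (\<lambda>r. f r \<bullet> K (K u) - p r (c *\<^sub>R J (K u - u)))"
      if st: "s \<in> I" "t \<in> I" "s \<le> t" for s t u
      unfolding peq[OF st]
    proof (rule integral_AE_cong[OF I _ sub[OF st(1,2)]])
      show "AE r in ?M. q (K u) r = f r \<bullet> K (K u) - p r (c *\<^sub>R J (K u - u))"
        using 1(8) 2(8) pw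
      proof eventually_elim
        case (elim r)
        have "q (K u) r = (vfield c \<kappa> (\<psi>1 r) - vfield c \<kappa> (\<psi>2 r)) \<bullet> K u"
          using elim(1,2) by (simp add: q_def blinfun.diff_left inner_diff_left)
        also have "vfield c \<kappa> (\<psi>1 r) - vfield c \<kappa> (\<psi>2 r) = c *\<^sub>R J (K (w r) - w r) + K (f r)"
          by (simp add: vfield_def w_def f_def K_simps J_simps algebra_simps)
        \<comment> \<open>Skewness of \<open>J\<close> and symmetry of \<open>K\<close> move the
          generator from \<open>w\<close> to the test element, which stays bounded because that
          element has the form \<open>K u\<close>.\<close>
        also have "(c *\<^sub>R J (K (w r) - w r) + K (f r)) \<bullet> K u = K (f r) \<bullet> K u - c * ((K (w r) - w r) \<bullet> J (K u))"
          by (simp add: inner_add_left J_skew)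
        also have "K (f r) \<bullet> K u = f r \<bullet> K (K u)" by (rule K_sym)
        also have "(K (w r) - w r) \<bullet> J (K u) = K (w r) \<bullet> J (K u - u)"
          using K_sym[of "w r" "J u"] by (simp add: inner_diff_left inner_diff_right J_simps K_J)
        also have "f r \<bullet> K (K u) - c * (K (w r) \<bullet> J (K u - u)) = f r \<bullet> K (K u) - p r (c *\<^sub>R J (K u - u))"
          using elim(3) by simp
        finally show ?case .
      qed
    qed
  qed
  then show ?thesis by (simp only: w_def)
qed

section \<open>Existence and continuous dependence\<close>

lemma test_function_deriv:
  assumes "test_function \<Omega> (\<eta> :: real \<Rightarrow> real)"
  shows "(\<eta> has_real_derivative deriv \<eta> x) (at x)" "continuous_on UNIV (deriv \<eta>)"
proof -
  have "continuously_differentiable (Suc 0) \<eta>" using assms unfolding test_function_def smooth_def by blast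
  then have d: "\<And>x. \<eta> differentiable (at x)" "\<And>v. continuous_on UNIV (\<lambda>x. frechet_derivative \<eta> (at x) v)" by simp_all
  show D: "(\<eta> has_real_derivative deriv \<eta> x) (at x)" for x
    using d(1)[of x] by (simp add: DERIV_deriv_iff_real_differentiable)
  have "frechet_derivative \<eta> (at x) 1 = deriv \<eta> x" for x
    using fun_cong[OF frechet_derivative_at[OF D[of x, unfolded has_field_derivative_def], symmetric], of 1] by simp
  then show "continuous_on UNIV (deriv \<eta>)" using d(2)[of 1] by simp
qed

lemma Linf_continuous:
  fixes f :: "real \<Rightarrow> 'b::real_normed_vector"
  assumes f: "continuous_on {- T..T} f" and X: "\<And>t. f t \<in> X"
  shows "f \<in> Linf {- T<..<T} X"
proof -
  obtain C where C: "\<forall>x\<in>f ` {- T..T}. norm x \<le> C"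
    using compact_imp_bounded[OF compact_continuous_image[OF f compact_Icc]] unfolding bounded_iff by (elim exE)
  have "AE t in lebesgue_on {- T<..<T}. norm (f t) \<le> C"
    by (rule AE_I2) (use C in \<open>auto simp: space_restrict_space\<close>)
  then show ?thesis
    unfolding Linf_def using strongly_measurable_continuous[OF f] X by auto
qed

text \<open>The product of \<open>\<eta>\<close> and \<open>u\<close> vanishes at both ends, so its
  derivative integrates to 0. The strong integrals exist by continuity, and the relation between
  them is checked on the real and imaginary parts of evaluations, which separate
  functionals.\<close>

lemma weak_time_derivative_continuous:
  fixes u u' :: "real \<Rightarrow> W12 \<Rightarrow>\<^sub>L complex"
  assumes T: "T > 0" and u: "continuous_on {- T..T} u" and u': "continuous_on {- T..T} u'"
    and deriv: "\<And>t. t \<in> {- T<..<T} \<Longrightarrow> (u has_vector_derivative u' t) (at t)"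
  shows "weak_time_derivative {- T<..<T} u u'"
  unfolding weak_time_derivative_def
proof (intro allI impI)
  let ?I = "{- T<..<T}"
  fix \<eta> assume "test_function (interior ?I) \<eta>"
  then have \<eta>: "test_function ?I \<eta>" by (simp add: interior_open)
  note d = test_function_deriv[OF \<eta>]
  have c: "continuous_on {- T..T} \<eta>" "continuous_on {- T..T} (deriv \<eta>)"
    using continuous_on_subset[OF test_function_continuous[OF \<eta>]] continuous_on_subset[OF d(2)] by simp_all
  have 0: "\<eta> T = 0" "\<eta> (- T) = 0"
  proof -
    have "{x. \<eta> x \<noteq> 0} \<subseteq> ?I" using \<eta> closure_subset[of "{x. \<eta> x \<noteq> 0}"] unfolding test_function_def by blast
    then show "\<eta> T = 0" "\<eta> (- T) = 0" by auto
  qed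
  obtain w1 where w1: "has_strong_integral (lebesgue_on ?I) (\<lambda>t. deriv \<eta> t *\<^sub>R u t) w1"
    using has_strong_integral_continuous[OF T continuous_on_scaleR[OF c(2) u]] ..
  obtain w2 where w2: "has_strong_integral (lebesgue_on ?I) (\<lambda>t. \<eta> t *\<^sub>R u' t) w2"
    using has_strong_integral_continuous[OF T continuous_on_scaleR[OF c(1) u']] ..
  have sum: "\<Lambda> w1 + \<Lambda> w2 = 0" if \<Lambda>: "bounded_linear \<Lambda>" for \<Lambda> :: "(W12 \<Rightarrow>\<^sub>L complex) \<Rightarrow> real"
  proof -
    let ?g = "\<lambda>t. \<Lambda> (deriv \<eta> t *\<^sub>R u t) + \<Lambda> (\<eta> t *\<^sub>R u' t)"
    have b: "has_bochner_integral (lebesgue_on ?I) ?g (\<Lambda> w1 + \<Lambda> w2)"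
      by (intro has_bochner_integral_add has_strong_integral_linear[OF _ w1 \<Lambda>] has_strong_integral_linear[OF _ w2 \<Lambda>]) simp_all
    have "(?g has_integral (\<Lambda> (\<eta> T *\<^sub>R u T) - \<Lambda> (\<eta> (- T) *\<^sub>R u (- T)))) {- T..T}"
    proof (rule fundamental_theorem_of_calculus_interior)
      show "- T \<le> T" using T by simp
      show "continuous_on {- T..T} (\<lambda>t. \<Lambda> (\<eta> t *\<^sub>R u t))"
        by (rule continuous_on_compose2[OF linear_continuous_on[OF \<Lambda>, of UNIV] continuous_on_scaleR[OF c(1) u]]) simp
      fix t assume t: "t \<in> {- T<..<T}"
      have "((\<lambda>t. \<eta> t *\<^sub>R u t) has_vector_derivative (\<eta> t *\<^sub>R u' t + deriv \<eta> t *\<^sub>R u t)) (at t)"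
        by (rule has_vector_derivative_scaleR[OF d(1) deriv[OF t]])
      from bounded_linear.has_vector_derivative[OF \<Lambda> this]
      show "((\<lambda>t. \<Lambda> (\<eta> t *\<^sub>R u t)) has_vector_derivative ?g t) (at t)"
        by (simp add: linear_simps[OF \<Lambda>] add.commute)
    qed
    then have "integral {- T..T} ?g = 0" by (simp add: 0 linear_simps[OF \<Lambda>] integral_unique)
    then have "integral ?I ?g = 0" by (simp only: integral_open_interval_real)
    moreover have "integral\<^sup>L (lebesgue_on ?I) ?g = integral ?I ?g"
      using b by (intro lebesgue_integral_eq_integral) (auto simp: has_bochner_integral_iff)
    ultimately show ?thesis using b by (simp add: has_bochner_integral_iff)
  qed
  have "w2 = - w1"
  proof (rule blinfun_eqI)
    fix v
    show "blinfun_apply w2 v = blinfun_apply (- w1) v"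
      using sum[OF bounded_linear_Re_apply(1), of v] sum[OF bounded_linear_Re_apply(2), of v]
      by (simp add: complex_eq_iff blinfun.minus_left)
  qed
  with w1 w2 show "\<exists>w. has_strong_integral (lebesgue_on ?I) (\<lambda>t. deriv \<eta> t *\<^sub>R u t) w \<and>
      has_strong_integral (lebesgue_on ?I) (\<lambda>t. \<eta> t *\<^sub>R u' t) (- w)" by blast
qed

lemma vfield_continuous: "continuous_on UNIV (vfield c \<kappa>)"
proof -
  interpret schroedinger_pair K J c by (rule K_pair)
  show ?thesis
    unfolding vfield_def[abs_def]
    by (intro continuous_intros friction_continuous bounded_linear.continuous_on[OF K] bounded_linear.continuous_on[OF J])
qed

text \<open>Since \<open>embed (\<psi> t) = dual_of (K (\<psi> t))\<close>, differentiability of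
  \<open>K \<psi>\<close> in the Sobolev space gives differentiability of
  \<open>embed \<psi>\<close> in the dual. Continuity up to the endpoints supplies the essential
  bounds.\<close>

lemma classical_imp_weak_solution:
  fixes hbar m G T :: real
  defines "c \<equiv> hbar / (2 * m)" and "\<kappa> \<equiv> 4 * pi * G * m\<^sup>2 / hbar"
  assumes T: "T > 0" and \<psi>: "continuous_on {- T..T} \<psi>" and 0: "\<psi> 0 = \<phi>"
    and deriv: "\<And>t. t \<in> {- T<..<T} \<Longrightarrow> ((\<lambda>t. K (\<psi> t)) has_vector_derivative vfield c \<kappa> (\<psi> t)) (at t)"
  shows "frictional_NS_solution hbar m G {- T<..<T} \<phi> \<psi>"
proof -
  interpret schroedinger_pair K J c by (rule K_pair)
  let ?I = "{- T<..<T}"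
  define \<psi>' where "\<psi>' = (\<lambda>t. dual_of (vfield c \<kappa> (\<psi> t)))"
  have em: "embed (\<psi> t) = dual_of (K (\<psi> t))" for t by (rule dual_of_K[symmetric])
  have ec: "continuous_on {- T..T} (\<lambda>t. embed (\<psi> t))"
    unfolding em by (intro bounded_linear.continuous_on[OF bounded_linear_dual_of] bounded_linear.continuous_on[OF K] \<psi>)
  have \<psi>'c: "continuous_on {- T..T} \<psi>'"
    unfolding \<psi>'_def
    by (intro bounded_linear.continuous_on[OF bounded_linear_dual_of] continuous_on_compose2[OF vfield_continuous \<psi>]) simp
  have "weak_time_derivative ?I (\<lambda>t. embed (\<psi> t)) \<psi>'"
  proof (rule weak_time_derivative_continuous[OF T ec \<psi>'c])
    fix t assume t: "t \<in> ?I"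
    show "((\<lambda>t. embed (\<psi> t)) has_vector_derivative \<psi>' t) (at t)"
      unfolding em \<psi>'_def by (rule bounded_linear.has_vector_derivative[OF bounded_linear_dual_of deriv[OF t]])
  qed
  moreover have "\<psi>' \<in> Linf ?I W_dual" by (rule Linf_continuous[OF \<psi>'c]) (simp add: \<psi>'_def dual_of_dual)
  moreover have "scaleC_dual \<i> (\<psi>' t) = - (c *\<^sub>R laplacian (\<psi> t)) + scaleC_dual (\<i> * of_real \<kappa>) (g1 (\<psi> t))
      - scaleC_dual (\<i> * of_real \<kappa>) (g2 (\<psi> t))" for t
    unfolding equation_pairing[OF dual_of_dual[of "vfield c \<kappa> (\<psi> t)", folded \<psi>'_def]] \<psi>'_def
    by (simp add: dual_of_pair vfield_def)
  ultimately have "\<exists>\<psi>' \<in> Linf ?I W_dual. weak_time_derivative ?I (\<lambda>t. embed (\<psi> t)) \<psi>' \<and>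
      (AE t in lebesgue_on ?I. scaleC_dual \<i> (\<psi>' t) = - (c *\<^sub>R laplacian (\<psi> t)) + scaleC_dual (\<i> * of_real \<kappa>) (g1 (\<psi> t))
      - scaleC_dual (\<i> * of_real \<kappa>) (g2 (\<psi> t)))" by (intro bexI[of _ \<psi>']) simp_all
  moreover have "\<exists>\<Psi>. continuous_on ?I \<Psi> \<and> (AE t in lebesgue_on ?I. \<Psi> t = embed (\<psi> t)) \<and> \<Psi> 0 = embed \<phi>"
  proof (intro exI conjI)
    show "continuous_on ?I (\<lambda>t. embed (\<psi> t))" by (rule continuous_on_subset[OF ec]) auto
  qed (simp_all add: 0)
  moreover have "\<psi> \<in> Linf ?I UNIV" by (rule Linf_continuous[OF \<psi>]) simp
  moreover have "(\<lambda>t. embed (\<psi> t)) \<in> Linf ?I W_dual" by (rule Linf_continuous[OF ec embed_dual])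
  moreover have "is_interval ?I" "0 \<in> ?I" using T by (simp_all add: is_interval_oo)
  ultimately show ?thesis unfolding frictional_NS_solution_def c_def \<kappa>_def by simp
qed

text \<open>\<open>T\<close> and \<open>R\<close> are fixed before the datum and depend on it only
  through \<open>M\<close>, so that one choice serves a whole sequence of data.\<close>

lemma uniform_local_existence:
  assumes "hbar > 0" "m > 0" "G > 0"
  obtains T R where "T > 0"
    "\<And>\<phi>. norm \<phi> \<le> M \<Longrightarrow> \<exists>\<psi>. frictional_NS_solution hbar m G {- T<..<T} \<phi> \<psi> \<and> (\<forall>t. norm (\<psi> t) \<le> R)"
proof -
  define c where "c = hbar / (2 * m)"
  define \<kappa> where "\<kappa> = 4 * pi * G * m\<^sup>2 / hbar"
  interpret schroedinger_pair K J c by (rule K_pair)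
  have F: "\<exists>L. \<forall>x y. norm x \<le> R \<longrightarrow> norm y \<le> R \<longrightarrow> norm (friction \<kappa> x - friction \<kappa> y) \<le> L * norm (x - y)" for R
  proof -
    obtain L where "0 \<le> L" "\<And>a b. norm a \<le> R \<Longrightarrow> norm b \<le> R \<Longrightarrow> norm (friction \<kappa> a - friction \<kappa> b) \<le> L * norm (a - b)"
      using friction_lipschitz[of R \<kappa>] by auto
    then show ?thesis by (intro exI[of _ L]) simp
  qed
  obtain T R where T: "T > 0"
    "\<And>\<phi>. norm \<phi> \<le> M \<Longrightarrow> \<exists>\<psi>. continuous_on {- T..T} \<psi> \<and> (\<forall>t. norm (\<psi> t) \<le> R) \<and> \<psi> 0 = \<phi> \<and>
      (\<forall>t\<in>{- T<..<T}. ((\<lambda>t. K (\<psi> t)) has_vector_derivative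
          c *\<^sub>R J (K (\<psi> t) - \<psi> t) + K (friction \<kappa> (\<psi> t))) (at t))"
    using local_existence[OF F, of M] by auto
  show thesis
  proof (rule that[OF T(1)])
    fix \<phi> :: W12 assume "norm \<phi> \<le> M"
    then obtain \<psi> where \<psi>: "continuous_on {- T..T} \<psi>" "\<forall>t. norm (\<psi> t) \<le> R" "\<psi> 0 = \<phi>"
      "\<forall>t\<in>{- T<..<T}. ((\<lambda>t. K (\<psi> t)) has_vector_derivative vfield c \<kappa> (\<psi> t)) (at t)"
      using T(2) unfolding vfield_def by blast
    have "frictional_NS_solution hbar m G {- T<..<T} \<phi> \<psi>"
      by (rule classical_imp_weak_solution[OF T(1) \<psi>(1,3), folded c_def \<kappa>_def]) (use \<psi>(4) in \<open>simp add: c_def \<kappa>_def\<close>)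
    with \<psi>(2) show "\<exists>\<psi>. frictional_NS_solution hbar m G {- T<..<T} \<phi> \<psi> \<and> (\<forall>t. norm (\<psi> t) \<le> R)" by blast
  qed
qed

text \<open>Uniqueness by comparison with the bounded solution \<open>\<psi>0\<close>. The
  comparison constant involves the unknown essential bound \<open>C\<close> of
  \<open>\<psi>\<close>, but it multiplies the difference of equal data, which is 0.\<close>

lemma solution_AE_bound:
  assumes sol: "frictional_NS_solution hbar m G {- T<..<T} \<phi> \<psi>" and T: "T > 0"
    and ex: "frictional_NS_solution hbar m G {- T<..<T} \<phi> \<psi>0" "\<forall>t. norm (\<psi>0 t) \<le> R"
  shows "AE t in lebesgue_on {- T<..<T}. norm (\<psi> t) \<le> R"
proof -
  let ?M = "lebesgue_on {- T<..<T}"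
  have "\<psi> \<in> Linf {- T<..<T} UNIV" using sol unfolding frictional_NS_solution_def by blast
  then obtain C where C: "AE t in ?M. norm (\<psi> t) \<le> C" unfolding Linf_def by blast
  define R' where "R' = max C R"
  obtain L where L: "0 \<le> L" "\<And>a b. norm a \<le> R' \<Longrightarrow> norm b \<le> R' \<Longrightarrow>
      norm (friction (4 * pi * G * m\<^sup>2 / hbar) a - friction (4 * pi * G * m\<^sup>2 / hbar) b) \<le> L * norm (a - b)"
    using friction_lipschitz[of R' "4 * pi * G * m\<^sup>2 / hbar"] by auto
  have "AE t in ?M. norm (\<psi> t) \<le> R'" using C by eventually_elim (simp add: R'_def)
  moreover have "AE t in ?M. norm (\<psi>0 t) \<le> R'" using ex(2) by (intro AE_I2) (simp add: R'_def le_max_iff_disj)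
  ultimately have "AE t in ?M. norm (\<psi> t - \<psi>0 t) \<le> 2 * norm (\<phi> - \<phi>) * exp (2 * L * T)"
    using solution_difference[OF T sol ex(1) _ _ L] by simp
  then show ?thesis
  proof eventually_elim
    case (elim t)
    then have "\<psi> t = \<psi>0 t" by simp
    then show ?case using ex(2) by simp
  qed
qed

theorem proposition3p3:
  fixes hbar m G :: real and \<phi>s :: "nat \<Rightarrow> W12" and \<phi> :: W12
  assumes "hbar > 0" and "m > 0" and "G > 0"
    and "(\<lambda>k. norm (\<phi>s k - \<phi>)) \<longlonglongrightarrow> 0"
  shows "\<exists>T>0.
    (\<exists>\<psi>. frictional_NS_solution hbar m G {-T<..<T} \<phi> \<psi>) \<and>
    (\<forall>\<^sub>F k in sequentially. \<exists>\<psi>. frictional_NS_solution hbar m G {-T<..<T} (\<phi>s k) \<psi>) \<and>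
    (\<forall>\<psi> \<psi>s.
       frictional_NS_solution hbar m G {-T<..<T} \<phi> \<psi> \<longrightarrow>
       (\<forall>\<^sub>F k in sequentially. frictional_NS_solution hbar m G {-T<..<T} (\<phi>s k) (\<psi>s k)) \<longrightarrow>
       (\<lambda>k. Linf_norm {-T<..<T} (\<lambda>t. \<psi> t - \<psi>s k t)) \<longlonglongrightarrow> 0)"
proof -
  \<comment> \<open>The ball of radius \<open>norm \<phi> + 1\<close> contains \<open>\<phi>\<close>
    and all but finitely many of the data, so these share \<open>T\<close> and
    \<open>R\<close>.\<close>
  obtain T R where T: "T > 0"
    and ex: "\<And>\<xi>. norm \<xi> \<le> norm \<phi> + 1 \<Longrightarrow> \<exists>\<psi>. frictional_NS_solution hbar m G {- T<..<T} \<xi> \<psi> \<and> (\<forall>t. norm (\<psi> t) \<le> R)"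
    using uniform_local_existence[OF assms(1-3), of "norm \<phi> + 1"] by auto
  let ?S = "frictional_NS_solution hbar m G {-T<..<T}"
  let ?M = "lebesgue_on {-T<..<T}"
  have near: "\<forall>\<^sub>F k in sequentially. norm (\<phi>s k) \<le> norm \<phi> + 1"
    using order_tendstoD(2)[OF assms(4) zero_less_one]
  proof eventually_elim
    case (elim k)
    then show ?case using norm_triangle_ineq2[of "\<phi>s k" \<phi>] by simp
  qed
  have bound: "AE t in ?M. norm (\<psi> t) \<le> R" if \<xi>: "?S \<xi> \<psi>" "norm \<xi> \<le> norm \<phi> + 1" for \<xi> \<psi>
  proof -
    obtain \<psi>0 where "?S \<xi> \<psi>0" "\<forall>t. norm (\<psi>0 t) \<le> R" using ex[OF \<xi>(2)] by blast
    then show ?thesis by (rule solution_AE_bound[OF \<xi>(1) T])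
  qed
  \<comment> \<open>The constant depends on \<open>R\<close> and the parameters of the equation,
    hence is the same for all \<open>k\<close>.\<close>
  obtain L where L: "0 \<le> L" "\<And>a b. norm a \<le> R \<Longrightarrow> norm b \<le> R \<Longrightarrow>
      norm (friction (4 * pi * G * m\<^sup>2 / hbar) a - friction (4 * pi * G * m\<^sup>2 / hbar) b) \<le> L * norm (a - b)"
    using friction_lipschitz[of R "4 * pi * G * m\<^sup>2 / hbar"] by auto
  \<comment> \<open>The interval has positive measure, so the essential supremum of the constant 0
    is 0; this is the lower bound in the sandwich argument.\<close>
  have M0: "emeasure ?M (space ?M) \<noteq> 0" using T by (simp add: space_restrict_space emeasure_restrict_space)
  have "(\<lambda>k. Linf_norm {-T<..<T} (\<lambda>t. \<psi> t - \<psi>s k t)) \<longlonglongrightarrow> 0"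
    if \<psi>: "?S \<phi> \<psi>" and \<psi>s: "\<forall>\<^sub>F k in sequentially. ?S (\<phi>s k) (\<psi>s k)" for \<psi> \<psi>s
  proof (rule tendsto_sandwich)
    let ?b = "\<lambda>k. 2 * norm (\<phi>s k - \<phi>) * exp (2 * L * T)"
    show "\<forall>\<^sub>F k in sequentially. Linf_norm {-T<..<T} (\<lambda>t. \<psi> t - \<psi>s k t) \<le> ereal (?b k)"
      using \<psi>s near
    proof eventually_elim
      case (elim k)
      have sm: "strongly_measurable ?M \<psi>" "strongly_measurable ?M (\<psi>s k)"
        using \<psi> elim(1) unfolding frictional_NS_solution_def Linf_def by blast+
      have [measurable]: "(\<lambda>t. norm (\<psi> t - \<psi>s k t)) \<in> borel_measurable ?M"
        by (intro strongly_measurable_real strongly_measurable_compose2[OF sm] continuous_intros) simp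
      have "AE t in ?M. norm (\<psi> t - \<psi>s k t) \<le> 2 * norm (\<phi> - \<phi>s k) * exp (2 * L * T)"
        by (rule solution_difference[OF T \<psi> elim(1) bound[OF \<psi>] bound[OF elim] L]) simp
      then show ?case
        unfolding Linf_norm_def by (intro esssup_I) (simp_all add: norm_minus_commute)
    qed
    show "\<forall>\<^sub>F k in sequentially. 0 \<le> Linf_norm {-T<..<T} (\<lambda>t. \<psi> t - \<psi>s k t)"
    proof (intro always_eventually allI)
      fix k
      have "esssup ?M (\<lambda>t. 0 :: ereal) \<le> Linf_norm {-T<..<T} (\<lambda>t. \<psi> t - \<psi>s k t)"
        unfolding Linf_norm_def by (rule esssup_mono) simp_all
      then show "0 \<le> Linf_norm {-T<..<T} (\<lambda>t. \<psi> t - \<psi>s k t)" by (simp add: esssup_const[OF M0])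
    qed
    have "?b \<longlonglongrightarrow> 2 * 0 * exp (2 * L * T)" by (intro tendsto_intros assms(4))
    then show "(\<lambda>k. ereal (?b k)) \<longlonglongrightarrow> 0" by (simp add: zero_ereal_def)
  qed simp
  moreover have "\<exists>\<psi>. ?S \<phi> \<psi>" using ex[of \<phi>] by auto
  moreover have "\<forall>\<^sub>F k in sequentially. \<exists>\<psi>. ?S (\<phi>s k) \<psi>"
    using near by eventually_elim (use ex in blast)
  ultimately show ?thesis using T by (intro exI[of _ T] conjI allI impI) simp_all
qed

end
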